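(* Let $d\in\mathbb{N}$, let $X$ be a Banach space with Fourier type $p_0\in(1,2]$ and $Y$ a Banach space with Fourier cotype $q_0\in[2,\infty)$, and let $p\in(1,p_0)$ and $q\in(q_0,\infty)$. Let $r\in[1,\infty]$ be such that $\frac1r=\frac1p-\frac1q$. Then there is a constant $C\ge0$ such that the following holds. Let $m:\mathbb{R}^d\to\mathcal{L}(X,Y)$ be an $X$-strongly measurable map such that $[\xi\mapsto\|m(\xi)\|_{\mathcal{L}(X,Y)}]\in L^{r,\infty}(\mathbb{R}^d)$. Then $T_m$ extends uniquely to a bounded map from $L^p(\mathbb{R}^d;X)$ into $L^q(\mathbb{R}^d;Y)$ with $$\|T_m\|_{\mathcal{L}(L^p(\mathbb{R}^d;X),L^q(\mathbb{R}^d;Y))}\le C\,\big\|\,\|m(\cdot)\|_{\mathcal{L}(X,Y)}\big\|_{L^{r,\infty}(\mathbb{R}^d)},$$ where $C$ is independent of $m$.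
   Context: Banach spaces are nonzero and over $\mathbb{C}$; $p'$ denotes the Hölder conjugate of $p$. The Fourier transform is $\widehat f(\xi)=\mathcal{F}f(\xi)=\int_{\mathbb{R}^d}e^{-2\pi i\xi\cdot t}f(t)\,dt$. A Banach space $X$ has Fourier type $p\in[1,2]$ if $\mathcal{F}$ is bounded from $L^p(\mathbb{R}^d;X)$ to $L^{p'}(\mathbb{R}^d;X)$ for some (equivalently all) $d\in\mathbb{N}$; $X$ has Fourier cotype $p'$ if it has Fourier type $p$. $L^{r,\infty}(\mathbb{R}^d)$ is the weak $L^r$-space, with $\|f\|_{L^{r,\infty}}:=\sup_{\alpha>0}\alpha\,|\{s:|f(s)|>\alpha\}|^{1/r}$. $m$ is $X$-strongly measurable if $m(\cdot)x$ is strongly measurable for every $x\in X$. For $f\in\mathcal{S}(\mathbb{R}^d;X)$ (Schwartz functions), $T_m(f):=\mathcal{F}^{-1}(m\widehat f\,)\in\mathcal{S}'(\mathbb{R}^d;Y)$. *)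

theory Defs
  imports "HOL-Analysis.Analysis"
begin

section \<open>Complex Banach spaces\<close>

text \<open>The library has only real Banach spaces. A complex one carries in addition a compatible
  complex scalar multiplication for which the norm is absolutely homogeneous.\<close>

class complex_banach = banach +
  fixes scaleC :: "complex \<Rightarrow> 'a \<Rightarrow> 'a"  (infixr "*\<^sub>C" 75)
  assumes scaleC_add_right: "c *\<^sub>C (x + y) = c *\<^sub>C x + c *\<^sub>C y"
    and scaleC_add_left: "(b + c) *\<^sub>C x = b *\<^sub>C x + c *\<^sub>C x"
    and scaleC_scaleC: "b *\<^sub>C c *\<^sub>C x = (b * c) *\<^sub>C x"
    and scaleR_scaleC: "r *\<^sub>R x = complex_of_real r *\<^sub>C x"
    and norm_scaleC: "norm (c *\<^sub>C x) = norm c * norm x"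

instantiation complex :: complex_banach
begin

definition scaleC_complex :: "complex \<Rightarrow> complex \<Rightarrow> complex"
  where "scaleC_complex c z = c * z"

instance
  by standard (simp_all add: scaleC_complex_def algebra_simps norm_mult scaleR_conv_of_real)

end

text \<open>\<open>'x \<Rightarrow>\<^sub>L 'y\<close> consists of the real-linear bounded operators. Complex-linear
  ones are singled out by this predicate; their operator norm is the library norm.\<close>

definition complex_linear :: "('x::complex_banach \<Rightarrow> 'y::complex_banach) \<Rightarrow> bool"
  where "complex_linear A \<longleftrightarrow>
    (\<forall>x y. A (x + y) = A x + A y) \<and> (\<forall>c x. A (c *\<^sub>C x) = c *\<^sub>C A x)"


section \<open>Strong measurability and the Bochner integral\<close>

text \<open>The library's \<open>has_bochner_integral\<close> requires a second countable (hence separable)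
  target. The following versions are for arbitrary Banach spaces; Borel measurability is replaced
  by strong measurability.\<close>

definition strongly_measurable :: "'a measure \<Rightarrow> ('a \<Rightarrow> 'b::real_normed_vector) \<Rightarrow> bool"
  where "strongly_measurable M f \<longleftrightarrow>
    (\<exists>s. (\<forall>i. simple_function M (s i)) \<and> (AE x in M. (\<lambda>i. s i x) \<longlonglongrightarrow> f x))"

definition has_strong_integral :: "'a measure \<Rightarrow> ('a \<Rightarrow> 'b::real_normed_vector) \<Rightarrow> 'b \<Rightarrow> bool"
  where "has_strong_integral M f y \<longleftrightarrow>
    strongly_measurable M f \<and>
    (\<exists>s. (\<forall>i. Bochner_Integration.simple_bochner_integrable M (s i)) \<and>
         (\<lambda>i. \<integral>\<^sup>+x. ennreal (norm (f x - s i x)) \<partial>M) \<longlonglongrightarrow> 0 \<and>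
         (\<lambda>i. Bochner_Integration.simple_bochner_integral M (s i)) \<longlonglongrightarrow> y)"

definition strong_integral :: "'a measure \<Rightarrow> ('a \<Rightarrow> 'b::real_normed_vector) \<Rightarrow> 'b"
  where "strong_integral M f =
    (if \<exists>y. has_strong_integral M f y then THE y. has_strong_integral M f y else 0)"


section \<open>Lebesgue and weak Lebesgue spaces\<close>

text \<open>Only meant for exponents \<open>a > 0\<close>.\<close>

definition ennreal_powr :: "ennreal \<Rightarrow> real \<Rightarrow> ennreal"
  where "ennreal_powr x a = (if x = \<infinity> then \<infinity> else ennreal (enn2real x powr a))"

text \<open>All exponents live in \<open>[1, \<infinity>]\<close>, so they have type \<^typ>\<open>ennreal\<close>, where
  \<open>1 / \<infinity> = 0\<close>.\<close>

definition Lp_norm :: "ennreal \<Rightarrow> ('a::euclidean_space \<Rightarrow> 'b::real_normed_vector) \<Rightarrow> ennreal"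
  where "Lp_norm p f =
    (if p = \<infinity> then Inf {c. AE x in lebesgue. ennreal (norm (f x)) \<le> c}
     else ennreal_powr (\<integral>\<^sup>+x. ennreal (norm (f x) powr enn2real p) \<partial>lebesgue) (1 / enn2real p))"

text \<open>Elements of \<open>L\<^sup>p\<close> are represented by functions; equality in \<open>L\<^sup>p\<close> is equality almost
  everywhere.\<close>

definition Lp :: "ennreal \<Rightarrow> ('a::euclidean_space \<Rightarrow> 'b::real_normed_vector) set"
  where "Lp p = {f. strongly_measurable lebesgue f \<and> Lp_norm p f < \<infinity>}"

definition weak_Lp_norm :: "ennreal \<Rightarrow> ('a::euclidean_space \<Rightarrow> real) \<Rightarrow> ennreal"
  where "weak_Lp_norm r f =
    (if r = \<infinity> then Lp_norm \<infinity> f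
     else SUP \<alpha>\<in>{0<..}. ennreal \<alpha> *
            ennreal_powr (emeasure lebesgue {s. \<bar>f s\<bar> > \<alpha>}) (1 / enn2real r))"

definition weak_Lp :: "ennreal \<Rightarrow> ('a::euclidean_space \<Rightarrow> real) set"
  where "weak_Lp r = {f. f \<in> borel_measurable lebesgue \<and> weak_Lp_norm r f < \<infinity>}"

text \<open>Operators act on representatives: linearity holds almost everywhere. Together with
  boundedness this implies that \<open>T\<close> respects equality almost everywhere.\<close>

definition Lp_opnorm :: "ennreal \<Rightarrow> ennreal \<Rightarrow>
    (('a::euclidean_space \<Rightarrow> 'x::complex_banach) \<Rightarrow> ('a \<Rightarrow> 'y::complex_banach)) \<Rightarrow> ennreal"
  where "Lp_opnorm p q T = (SUP f\<in>{f \<in> Lp p. Lp_norm p f \<le> 1}. Lp_norm q (T f))"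

definition bounded_Lp_operator :: "ennreal \<Rightarrow> ennreal \<Rightarrow>
    (('a::euclidean_space \<Rightarrow> 'x::complex_banach) \<Rightarrow> ('a \<Rightarrow> 'y::complex_banach)) \<Rightarrow> bool"
  where "bounded_Lp_operator p q T \<longleftrightarrow>
    (\<forall>f\<in>Lp p. T f \<in> Lp q) \<and>
    (\<forall>f\<in>Lp p. \<forall>g\<in>Lp p. AE x in lebesgue. T (\<lambda>t. f t + g t) x = T f x + T g x) \<and>
    (\<forall>c. \<forall>f\<in>Lp p. AE x in lebesgue. T (\<lambda>t. c *\<^sub>C f t) x = c *\<^sub>C T f x) \<and>
    Lp_opnorm p q T < \<infinity>"


section \<open>Schwartz functions and the Fourier transform\<close>

fun iterated_partial :: "'a list \<Rightarrow> ('a::euclidean_space \<Rightarrow> 'b::real_normed_vector) \<Rightarrow> 'a \<Rightarrow> 'b"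
  where
    "iterated_partial [] f = f"
  | "iterated_partial (b # bs) f = (\<lambda>x. frechet_derivative (iterated_partial bs f) (at x) b)"

definition schwartz :: "('a::euclidean_space \<Rightarrow> 'b::real_normed_vector) set"
  where "schwartz = {f. \<forall>bs. set bs \<subseteq> Basis \<longrightarrow>
    (\<forall>x. iterated_partial bs f differentiable (at x)) \<and>
    (\<forall>k::nat. bounded (range (\<lambda>x. norm x ^ k *\<^sub>R iterated_partial bs f x)))}"

definition fourier :: "('a::euclidean_space \<Rightarrow> 'b::complex_banach) \<Rightarrow> 'a \<Rightarrow> 'b"
  where "fourier f \<xi> =
    strong_integral lebesgue (\<lambda>t. exp (- 2 * of_real pi * \<i> * of_real (\<xi> \<bullet> t)) *\<^sub>C f t)"

definition inv_fourier :: "('a::euclidean_space \<Rightarrow> 'b::complex_banach) \<Rightarrow> 'a \<Rightarrow> 'b"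
  where "inv_fourier f t =
    strong_integral lebesgue (\<lambda>\<xi>. exp (2 * of_real pi * \<i> * of_real (\<xi> \<bullet> t)) *\<^sub>C f \<xi>)"

text \<open>A vector-valued tempered distribution is a functional on the scalar Schwartz functions. It
  is represented by a total function on all scalar functions, of which only the values on
  \<^const>\<open>schwartz\<close> matter.\<close>

type_synonym ('a, 'b) distribution = "('a \<Rightarrow> complex) \<Rightarrow> 'b"

definition distribution_eq ::
    "('a::euclidean_space, 'b) distribution \<Rightarrow> ('a, 'b) distribution \<Rightarrow> bool"
  where "distribution_eq u v \<longleftrightarrow> (\<forall>\<phi>\<in>schwartz. u \<phi> = v \<phi>)"

definition regular_distribution ::
    "('a::euclidean_space \<Rightarrow> 'b::complex_banach) \<Rightarrow> ('a, 'b) distribution"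
  where "regular_distribution g = (\<lambda>\<phi>. strong_integral lebesgue (\<lambda>x. \<phi> x *\<^sub>C g x))"

definition fourier_distribution ::
    "('a::euclidean_space, 'b) distribution \<Rightarrow> ('a, 'b) distribution"
  where "fourier_distribution u = (\<lambda>\<phi>. u (fourier \<phi>))"

definition inv_fourier_distribution ::
    "('a::euclidean_space, 'b) distribution \<Rightarrow> ('a, 'b) distribution"
  where "inv_fourier_distribution u = (\<lambda>\<phi>. u (inv_fourier \<phi>))"


section \<open>Fourier type and cotype\<close>

text \<open>\<open>fourier_type TYPE('a) TYPE('x) p\<close> says that the Fourier transform, taken in the sense of
  tempered distributions, is bounded from \<open>L\<^sup>p('a; 'x)\<close> to \<open>L\<^sup>p\<^sup>'('a; 'x)\<close>. The space \<open>'x\<close> has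
  Fourier type \<open>p\<close> if this holds for some \<open>'a = \<real>\<^sup>k\<close>. As types cannot be quantified inside a
  formula, a theorem with the hypothesis ``\<open>'x\<close> has Fourier type \<open>p\<close>'' assumes
  \<open>fourier_type TYPE(real ^ 'k) TYPE('x) p\<close> for a type variable \<open>'k\<close> that occurs nowhere
  else: its outer universal quantification is an existential one in the hypothesis.\<close>

definition hoelder_conjugate :: "ennreal \<Rightarrow> ennreal \<Rightarrow> bool"
  where "hoelder_conjugate p p' \<longleftrightarrow> 1 / p + 1 / p' = 1"

definition fourier_type :: "'a::euclidean_space itself \<Rightarrow> 'x::complex_banach itself \<Rightarrow> ennreal \<Rightarrow> bool"
  where "fourier_type _ _ p \<longleftrightarrow>
    1 \<le> p \<and> p \<le> 2 \<and>
    (\<exists>p' C. hoelder_conjugate p p' \<and> 0 \<le> C \<and>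
      (\<forall>f\<in>(Lp p :: ('a \<Rightarrow> 'x) set). \<exists>g\<in>(Lp p' :: ('a \<Rightarrow> 'x) set).
         distribution_eq (fourier_distribution (regular_distribution f)) (regular_distribution g) \<and>
         Lp_norm p' g \<le> ennreal C * Lp_norm p f))"

definition fourier_cotype :: "'a::euclidean_space itself \<Rightarrow> 'x::complex_banach itself \<Rightarrow> ennreal \<Rightarrow> bool"
  where "fourier_cotype A X q \<longleftrightarrow> (\<exists>p. hoelder_conjugate p q \<and> fourier_type A X p)"


section \<open>Fourier multipliers\<close>

definition fourier_multiplier :: "('a::euclidean_space \<Rightarrow> 'x \<Rightarrow>\<^sub>L 'y) \<Rightarrow>
    ('a \<Rightarrow> 'x::complex_banach) \<Rightarrow> ('a, 'y::complex_banach) distribution"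
  where "fourier_multiplier m f =
    inv_fourier_distribution (regular_distribution (\<lambda>\<xi>. blinfun_apply (m \<xi>) (fourier f \<xi>)))"

text \<open>\<open>L\<^sup>q\<close> is regarded as a subspace of the tempered distributions.\<close>

definition bounded_extension :: "ennreal \<Rightarrow> ennreal \<Rightarrow>
    ('a::euclidean_space \<Rightarrow> 'x::complex_banach \<Rightarrow>\<^sub>L 'y::complex_banach) \<Rightarrow>
    (('a \<Rightarrow> 'x) \<Rightarrow> ('a \<Rightarrow> 'y)) \<Rightarrow> bool"
  where "bounded_extension p q m T \<longleftrightarrow>
    bounded_Lp_operator p q T \<and>
    (\<forall>f\<in>schwartz. distribution_eq (regular_distribution (T f)) (fourier_multiplier m f))"

end

theory Submission
  imports Defs
begin

text \<open>Write \<open>T\<^sub>m = F\<^sup>-\<^sup>1 m F\<close> and let \<open>p\<^sub>1\<close> be an exponent in \<open>(1, p\<^sub>0)\<close>. Splitting a function at a suitable height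
  and using \<open>L\<^sup>1 \<rightarrow> L\<^sup>\<infinity>\<close> on the large part and Fourier type on the small one shows that \<open>F\<close> maps weak
  \<open>L\<^bsup>p\<^sub>1\<^esup>\<close> to the weak space of the conjugate exponent. The elementary weak Hoelder inequality and the same estimate for
  \<open>F\<^sup>-\<^sup>1\<close> on \<open>Y\<close> then give that \<open>T\<^sub>m\<close> is of weak type \<open>(p\<^sub>1, q\<^sub>1)\<close> whenever
  \<open>1/p\<^sub>1 - 1/q\<^sub>1 = 1/r\<close>. Using this on both sides of \<open>(p, q)\<close>, the Marcinkiewicz splitting of \<open>f\<close> at a height
  depending on the level set of \<open>T\<^sub>m f\<close> gives the strong type \<open>(p, q)\<close>.

  Fourier type is only given on some \<open>\<real>\<^sup>k\<close> and is needed on \<open>\<real>\<^sup>d\<close>. It is transferred through trigonometric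
  sums: step functions on \<open>\<real>\<^sup>k\<close> whose translates lie on a line bound trigonometric sums with integer
  frequencies on a line, averaging along a separating integer vector extends this to sums with
  frequencies in the integer lattice of \<open>\<real>\<^sup>d\<close>, and rescaling these sums yields the transforms of dyadic
  step functions, which are dense.\<close>

section \<open>Strong measurability\<close>

text \<open>Only the distribution function of \<open>m\<close> is known, so a product with the
  transform of \<open>f\<close> can be estimated only between weak spaces; the strict inequalities
  \<open>p < p\<^sub>0\<close> and \<open>q\<^sub>0 < q\<close> leave room to move
  \<open>(1/p, 1/q)\<close> in both directions along the line where the difference is
  \<open>1/r\<close>, which interpolation needs. Functions in these weak spaces need not be
  integrable, so their transforms exist only as distributions. They are handled by the relation
  \<open>has_fourier\<close> between functions, additive and single-valued almost everywhere, and
  the multiplier is a composite of two such relations; an operator is chosen from it only at the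
  very end. Interpolation is not linear in the weak norm of \<open>m\<close>, so the output is
  normalised before it. The Banach spaces need not be separable: a Fubini theorem for vector values
  is avoided by checking identities on a vector times the indicator of a box and extending them by
  density, in a gauge that controls \<open>L^1\<close> and \<open>L^s\<close> at once, because the
  integral formula for the transform lives in \<open>L^1\<close> and its bounds in
  \<open>L^s\<close>.\<close>

lemma measurable_lebesgue_cong_AE:
  assumes "f \<in> measurable lebesgue N" "AE x in lebesgue. f x = g x" "\<And>x. g x \<in> space N"
  shows "g \<in> measurable lebesgue N"
proof (rule measurableI)
  fix A assume A: "A \<in> sets N"
  have "f -` A \<inter> space lebesgue \<in> sets lebesgue"
    using assms(1) A by (rule measurable_sets)
  moreover have "AE x in lebesgue. x \<in> f -` A \<inter> space lebesgue \<longleftrightarrow> x \<in> g -` A \<inter> space lebesgue"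
    using assms(2) by eventually_elim auto
  ultimately show "g -` A \<inter> space lebesgue \<in> sets lebesgue"
    using completion.in_sets_AE[where M=lborel and A="f -` A \<inter> space lebesgue" and B="g -` A \<inter> space lebesgue"] by simp
qed (use assms in auto)

text \<open>Borel measurability survives pointwise limits in any metric target, so only the
  exceptional set needs care: the functions are set to 0 on a measurable null set, and completeness
  of the Lebesgue measure restores \<open>g\<close> there.\<close>

lemma borel_measurable_lebesgue_LIMSEQ_AE:
  fixes f :: "nat \<Rightarrow> 'a::euclidean_space \<Rightarrow> 'b::real_normed_vector"
  assumes f: "\<And>i. f i \<in> borel_measurable lebesgue"
    and lim: "AE x in lebesgue. (\<lambda>i. f i x) \<longlonglongrightarrow> g x"
  shows "g \<in> borel_measurable lebesgue"
proof -
  from lim obtain N where N: "{x \<in> space lebesgue. \<not> (\<lambda>i. f i x) \<longlonglongrightarrow> g x} \<subseteq> N"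
    "emeasure lebesgue N = 0" "N \<in> sets lebesgue"
    by (rule AE_E)
  define h where "h = (\<lambda>x. if x \<in> N then 0 else g x)"
  have "h \<in> borel_measurable lebesgue"
  proof (rule borel_measurable_LIMSEQ_metric)
    fix i show "(\<lambda>x. if x \<in> N then 0 else f i x) \<in> borel_measurable lebesgue"
      using N f by (intro measurable_If_set) auto
  next
    fix x :: 'a show "(\<lambda>i. if x \<in> N then 0 else f i x) \<longlonglongrightarrow> h x"
      using N by (auto simp: h_def)
  qed
  moreover have "AE x in lebesgue. h x = g x"
    using N by (intro AE_I[of _ _ N]) (auto simp: h_def)
  ultimately show ?thesis
    by (rule measurable_lebesgue_cong_AE) simp
qed

text \<open>The analogue of Pettis' theorem. Being Borel and having almost all values in the closure
  of a countable set are inherited by limits, whereas the defining sequences of simple functions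
  would call for a diagonal argument.\<close>

lemma strongly_measurable_iff:
  fixes f :: "'a::euclidean_space \<Rightarrow> 'b::real_normed_vector"
  shows "strongly_measurable lebesgue f \<longleftrightarrow>
    f \<in> borel_measurable lebesgue \<and> (\<exists>D. countable D \<and> (AE x in lebesgue. f x \<in> closure D))"
proof
  assume "strongly_measurable lebesgue f"
  then obtain s where s: "\<And>i. simple_function lebesgue (s i)"
    "AE x in lebesgue. (\<lambda>i. s i x) \<longlonglongrightarrow> f x"
    by (auto simp: strongly_measurable_def)
  have "f \<in> borel_measurable lebesgue"
    by (rule borel_measurable_lebesgue_LIMSEQ_AE[OF borel_measurable_simple_function[OF s(1)] s(2)])
  moreover have "countable (\<Union>i. range (s i))"
    using s(1) by (intro countable_UN) (auto simp: simple_function_def intro!: countable_finite)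
  moreover have "AE x in lebesgue. f x \<in> closure (\<Union>i. range (s i))"
    using s(2)
  proof eventually_elim
    case (elim x)
    then show ?case unfolding closure_sequential
      by (intro exI[of _ "\<lambda>i. s i x"]) auto
  qed
  ultimately show "f \<in> borel_measurable lebesgue \<and> (\<exists>D. countable D \<and> (AE x in lebesgue. f x \<in> closure D))"
    by blast
next
  assume "f \<in> borel_measurable lebesgue \<and> (\<exists>D. countable D \<and> (AE x in lebesgue. f x \<in> closure D))"
  then obtain D where f[measurable]: "f \<in> borel_measurable lebesgue"
    and D: "countable D" "AE x in lebesgue. f x \<in> closure D"
    by blast
  \<comment> \<open>Adding 0 makes the set nonempty, so that \<open>d\<close> enumerates it.\<close>
  define d where "d = from_nat_into (insert 0 D)"
  have rd: "range d = insert 0 D"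
    unfolding d_def using D by (intro range_from_nat_into) auto
  \<comment> \<open>\<open>k n x\<close> is the first index of a point nearest to \<open>f x\<close>
    among \<open>d 0, ..., d n\<close>. Taking the least such index makes the choice measurable, and
    finitely many values make \<open>d (k n x)\<close> simple in \<open>x\<close>.\<close>
  define k where "k = (\<lambda>n x. LEAST i. i \<le> n \<and> (\<forall>j\<le>n. dist (f x) (d i) \<le> dist (f x) (d j)))"
  have k: "k n x \<le> n \<and> (\<forall>j\<le>n. dist (f x) (d (k n x)) \<le> dist (f x) (d j))" for n x
  proof -
    have "\<exists>i. i \<le> n \<and> (\<forall>j\<le>n. dist (f x) (d i) \<le> dist (f x) (d j))"
      using arg_min_if_finite[of "{..n}" "\<lambda>i. dist (f x) (d i)"]
      by (intro exI[of _ "arg_min_on (\<lambda>i. dist (f x) (d i)) {..n}"]) (auto simp: not_less)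
    from LeastI_ex[OF this] show ?thesis by (simp add: k_def)
  qed
  define e where "e = (\<lambda>i x. dist (f x) (d i))"
  have [measurable]: "e i \<in> borel_measurable lebesgue" for i
    unfolding e_def
    by (rule measurable_compose[OF f]) (intro borel_measurable_continuous_onI continuous_intros)
  have e: "dist (f x) (d i) = e i x" for i x
    by (simp add: e_def)
  have "Measurable.pred lebesgue (\<lambda>x. i \<le> n \<and> (\<forall>j\<in>{..n}. e i x \<le> e j x))" for i n
    unfolding not_less[symmetric]
    by (intro pred_intros_logic(2,3) pred_intros_finite borel_measurable_pred_less) auto
  then have pk: "Measurable.pred lebesgue (\<lambda>x. i \<le> n \<and> (\<forall>j\<le>n. e i x \<le> e j x))" for i n
    by (simp add: Ball_def)
  have km: "k n \<in> measurable lebesgue (count_space UNIV)" for n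
    unfolding k_def e by (intro measurable_Least pk)
  have "simple_function lebesgue (\<lambda>x. d (k n x))" for n
  proof (rule simple_function_compose1[where f="k n" and g=d])
    have "k n ` UNIV \<subseteq> {..n}" using k by auto
    then show "simple_function lebesgue (k n)"
      unfolding simple_function_def using finite_subset[of "k n ` UNIV" "{..n}"]
      by (auto intro!: measurable_sets[OF km, simplified])
  qed
  moreover have "AE x in lebesgue. (\<lambda>n. d (k n x)) \<longlonglongrightarrow> f x"
    using D(2)
  proof eventually_elim
    case (elim x)
    show ?case
    proof (rule metric_LIMSEQ_I)
      fix e :: real assume "0 < e"
      with elim obtain y where "y \<in> D" "dist y (f x) < e"
        by (auto simp: closure_approachable)
      then obtain j where j: "dist (f x) (d j) < e"
        using rd by (metis dist_commute insertI2 rangeE)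
      have "dist (d (k n x)) (f x) < e" if "n \<ge> j" for n
        using k[of n x] that j by (metis dist_commute le_less_trans)
      then show "\<exists>no. \<forall>n\<ge>no. dist (d (k n x)) (f x) < e" by blast
    qed
  qed
  ultimately show "strongly_measurable lebesgue f"
    unfolding strongly_measurable_def by (intro exI[of _ "\<lambda>n x. d (k n x)"]) auto
qed

lemma strongly_measurable_borel:
  "strongly_measurable lebesgue f \<Longrightarrow> f \<in> borel_measurable lebesgue"
  by (simp add: strongly_measurable_iff)

lemma strongly_measurable_norm[measurable_dest]:
  "strongly_measurable lebesgue f \<Longrightarrow> (\<lambda>x. norm (f x)) \<in> borel_measurable lebesgue"
  by (rule measurable_compose[OF strongly_measurable_borel borel_measurable_norm])

lemma closure_dense:
  fixes D :: "'b::metric_space set"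
  assumes "\<And>X. open X \<Longrightarrow> X \<noteq> {} \<Longrightarrow> \<exists>d\<in>D. d \<in> X"
  shows "closure D = UNIV"
proof -
  have "\<exists>y\<in>D. dist y x < e" if "0 < e" for x e
    using assms[of "ball x e"] that by (auto simp: dist_commute)
  then show ?thesis by (auto simp: closure_approachable)
qed

lemma strongly_measurable_separable:
  fixes f :: "'a::euclidean_space \<Rightarrow> 'b::{real_normed_vector,second_countable_topology}"
  assumes "f \<in> borel_measurable lebesgue"
  shows "strongly_measurable lebesgue f"
proof -
  obtain D :: "'b set" where D: "countable D" "\<And>X. open X \<Longrightarrow> X \<noteq> {} \<Longrightarrow> \<exists>d\<in>D. d \<in> X"
    using countable_dense_exists by metis
  have "closure D = UNIV"
    using D(2) by (rule closure_dense)
  with assms \<open>countable D\<close> show ?thesis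
    unfolding strongly_measurable_iff by (auto intro!: exI[of _ D])
qed

lemma strongly_measurable_simple: "simple_function lebesgue f \<Longrightarrow> strongly_measurable lebesgue f"
  unfolding strongly_measurable_def by (intro exI[of _ "\<lambda>i. f"]) auto

lemma strongly_measurable_const[simp]: "strongly_measurable lebesgue (\<lambda>x. c)"
  by (rule strongly_measurable_simple) auto

lemma strongly_measurable_LIMSEQ_AE:
  assumes f: "\<And>i. strongly_measurable lebesgue (f i)"
    and lim: "AE x in lebesgue. (\<lambda>i. f i x) \<longlonglongrightarrow> g x"
  shows "strongly_measurable lebesgue g"
proof -
  from f obtain D where D: "\<And>i. countable (D i)" "\<And>i. AE x in lebesgue. f i x \<in> closure (D i)"
    unfolding strongly_measurable_iff by metis
  have "AE x in lebesgue. \<forall>i. f i x \<in> closure (D i)"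
    using D(2) by (simp add: AE_all_countable)
  from lim this have "AE x in lebesgue. g x \<in> closure (\<Union>i. D i)"
  proof eventually_elim
    case (elim x)
    have "f i x \<in> closure (\<Union>i. D i)" for i
      using elim(2) closure_mono[of "D i" "\<Union>i. D i"] by blast
    with closed_sequentially[OF closed_closure _ elim(1)] show ?case by blast
  qed
  moreover have "g \<in> borel_measurable lebesgue"
    by (rule borel_measurable_lebesgue_LIMSEQ_AE[OF strongly_measurable_borel[OF f] lim])
  ultimately show ?thesis
    unfolding strongly_measurable_iff using D(1) by (auto intro!: exI[of _ "\<Union>i. D i"] countable_UN)
qed

lemma strongly_measurable_cong_AE:
  assumes "strongly_measurable lebesgue f" "AE x in lebesgue. f x = g x"
  shows "strongly_measurable lebesgue g"
  using assms(2) by (intro strongly_measurable_LIMSEQ_AE[of "\<lambda>i. f", OF assms(1)]) auto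

lemma strongly_measurable_compose2:
  assumes f: "strongly_measurable lebesgue f" and g: "strongly_measurable lebesgue g"
    and h: "continuous_on UNIV (\<lambda>z. h (fst z) (snd z))"
  shows "strongly_measurable lebesgue (\<lambda>x. h (f x) (g x))"
proof -
  from f obtain s where s: "\<And>i. simple_function lebesgue (s i)"
    "AE x in lebesgue. (\<lambda>i. s i x) \<longlonglongrightarrow> f x"
    by (auto simp: strongly_measurable_def)
  from g obtain t where t: "\<And>i. simple_function lebesgue (t i)"
    "AE x in lebesgue. (\<lambda>i. t i x) \<longlonglongrightarrow> g x"
    by (auto simp: strongly_measurable_def)
  have "AE x in lebesgue. (\<lambda>i. h (s i x) (t i x)) \<longlonglongrightarrow> h (f x) (g x)"
    using s(2) t(2)
  proof eventually_elim
    case (elim x)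
    have "isCont (\<lambda>z. h (fst z) (snd z)) (f x, g x)"
      using h by (simp add: continuous_on_eq_continuous_at)
    from isCont_tendsto_compose[OF this tendsto_Pair[OF elim]] show ?case by simp
  qed
  moreover have "simple_function lebesgue (\<lambda>x. h (s i x) (t i x))" for i
    using s(1) t(1) by (rule simple_function_compose2)
  ultimately show ?thesis
    unfolding strongly_measurable_def by (intro exI[of _ "\<lambda>i x. h (s i x) (t i x)"]) auto
qed

lemma strongly_measurable_add:
  "strongly_measurable lebesgue f \<Longrightarrow> strongly_measurable lebesgue g \<Longrightarrow>
    strongly_measurable lebesgue (\<lambda>x. f x + g x)"
  by (rule strongly_measurable_compose2[where h="(+)"]) (auto intro!: continuous_intros)

lemma strongly_measurable_diff:
  "strongly_measurable lebesgue f \<Longrightarrow> strongly_measurable lebesgue g \<Longrightarrow>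
    strongly_measurable lebesgue (\<lambda>x. f x - g x)"
  by (rule strongly_measurable_compose2[where h="(-)"]) (auto intro!: continuous_intros)

lemma strongly_measurable_compose:
  assumes "strongly_measurable lebesgue f" "continuous_on UNIV h"
  shows "strongly_measurable lebesgue (\<lambda>x. h (f x))"
  by (rule strongly_measurable_compose2[OF assms(1) assms(1), of "\<lambda>x y. h x"])
    (auto intro!: continuous_on_compose2[OF assms(2)] continuous_intros)

lemma strongly_measurable_sum:
  "(\<And>i. i \<in> I \<Longrightarrow> strongly_measurable lebesgue (f i)) \<Longrightarrow>
    strongly_measurable lebesgue (\<lambda>x. \<Sum>i\<in>I. f i x)"
  by (induction I rule: infinite_finite_induct) (auto intro!: strongly_measurable_add)

lemma strongly_measurable_scaleR:
  assumes "u \<in> borel_measurable lebesgue" "strongly_measurable lebesgue f"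
  shows "strongly_measurable lebesgue (\<lambda>x. (u x :: real) *\<^sub>R f x)"
  using strongly_measurable_separable[OF assms(1)] assms(2)
  by (rule strongly_measurable_compose2[where h="(*\<^sub>R)"]) (auto intro!: continuous_intros)

lemma strongly_measurable_indicator:
  assumes "A \<in> sets lebesgue" "strongly_measurable lebesgue f"
  shows "strongly_measurable lebesgue (\<lambda>x. indicator A x *\<^sub>R f x)"
  using assms by (intro strongly_measurable_scaleR) auto

text \<open>The image of a countable dense subset of the domain is a countable set whose closure
  contains the whole range, so separability of the domain replaces that of the target.\<close>

lemma strongly_measurable_continuous:
  fixes f :: "'a::euclidean_space \<Rightarrow> 'b::real_normed_vector"
  assumes f: "continuous_on UNIV f"
  shows "strongly_measurable lebesgue f"
proof -
  have "f \<in> borel_measurable borel"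
    using f by (rule borel_measurable_continuous_onI)
  then have "f \<in> borel_measurable lebesgue"
    by (intro measurable_completion) simp
  moreover obtain D :: "'a set" where D: "countable D" "\<And>X. open X \<Longrightarrow> X \<noteq> {} \<Longrightarrow> \<exists>d\<in>D. d \<in> X"
    using countable_dense_exists by metis
  have "f x \<in> closure (f ` D)" for x
  proof -
    have "closure D = UNIV"
      using D(2) by (rule closure_dense)
    then have "x \<in> closure D" by simp
    then obtain y where "\<And>n. y n \<in> D" "y \<longlonglongrightarrow> x"
      by (auto simp: closure_sequential)
    moreover have "(\<lambda>n. f (y n)) \<longlonglongrightarrow> f x"
      using f \<open>y \<longlonglongrightarrow> x\<close> by (auto simp: continuous_on_eq_continuous_at intro: isCont_tendsto_compose)
    ultimately show ?thesis
      unfolding closure_sequential by (intro exI[of _ "\<lambda>n. f (y n)"]) auto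
  qed
  ultimately show ?thesis
    unfolding strongly_measurable_iff using D(1) by (auto intro!: exI[of _ "f ` D"])
qed

section \<open>Complex scalar multiplication and measurability of operator-valued maps\<close>

interpretation scaleC: bounded_bilinear "scaleC :: complex \<Rightarrow> 'b \<Rightarrow> 'b::complex_banach"
proof (rule bounded_bilinear.intro)
  fix r :: real and c :: complex and x :: 'b
  show "(r *\<^sub>R c) *\<^sub>C x = r *\<^sub>R (c *\<^sub>C x)"
    by (simp add: scaleR_scaleC[of r x] scaleR_scaleC[of r "c *\<^sub>C x"] scaleC_scaleC scaleR_conv_of_real)
  show "c *\<^sub>C (r *\<^sub>R x) = r *\<^sub>R (c *\<^sub>C x)"
    by (simp add: scaleR_scaleC scaleC_scaleC mult.commute)
next
  show "\<exists>K. \<forall>(a::complex) b::'b. norm (a *\<^sub>C b) \<le> norm a * norm b * K"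
    by (intro exI[of _ 1]) (simp add: norm_scaleC)
qed (simp_all add: scaleC_add_left scaleC_add_right)

lemma scaleC_one[simp]: "1 *\<^sub>C (x::'b::complex_banach) = x"
  using scaleR_scaleC[of 1 x] by simp

lemma strongly_measurable_scaleC:
  assumes "u \<in> borel_measurable lebesgue" "strongly_measurable lebesgue f"
  shows "strongly_measurable lebesgue (\<lambda>x. u x *\<^sub>C f x)"
  using strongly_measurable_separable[OF assms(1)] assms(2)
  by (rule strongly_measurable_compose2[where h="(*\<^sub>C)"])
     (auto intro!: scaleC.continuous_on continuous_intros)

text \<open>Measurability of \<open>m\<close> is available only on fixed vectors, not as a map into
  the operators. For a simple \<open>g\<close> the composite is a finite sum of such orbits cut off
  to level sets, and continuity of each single operator gives the limit.\<close>

lemma strongly_measurable_apply: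
  fixes m :: "'a::euclidean_space \<Rightarrow> 'x::real_normed_vector \<Rightarrow>\<^sub>L 'y::real_normed_vector"
  assumes m: "\<And>x. strongly_measurable lebesgue (\<lambda>\<xi>. blinfun_apply (m \<xi>) x)"
    and g: "strongly_measurable lebesgue g"
  shows "strongly_measurable lebesgue (\<lambda>\<xi>. blinfun_apply (m \<xi>) (g \<xi>))"
proof -
  from g obtain s where s: "\<And>i. simple_function lebesgue (s i)"
    "AE x in lebesgue. (\<lambda>i. s i x) \<longlonglongrightarrow> g x"
    by (auto simp: strongly_measurable_def)
  have "strongly_measurable lebesgue (\<lambda>\<xi>. blinfun_apply (m \<xi>) (s i \<xi>))" for i
  proof -
    have "(\<lambda>\<xi>. blinfun_apply (m \<xi>) (s i \<xi>)) =
        (\<lambda>\<xi>. \<Sum>y\<in>range (s i). indicator (s i -` {y}) \<xi> *\<^sub>R blinfun_apply (m \<xi>) y)"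
    proof
      fix \<xi>
      have "finite (range (s i))" using s(1)[of i] by (auto simp: simple_function_def)
      then show "blinfun_apply (m \<xi>) (s i \<xi>) = (\<Sum>y\<in>range (s i). indicator (s i -` {y}) \<xi> *\<^sub>R blinfun_apply (m \<xi>) y)"
        by (subst sum.remove[of _ "s i \<xi>"]) (auto simp: indicator_def intro!: sum.neutral)
    qed
    moreover have "s i -` {y} \<in> sets lebesgue" for y
      using simple_functionD(2)[OF s(1)[of i], of "{y}"] by simp
    ultimately show ?thesis
      using m by (auto intro!: strongly_measurable_sum strongly_measurable_indicator)
  qed
  moreover have "AE x in lebesgue. (\<lambda>i. blinfun_apply (m x) (s i x)) \<longlonglongrightarrow> blinfun_apply (m x) (g x)"
    using s(2) by eventually_elim (intro tendsto_intros)
  ultimately show ?thesis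
    by (rule strongly_measurable_LIMSEQ_AE)
qed

section \<open>The Bochner integral for non-separable targets\<close>

text \<open>Bochner's criterion as the working notion: it can be checked by domination, and
  completeness of the target then provides the integral.\<close>

definition sintegrable :: "('a::euclidean_space \<Rightarrow> 'b::real_normed_vector) \<Rightarrow> bool"
  where "sintegrable f \<longleftrightarrow>
    strongly_measurable lebesgue f \<and> (\<integral>\<^sup>+x. ennreal (norm (f x)) \<partial>lebesgue) < \<infinity>"

lemma sintegrableD:
  assumes "sintegrable f"
  shows "strongly_measurable lebesgue f" "(\<integral>\<^sup>+x. ennreal (norm (f x)) \<partial>lebesgue) < \<infinity>"
  using assms by (auto simp: sintegrable_def)

lemma simple_bochner_integrable_strongly_measurable:
  "Bochner_Integration.simple_bochner_integrable lebesgue s \<Longrightarrow> strongly_measurable lebesgue s"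
  by (rule strongly_measurable_simple) (auto elim: Bochner_Integration.simple_bochner_integrable.cases)

text \<open>One estimate with three uses: two approximating sequences give uniqueness of the
  integral, one sequence gives the Cauchy property, and \<open>t = 0\<close> gives the bound on the
  norm of the integral.\<close>

lemma simple_bochner_integral_dist_le:
  fixes f :: "'a::euclidean_space \<Rightarrow> 'b::real_normed_vector"
  assumes f: "strongly_measurable lebesgue f"
    and s: "Bochner_Integration.simple_bochner_integrable lebesgue s"
    and t: "Bochner_Integration.simple_bochner_integrable lebesgue t"
  shows "ennreal (dist (Bochner_Integration.simple_bochner_integral lebesgue s)
      (Bochner_Integration.simple_bochner_integral lebesgue t)) \<le>
    (\<integral>\<^sup>+x. ennreal (norm (f x - s x)) \<partial>lebesgue) + (\<integral>\<^sup>+x. ennreal (norm (f x - t x)) \<partial>lebesgue)"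
    (is "ennreal (dist ?s ?t) \<le> ?S + ?T")
proof -
  have sm: "strongly_measurable lebesgue s" "strongly_measurable lebesgue t"
    using s t by (auto intro: simple_bochner_integrable_strongly_measurable)
  have "ennreal (dist ?s ?t) =
      norm (Bochner_Integration.simple_bochner_integral lebesgue (\<lambda>x. s x - t x))"
    using s t by (subst simple_bochner_integral_diff) (auto simp: dist_norm)
  also have "\<dots> \<le> Bochner_Integration.simple_bochner_integral lebesgue (\<lambda>x. norm (s x - t x))"
    using simple_bochner_integrable_compose2[of "(-)" lebesgue "s" "t"] s t
    by (auto intro!: simple_bochner_integral_norm_bound)
  also have "\<dots> = (\<integral>\<^sup>+x. norm (s x - t x) \<partial>lebesgue)"
    using simple_bochner_integrable_compose2[of "\<lambda>x y. norm (x - y)" lebesgue "s" "t"] s t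
    by (auto intro!: simple_bochner_integral_eq_nn_integral)
  also have "\<dots> \<le> (\<integral>\<^sup>+x. ennreal (norm (f x - s x)) + ennreal (norm (f x - t x)) \<partial>lebesgue)"
  proof (rule nn_integral_mono)
    fix x
    have "norm (s x - t x) \<le> norm (f x - s x) + norm (f x - t x)"
      by (metis norm_minus_commute norm_triangle_sub add.commute norm_diff_triangle_le order_refl)
    then show "ennreal (norm (s x - t x)) \<le> ennreal (norm (f x - s x)) + ennreal (norm (f x - t x))"
      by (simp flip: ennreal_plus)
  qed
  also have "\<dots> = ?S + ?T"
    using f sm by (intro nn_integral_add measurable_compose[OF _ measurable_ennreal]
        strongly_measurable_norm strongly_measurable_diff)
  finally show ?thesis .
qed

text \<open>Simple functions tending to \<open>f\<close> almost everywhere need neither be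
  integrable nor converge in mean. Cutting them off where they exceed twice the norm of
  \<open>f\<close> gives both from a single dominating function.\<close>

lemma sintegrable_approx:
  assumes f: "sintegrable f"
  obtains s where "\<And>i. Bochner_Integration.simple_bochner_integrable lebesgue (s i)"
    "(\<lambda>i. \<integral>\<^sup>+x. ennreal (norm (f x - s i x)) \<partial>lebesgue) \<longlonglongrightarrow> 0"
    "AE x in lebesgue. (\<lambda>i. s i x) \<longlonglongrightarrow> f x" "\<And>i x. norm (s i x) \<le> 2 * norm (f x)"
proof -
  have fm: "strongly_measurable lebesgue f" and ff: "(\<integral>\<^sup>+x. ennreal (norm (f x)) \<partial>lebesgue) < \<infinity>"
    using f by (auto simp: sintegrable_def)
  obtain s where s: "\<And>i. simple_function lebesgue (s i)"
    "AE x in lebesgue. (\<lambda>i. s i x) \<longlonglongrightarrow> f x"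
    using fm by (auto simp: strongly_measurable_def)
  have sn: "(\<lambda>x. norm (s i x)) \<in> borel_measurable lebesgue" for i
    using strongly_measurable_norm[OF strongly_measurable_simple[OF s(1)]] .
  \<comment> \<open>The factor 2 makes the cut-off eventually inactive wherever \<open>f x\<close>
    is nonzero; where \<open>f x = 0\<close>, the cut-off functions vanish, which is the right
    limit.\<close>
  define t where "t = (\<lambda>i x. if norm (s i x) \<le> 2 * norm (f x) then s i x else 0)"
  have t: "simple_function lebesgue (t i)" for i
  proof -
    have "{x \<in> space lebesgue. norm (s i x) \<le> 2 * norm (f x)} \<in> sets lebesgue"
      using sn[of i] strongly_measurable_norm[OF fm] by (intro borel_measurable_le) auto
    then show ?thesis
      unfolding t_def by (intro simple_function_If s simple_function_const)
  qed
  have tm: "strongly_measurable lebesgue (t i)" for i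
    using t by (rule strongly_measurable_simple)
  have tb: "norm (t i x) \<le> 2 * norm (f x)" for i x
    by (auto simp: t_def)
  have tl: "AE x in lebesgue. (\<lambda>i. t i x) \<longlonglongrightarrow> f x"
    using s(2)
  proof eventually_elim
    case (elim x)
    show ?case
    proof (cases "f x = 0")
      case True
      then have "t i x = 0" for i by (auto simp: t_def)
      with True show ?thesis by simp
    next
      case False
      have "(\<lambda>i. norm (s i x)) \<longlonglongrightarrow> norm (f x)" using elim by (rule tendsto_norm)
      moreover have "norm (f x) < 2 * norm (f x)" using False by simp
      ultimately have "eventually (\<lambda>i. norm (s i x) < 2 * norm (f x)) sequentially"
        by (rule order_tendstoD)
      then have "eventually (\<lambda>i. s i x = t i x) sequentially"
        by eventually_elim (auto simp: t_def)
      with elim show ?thesis by (rule Lim_transform_eventually)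
    qed
  qed
  have "(\<lambda>i. \<integral>\<^sup>+x. ennreal (norm (f x - t i x)) \<partial>lebesgue) \<longlonglongrightarrow> (\<integral>\<^sup>+x. 0 \<partial>(lebesgue :: 'a measure))"
  proof (rule nn_integral_dominated_convergence[where w="\<lambda>x. 3 * ennreal (norm (f x))"])
    show "(\<lambda>x. ennreal (norm (f x - t i x))) \<in> borel_measurable lebesgue" for i
      using fm tm by (intro measurable_compose[OF _ measurable_ennreal]
        strongly_measurable_norm strongly_measurable_diff)
    show "(\<lambda>x. 3 * ennreal (norm (f x))) \<in> borel_measurable lebesgue"
      using strongly_measurable_norm[OF fm] by (auto intro!: borel_measurable_times_ennreal)
    show "(\<integral>\<^sup>+x. 3 * ennreal (norm (f x)) \<partial>lebesgue) < \<infinity>"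
      using ff strongly_measurable_norm[OF fm] by (subst nn_integral_cmult) (auto simp: ennreal_mult_less_top)
    show "AE x in lebesgue. ennreal (norm (f x - t i x)) \<le> 3 * ennreal (norm (f x))" for i
    proof (rule AE_I2)
      fix x
      have "norm (f x - t i x) \<le> 3 * norm (f x)"
        using norm_triangle_ineq4[of "f x" "t i x"] tb[of i x] by linarith
      then have "ennreal (norm (f x - t i x)) \<le> ennreal (3 * norm (f x))"
        by (rule ennreal_leI)
      then show "ennreal (norm (f x - t i x)) \<le> 3 * ennreal (norm (f x))"
        by (simp add: ennreal_mult)
    qed
    show "AE x in lebesgue. (\<lambda>i. ennreal (norm (f x - t i x))) \<longlonglongrightarrow> 0"
      using tl
    proof eventually_elim
      case (elim x)
      have "(\<lambda>i. ennreal (norm (f x - t i x))) \<longlonglongrightarrow> ennreal (norm (f x - f x))"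
        using elim by (intro tendsto_intros)
      then show ?case by simp
    qed
  qed simp
  then have "(\<lambda>i. \<integral>\<^sup>+x. ennreal (norm (f x - t i x)) \<partial>lebesgue) \<longlonglongrightarrow> 0" by simp
  moreover have "Bochner_Integration.simple_bochner_integrable lebesgue (t i)" for i
  proof (rule simple_bochner_integrableI_bounded[OF t])
    have "(\<integral>\<^sup>+x. ennreal (norm (t i x)) \<partial>lebesgue) \<le> (\<integral>\<^sup>+x. 2 * ennreal (norm (f x)) \<partial>lebesgue)"
    proof (rule nn_integral_mono)
      fix x show "ennreal (norm (t i x)) \<le> 2 * ennreal (norm (f x))"
        using ennreal_leI[OF tb[of i x]] by (simp add: ennreal_mult)
    qed
    also have "\<dots> < \<infinity>"
      using ff strongly_measurable_norm[OF fm] by (subst nn_integral_cmult) (auto simp: ennreal_mult_less_top)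
    finally show "(\<integral>\<^sup>+x. ennreal (norm (t i x)) \<partial>lebesgue) < \<infinity>" .
  qed
  ultimately show ?thesis
    using that tl tb by blast
qed

lemma has_strong_integralE:
  assumes "has_strong_integral M f y"
  obtains s where "strongly_measurable M f"
    "\<And>i. Bochner_Integration.simple_bochner_integrable M (s i)"
    "(\<lambda>i. \<integral>\<^sup>+x. ennreal (norm (f x - s i x)) \<partial>M) \<longlonglongrightarrow> 0"
    "(\<lambda>i. Bochner_Integration.simple_bochner_integral M (s i)) \<longlonglongrightarrow> y"
  using assms unfolding has_strong_integral_def by blast

lemma has_strong_integral_unique:
  fixes f :: "'a::euclidean_space \<Rightarrow> 'b::real_normed_vector"
  assumes "has_strong_integral lebesgue f y" "has_strong_integral lebesgue f z"
  shows "y = z"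
proof -
  from assms(1) obtain s where f: "strongly_measurable lebesgue f"
    and s: "\<And>i. Bochner_Integration.simple_bochner_integrable lebesgue (s i)"
    "(\<lambda>i. \<integral>\<^sup>+x. ennreal (norm (f x - s i x)) \<partial>lebesgue) \<longlonglongrightarrow> 0"
    "(\<lambda>i. Bochner_Integration.simple_bochner_integral lebesgue (s i)) \<longlonglongrightarrow> y"
    by (rule has_strong_integralE) (rule that)
  from assms(2) obtain t where "strongly_measurable lebesgue f"
    and t: "\<And>i. Bochner_Integration.simple_bochner_integrable lebesgue (t i)"
    "(\<lambda>i. \<integral>\<^sup>+x. ennreal (norm (f x - t i x)) \<partial>lebesgue) \<longlonglongrightarrow> 0"
    "(\<lambda>i. Bochner_Integration.simple_bochner_integral lebesgue (t i)) \<longlonglongrightarrow> z"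
    by (rule has_strong_integralE) (rule that)
  have "ennreal (dist y z) \<le> 0 + 0"
  proof (rule tendsto_le[OF _ tendsto_add[OF s(2) t(2)] tendsto_ennrealI[OF tendsto_dist[OF s(3) t(3)]]])
    show "\<forall>\<^sub>F i in sequentially. ennreal (dist (Bochner_Integration.simple_bochner_integral lebesgue (s i))
        (Bochner_Integration.simple_bochner_integral lebesgue (t i)))
      \<le> (\<integral>\<^sup>+x. ennreal (norm (f x - s i x)) \<partial>lebesgue) + (\<integral>\<^sup>+x. ennreal (norm (f x - t i x)) \<partial>lebesgue)"
      using simple_bochner_integral_dist_le[OF f s(1) t(1)] by simp
  qed simp
  then show ?thesis by simp
qed

lemma strong_integral_eq:
  fixes f :: "'a::euclidean_space \<Rightarrow> 'b::real_normed_vector"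
  shows "has_strong_integral lebesgue f y \<Longrightarrow> strong_integral lebesgue f = y"
  unfolding strong_integral_def by (auto intro: has_strong_integral_unique)

lemma has_strong_integral_strong_integral:
  fixes f :: "'a::euclidean_space \<Rightarrow> 'b::banach"
  assumes f: "sintegrable f"
  shows "has_strong_integral lebesgue f (strong_integral lebesgue f)"
proof -
  obtain s where s: "\<And>i. Bochner_Integration.simple_bochner_integrable lebesgue (s i)"
    "(\<lambda>i. \<integral>\<^sup>+x. ennreal (norm (f x - s i x)) \<partial>lebesgue) \<longlonglongrightarrow> 0"
    "AE x in lebesgue. (\<lambda>i. s i x) \<longlonglongrightarrow> f x" "\<And>i x. norm (s i x) \<le> 2 * norm (f x)"
    using f by (rule sintegrable_approx) (rule that)
  have fm: "strongly_measurable lebesgue f"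
    using f by (simp add: sintegrable_def)
  let ?I = "\<lambda>i. Bochner_Integration.simple_bochner_integral lebesgue (s i)"
  have "Cauchy ?I"
  proof (rule metric_CauchyI)
    fix e :: real assume "0 < e"
    then have "0 < ennreal (e / 2)" by simp
    from order_tendstoD(2)[OF s(2) this] obtain M where
      M: "\<And>i. i \<ge> M \<Longrightarrow> (\<integral>\<^sup>+x. ennreal (norm (f x - s i x)) \<partial>lebesgue) < ennreal (e / 2)"
      by (auto simp: eventually_sequentially)
    have "dist (?I i) (?I j) < e" if "i \<ge> M" "j \<ge> M" for i j
    proof -
      have "ennreal (dist (?I i) (?I j)) \<le>
        (\<integral>\<^sup>+x. ennreal (norm (f x - s i x)) \<partial>lebesgue) + (\<integral>\<^sup>+x. ennreal (norm (f x - s j x)) \<partial>lebesgue)"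
        by (rule simple_bochner_integral_dist_le[OF fm s(1) s(1)])
      also have "\<dots> < ennreal (e / 2) + ennreal (e / 2)"
        using M[OF that(1)] M[OF that(2)] by (intro add_strict_mono)
      also have "\<dots> = ennreal e" using \<open>0 < e\<close> by (simp flip: ennreal_plus)
      finally show ?thesis using \<open>0 < e\<close> by (simp add: ennreal_less_iff)
    qed
    then show "\<exists>M. \<forall>m\<ge>M. \<forall>n\<ge>M. dist (?I m) (?I n) < e" by blast
  qed
  then obtain y where "?I \<longlonglongrightarrow> y"
    using Cauchy_convergent_iff convergent_def by blast
  then have "has_strong_integral lebesgue f y"
    unfolding has_strong_integral_def using fm s by blast
  then show ?thesis
    using strong_integral_eq by metis
qed

text \<open>A measurable function that is not integrable makes the right-hand side infinite; for an
  integrable one the approximating sums are compared with the zero function.\<close>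

lemma strong_integral_norm_le:
  fixes f :: "'a::euclidean_space \<Rightarrow> 'b::banach"
  assumes f: "strongly_measurable lebesgue f"
  shows "ennreal (norm (strong_integral lebesgue f)) \<le> (\<integral>\<^sup>+x. ennreal (norm (f x)) \<partial>lebesgue)"
proof (cases "sintegrable f")
  case True
  obtain s where "strongly_measurable lebesgue f" and s: "\<And>i. Bochner_Integration.simple_bochner_integrable lebesgue (s i)"
    "(\<lambda>i. \<integral>\<^sup>+x. ennreal (norm (f x - s i x)) \<partial>lebesgue) \<longlonglongrightarrow> 0"
    "(\<lambda>i. Bochner_Integration.simple_bochner_integral lebesgue (s i)) \<longlonglongrightarrow> strong_integral lebesgue f"
    using has_strong_integral_strong_integral[OF True] by (rule has_strong_integralE) (rule that)
  have z: "Bochner_Integration.simple_bochner_integrable lebesgue (\<lambda>x::'a. 0 :: 'b)"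
    by (auto intro!: Bochner_Integration.simple_bochner_integrable.intros)
  have z0: "Bochner_Integration.simple_bochner_integral lebesgue (\<lambda>x::'a. 0 :: 'b) = 0"
    by (auto simp: Bochner_Integration.simple_bochner_integral_def)
  have "ennreal (dist (strong_integral lebesgue f) 0) \<le> 0 + (\<integral>\<^sup>+x. ennreal (norm (f x)) \<partial>lebesgue)"
  proof (rule tendsto_le[OF _ tendsto_add[OF s(2) tendsto_const] tendsto_ennrealI[OF tendsto_dist[OF s(3) tendsto_const]]])
    show "\<forall>\<^sub>F i in sequentially. ennreal (dist (Bochner_Integration.simple_bochner_integral lebesgue (s i)) 0)
      \<le> (\<integral>\<^sup>+x. ennreal (norm (f x - s i x)) \<partial>lebesgue) + (\<integral>\<^sup>+x. ennreal (norm (f x)) \<partial>lebesgue)"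
      using simple_bochner_integral_dist_le[OF f s(1) z] z0 by simp
  qed simp
  then show ?thesis by simp
next
  case False
  then show ?thesis using f by (simp add: sintegrable_def not_less top_unique)
qed

lemma has_strong_integral_bounded_linear:
  fixes f :: "'a::euclidean_space \<Rightarrow> 'b::real_normed_vector"
  assumes h: "bounded_linear h" and f: "has_strong_integral lebesgue f y"
  shows "has_strong_integral lebesgue (\<lambda>x. h (f x)) (h y)"
proof -
  interpret h: bounded_linear h by fact
  from f obtain s where fm: "strongly_measurable lebesgue f"
    and s: "\<And>i. Bochner_Integration.simple_bochner_integrable lebesgue (s i)"
    "(\<lambda>i. \<integral>\<^sup>+x. ennreal (norm (f x - s i x)) \<partial>lebesgue) \<longlonglongrightarrow> 0"
    "(\<lambda>i. Bochner_Integration.simple_bochner_integral lebesgue (s i)) \<longlonglongrightarrow> y"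
    by (rule has_strong_integralE) (rule that)
  obtain K where K: "K > 0" "\<And>x. norm (h x) \<le> norm x * K" using h.pos_bounded by blast
  have hm: "strongly_measurable lebesgue (\<lambda>x. h (f x))"
    using fm by (rule strongly_measurable_compose) (intro linear_continuous_on h)
  have "Bochner_Integration.simple_bochner_integrable lebesgue (\<lambda>x. h (s i x))" for i
    using simple_bochner_integrable_compose2[of "\<lambda>x y. h x", OF _ s(1) s(1)] by (simp add: h.zero)
  moreover have "Bochner_Integration.simple_bochner_integral lebesgue (\<lambda>x. h (s i x)) =
      h (Bochner_Integration.simple_bochner_integral lebesgue (s i))" for i
    by (rule simple_bochner_integral_linear[OF h.linear_axioms s(1)])
  moreover have "(\<lambda>i. \<integral>\<^sup>+x. ennreal (norm (h (f x) - h (s i x))) \<partial>lebesgue) \<longlonglongrightarrow> 0"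
  proof (rule tendsto_sandwich[OF _ _ tendsto_const])
    show "\<forall>\<^sub>F i in sequentially. (\<integral>\<^sup>+x. ennreal (norm (h (f x) - h (s i x))) \<partial>lebesgue) \<le>
      ennreal K * (\<integral>\<^sup>+x. ennreal (norm (f x - s i x)) \<partial>lebesgue)"
    proof (rule always_eventually, rule allI)
      fix i
      have "(\<integral>\<^sup>+x. ennreal (norm (h (f x) - h (s i x))) \<partial>lebesgue) \<le>
        (\<integral>\<^sup>+x. ennreal K * ennreal (norm (f x - s i x)) \<partial>lebesgue)"
        using K by (intro nn_integral_mono)
          (auto simp: h.diff[symmetric] mult.commute ennreal_mult[symmetric])
      also have "\<dots> = ennreal K * (\<integral>\<^sup>+x. ennreal (norm (f x - s i x)) \<partial>lebesgue)"
        using fm simple_bochner_integrable_strongly_measurable[OF s(1)]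
        by (intro nn_integral_cmult measurable_compose[OF _ measurable_ennreal]
            strongly_measurable_norm strongly_measurable_diff)
      finally show "(\<integral>\<^sup>+x. ennreal (norm (h (f x) - h (s i x))) \<partial>lebesgue) \<le>
        ennreal K * (\<integral>\<^sup>+x. ennreal (norm (f x - s i x)) \<partial>lebesgue)" .
    qed
    show "(\<lambda>i. ennreal K * (\<integral>\<^sup>+x. ennreal (norm (f x - s i x)) \<partial>lebesgue)) \<longlonglongrightarrow> 0"
      using tendsto_mult_ennreal[OF tendsto_const s(2), of "ennreal K"] by simp
  qed simp
  moreover have "(\<lambda>i. h (Bochner_Integration.simple_bochner_integral lebesgue (s i))) \<longlonglongrightarrow> h y"
    using s(3) by (rule h.tendsto)
  ultimately show ?thesis
    unfolding has_strong_integral_def using hm by (auto intro!: exI[of _ "\<lambda>i x. h (s i x)"])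
qed

lemma has_strong_integral_add:
  fixes f g :: "'a::euclidean_space \<Rightarrow> 'b::real_normed_vector"
  assumes f: "has_strong_integral lebesgue f y" and g: "has_strong_integral lebesgue g z"
  shows "has_strong_integral lebesgue (\<lambda>x. f x + g x) (y + z)"
proof -
  from f obtain s where fm: "strongly_measurable lebesgue f"
    and s: "\<And>i. Bochner_Integration.simple_bochner_integrable lebesgue (s i)"
    "(\<lambda>i. \<integral>\<^sup>+x. ennreal (norm (f x - s i x)) \<partial>lebesgue) \<longlonglongrightarrow> 0"
    "(\<lambda>i. Bochner_Integration.simple_bochner_integral lebesgue (s i)) \<longlonglongrightarrow> y"
    by (rule has_strong_integralE) (rule that)
  from g obtain t where gm: "strongly_measurable lebesgue g"
    and t: "\<And>i. Bochner_Integration.simple_bochner_integrable lebesgue (t i)"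
    "(\<lambda>i. \<integral>\<^sup>+x. ennreal (norm (g x - t i x)) \<partial>lebesgue) \<longlonglongrightarrow> 0"
    "(\<lambda>i. Bochner_Integration.simple_bochner_integral lebesgue (t i)) \<longlonglongrightarrow> z"
    by (rule has_strong_integralE) (rule that)
  note sm = simple_bochner_integrable_strongly_measurable[OF s(1)]
    simple_bochner_integrable_strongly_measurable[OF t(1)]
  have "strongly_measurable lebesgue (\<lambda>x. f x + g x)"
    using fm gm by (rule strongly_measurable_add)
  moreover have "Bochner_Integration.simple_bochner_integrable lebesgue (\<lambda>x. s i x + t i x)" for i
    by (rule simple_bochner_integrable_compose2[where p="(+)", OF _ s(1) t(1)]) simp
  moreover have "Bochner_Integration.simple_bochner_integral lebesgue (\<lambda>x. s i x + t i x) =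
      Bochner_Integration.simple_bochner_integral lebesgue (s i) +
      Bochner_Integration.simple_bochner_integral lebesgue (t i)" for i
    by (rule simple_bochner_integral_add[OF s(1) t(1)])
  moreover have "(\<lambda>i. \<integral>\<^sup>+x. ennreal (norm ((f x + g x) - (s i x + t i x))) \<partial>lebesgue) \<longlonglongrightarrow> 0"
  proof (rule tendsto_sandwich[OF _ _ tendsto_const])
    show "\<forall>\<^sub>F i in sequentially. (\<integral>\<^sup>+x. ennreal (norm ((f x + g x) - (s i x + t i x))) \<partial>lebesgue) \<le>
      (\<integral>\<^sup>+x. ennreal (norm (f x - s i x)) \<partial>lebesgue) + (\<integral>\<^sup>+x. ennreal (norm (g x - t i x)) \<partial>lebesgue)"
    proof (rule always_eventually, rule allI)
      fix i
      have "(\<integral>\<^sup>+x. ennreal (norm ((f x + g x) - (s i x + t i x))) \<partial>lebesgue) \<le>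
        (\<integral>\<^sup>+x. ennreal (norm (f x - s i x)) + ennreal (norm (g x - t i x)) \<partial>lebesgue)"
        by (intro nn_integral_mono) (auto simp: norm_diff_triangle_ineq simp flip: ennreal_plus)
      also have "\<dots> = (\<integral>\<^sup>+x. ennreal (norm (f x - s i x)) \<partial>lebesgue) + (\<integral>\<^sup>+x. ennreal (norm (g x - t i x)) \<partial>lebesgue)"
        using fm gm sm by (intro nn_integral_add measurable_compose[OF _ measurable_ennreal]
            strongly_measurable_norm strongly_measurable_diff)
      finally show "(\<integral>\<^sup>+x. ennreal (norm ((f x + g x) - (s i x + t i x))) \<partial>lebesgue) \<le>
        (\<integral>\<^sup>+x. ennreal (norm (f x - s i x)) \<partial>lebesgue) + (\<integral>\<^sup>+x. ennreal (norm (g x - t i x)) \<partial>lebesgue)" .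
    qed
    show "(\<lambda>i. (\<integral>\<^sup>+x. ennreal (norm (f x - s i x)) \<partial>lebesgue) +
        (\<integral>\<^sup>+x. ennreal (norm (g x - t i x)) \<partial>lebesgue)) \<longlonglongrightarrow> 0"
      using tendsto_add[OF s(2) t(2)] by simp
  qed simp
  moreover have "(\<lambda>i. Bochner_Integration.simple_bochner_integral lebesgue (s i) +
      Bochner_Integration.simple_bochner_integral lebesgue (t i)) \<longlonglongrightarrow> y + z"
    using s(3) t(3) by (rule tendsto_add)
  ultimately show ?thesis
    unfolding has_strong_integral_def by (auto intro!: exI[of _ "\<lambda>i x. s i x + t i x"])
qed

lemma nn_integral_norm_add_le:
  assumes "strongly_measurable lebesgue f" "strongly_measurable lebesgue g"
  shows "(\<integral>\<^sup>+x. ennreal (norm (f x + g x)) \<partial>lebesgue) \<le>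
    (\<integral>\<^sup>+x. ennreal (norm (f x)) \<partial>lebesgue) + (\<integral>\<^sup>+x. ennreal (norm (g x)) \<partial>lebesgue)"
proof -
  have "(\<integral>\<^sup>+x. ennreal (norm (f x + g x)) \<partial>lebesgue) \<le>
      (\<integral>\<^sup>+x. ennreal (norm (f x)) + ennreal (norm (g x)) \<partial>lebesgue)"
    by (intro nn_integral_mono) (auto simp: norm_triangle_ineq simp flip: ennreal_plus)
  also have "\<dots> = (\<integral>\<^sup>+x. ennreal (norm (f x)) \<partial>lebesgue) + (\<integral>\<^sup>+x. ennreal (norm (g x)) \<partial>lebesgue)"
    using assms by (intro nn_integral_add measurable_compose[OF _ measurable_ennreal]
        strongly_measurable_norm)
  finally show ?thesis .
qed

lemma sintegrable_add:
  assumes "sintegrable f" "sintegrable g"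
  shows "sintegrable (\<lambda>x. f x + g x)"
  using assms le_less_trans[OF nn_integral_norm_add_le[of f g]]
  by (auto simp: sintegrable_def strongly_measurable_add)

lemma sintegrable_bound:
  assumes "strongly_measurable lebesgue f" "(\<integral>\<^sup>+x. w x \<partial>lebesgue) < \<infinity>"
    and "AE x in lebesgue. ennreal (norm (f x)) \<le> w x"
  shows "sintegrable f"
  using assms le_less_trans[OF nn_integral_mono_AE[OF assms(3)]] by (auto simp: sintegrable_def)

lemma sintegrable_bounded_linear:
  assumes h: "bounded_linear h" and f: "sintegrable f"
  shows "sintegrable (\<lambda>x. h (f x))"
proof -
  interpret h: bounded_linear h by fact
  obtain K where K: "K > 0" "\<And>x. norm (h x) \<le> norm x * K" using h.pos_bounded by blast
  show ?thesis
  proof (rule sintegrable_bound[where w="\<lambda>x. ennreal K * ennreal (norm (f x))"])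
    show "strongly_measurable lebesgue (\<lambda>x. h (f x))"
      using sintegrableD(1)[OF f] by (rule strongly_measurable_compose) (intro linear_continuous_on h)
    have "(\<integral>\<^sup>+x. ennreal K * ennreal (norm (f x)) \<partial>lebesgue) = ennreal K * (\<integral>\<^sup>+x. ennreal (norm (f x)) \<partial>lebesgue)"
      using strongly_measurable_norm[OF sintegrableD(1)[OF f]] by (intro nn_integral_cmult) auto
    then show "(\<integral>\<^sup>+x. ennreal K * ennreal (norm (f x)) \<partial>lebesgue) < \<infinity>"
      using sintegrableD(2)[OF f] by (auto simp: ennreal_mult_less_top)
    show "AE x in lebesgue. ennreal (norm (h (f x))) \<le> ennreal K * ennreal (norm (f x))"
      using K by (intro AE_I2) (auto simp: mult.commute ennreal_mult[symmetric])
  qed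
qed

lemma strong_integral_bounded_linear:
  fixes f :: "'a::euclidean_space \<Rightarrow> 'b::banach"
  assumes "bounded_linear h" "sintegrable f"
  shows "strong_integral lebesgue (\<lambda>x. h (f x)) = h (strong_integral lebesgue f)"
  using has_strong_integral_bounded_linear[OF assms(1) has_strong_integral_strong_integral[OF assms(2)]]
  by (rule strong_integral_eq)

lemma strong_integral_add:
  fixes f g :: "'a::euclidean_space \<Rightarrow> 'b::banach"
  assumes "sintegrable f" "sintegrable g"
  shows "strong_integral lebesgue (\<lambda>x. f x + g x) = strong_integral lebesgue f + strong_integral lebesgue g"
  using has_strong_integral_add[OF assms[THEN has_strong_integral_strong_integral]]
  by (rule strong_integral_eq)

lemma sintegrable_diff:
  assumes "sintegrable f" "sintegrable g"
  shows "sintegrable (\<lambda>x. f x - g x)"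
  using sintegrable_add[OF assms(1) sintegrable_bounded_linear[OF bounded_linear_minus[OF bounded_linear_ident] assms(2)]]
  by simp

lemma strong_integral_diff:
  fixes f g :: "'a::euclidean_space \<Rightarrow> 'b::banach"
  assumes "sintegrable f" "sintegrable g"
  shows "strong_integral lebesgue (\<lambda>x. f x - g x) = strong_integral lebesgue f - strong_integral lebesgue g"
  using strong_integral_add[OF assms(1) sintegrable_bounded_linear[OF bounded_linear_minus[OF bounded_linear_ident] assms(2)]]
    strong_integral_bounded_linear[OF bounded_linear_minus[OF bounded_linear_ident] assms(2)]
  by simp

lemma has_strong_integral_0: "has_strong_integral lebesgue (\<lambda>x. 0) 0"
  unfolding has_strong_integral_def
  by (auto intro!: exI[of _ "\<lambda>i x. 0"] Bochner_Integration.simple_bochner_integrable.intros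
      simp: Bochner_Integration.simple_bochner_integral_def)

lemma sintegrable_0[simp]: "sintegrable (\<lambda>x. 0)"
  by (simp add: sintegrable_def)

lemma strong_integral_0[simp]: "strong_integral lebesgue (\<lambda>x. 0 :: 'b::real_normed_vector) = 0"
  by (rule strong_integral_eq[OF has_strong_integral_0])

lemma sintegrable_sum:
  "(\<And>i. i \<in> I \<Longrightarrow> sintegrable (f i)) \<Longrightarrow> sintegrable (\<lambda>x. \<Sum>i\<in>I. f i x)"
  by (induction I rule: infinite_finite_induct) (auto intro!: sintegrable_add)

lemma strong_integral_sum:
  fixes f :: "'i \<Rightarrow> 'a::euclidean_space \<Rightarrow> 'b::banach"
  assumes "\<And>i. i \<in> I \<Longrightarrow> sintegrable (f i)"
  shows "strong_integral lebesgue (\<lambda>x. \<Sum>i\<in>I. f i x) = (\<Sum>i\<in>I. strong_integral lebesgue (f i))"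
  using assms
  by (induction I rule: infinite_finite_induct) (auto simp: strong_integral_add sintegrable_sum)

text \<open>The predicate \<open>has_strong_integral\<close> itself does not change, so the equality
  includes functions on which \<open>strong_integral\<close> takes its default value.\<close>

lemma strong_integral_cong_AE:
  fixes f g :: "'a::euclidean_space \<Rightarrow> 'b::real_normed_vector"
  assumes eq: "AE x in lebesgue. f x = g x"
  shows "strong_integral lebesgue f = strong_integral lebesgue g"
proof -
  have "AE x in lebesgue. g x = f x" using eq by eventually_elim simp
  then have m: "strongly_measurable lebesgue f = strongly_measurable lebesgue g"
    using eq strongly_measurable_cong_AE by metis
  have i: "(\<integral>\<^sup>+x. ennreal (norm (f x - s x)) \<partial>lebesgue) = (\<integral>\<^sup>+x. ennreal (norm (g x - s x)) \<partial>lebesgue)" for s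
    by (rule nn_integral_cong_AE) (use eq in \<open>eventually_elim, auto\<close>)
  have "has_strong_integral lebesgue f = has_strong_integral lebesgue g"
    unfolding has_strong_integral_def[abs_def] m i ..
  then show ?thesis by (simp add: strong_integral_def)
qed

lemma tendsto_strong_integral_L1:
  fixes f :: "'a::euclidean_space \<Rightarrow> 'b::banach"
  assumes g: "\<And>i. sintegrable (g i)" and f: "sintegrable f"
    and lim: "((\<lambda>i. \<integral>\<^sup>+x. ennreal (norm (g i x - f x)) \<partial>lebesgue) \<longlongrightarrow> 0) F"
  shows "((\<lambda>i. strong_integral lebesgue (g i)) \<longlongrightarrow> strong_integral lebesgue f) F"
proof -
  have "((\<lambda>i. ennreal (dist (strong_integral lebesgue (g i)) (strong_integral lebesgue f))) \<longlongrightarrow> 0) F"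
  proof (rule tendsto_sandwich[OF _ _ tendsto_const lim])
    show "\<forall>\<^sub>F i in F. ennreal (dist (strong_integral lebesgue (g i)) (strong_integral lebesgue f))
      \<le> (\<integral>\<^sup>+x. ennreal (norm (g i x - f x)) \<partial>lebesgue)"
      using strong_integral_norm_le[OF strongly_measurable_diff[OF sintegrableD(1)[OF g] sintegrableD(1)[OF f]]]
      by (auto simp: dist_norm strong_integral_diff[OF g f] intro!: always_eventually)
  qed simp
  then have "((\<lambda>i. dist (strong_integral lebesgue (g i)) (strong_integral lebesgue f)) \<longlongrightarrow> 0) F"
    by (subst tendsto_ennreal_iff[symmetric]) auto
  then show ?thesis by (rule tendsto_dist_iff[THEN iffD2])
qed

lemma nn_integral_norm_diff_tendsto_0:
  fixes f :: "'a::euclidean_space \<Rightarrow> 'b::real_normed_vector"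
  assumes g: "\<And>i::nat. strongly_measurable lebesgue (g i)"
    and lim: "AE x in lebesgue. (\<lambda>i. g i x) \<longlonglongrightarrow> f x"
    and w: "\<And>i. AE x in lebesgue. ennreal (norm (g i x)) \<le> w x" "(\<integral>\<^sup>+x. w x \<partial>lebesgue) < \<infinity>"
      "w \<in> borel_measurable lebesgue"
  shows "sintegrable f" "\<And>i. sintegrable (g i)"
    "(\<lambda>i. \<integral>\<^sup>+x. ennreal (norm (g i x - f x)) \<partial>lebesgue) \<longlonglongrightarrow> 0"
proof -
  have fm: "strongly_measurable lebesgue f"
    using g lim by (rule strongly_measurable_LIMSEQ_AE)
  have "AE x in lebesgue. \<forall>i. ennreal (norm (g i x)) \<le> w x"
    using w(1) by (simp add: AE_all_countable)
  with lim have fw: "AE x in lebesgue. ennreal (norm (f x)) \<le> w x"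
  proof eventually_elim
    case (elim x)
    then show ?case
      by (intro tendsto_upperbound[OF tendsto_ennrealI[OF tendsto_norm[OF elim(1)]]]) auto
  qed
  show "sintegrable f" by (rule sintegrable_bound[OF fm w(2) fw])
  show "sintegrable (g i)" for i by (rule sintegrable_bound[OF g w(2) w(1)])
  have "(\<lambda>i. \<integral>\<^sup>+x. ennreal (norm (g i x - f x)) \<partial>lebesgue) \<longlonglongrightarrow> (\<integral>\<^sup>+x. 0 \<partial>(lebesgue :: 'a measure))"
  proof (rule nn_integral_dominated_convergence[where w="\<lambda>x. 2 * w x"])
    show "(\<lambda>x. ennreal (norm (g i x - f x))) \<in> borel_measurable lebesgue" for i
      using fm g by (intro measurable_compose[OF _ measurable_ennreal]
        strongly_measurable_norm strongly_measurable_diff)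
    show "(\<lambda>x. 2 * w x) \<in> borel_measurable lebesgue"
      using w(3) by (auto intro!: borel_measurable_times_ennreal)
    show "(\<integral>\<^sup>+x. 2 * w x \<partial>lebesgue) < \<infinity>"
      using w by (subst nn_integral_cmult) (auto simp: ennreal_mult_less_top)
    show "AE x in lebesgue. ennreal (norm (g i x - f x)) \<le> 2 * w x" for i
      using w(1)[of i] fw
    proof eventually_elim
      case (elim x)
      have "ennreal (norm (g i x - f x)) \<le> ennreal (norm (g i x)) + ennreal (norm (f x))"
        by (simp add: norm_triangle_ineq4 flip: ennreal_plus)
      also have "\<dots> \<le> w x + w x" using elim by (rule add_mono)
      finally show ?case by (simp add: mult_2)
    qed
    show "AE x in lebesgue. (\<lambda>i. ennreal (norm (g i x - f x))) \<longlonglongrightarrow> 0"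
      using lim
    proof eventually_elim
      case (elim x)
      have "(\<lambda>i. ennreal (norm (g i x - f x))) \<longlonglongrightarrow> ennreal (norm (f x - f x))"
        using elim by (intro tendsto_intros)
      then show ?case by simp
    qed
  qed simp
  then show "(\<lambda>i. \<integral>\<^sup>+x. ennreal (norm (g i x - f x)) \<partial>lebesgue) \<longlonglongrightarrow> 0" by simp
qed

lemma strong_integral_dominated_convergence:
  fixes f :: "'a::euclidean_space \<Rightarrow> 'b::banach"
  assumes "\<And>i::nat. strongly_measurable lebesgue (g i)"
    and "AE x in lebesgue. (\<lambda>i. g i x) \<longlonglongrightarrow> f x"
    and "\<And>i. AE x in lebesgue. ennreal (norm (g i x)) \<le> w x" "(\<integral>\<^sup>+x. w x \<partial>lebesgue) < \<infinity>"
      "w \<in> borel_measurable lebesgue"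
  shows "(\<lambda>i. strong_integral lebesgue (g i)) \<longlonglongrightarrow> strong_integral lebesgue f"
  using nn_integral_norm_diff_tendsto_0[OF assms] by (intro tendsto_strong_integral_L1)

text \<open>The bridge to \<open>integral\<^sup>L\<close>, through which Fubini's theorem and
  translation invariance become available for complex functions.\<close>

lemma integrable_sintegrable:
  fixes f :: "'a::euclidean_space \<Rightarrow> 'b::{banach,second_countable_topology}"
  assumes "integrable lebesgue f"
  shows "sintegrable f" "strong_integral lebesgue f = integral\<^sup>L lebesgue f"
proof -
  show "sintegrable f"
    using assms by (auto simp: sintegrable_def integrable_iff_bounded intro: strongly_measurable_separable)
  then have fm: "strongly_measurable lebesgue f" by (rule sintegrableD)
  have "has_bochner_integral lebesgue f (integral\<^sup>L lebesgue f)"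
    using assms by (rule has_bochner_integral_integrable)
  then have "has_strong_integral lebesgue f (integral\<^sup>L lebesgue f)"
    using fm by cases (auto simp: has_strong_integral_def)
  then show "strong_integral lebesgue f = integral\<^sup>L lebesgue f" by (rule strong_integral_eq)
qed

lemma strong_integral_scaleC_left:
  fixes u :: "'a::euclidean_space \<Rightarrow> complex" and x :: "'b::complex_banach"
  assumes "integrable lebesgue u"
  shows "sintegrable (\<lambda>t. u t *\<^sub>C x)"
    "strong_integral lebesgue (\<lambda>t. u t *\<^sub>C x) = integral\<^sup>L lebesgue u *\<^sub>C x"
  using sintegrable_bounded_linear[OF scaleC.bounded_linear_left integrable_sintegrable(1)[OF assms]]
    strong_integral_bounded_linear[OF scaleC.bounded_linear_left integrable_sintegrable(1)[OF assms]]
    integrable_sintegrable(2)[OF assms] by auto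

section \<open>Schwartz functions\<close>

text \<open>A product of functions of one coordinate, so that its integral factorises into integrals
  of \<open>1 / (1 + t^2)\<close>. It lies above a power of \<open>1 / (1 + norm x ^ 2)\<close>,
  hence a multiple of it majorises any given Schwartz function.\<close>

definition weight :: "'a::euclidean_space \<Rightarrow> real"
  where "weight x = (\<Prod>b\<in>Basis. inverse (1 + (x \<bullet> b)\<^sup>2))"

lemma weight_pos: "0 < weight x"
  unfolding weight_def by (intro prod_pos) (auto intro: add_pos_nonneg)

lemma weight_le_1: "weight x \<le> 1"
  unfolding weight_def by (intro prod_le_1) (auto simp: inverse_le_1_iff)

lemma borel_measurable_weight[measurable]: "weight \<in> borel_measurable borel"
  unfolding weight_def[abs_def]
  by (intro borel_measurable_continuous_onI continuous_intros) (auto simp: add_nonneg_eq_0_iff)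

lemma weight_lebesgue[measurable]: "weight \<in> borel_measurable lebesgue"
  using borel_measurable_weight by (intro measurable_completion) simp

lemma weight_ge: "inverse ((1 + (norm x)\<^sup>2) ^ DIM('a)) \<le> weight (x::'a::euclidean_space)"
proof -
  have "(1 + (x \<bullet> b)\<^sup>2) \<le> 1 + (norm x)\<^sup>2" if "b \<in> Basis" for b
    using Basis_le_norm[OF that, of x] by (simp add: abs_le_square_iff[symmetric])
  then have "(\<Prod>b\<in>(Basis::'a set). inverse (1 + (norm x)\<^sup>2)) \<le> weight x"
    unfolding weight_def by (intro prod_mono) (auto intro!: le_imp_inverse_le add_pos_nonneg)
  then show ?thesis by (simp add: power_inverse)
qed

lemma nn_integral_inverse_1_plus_square: "(\<integral>\<^sup>+t. ennreal (inverse (1 + t\<^sup>2)) \<partial>lborel) < \<infinity>"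
proof -
  have h: "(\<integral>\<^sup>+t. ennreal (inverse (1 + t\<^sup>2)) * indicator {0..} t \<partial>lborel) = ennreal (pi / 2 - arctan 0)"
    by (rule nn_integral_FTC_atLeast) (auto intro!: DERIV_arctan tendsto_arctan_at_top add_nonneg_nonneg)
  have "(\<integral>\<^sup>+t. ennreal (inverse (1 + t\<^sup>2)) * indicator {..0} t \<partial>lborel) =
      (\<integral>\<^sup>+t. ennreal (inverse (1 + t\<^sup>2)) * indicator {0..} t \<partial>lborel)"
    by (subst nn_integral_real_affine[of _ "-1" 0])
      (auto simp: indicator_def intro!: nn_integral_cong)
  then have "(\<integral>\<^sup>+t. ennreal (inverse (1 + t\<^sup>2)) * indicator {0..} t + ennreal (inverse (1 + t\<^sup>2)) * indicator {..0} t \<partial>lborel)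
      = ennreal (pi / 2) + ennreal (pi / 2)"
    using h by (subst nn_integral_add) auto
  also have "\<dots> < \<infinity>" by (simp add: less_top)
  finally have "(\<integral>\<^sup>+t. ennreal (inverse (1 + t\<^sup>2)) * indicator {0..} t + ennreal (inverse (1 + t\<^sup>2)) * indicator {..0} t \<partial>lborel) < \<infinity>" .
  moreover have "(\<integral>\<^sup>+t. ennreal (inverse (1 + t\<^sup>2)) \<partial>lborel) \<le>
    (\<integral>\<^sup>+t. ennreal (inverse (1 + t\<^sup>2)) * indicator {0..} t + ennreal (inverse (1 + t\<^sup>2)) * indicator {..0} t \<partial>lborel)"
    by (intro nn_integral_mono) (auto simp: indicator_def)
  ultimately show ?thesis by simp
qed

lemma nn_integral_weight: "(\<integral>\<^sup>+x. ennreal (weight (x::'a::euclidean_space)) \<partial>lebesgue) < \<infinity>"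
proof -
  have "(\<integral>\<^sup>+x. ennreal (weight (x::'a)) \<partial>lborel) =
      (\<integral>\<^sup>+x. (\<Prod>b\<in>Basis. ennreal (inverse (1 + ((x::'a) \<bullet> b)\<^sup>2))) \<partial>lborel)"
    unfolding weight_def by (intro nn_integral_cong) (auto simp: prod_ennreal add_nonneg_nonneg)
  also have "\<dots> = (\<Prod>b\<in>(Basis::'a set). (\<integral>\<^sup>+t. ennreal (inverse (1 + t\<^sup>2)) \<partial>lborel))"
    by (rule nn_integral_lborel_prod) auto
  also have "\<dots> < \<infinity>"
    using nn_integral_inverse_1_plus_square by (simp add: power_less_top_ennreal)
  finally show ?thesis by (simp add: nn_integral_completion)
qed

text \<open>Two seminorms suffice: with \<open>n\<close> the squared norm and \<open>d\<close> the
  dimension, \<open>(1 + n) ^ d\<close> is at most \<open>2 ^ d * (1 + n ^ d)\<close>, so the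
  suprema of \<open>f\<close> and of \<open>norm x ^ (2 * d)\<close> times \<open>f\<close> control
  everything.\<close>

lemma schwartz_le_weight:
  fixes f :: "'a::euclidean_space \<Rightarrow> 'b::real_normed_vector"
  assumes "f \<in> schwartz"
  obtains C where "C \<ge> 0" "\<And>x. norm (f x) \<le> C * weight x"
proof -
  have b: "bounded (range (\<lambda>x. norm x ^ k *\<^sub>R f x))" for k
    using assms unfolding schwartz_def by (auto dest!: spec[of _ "[]"])
  obtain C0 where C0: "\<And>x. norm (f x) \<le> C0"
    using b[of 0] by (auto simp: bounded_iff)
  obtain C1 where C1: "\<And>x. norm x ^ (2 * DIM('a)) * norm (f x) \<le> C1"
    using b[of "2 * DIM('a)"] by (auto simp: bounded_iff)
  have C0': "0 \<le> C0" using C0[of 0] norm_ge_zero order_trans by blast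
  have C1': "0 \<le> C1" using C1[of 0] by (rule order_trans[rotated]) simp
  have "norm (f x) \<le> (2 ^ DIM('a) * (C0 + C1)) * weight x" for x
  proof -
    let ?n = "(norm x)\<^sup>2" and ?d = "DIM('a)"
    have "(1 + ?n) ^ ?d \<le> (2 * max 1 ?n) ^ ?d"
      by (intro power_mono) auto
    also have "\<dots> = 2 ^ ?d * (max 1 ?n) ^ ?d" by (rule power_mult_distrib)
    also have "\<dots> \<le> 2 ^ ?d * (1 + ?n ^ ?d)"
      by (intro mult_left_mono) (auto simp: max_def)
    finally have "norm (f x) * (1 + ?n) ^ ?d \<le> norm (f x) * (2 ^ ?d * (1 + ?n ^ ?d))"
      by (intro mult_left_mono) auto
    also have "\<dots> = 2 ^ ?d * (norm (f x) + norm x ^ (2 * ?d) * norm (f x))"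
      by (simp add: power_mult distrib_left mult.assoc mult.left_commute)
    also have "\<dots> \<le> 2 ^ ?d * (C0 + C1)"
      using C0[of x] C1[of x] by (intro mult_left_mono add_mono) auto
    finally have "norm (f x) \<le> (2 ^ ?d * (C0 + C1)) * inverse ((1 + ?n) ^ ?d)"
      by (simp add: field_simps add_pos_nonneg)
    also have "\<dots> \<le> (2 ^ ?d * (C0 + C1)) * weight x"
      using weight_ge[of x] C0' C1' by (intro mult_left_mono) auto
    finally show ?thesis .
  qed
  then show ?thesis using C0' C1' by (intro that[of "2 ^ DIM('a) * (C0 + C1)"]) auto
qed

lemma schwartz_continuous: "f \<in> schwartz \<Longrightarrow> continuous_on UNIV f"
  unfolding schwartz_def
  by (auto dest!: spec[of _ "[]"] simp: continuous_on_eq_continuous_at differentiable_imp_continuous_within)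

lemma iterated_partial_add:
  assumes "f \<in> schwartz" "g \<in> schwartz" "set bs \<subseteq> Basis"
  shows "iterated_partial bs (\<lambda>x. f x + g x) = (\<lambda>x. iterated_partial bs f x + iterated_partial bs g x)"
  using assms(3)
proof (induction bs)
  case (Cons b bs)
  have "iterated_partial bs f differentiable (at x)" "iterated_partial bs g differentiable (at x)" for x
    using assms(1,2) Cons.prems by (auto simp: schwartz_def)
  then have "((\<lambda>x. iterated_partial bs f x + iterated_partial bs g x) has_derivative
      (\<lambda>h. frechet_derivative (iterated_partial bs f) (at x) h + frechet_derivative (iterated_partial bs g) (at x) h)) (at x)" for x
    by (intro has_derivative_add) (auto simp: frechet_derivative_works[symmetric])
  from frechet_derivative_at[OF this] show ?case
    using Cons by (auto simp: fun_eq_iff) metis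
qed simp

lemma schwartz_add:
  assumes "f \<in> schwartz" "g \<in> schwartz"
  shows "(\<lambda>x. f x + g x) \<in> schwartz"
  unfolding schwartz_def
proof (intro CollectI allI impI conjI)
  fix bs :: "'a list" assume bs: "set bs \<subseteq> Basis"
  fix x show "iterated_partial bs (\<lambda>x. f x + g x) differentiable at x"
    using assms bs by (auto simp: iterated_partial_add schwartz_def intro!: differentiable_add)
next
  fix bs :: "'a list" and k :: nat assume bs: "set bs \<subseteq> Basis"
  have "bounded (range (\<lambda>x. norm x ^ k *\<^sub>R iterated_partial bs f x))"
    "bounded (range (\<lambda>x. norm x ^ k *\<^sub>R iterated_partial bs g x))"
    using assms bs by (auto simp: schwartz_def)
  then obtain A B where A: "\<And>x. norm (norm x ^ k *\<^sub>R iterated_partial bs f x) \<le> A"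
    and B: "\<And>x. norm (norm x ^ k *\<^sub>R iterated_partial bs g x) \<le> B"
    unfolding bounded_iff by (metis rangeI)
  have "norm (norm x ^ k *\<^sub>R (iterated_partial bs f x + iterated_partial bs g x)) \<le> A + B" for x
    unfolding scaleR_add_right by (rule norm_triangle_le[OF add_mono[OF A B]])
  then show "bounded (range (\<lambda>x. norm x ^ k *\<^sub>R iterated_partial bs (\<lambda>x. f x + g x) x))"
    using iterated_partial_add[OF assms bs] unfolding bounded_iff by auto
qed

section \<open>Polynomials times exponentials as Schwartz functions\<close>

lemma real_polynomial_function_has_derivative:
  fixes Q :: "'a::euclidean_space \<Rightarrow> real"
  assumes "real_polynomial_function Q"
  shows "\<exists>D. (\<forall>x. (Q has_derivative D x) (at x)) \<and> (\<forall>b. real_polynomial_function (\<lambda>x. D x b))"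
  using assms
proof induction
  case (linear h)
  then show ?case
    by (intro exI[of _ "\<lambda>x. h"]) (auto intro: bounded_linear_imp_has_derivative real_polynomial_function.intros)
next
  case (const c)
  show ?case by (intro exI[of _ "\<lambda>x h. 0"]) (auto intro: real_polynomial_function.intros)
next
  case (add f g)
  then obtain F G where "\<And>x. (f has_derivative F x) (at x)" "\<And>b. real_polynomial_function (\<lambda>x. F x b)"
    "\<And>x. (g has_derivative G x) (at x)" "\<And>b. real_polynomial_function (\<lambda>x. G x b)" by blast
  then show ?case
    by (intro exI[of _ "\<lambda>x h. F x h + G x h"]) (auto intro: real_polynomial_function.intros has_derivative_add)
next
  case (mult f g)
  then obtain F G where "\<And>x. (f has_derivative F x) (at x)" "\<And>b. real_polynomial_function (\<lambda>x. F x b)"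
    "\<And>x. (g has_derivative G x) (at x)" "\<And>b. real_polynomial_function (\<lambda>x. G x b)" by blast
  then show ?case
    using mult.hyps by (intro exI[of _ "\<lambda>x h. f x * G x h + F x h * g x"])
      (auto intro!: real_polynomial_function.intros(3,4) has_derivative_mult)
qed

lemma real_polynomial_function_growth:
  fixes Q :: "'a::euclidean_space \<Rightarrow> real"
  assumes "real_polynomial_function Q"
  shows "\<exists>C N. 0 \<le> C \<and> (\<forall>x. \<bar>Q x\<bar> \<le> C * (1 + norm x) ^ N)"
  using assms
proof induction
  case (linear h)
  then obtain K where K: "K > 0" "\<And>x. norm (h x) \<le> norm x * K"
    using bounded_linear.pos_bounded by blast
  have "\<bar>h x\<bar> \<le> K * (1 + norm x) ^ 1" for x
    using K(2)[of x] K(1) by (simp add: algebra_simps)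
  then show ?case using K(1) by (intro exI[of _ K] exI[of _ 1]) auto
next
  case (const c)
  show ?case by (intro exI[of _ "\<bar>c\<bar>"] exI[of _ 0]) auto
next
  case (add f g)
  then obtain C N D M where C: "0 \<le> C" "\<And>x. \<bar>f x\<bar> \<le> C * (1 + norm x) ^ N"
    and D: "0 \<le> D" "\<And>x. \<bar>g x\<bar> \<le> D * (1 + norm x) ^ M" by blast
  have "\<bar>f x + g x\<bar> \<le> (C + D) * (1 + norm x) ^ (N + M)" for x
  proof -
    have "C * (1 + norm x) ^ N \<le> C * (1 + norm x) ^ (N + M)" "D * (1 + norm x) ^ M \<le> D * (1 + norm x) ^ (N + M)"
      using C D by (auto intro!: mult_left_mono power_increasing)
    then show ?thesis using C(2)[of x] D(2)[of x] by (simp add: algebra_simps)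
  qed
  then show ?case using C D by (intro exI[of _ "C + D"] exI[of _ "N + M"]) auto
next
  case (mult f g)
  then obtain C N D M where C: "0 \<le> C" "\<And>x. \<bar>f x\<bar> \<le> C * (1 + norm x) ^ N"
    and D: "0 \<le> D" "\<And>x. \<bar>g x\<bar> \<le> D * (1 + norm x) ^ M" by blast
  have "\<bar>f x * g x\<bar> \<le> (C * D) * (1 + norm x) ^ (N + M)" for x
    using mult_mono[OF C(2)[of x] D(2)[of x]] C(1) by (simp add: abs_mult power_add algebra_simps)
  then show ?case using C D by (intro exI[of _ "C * D"] exI[of _ "N + M"]) auto
qed

text \<open>This is \<open>(1 + u / N) ^ N <= exp u\<close> at
  \<open>u = (1 + t) * \<epsilon>\<close>, with the first 1 dropped.\<close>

lemma one_plus_power_le_exp: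
  fixes \<epsilon> :: real
  assumes "\<epsilon> > 0"
  obtains K where "K \<ge> 0" "\<And>t. t \<ge> 0 \<Longrightarrow> (1 + t) ^ N \<le> K * exp (\<epsilon> * t)"
proof (cases "N = 0")
  case True
  then show ?thesis using assms by (intro that[of 1]) auto
next
  case False
  have "(1 + t) ^ N \<le> ((real N / \<epsilon>) ^ N * exp \<epsilon>) * exp (\<epsilon> * t)" if "t \<ge> 0" for t
  proof -
    have "((1 + t) * \<epsilon> / N) ^ N \<le> (1 + (1 + t) * \<epsilon> / N) ^ N"
      using that assms by (intro power_mono) auto
    also have "\<dots> \<le> exp ((1 + t) * \<epsilon>)"
      using that assms False by (intro exp_ge_one_plus_x_over_n_power_n) (auto intro: order_trans[of _ 0])
    also have "\<dots> = exp \<epsilon> * exp (\<epsilon> * t)" by (simp add: algebra_simps flip: exp_add)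
    finally have "(real N / \<epsilon>) ^ N * ((1 + t) * \<epsilon> / N) ^ N \<le> (real N / \<epsilon>) ^ N * (exp \<epsilon> * exp (\<epsilon> * t))"
      using assms by (intro mult_left_mono) auto
    also have "(real N / \<epsilon>) ^ N * ((1 + t) * \<epsilon> / N) ^ N = (1 + t) ^ N"
      using assms False by (simp flip: power_mult_distrib)
    finally show ?thesis by (simp add: mult.assoc)
  qed
  then show ?thesis using assms by (intro that[of "(real N / \<epsilon>) ^ N * exp \<epsilon>"]) auto
qed

text \<open>For fixed \<open>P\<close>, the products of \<open>exp (- P)\<close> with polynomials
  are closed under directional derivatives, so every iterated partial is again of this form. At
  least linear growth of \<open>P\<close> then beats any polynomial.\<close>

lemma polynomial_exp_schwartz:
  fixes Q P :: "'a::euclidean_space \<Rightarrow> real" and v :: "'b::real_normed_vector"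
  assumes Q: "real_polynomial_function Q" and P: "real_polynomial_function P"
    and \<epsilon>: "\<epsilon> > 0" and lb: "\<And>x. P x \<ge> \<epsilon> * norm x - C"
  shows "(\<lambda>x. (Q x * exp (- P x)) *\<^sub>R v) \<in> schwartz"
proof -
  obtain DP where DP: "\<And>x. (P has_derivative DP x) (at x)" "\<And>b. real_polynomial_function (\<lambda>x. DP x b)"
    using real_polynomial_function_has_derivative[OF P] by blast
  have step: "\<exists>D. (\<forall>x. ((\<lambda>x. (R x * exp (- P x)) *\<^sub>R v) has_derivative (\<lambda>h. (D x h * exp (- P x)) *\<^sub>R v)) (at x)) \<and>
      (\<forall>b. real_polynomial_function (\<lambda>x. D x b))"
    if R: "real_polynomial_function R" for R
  proof -
    obtain DR where DR: "\<And>x. (R has_derivative DR x) (at x)" "\<And>b. real_polynomial_function (\<lambda>x. DR x b)"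
      using real_polynomial_function_has_derivative[OF R] by blast
    have "((\<lambda>x. (R x * exp (- P x)) *\<^sub>R v) has_derivative
        (\<lambda>h. ((DR x h - R x * DP x h) * exp (- P x)) *\<^sub>R v)) (at x)" for x
      by (rule has_derivative_eq_rhs[OF has_derivative_scaleR_left[OF has_derivative_mult[OF DR(1)
            has_derivative_exp[OF has_derivative_minus[OF DP(1)]]]]])
        (auto simp: fun_eq_iff algebra_simps)
    moreover have "real_polynomial_function (\<lambda>x. DR x b - R x * DP x b)" for b
      using DR(2) DP(2) R by (intro real_polynomial_function_diff real_polynomial_function.intros(4))
    ultimately show ?thesis by (intro exI[of _ "\<lambda>x h. DR x h - R x * DP x h"]) auto
  qed
  have it: "\<exists>R. real_polynomial_function R \<and>
      iterated_partial bs (\<lambda>x. (Q x * exp (- P x)) *\<^sub>R v) = (\<lambda>x. (R x * exp (- P x)) *\<^sub>R v)" for bs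
  proof (induction bs)
    case Nil
    show ?case using Q by (intro exI[of _ Q]) auto
  next
    case (Cons b bs)
    then obtain R where R: "real_polynomial_function R"
      "iterated_partial bs (\<lambda>x. (Q x * exp (- P x)) *\<^sub>R v) = (\<lambda>x. (R x * exp (- P x)) *\<^sub>R v)" by blast
    obtain D where D: "\<And>x. ((\<lambda>x. (R x * exp (- P x)) *\<^sub>R v) has_derivative (\<lambda>h. (D x h * exp (- P x)) *\<^sub>R v)) (at x)"
      "\<And>b. real_polynomial_function (\<lambda>x. D x b)" using step[OF R(1)] by blast
    have "frechet_derivative (\<lambda>x. (R x * exp (- P x)) *\<^sub>R v) (at x) b = (D x b * exp (- P x)) *\<^sub>R v" for x
      using frechet_derivative_at[OF D(1)[of x]] by metis
    then show ?case
      using D(2)[of b] R(2) by (intro exI[of _ "\<lambda>x. D x b"]) auto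
  qed
  show ?thesis
    unfolding schwartz_def
  proof (intro CollectI allI impI conjI)
    fix bs :: "'a list" and x
    obtain R where R: "real_polynomial_function R"
      "iterated_partial bs (\<lambda>x. (Q x * exp (- P x)) *\<^sub>R v) = (\<lambda>x. (R x * exp (- P x)) *\<^sub>R v)"
      using it by blast
    show "iterated_partial bs (\<lambda>x. (Q x * exp (- P x)) *\<^sub>R v) differentiable (at x)"
      unfolding R(2) using step[OF R(1)] by (auto simp: differentiable_def)
  next
    fix bs :: "'a list" and k :: nat
    obtain R where R: "real_polynomial_function R"
      "iterated_partial bs (\<lambda>x. (Q x * exp (- P x)) *\<^sub>R v) = (\<lambda>x. (R x * exp (- P x)) *\<^sub>R v)"
      using it by blast
    obtain A N where A: "0 \<le> A" "\<And>x. \<bar>R x\<bar> \<le> A * (1 + norm x) ^ N"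
      using real_polynomial_function_growth[OF R(1)] by blast
    obtain K where K: "K \<ge> 0" "\<And>t. t \<ge> 0 \<Longrightarrow> (1 + t) ^ (k + N) \<le> K * exp (\<epsilon> * t)"
      using one_plus_power_le_exp[OF \<epsilon>] by metis
    have "norm (norm x ^ k *\<^sub>R ((R x * exp (- P x)) *\<^sub>R v)) \<le> A * K * exp C * norm v" for x
    proof -
      have "norm x ^ k * \<bar>R x\<bar> \<le> (1 + norm x) ^ k * (A * (1 + norm x) ^ N)"
        using A by (intro mult_mono power_mono) auto
      also have "\<dots> = A * (1 + norm x) ^ (k + N)" by (simp add: power_add)
      also have "\<dots> \<le> A * (K * exp (\<epsilon> * norm x))" using K A by (intro mult_left_mono) auto
      finally have 1: "norm x ^ k * \<bar>R x\<bar> \<le> A * (K * exp (\<epsilon> * norm x))" .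
      have "exp (- P x) \<le> exp (C - \<epsilon> * norm x)" using lb[of x] by simp
      then have "(norm x ^ k * \<bar>R x\<bar>) * exp (- P x) \<le> (A * (K * exp (\<epsilon> * norm x))) * exp (C - \<epsilon> * norm x)"
        using A K by (intro mult_mono[OF 1]) auto
      also have "\<dots> = A * K * exp C" by (simp flip: exp_add)
      finally have "(norm x ^ k * \<bar>R x\<bar> * exp (- P x)) * norm v \<le> A * K * exp C * norm v"
        by (intro mult_right_mono) auto
      then show ?thesis by (simp add: abs_mult mult.assoc)
    qed
    then show "bounded (range (\<lambda>x. norm x ^ k *\<^sub>R iterated_partial bs (\<lambda>x. (Q x * exp (- P x)) *\<^sub>R v) x))"
      unfolding R(2) bounded_iff by blast
  qed
qed

text \<open>The bumps are \<open>exp (- \<Sum>\<^sub>i y\<^sub>i ^ (2 n))\<close> for the affine coordinates \<open>y\<close> that map the box to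
  \<open>(-1, 1)\<close> in every direction.\<close>

lemma box_bump:
  fixes a b :: "'a::euclidean_space"
  obtains \<phi> :: "nat \<Rightarrow> 'a \<Rightarrow> real" and C where "C \<ge> 0"
    "\<And>n (v::'b::real_normed_vector). (\<lambda>x. \<phi> n x *\<^sub>R v) \<in> schwartz"
    "\<And>n (v::complex). (\<lambda>x. \<phi> n x *\<^sub>R v) \<in> schwartz"
    "\<And>n x. 0 \<le> \<phi> n x" "\<And>n x. \<phi> n x \<le> C * weight x"
    "AE x in lebesgue. (\<lambda>n. \<phi> n x) \<longlonglongrightarrow> indicator (box a b) x" "\<And>n. continuous_on UNIV (\<phi> n)"
proof -
  define ne where "ne \<longleftrightarrow> box a b \<noteq> {}"
  define c where "c = (\<lambda>i. if ne then 2 / ((b - a) \<bullet> i) else 1)"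
  define m where "m = (\<lambda>i. ((a + b) \<bullet> i) / 2)"
  \<comment> \<open>For an empty box the factor \<open>q\<close> is 0 and the slopes
    \<open>c\<close> are 1, so that \<open>P\<close> still grows and all bounds hold without a case
    distinction.\<close>
  define q :: real where "q = (if ne then 1 else 0)"
  define y where "y = (\<lambda>i x. c i * (x \<bullet> i - m i))"
  define P where "P = (\<lambda>n x. \<Sum>i\<in>Basis. (y i x) ^ (2 * Suc n))"
  define \<epsilon> where "\<epsilon> = Min (c ` Basis)"
  define C' where "C' = (\<Sum>i\<in>(Basis::'a set). c i * \<bar>m i\<bar> + 1)"
  have ab: "a \<bullet> i < b \<bullet> i" if "i \<in> Basis" ne for i
    using that by (auto simp: ne_def box_ne_empty)
  have c: "c i > 0" if "i \<in> Basis" for i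
    using ab[OF that] by (auto simp: c_def inner_diff_left)
  have \<epsilon>: "\<epsilon> > 0" and \<epsilon>c: "\<And>i. i \<in> Basis \<Longrightarrow> \<epsilon> \<le> c i"
    unfolding \<epsilon>_def using c by (auto intro!: Min_gr_iff[THEN iffD2])
  have poly: "real_polynomial_function (P n)" for n
    unfolding P_def y_def
    by (intro real_polynomial_function_sum real_polynomial_function_power
        real_polynomial_function.intros(2,4) real_polynomial_function_diff
        real_polynomial_function.intros(1)[OF bounded_linear_inner_left]) auto
  \<comment> \<open>The bound is independent of \<open>n\<close> and therefore yields one dominating
    function for the whole sequence. With exponent \<open>2 * Suc n\<close> it holds at
    \<open>n = 0\<close> as well.\<close>
  have pow: "t ^ (2 * Suc n) \<ge> \<bar>t\<bar> - 1" for t :: real and n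
  proof (cases "\<bar>t\<bar> \<le> 1")
    case True
    moreover have "0 \<le> t ^ (2 * Suc n)" by (rule zero_le_even_power) simp
    ultimately show ?thesis by linarith
  next
    case False
    then have "\<bar>t\<bar> ^ 1 \<le> \<bar>t\<bar> ^ (2 * Suc n)" by (intro power_increasing) auto
    then have "\<bar>t\<bar> \<le> \<bar>t\<bar> ^ (2 * Suc n)" by (simp only: power_one_right)
    moreover have "\<bar>t\<bar> ^ (2 * Suc n) = t ^ (2 * Suc n)" by (rule power_even_abs) simp
    ultimately show ?thesis by linarith
  qed
  have lb: "P n x \<ge> \<epsilon> * norm x - C'" for n x
  proof -
    have "\<epsilon> * norm x \<le> \<epsilon> * (\<Sum>i\<in>Basis. \<bar>x \<bullet> i\<bar>)"
      using \<epsilon> norm_le_l1[of x] by (intro mult_left_mono) auto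
    also have "\<dots> \<le> (\<Sum>i\<in>Basis. c i * \<bar>x \<bullet> i\<bar>)"
      using \<epsilon>c unfolding sum_distrib_left by (intro sum_mono mult_right_mono) auto
    finally have "\<epsilon> * norm x - C' \<le> (\<Sum>i\<in>Basis. c i * \<bar>x \<bullet> i\<bar> - (c i * \<bar>m i\<bar> + 1))"
      by (simp add: C'_def sum_subtractf)
    also have "\<dots> \<le> P n x"
      unfolding P_def
    proof (rule sum_mono)
      fix i :: 'a assume i: "i \<in> Basis"
      have "c i * \<bar>x \<bullet> i\<bar> \<le> c i * (\<bar>x \<bullet> i - m i\<bar> + \<bar>m i\<bar>)"
        using c[OF i] by (intro mult_left_mono) auto
      moreover have "\<bar>y i x\<bar> = c i * \<bar>x \<bullet> i - m i\<bar>"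
        using c[OF i] by (simp add: y_def abs_mult)
      ultimately have "c i * \<bar>x \<bullet> i\<bar> - (c i * \<bar>m i\<bar> + 1) \<le> \<bar>y i x\<bar> - 1"
        by (simp add: distrib_left)
      also have "\<dots> \<le> y i x ^ (2 * Suc n)" by (rule pow)
      finally show "c i * \<bar>x \<bullet> i\<bar> - (c i * \<bar>m i\<bar> + 1) \<le> y i x ^ (2 * Suc n)" .
    qed
    finally show ?thesis .
  qed
  define \<phi> where "\<phi> = (\<lambda>n x. q * exp (- P n x))"
  have sch: "(\<lambda>x. \<phi> n x *\<^sub>R v) \<in> schwartz" for n and v :: "'c::real_normed_vector"
    unfolding \<phi>_def using poly[of n] lb[of _ n]
    by (intro polynomial_exp_schwartz[OF _ _ \<epsilon>]) (auto intro: real_polynomial_function.intros)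
  obtain K where K: "K \<ge> 0" "\<And>t. t \<ge> 0 \<Longrightarrow> (1 + t) ^ (2 * DIM('a)) \<le> K * exp (\<epsilon> * t)"
    using one_plus_power_le_exp[OF \<epsilon>] by metis
  have bd: "\<phi> n x \<le> (exp C' * K) * weight x" for n x
  proof -
    have "(1 + (norm x)\<^sup>2) ^ DIM('a) \<le> ((1 + norm x)\<^sup>2) ^ DIM('a)"
      by (intro power_mono) (auto simp: power2_eq_square algebra_simps)
    also have "\<dots> \<le> K * exp (\<epsilon> * norm x)" using K(2)[of "norm x"] by (simp add: power_mult)
    finally have *: "(1 + (norm x)\<^sup>2) ^ DIM('a) \<le> K * exp (\<epsilon> * norm x)" .
    have "\<phi> n x \<le> exp (- P n x)" by (auto simp: \<phi>_def q_def)
    also have "\<dots> \<le> exp (C' - \<epsilon> * norm x)" using lb[of x n] by simp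
    also have "\<dots> = exp C' * inverse (exp (\<epsilon> * norm x))" by (simp add: exp_diff divide_inverse)
    also have "\<dots> \<le> exp C' * (K * inverse ((1 + (norm x)\<^sup>2) ^ DIM('a)))"
      using * by (intro mult_left_mono) (auto simp: field_simps add_pos_nonneg)
    also have "\<dots> \<le> exp C' * (K * weight x)"
      using weight_ge[of x] K(1) by (intro mult_left_mono) auto
    finally show ?thesis by (simp add: mult.assoc)
  qed
  \<comment> \<open>On the boundary of a nonempty box some coordinate \<open>y i x\<close> is 1 or
    -1, so its term in \<open>P\<close> stays 1 and the limit is not the indicator.\<close>
  have "cbox a b - box a b \<in> null_sets lebesgue"
    using negligible_frontier_interval[of a b] by (simp add: negligible_iff_null_sets)
  then have "AE x in lebesgue. x \<notin> cbox a b - box a b" by (rule AE_not_in)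
  then have lim: "AE x in lebesgue. (\<lambda>n. \<phi> n x) \<longlonglongrightarrow> indicator (box a b) x"
  proof eventually_elim
    case (elim x)
    show ?case
    proof (cases ne)
      case False
      then show ?thesis by (auto simp: \<phi>_def q_def ne_def)
    next
      case True
      have yi: "\<bar>y i x\<bar> < 1 \<longleftrightarrow> a \<bullet> i < x \<bullet> i \<and> x \<bullet> i < b \<bullet> i" "\<bar>y i x\<bar> \<le> 1 \<longleftrightarrow> a \<bullet> i \<le> x \<bullet> i \<and> x \<bullet> i \<le> b \<bullet> i"
        if "i \<in> Basis" for i
      proof -
        have d: "(b - a) \<bullet> i > 0" using ab[OF that True] by (simp add: inner_diff_left)
        have "\<bar>y i x\<bar> = \<bar>2 * (x \<bullet> i) - (a + b) \<bullet> i\<bar> / ((b - a) \<bullet> i)"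
          using d True by (simp add: y_def c_def m_def abs_mult abs_if field_simps)
        then show "\<bar>y i x\<bar> < 1 \<longleftrightarrow> a \<bullet> i < x \<bullet> i \<and> x \<bullet> i < b \<bullet> i" "\<bar>y i x\<bar> \<le> 1 \<longleftrightarrow> a \<bullet> i \<le> x \<bullet> i \<and> x \<bullet> i \<le> b \<bullet> i"
          using d by (auto simp: inner_diff_left inner_add_left abs_if)
      qed
      show ?thesis
      proof (cases "x \<in> box a b")
        case inb: True
        have "(\<lambda>n. P n x) \<longlonglongrightarrow> (\<Sum>i\<in>(Basis::'a set). 0)"
          unfolding P_def
        proof (rule tendsto_sum)
          fix i :: 'a assume i: "i \<in> Basis"
          have "\<bar>y i x\<bar> < 1" using inb i by (auto simp: yi mem_box)
          then have "(y i x)\<^sup>2 < 1" by (simp add: abs_square_less_1)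
          then have "(\<lambda>n. ((y i x)\<^sup>2) ^ n) \<longlonglongrightarrow> 0" by (intro LIMSEQ_realpow_zero) auto
          then have "(\<lambda>n. ((y i x)\<^sup>2) ^ Suc n) \<longlonglongrightarrow> 0" by (rule LIMSEQ_Suc)
          then show "(\<lambda>n. y i x ^ (2 * Suc n)) \<longlonglongrightarrow> 0" by (simp only: power_mult)
        qed
        then have "(\<lambda>n. q * exp (- P n x)) \<longlonglongrightarrow> q * exp (- 0)"
          by (intro tendsto_intros) simp
        then show ?thesis using inb True by (simp add: \<phi>_def q_def)
      next
        case nin: False
        with elim have "x \<notin> cbox a b" by auto
        then obtain i where i: "i \<in> Basis" "\<not> \<bar>y i x\<bar> \<le> 1" by (auto simp: mem_box yi)
        have y1: "1 < (y i x)\<^sup>2" using i(2) abs_square_le_1[of "y i x"] by linarith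
        have PP: "P n x \<ge> ((y i x)\<^sup>2) ^ n" for n
        proof -
          have "((y i x)\<^sup>2) ^ n \<le> ((y i x)\<^sup>2) ^ Suc n"
            using y1 by (intro power_increasing) auto
          also have "\<dots> = (y i x) ^ (2 * Suc n)" by (simp only: power_mult)
          also have "\<dots> \<le> P n x" unfolding P_def
            using i(1) by (intro member_le_sum zero_le_even_power) auto
          finally show ?thesis .
        qed
        have FF: "filterlim (\<lambda>n. ((y i x)\<^sup>2) ^ n) at_top sequentially"
        proof (rule filterlim_at_infinity_imp_filterlim_at_top)
          show "filterlim (\<lambda>n. ((y i x)\<^sup>2) ^ n) at_infinity sequentially"
            using y1 by (intro filterlim_realpow_sequentially_gt1) auto
          show "\<forall>\<^sub>F n in sequentially. 0 < ((y i x)\<^sup>2) ^ n"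
            using y1 by (intro always_eventually allI zero_less_power[of "(y i x)\<^sup>2"]) linarith
        qed
        have "filterlim (\<lambda>n. P n x) at_top sequentially"
          by (rule filterlim_at_top_mono[OF FF always_eventually[OF allI[OF PP]]])
        then have "(\<lambda>n. exp (- P n x)) \<longlonglongrightarrow> 0"
          by (intro filterlim_compose[OF exp_at_bot]) (simp add: filterlim_uminus_at_bot)
        from tendsto_mult_right_zero[OF this, of q] show ?thesis using nin by (simp add: \<phi>_def)
      qed
    qed
  qed
  have "continuous_on UNIV (\<phi> n)" for n
    using schwartz_continuous[OF sch[of n "1::real"]] by simp
  moreover have "\<phi> n x \<ge> 0" for n x by (simp add: \<phi>_def q_def)
  ultimately show ?thesis
    using K(1) by (intro that[of "exp C' * K" \<phi>] sch bd lim) auto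
qed

text \<open>Approximation in this gauge is approximation in \<open>L\<^sup>1\<close> and in \<open>L\<^sup>s\<close> by the same functions.\<close>

definition L1_Lp_gauge :: "real \<Rightarrow> ('a::euclidean_space \<Rightarrow> 'b::real_normed_vector) \<Rightarrow> ennreal"
  where "L1_Lp_gauge s f = (\<integral>\<^sup>+x. ennreal (norm (f x) + norm (f x) powr s) \<partial>lebesgue)"

lemma powr_add_le:
  fixes a b s :: real
  assumes "0 \<le> a" "0 \<le> b" "0 \<le> s"
  shows "(a + b) powr s \<le> 2 powr s * (a powr s + b powr s)"
proof -
  have "(a + b) powr s \<le> (2 * max a b) powr s"
    using assms by (intro powr_mono2) auto
  also have "\<dots> = 2 powr s * max a b powr s" using assms by (simp add: powr_mult)
  also have "\<dots> \<le> 2 powr s * (a powr s + b powr s)"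
    by (intro mult_left_mono) (auto simp: max_def)
  finally show ?thesis .
qed

lemma gauge_add_le:
  fixes x y :: "'b::real_normed_vector"
  assumes "s \<ge> 1"
  shows "norm (x + y) + norm (x + y) powr s \<le>
    2 powr s * ((norm x + norm x powr s) + (norm y + norm y powr s))"
proof -
  have "norm (x + y) powr s \<le> (norm x + norm y) powr s"
    using assms by (intro powr_mono2) (auto simp: norm_triangle_ineq)
  also have "\<dots> \<le> 2 powr s * (norm x powr s + norm y powr s)"
    using assms by (intro powr_add_le) auto
  finally have 1: "norm (x + y) powr s \<le> 2 powr s * (norm x powr s + norm y powr s)" .
  have "1 \<le> 2 powr s" using assms by (simp add: ge_one_powr_ge_zero)
  then have "1 * (norm x + norm y) \<le> 2 powr s * (norm x + norm y)" by (intro mult_right_mono) auto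
  then have "norm (x + y) \<le> 2 powr s * (norm x + norm y)"
    using norm_triangle_ineq[of x y] by (metis mult_1 order_trans)
  with 1 show ?thesis by (simp add: algebra_simps)
qed

lemma borel_measurable_gauge:
  "h \<in> borel_measurable M \<Longrightarrow> (\<lambda>x. ennreal (h x + h x powr s)) \<in> borel_measurable M"
  for h :: "'a \<Rightarrow> real"
  by (intro measurable_compose[OF _ measurable_ennreal] borel_measurable_add powr_real_measurable) auto

lemma L1_Lp_gauge_measurable:
  "strongly_measurable lebesgue f \<Longrightarrow>
    (\<lambda>x. ennreal (norm (f x) + norm (f x) powr s)) \<in> borel_measurable lebesgue"
  by (rule borel_measurable_gauge[OF strongly_measurable_norm])

lemma L1_Lp_gauge_add_le:
  assumes "strongly_measurable lebesgue f" "strongly_measurable lebesgue g" "s \<ge> 1"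
  shows "L1_Lp_gauge s (\<lambda>x. f x + g x) \<le> ennreal (2 powr s) * (L1_Lp_gauge s f + L1_Lp_gauge s g)"
proof -
  have "L1_Lp_gauge s (\<lambda>x. f x + g x) \<le> (\<integral>\<^sup>+x. ennreal (2 powr s) *
      (ennreal (norm (f x) + norm (f x) powr s) + ennreal (norm (g x) + norm (g x) powr s)) \<partial>lebesgue)"
    unfolding L1_Lp_gauge_def
    by (intro nn_integral_mono) (auto simp: gauge_add_le[OF assms(3)] simp flip: ennreal_plus ennreal_mult)
  also have "\<dots> = ennreal (2 powr s) * (L1_Lp_gauge s f + L1_Lp_gauge s g)"
    unfolding L1_Lp_gauge_def using L1_Lp_gauge_measurable[OF assms(1)] L1_Lp_gauge_measurable[OF assms(2)]
    by (subst nn_integral_cmult) (auto simp: nn_integral_add intro!: borel_measurable_add)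
  finally show ?thesis .
qed

lemma L1_Lp_gauge_minus: "L1_Lp_gauge s (\<lambda>x. - f x) = L1_Lp_gauge s f"
  by (simp add: L1_Lp_gauge_def)

lemma L1_Lp_gauge_add_finite:
  assumes "strongly_measurable lebesgue f" "strongly_measurable lebesgue g" "s \<ge> 1" "L1_Lp_gauge s f < \<infinity>" "L1_Lp_gauge s g < \<infinity>"
  shows "L1_Lp_gauge s (\<lambda>x. f x + g x) < \<infinity>"
  using L1_Lp_gauge_add_le[OF assms(1-3)] assms(4,5) by (auto simp: ennreal_mult_less_top intro: le_less_trans)

lemma L1_Lp_gauge_finite_iff:
  assumes f: "strongly_measurable lebesgue f"
  shows "L1_Lp_gauge s f < \<infinity> \<longleftrightarrow> sintegrable f \<and> (\<integral>\<^sup>+x. ennreal (norm (f x) powr s) \<partial>lebesgue) < \<infinity>"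
proof -
  have "L1_Lp_gauge s f = (\<integral>\<^sup>+x. ennreal (norm (f x)) \<partial>lebesgue) + (\<integral>\<^sup>+x. ennreal (norm (f x) powr s) \<partial>lebesgue)"
    unfolding L1_Lp_gauge_def using strongly_measurable_norm[OF f]
    by (subst nn_integral_add[symmetric]) (auto simp flip: ennreal_plus)
  then show ?thesis using f by (simp add: sintegrable_def)
qed

lemma nn_integral_powr_le_L1_Lp_gauge: "(\<integral>\<^sup>+x. ennreal (norm (f x) powr s) \<partial>lebesgue) \<le> L1_Lp_gauge s f"
  unfolding L1_Lp_gauge_def by (intro nn_integral_mono) (auto intro: ennreal_leI)

lemma nn_integral_norm_le_L1_Lp_gauge: "(\<integral>\<^sup>+x. ennreal (norm (f x)) \<partial>lebesgue) \<le> L1_Lp_gauge s f"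
  unfolding L1_Lp_gauge_def by (intro nn_integral_mono) (auto intro: ennreal_leI)

lemma L1_Lp_gauge_dominated:
  fixes f :: "'a::euclidean_space \<Rightarrow> 'b::real_normed_vector" and h :: "'a \<Rightarrow> real"
  assumes s: "s \<ge> 1"
    and g: "\<And>i::nat. strongly_measurable lebesgue (g i)"
    and lim: "AE x in lebesgue. (\<lambda>i. g i x) \<longlonglongrightarrow> f x"
    and h: "\<And>i. AE x in lebesgue. norm (g i x) \<le> h x" "h \<in> borel_measurable lebesgue"
      "(\<integral>\<^sup>+x. ennreal (h x + h x powr s) \<partial>lebesgue) < \<infinity>"
  shows "strongly_measurable lebesgue f" "L1_Lp_gauge s f < \<infinity>" "\<And>i. L1_Lp_gauge s (g i) < \<infinity>"
    "(\<lambda>i. L1_Lp_gauge s (\<lambda>x. g i x - f x)) \<longlonglongrightarrow> 0"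
proof -
  show fm: "strongly_measurable lebesgue f"
    using g lim by (rule strongly_measurable_LIMSEQ_AE)
  have "AE x in lebesgue. \<forall>i. norm (g i x) \<le> h x"
    using h(1) by (simp add: AE_all_countable)
  with lim have fh: "AE x in lebesgue. norm (f x) \<le> h x"
  proof eventually_elim
    case (elim x)
    then show ?case by (intro tendsto_upperbound[OF tendsto_norm[OF elim(1)]]) auto
  qed
  have bd: "L1_Lp_gauge s u < \<infinity>" if "AE x in lebesgue. norm (u x) \<le> h x" for u :: "'a \<Rightarrow> 'b"
  proof -
    have "L1_Lp_gauge s u \<le> (\<integral>\<^sup>+x. ennreal (h x + h x powr s) \<partial>lebesgue)"
      unfolding L1_Lp_gauge_def
    proof (rule nn_integral_mono_AE)
      show "AE x in lebesgue. ennreal (norm (u x) + norm (u x) powr s) \<le> ennreal (h x + h x powr s)"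
        using that
      proof eventually_elim
        case (elim x)
        then show ?case using s by (intro ennreal_leI add_mono powr_mono2) auto
      qed
    qed
    with h(3) show ?thesis by simp
  qed
  show "L1_Lp_gauge s f < \<infinity>" using fh by (rule bd)
  show "L1_Lp_gauge s (g i) < \<infinity>" for i using h(1) by (rule bd)
  have "(\<lambda>i. \<integral>\<^sup>+x. ennreal (norm (g i x - f x) + norm (g i x - f x) powr s) \<partial>lebesgue) \<longlonglongrightarrow>
      (\<integral>\<^sup>+x. 0 \<partial>(lebesgue :: 'a measure))"
  proof (rule nn_integral_dominated_convergence[where w="\<lambda>x. ennreal (2 powr s * 2) * ennreal (h x + h x powr s)"])
    show "(\<lambda>x. ennreal (norm (g i x - f x) + norm (g i x - f x) powr s)) \<in> borel_measurable lebesgue" for i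
      by (intro L1_Lp_gauge_measurable strongly_measurable_diff g fm)
    show "(\<lambda>x. ennreal (2 powr s * 2) * ennreal (h x + h x powr s)) \<in> borel_measurable lebesgue"
      using h(2) by measurable
    show "(\<integral>\<^sup>+x. ennreal (2 powr s * 2) * ennreal (h x + h x powr s) \<partial>lebesgue) < \<infinity>"
      using h(2,3) by (subst nn_integral_cmult) (auto simp: ennreal_mult_less_top)
    show "AE x in lebesgue. ennreal (norm (g i x - f x) + norm (g i x - f x) powr s) \<le>
        ennreal (2 powr s * 2) * ennreal (h x + h x powr s)" for i
      using h(1)[of i] fh
    proof eventually_elim
      case (elim x)
      have p: "norm (g i x) powr s \<le> h x powr s" "norm (f x) powr s \<le> h x powr s"
        using elim s by (auto intro: powr_mono2)
      have "norm (g i x - f x) + norm (g i x - f x) powr s \<le>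
          2 powr s * ((norm (g i x) + norm (g i x) powr s) + (norm (f x) + norm (f x) powr s))"
        using gauge_add_le[OF s, of "g i x" "- f x"] by simp
      also have "\<dots> \<le> 2 powr s * ((h x + h x powr s) + (h x + h x powr s))"
        using elim p by (intro mult_left_mono add_mono) auto
      also have "\<dots> = (2 powr s * 2) * (h x + h x powr s)" by simp
      finally have "ennreal (norm (g i x - f x) + norm (g i x - f x) powr s) \<le>
          ennreal ((2 powr s * 2) * (h x + h x powr s))" by (rule ennreal_leI)
      moreover have "0 \<le> h x" using elim(1) norm_ge_zero order_trans by blast
      ultimately show ?case by (simp add: ennreal_mult)
    qed
    show "AE x in lebesgue. (\<lambda>i. ennreal (norm (g i x - f x) + norm (g i x - f x) powr s)) \<longlonglongrightarrow> 0"
      using lim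
    proof eventually_elim
      case (elim x)
      have n: "(\<lambda>i. norm (g i x - f x)) \<longlonglongrightarrow> 0"
        using elim by (simp add: LIM_zero tendsto_norm_zero)
      have "(\<lambda>i. norm (g i x - f x) powr s) \<longlonglongrightarrow> 0 powr s"
        using s by (intro tendsto_powr'[OF n tendsto_const]) auto
      then have "(\<lambda>i. ennreal (norm (g i x - f x) + norm (g i x - f x) powr s)) \<longlonglongrightarrow> ennreal (0 + 0)"
        using n by (intro tendsto_ennrealI tendsto_add) auto
      then show ?case by simp
    qed
  qed simp
  then show "(\<lambda>i. L1_Lp_gauge s (\<lambda>x. g i x - f x)) \<longlonglongrightarrow> 0"
    by (simp add: L1_Lp_gauge_def)
qed

lemma L1_Lp_gauge_indicator_finite:
  assumes "A \<in> sets lebesgue" "emeasure lebesgue A < \<infinity>"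
  shows "(\<integral>\<^sup>+x. ennreal (c * indicator A x + (c * indicator A x) powr s) \<partial>lebesgue) < \<infinity>"
proof -
  have "(\<integral>\<^sup>+x. ennreal (c * indicator A x + (c * indicator A x) powr s) \<partial>lebesgue) =
      (\<integral>\<^sup>+x. ennreal (c + c powr s) * indicator A x \<partial>lebesgue)"
    by (intro nn_integral_cong) (auto simp: indicator_def)
  then show ?thesis using assms by (simp add: nn_integral_cmult_indicator ennreal_mult_less_top)
qed

text \<open>Dynkin's argument: the open boxes generate the Borel sets and are closed under
  intersection; the empty set is one of them.\<close>

lemma borel_box_induct [consumes 1, case_names box compl union]:
  fixes A :: "'a::euclidean_space set"
  assumes A: "A \<in> sets borel"
    and box: "\<And>a b. P (box a b)"
    and compl: "\<And>A. A \<in> sets borel \<Longrightarrow> P A \<Longrightarrow> P (- A)"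
    and union: "\<And>A. disjoint_family A \<Longrightarrow> range A \<subseteq> sets borel \<Longrightarrow> (\<And>i::nat. P (A i)) \<Longrightarrow> P (\<Union>i. A i)"
  shows "P A"
proof -
  let ?G = "range (\<lambda>(a, b). box a b :: 'a set)"
  have eq: "sets (borel :: 'a measure) = sigma_sets UNIV ?G"
    by (subst borel_eq_box) simp
  have "Int_stable ?G"
    by (auto simp: Int_stable_def box_Int_box)
  moreover have "?G \<subseteq> Pow UNIV" by simp
  moreover have "A \<in> sigma_sets UNIV ?G" using A eq by simp
  ultimately show ?thesis
  proof (induction rule: sigma_sets_induct_disjoint)
    case (basic A)
    then show ?case using box by auto
  next
    case empty
    then show ?case using box[of 0 0] by simp
  next
    case (compl A)
    then show ?case using assms(3)[of A] eq by (simp add: Compl_eq_Diff_UNIV)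
  next
    case (union A)
    then show ?case using assms(4)[of A] eq by simp
  qed
qed

lemma emeasure_lebesgue_box_finite: "emeasure lebesgue (box a b :: 'a::euclidean_space set) < \<infinity>"
  using emeasure_lborel_box_finite[of a b] by (simp add: emeasure_completion)

lemma lebesgue_AE_borel:
  fixes A :: "'a::euclidean_space set"
  assumes "A \<in> sets lebesgue"
  obtains B where "B \<in> sets borel" "AE x in lebesgue. x \<in> A \<longleftrightarrow> x \<in> B" "emeasure lebesgue B = emeasure lebesgue A"
proof -
  from assms obtain S N N' where A: "A = S \<union> N" "N \<subseteq> N'" "N' \<in> null_sets lborel" "S \<in> sets lborel"
    by (auto simp: sets_completion)
  have "N' \<in> null_sets lebesgue" using A(3) by (rule null_sets_completionI)
  then have ae: "AE x in lebesgue. x \<in> A \<longleftrightarrow> x \<in> S"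
    by (rule AE_I') (use A in auto)
  have "emeasure lebesgue S = emeasure lebesgue A"
    using ae assms A(4) by (intro emeasure_eq_AE) auto
  then show ?thesis using ae A(4) by (intro that[of S]) auto
qed

text \<open>Reduces a claim to vectors times indicators of boxes, passing through Borel subsets of
  boxes, sets of finite measure and simple functions. As the limits are taken in the gauge, it
  serves claims that are continuous in \<open>L^1\<close> or in \<open>L^s\<close>.\<close>

lemma L1_Lp_induct [consumes 3, case_names box add lim]:
  fixes f :: "'a::euclidean_space \<Rightarrow> 'b::real_normed_vector"
  assumes s: "s \<ge> 1" and f: "strongly_measurable lebesgue f" "L1_Lp_gauge s f < \<infinity>"
    and box: "\<And>a b v. P (\<lambda>x. indicator (box a b) x *\<^sub>R v)"
    and add: "\<And>f g. strongly_measurable lebesgue f \<Longrightarrow> L1_Lp_gauge s f < \<infinity> \<Longrightarrow> P f \<Longrightarrow>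
      strongly_measurable lebesgue g \<Longrightarrow> L1_Lp_gauge s g < \<infinity> \<Longrightarrow> P g \<Longrightarrow> P (\<lambda>x. f x + g x)"
    and lim: "\<And>f g. (\<And>n::nat. strongly_measurable lebesgue (g n)) \<Longrightarrow> (\<And>n. L1_Lp_gauge s (g n) < \<infinity>) \<Longrightarrow>
      (\<And>n. P (g n)) \<Longrightarrow> strongly_measurable lebesgue f \<Longrightarrow> L1_Lp_gauge s f < \<infinity> \<Longrightarrow>
      (\<lambda>n. L1_Lp_gauge s (\<lambda>x. g n x - f x)) \<longlonglongrightarrow> 0 \<Longrightarrow> P f"
  shows "P f"
proof -
  have ind: "strongly_measurable lebesgue (\<lambda>x. indicator A x *\<^sub>R v)" "L1_Lp_gauge s (\<lambda>x. indicator A x *\<^sub>R v) < \<infinity>"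
    if A: "A \<in> sets lebesgue" "emeasure lebesgue A < \<infinity>" for A and v :: 'b
  proof -
    show "strongly_measurable lebesgue (\<lambda>x. indicator A x *\<^sub>R v)"
      using A by (intro strongly_measurable_indicator) auto
    show "L1_Lp_gauge s (\<lambda>x. indicator A x *\<^sub>R v) < \<infinity>"
      using L1_Lp_gauge_indicator_finite[OF A, of "norm v" s]
      by (simp add: L1_Lp_gauge_def mult.commute)
  qed
  have indlim: "P (\<lambda>x. indicator A x *\<^sub>R v)"
    if A: "\<And>n::nat. AA n \<in> sets lebesgue" "\<And>n. P (\<lambda>x. indicator (AA n) x *\<^sub>R v)"
      and B: "B \<in> sets lebesgue" "emeasure lebesgue B < \<infinity>" "\<And>n. AA n \<subseteq> B"
      and l: "AE x in lebesgue. (\<lambda>n. indicator (AA n) x) \<longlonglongrightarrow> (indicator A x :: real)" for A AA B and v :: 'b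
  proof -
    have *: "AE x in lebesgue. norm (indicator (AA n) x *\<^sub>R v) \<le> norm v * indicator B x" for n
      using B(3)[of n] by (auto simp: indicator_def)
    have l': "AE x in lebesgue. (\<lambda>n. indicator (AA n) x *\<^sub>R v) \<longlonglongrightarrow> indicator A x *\<^sub>R v"
      using l by eventually_elim (intro tendsto_intros)
    have "(\<lambda>x. norm v * indicator B x) \<in> borel_measurable lebesgue"
      using B(1) by (intro borel_measurable_times) auto
    moreover have fin: "emeasure lebesgue (AA n) < \<infinity>" for n
      using emeasure_mono[OF B(3) B(1), of n] B(2) by (rule le_less_trans)
    ultimately show ?thesis
      using L1_Lp_gauge_dominated[OF s ind(1)[OF A(1) fin] l' * _ L1_Lp_gauge_indicator_finite[OF B(1,2)]]
      by (intro lim[OF ind[OF A(1) fin] A(2)]) auto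
  qed
  \<comment> \<open>Intersecting with a box keeps all measures finite, which permits complements in
    the induction over Borel sets. The vector is quantified because the only operation available is
    addition: the complement is obtained by adding the function for \<open>- v\<close>.\<close>
  have 1: "\<forall>a b v. P (\<lambda>x. indicator (A \<inter> box a b) x *\<^sub>R v)" if "A \<in> sets borel" for A
    using that
  proof (induction rule: borel_box_induct)
    case (box a b)
    then show ?case using assms(4) by (auto simp: box_Int_box)
  next
    case (compl A)
    show ?case
    proof (intro allI)
      fix a b :: 'a and v :: 'b
      have "(\<lambda>x. indicator (- A \<inter> box a b) x *\<^sub>R v) =
          (\<lambda>x. indicator (box a b) x *\<^sub>R v + indicator (A \<inter> box a b) x *\<^sub>R (- v))"
        by (auto simp: indicator_def fun_eq_iff)
      moreover have "emeasure lebesgue (A \<inter> box a b) < \<infinity>"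
        using emeasure_mono[of "A \<inter> box a b" "box a b" lebesgue] emeasure_lebesgue_box_finite[of a b]
        by (auto intro: le_less_trans)
      moreover have "P (\<lambda>x. indicator (A \<inter> box a b) x *\<^sub>R (- v))" using compl(2) by blast
      moreover have "A \<inter> box a b \<in> sets lebesgue" "box a b \<in> sets lebesgue" using compl(1) by auto
      ultimately show "P (\<lambda>x. indicator (- A \<inter> box a b) x *\<^sub>R v)"
        using emeasure_lebesgue_box_finite[of a b] assms(4) by (simp only:) (intro add ind)
    qed
  next
    case (union A)
    show ?case
    proof (intro allI)
      fix a b :: 'a and v :: 'b
      have A: "A i \<in> sets lebesgue" for i using union(2) by auto
      have "P (\<lambda>x. indicator ((\<Union>i<n. A i) \<inter> box a b) x *\<^sub>R v)" for n
      proof (induction n)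
        case 0
        show ?case using assms(4)[of 0 0 v] by simp
      next
        case (Suc n)
        have "A n \<inter> A i = {}" if "i < n" for i
          using disjoint_family_onD[OF union(1), of n i] that by simp
        then have "A n \<inter> (\<Union>i<n. A i) = {}" by blast
        then have "(\<lambda>x. indicator ((\<Union>i<Suc n. A i) \<inter> box a b) x *\<^sub>R v) =
          (\<lambda>x. indicator ((\<Union>i<n. A i) \<inter> box a b) x *\<^sub>R v + indicator (A n \<inter> box a b) x *\<^sub>R v)"
          by (auto simp: indicator_def fun_eq_iff lessThan_Suc split: if_splits)
        moreover have "emeasure lebesgue (B \<inter> box a b) < \<infinity>" if "B \<in> sets lebesgue" for B
          using emeasure_mono[of "B \<inter> box a b" "box a b" lebesgue] emeasure_lebesgue_box_finite[of a b]
          by (auto intro: le_less_trans)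
        ultimately show ?case
          using Suc union(3)[of n] A by (auto intro!: add ind sets.Int sets.finite_UN)
      qed
      note P = this
      have l: "AE x in lebesgue. (\<lambda>n. indicator ((\<Union>i<n. A i) \<inter> box a b) x) \<longlonglongrightarrow>
          (indicator ((\<Union>i. A i) \<inter> box a b) x :: real)"
      proof (rule AE_I2)
        fix x
        show "(\<lambda>n. indicator ((\<Union>i<n. A i) \<inter> box a b) x) \<longlonglongrightarrow>
          (indicator ((\<Union>i. A i) \<inter> box a b) x :: real)"
        proof (cases "\<exists>i. x \<in> A i")
          case True
          then obtain i where "x \<in> A i" by blast
          then have "indicator ((\<Union>i<n. A i) \<inter> box a b) x = (indicator ((\<Union>i. A i) \<inter> box a b) x :: real)" if "n > i" for n
            using that by (auto simp: indicator_def)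
          then show ?thesis
            by (intro tendsto_eventually eventually_sequentiallyI[of "Suc i"]) auto
        qed (auto simp: indicator_def)
      qed
      have "(\<Union>i<n. A i) \<inter> box a b \<in> sets lebesgue" "(\<Union>i<n. A i) \<inter> box a b \<subseteq> box a b" for n
        using A by auto
      from indlim[OF this(1) P _ emeasure_lebesgue_box_finite this(2) l]
      show "P (\<lambda>x. indicator ((\<Union>i. A i) \<inter> box a b) x *\<^sub>R v)" by simp
    qed
  qed
  have 2: "P (\<lambda>x. indicator A x *\<^sub>R v)" if A: "A \<in> sets lebesgue" "emeasure lebesgue A < \<infinity>" for A v
  proof -
    obtain B where B: "B \<in> sets borel" "AE x in lebesgue. x \<in> A \<longleftrightarrow> x \<in> B" "emeasure lebesgue B = emeasure lebesgue A"
      using A(1) by (rule lebesgue_AE_borel)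
    \<comment> \<open>A set of finite measure may be unbounded, so it is exhausted by its
      intersections with boxes.\<close>
    let ?Q = "\<lambda>n. box (- (real n *\<^sub>R One)) (real n *\<^sub>R One) :: 'a set"
    have B': "\<And>n. B \<inter> ?Q n \<in> sets lebesgue" "\<And>n. B \<inter> ?Q n \<subseteq> B" "B \<in> sets lebesgue"
      "emeasure lebesgue B < \<infinity>" "\<And>n. P (\<lambda>x. indicator (B \<inter> ?Q n) x *\<^sub>R v)"
      using 1[OF B(1)] A B by auto
    have "AE x in lebesgue. (\<lambda>n. indicator (B \<inter> ?Q n) x) \<longlonglongrightarrow> (indicator A x :: real)"
        using B(2)
      proof eventually_elim
        case (elim x)
        have "x \<in> (\<Union>n. ?Q n)" using UN_box_eq_UNIV by blast
        then obtain n where n: "x \<in> ?Q n" by blast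
        have "x \<in> ?Q k" if "k \<ge> n" for k
        proof -
          have "real n \<le> real k" using that by simp
          moreover have "One \<bullet> i = (1::real)" if "i \<in> Basis" for i :: 'a
            using that by (simp add: inner_sum_left inner_Basis)
          ultimately show ?thesis using n unfolding mem_box by force
        qed
        then have "indicator (B \<inter> ?Q k) x = (indicator A x :: real)" if "k \<ge> n" for k
          using that elim by (auto simp: indicator_def)
        then show ?case by (intro tendsto_eventually eventually_sequentiallyI[of n]) auto
    qed
    from indlim[OF B'(1) B'(5) B'(3,4) B'(2) this] show ?thesis .
  qed
  have 3: "P t" if t: "Bochner_Integration.simple_bochner_integrable lebesgue t" for t
  proof -
    have tf: "simple_function lebesgue t" "emeasure lebesgue {y. t y \<noteq> 0} \<noteq> \<infinity>"
      using t by (auto elim: Bochner_Integration.simple_bochner_integrable.cases)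
    have pre: "t -` {y} \<in> sets lebesgue" for y using simple_functionD(2)[OF tf(1), of "{y}"] by simp
    have m: "emeasure lebesgue (t -` {y}) < \<infinity>" if "y \<noteq> 0" for y
    proof -
      have "{y. t y \<noteq> 0} \<in> sets lebesgue"
        using simple_functionD(2)[OF tf(1), of "- {0}"] by (auto simp: vimage_def)
      then have "emeasure lebesgue (t -` {y}) \<le> emeasure lebesgue {y. t y \<noteq> 0}"
        using that by (intro emeasure_mono) auto
      with tf(2) show ?thesis by (simp add: less_top[symmetric] top_unique) (metis top_unique)
    qed
    have fin: "finite (range t - {0})" using tf(1) by (simp add: simple_function_def)
    have sumP: "P (\<lambda>x. \<Sum>y\<in>F. indicator (t -` {y}) x *\<^sub>R y) \<and>
        strongly_measurable lebesgue (\<lambda>x. \<Sum>y\<in>F. indicator (t -` {y}) x *\<^sub>R y) \<and>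
        L1_Lp_gauge s (\<lambda>x. \<Sum>y\<in>F. indicator (t -` {y}) x *\<^sub>R y) < \<infinity>" if "finite F" "0 \<notin> F" for F
      using that
    proof (induction F)
      case empty
      show ?case using assms(4)[of 0 0 0] s by (simp add: L1_Lp_gauge_def)
    next
      case (insert y F)
      then have y: "y \<noteq> 0" "0 \<notin> F" by auto
      note IH = insert.IH[OF y(2)] and i = ind[OF pre[of y] m[OF y(1)], of y] 2[OF pre[of y] m[OF y(1)], of y]
      have "(\<lambda>x. \<Sum>y\<in>insert y F. indicator (t -` {y}) x *\<^sub>R y) =
        (\<lambda>x. indicator (t -` {y}) x *\<^sub>R y + (\<Sum>y\<in>F. indicator (t -` {y}) x *\<^sub>R y))"
        by (rule ext) (rule sum.insert[OF insert.hyps(1,2)])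
      then show ?case
        using IH i by (simp only:) (intro conjI add strongly_measurable_add L1_Lp_gauge_add_finite[OF _ _ s]; blast)
    qed
    have "t = (\<lambda>x. \<Sum>y\<in>range t - {0}. indicator (t -` {y}) x *\<^sub>R y)"
    proof
      fix x
      show "t x = (\<Sum>y\<in>range t - {0}. indicator (t -` {y}) x *\<^sub>R y)"
      proof (cases "t x = 0")
        case True
        then have "(\<Sum>y\<in>range t - {0}. indicator (t -` {y}) x *\<^sub>R y) = 0"
          by (intro sum.neutral) (auto simp: indicator_def)
        with True show ?thesis by simp
      next
        case False
        then show ?thesis using fin
          by (subst sum.remove[of _ "t x"]) (auto simp: indicator_def intro!: sum.neutral)
      qed
    qed
    with sumP[OF fin] show ?thesis by simp
  qed
  have fi: "sintegrable f" and ff: "(\<integral>\<^sup>+x. ennreal (norm (f x) powr s) \<partial>lebesgue) < \<infinity>"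
    using f L1_Lp_gauge_finite_iff by blast+
  obtain t where t: "\<And>i. Bochner_Integration.simple_bochner_integrable lebesgue (t i)"
    "(\<lambda>i. \<integral>\<^sup>+x. ennreal (norm (f x - t i x)) \<partial>lebesgue) \<longlonglongrightarrow> 0"
    "AE x in lebesgue. (\<lambda>i. t i x) \<longlonglongrightarrow> f x" "\<And>i x. norm (t i x) \<le> 2 * norm (f x)"
    using fi by (rule sintegrable_approx) (rule that)
  have tm: "strongly_measurable lebesgue (t i)" for i
    by (rule simple_bochner_integrable_strongly_measurable[OF t(1)])
  have "L1_Lp_gauge s (\<lambda>x. 2 *\<^sub>R f x) < \<infinity>"
    using L1_Lp_gauge_add_finite[OF f(1) f(1) s f(2) f(2)] by (simp add: scaleR_2)
  then have i2: "(\<integral>\<^sup>+x. ennreal (2 * norm (f x) + (2 * norm (f x)) powr s) \<partial>lebesgue) < \<infinity>"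
    by (simp add: L1_Lp_gauge_def)
  have h2: "(\<lambda>x. 2 * norm (f x)) \<in> borel_measurable lebesgue"
    using strongly_measurable_norm[OF f(1)] by measurable
  note d = L1_Lp_gauge_dominated[OF s tm t(3) AE_I2[OF t(4)] h2 i2]
  show "P f"
    using d by (intro lim[of t f] tm 3[OF t(1)]) auto
qed

section \<open>Density of Schwartz functions and tempered functions\<close>

text \<open>The class \<open>V\<close> is kept abstract because the result is used twice, for
  Schwartz functions and for dyadic step functions. Only the approximation of box indicators depends
  on the class.\<close>

lemma L1_Lp_gauge_dense:
  fixes f :: "'a::euclidean_space \<Rightarrow> 'b::real_normed_vector"
  assumes s: "s \<ge> 1" and f: "strongly_measurable lebesgue f" "L1_Lp_gauge s f < \<infinity>"
    and V: "\<And>u. u \<in> V \<Longrightarrow> strongly_measurable lebesgue u"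
    and add: "\<And>u v. u \<in> V \<Longrightarrow> v \<in> V \<Longrightarrow> (\<lambda>x. u x + v x) \<in> V"
    and box: "\<And>a b v. \<exists>g. (\<forall>n::nat. g n \<in> V) \<and>
      (\<lambda>n. L1_Lp_gauge s (\<lambda>x. g n x - indicator (box a b) x *\<^sub>R v)) \<longlonglongrightarrow> 0"
  shows "\<exists>g. (\<forall>n::nat. g n \<in> V) \<and> (\<lambda>n. L1_Lp_gauge s (\<lambda>x. g n x - f x)) \<longlonglongrightarrow> 0"
  using s f
proof (induction rule: L1_Lp_induct)
  case (box a b v)
  then show ?case using assms(6) by blast
next
  case (add f g)
  then obtain u v where u: "\<And>n::nat. u n \<in> V" "(\<lambda>n. L1_Lp_gauge s (\<lambda>x. u n x - f x)) \<longlonglongrightarrow> 0"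
    and v: "\<And>n::nat. v n \<in> V" "(\<lambda>n. L1_Lp_gauge s (\<lambda>x. v n x - g x)) \<longlonglongrightarrow> 0"
    by blast
  have "(\<lambda>n. L1_Lp_gauge s (\<lambda>x. (u n x + v n x) - (f x + g x))) \<longlonglongrightarrow> 0"
  proof (rule tendsto_sandwich[OF _ _ tendsto_const])
    show "\<forall>\<^sub>F n in sequentially. L1_Lp_gauge s (\<lambda>x. (u n x + v n x) - (f x + g x)) \<le>
        ennreal (2 powr s) * (L1_Lp_gauge s (\<lambda>x. u n x - f x) + L1_Lp_gauge s (\<lambda>x. v n x - g x))"
    proof (intro always_eventually allI)
      fix n
      show "L1_Lp_gauge s (\<lambda>x. (u n x + v n x) - (f x + g x)) \<le>
        ennreal (2 powr s) * (L1_Lp_gauge s (\<lambda>x. u n x - f x) + L1_Lp_gauge s (\<lambda>x. v n x - g x))"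
        using L1_Lp_gauge_add_le[OF strongly_measurable_diff[OF V[OF u(1)] add.hyps(1)]
            strongly_measurable_diff[OF V[OF v(1)] add.hyps(3)] s, of n n]
        by (simp add: algebra_simps)
    qed
    have "(\<lambda>n. ennreal (2 powr s) * (L1_Lp_gauge s (\<lambda>x. u n x - f x) + L1_Lp_gauge s (\<lambda>x. v n x - g x))) \<longlonglongrightarrow>
        ennreal (2 powr s) * (0 + 0)"
      by (intro tendsto_mult_ennreal tendsto_add u v tendsto_const) auto
    then show "(\<lambda>n. ennreal (2 powr s) * (L1_Lp_gauge s (\<lambda>x. u n x - f x) + L1_Lp_gauge s (\<lambda>x. v n x - g x))) \<longlonglongrightarrow> 0"
      by simp
  qed simp
  then show ?case using assms(5) u v by (intro exI[of _ "\<lambda>n x. u n x + v n x"]) auto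
next
  case (lim f g)
  have "\<exists>u\<in>V. L1_Lp_gauge s (\<lambda>x. u x - g n x) < ennreal (inverse (real (Suc n)))" for n
  proof -
    obtain u where u: "\<And>k::nat. u k \<in> V" "(\<lambda>k. L1_Lp_gauge s (\<lambda>x. u k x - g n x)) \<longlonglongrightarrow> 0"
      using lim.IH by blast
    have "0 < ennreal (inverse (real (Suc n)))" by simp
    from order_tendstoD(2)[OF u(2) this] obtain k where
      "L1_Lp_gauge s (\<lambda>x. u k x - g n x) < ennreal (inverse (real (Suc n)))"
      by (auto simp: eventually_sequentially)
    then show ?thesis using u(1) by blast
  qed
  then obtain u where u: "\<And>n. u n \<in> V" "\<And>n. L1_Lp_gauge s (\<lambda>x. u n x - g n x) < ennreal (inverse (real (Suc n)))"
    by metis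
  have "(\<lambda>n. L1_Lp_gauge s (\<lambda>x. u n x - f x)) \<longlonglongrightarrow> 0"
  proof (rule tendsto_sandwich[OF _ _ tendsto_const])
    show "\<forall>\<^sub>F n in sequentially. L1_Lp_gauge s (\<lambda>x. u n x - f x) \<le>
        ennreal (2 powr s) * (ennreal (inverse (real (Suc n))) + L1_Lp_gauge s (\<lambda>x. g n x - f x))"
    proof (intro always_eventually allI)
      fix n
      have "L1_Lp_gauge s (\<lambda>x. u n x - f x) \<le>
          ennreal (2 powr s) * (L1_Lp_gauge s (\<lambda>x. u n x - g n x) + L1_Lp_gauge s (\<lambda>x. g n x - f x))"
        using L1_Lp_gauge_add_le[OF strongly_measurable_diff[OF V[OF u(1)] lim.hyps(1)]
            strongly_measurable_diff[OF lim.hyps(1) lim.hyps(3)] s, of n n n] by simp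
      also have "\<dots> \<le> ennreal (2 powr s) * (ennreal (inverse (real (Suc n))) + L1_Lp_gauge s (\<lambda>x. g n x - f x))"
        using u(2)[of n] by (intro mult_left_mono add_right_mono) auto
      finally show "L1_Lp_gauge s (\<lambda>x. u n x - f x) \<le>
        ennreal (2 powr s) * (ennreal (inverse (real (Suc n))) + L1_Lp_gauge s (\<lambda>x. g n x - f x))" .
    qed
    have "(\<lambda>n. ennreal (2 powr s) * (ennreal (inverse (real (Suc n))) + L1_Lp_gauge s (\<lambda>x. g n x - f x))) \<longlonglongrightarrow>
        ennreal (2 powr s) * (ennreal 0 + 0)"
      by (intro tendsto_mult_ennreal tendsto_add lim.hyps(5) tendsto_const tendsto_ennrealI LIMSEQ_inverse_real_of_nat) auto
    then show "(\<lambda>n. ennreal (2 powr s) * (ennreal (inverse (real (Suc n))) + L1_Lp_gauge s (\<lambda>x. g n x - f x))) \<longlonglongrightarrow> 0"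
      by simp
  qed simp
  then show ?case using u(1) by blast
qed

lemma weight_gauge_finite:
  assumes "0 \<le> C" "1 \<le> s"
  shows "(\<integral>\<^sup>+x. ennreal (C * weight (x::'a::euclidean_space) + (C * weight x) powr s) \<partial>lebesgue) < \<infinity>"
proof -
  have "(\<integral>\<^sup>+x. ennreal (C * weight (x::'a) + (C * weight x) powr s) \<partial>lebesgue) \<le>
      (\<integral>\<^sup>+x. ennreal (C + C powr s) * ennreal (weight (x::'a)) \<partial>lebesgue)"
  proof (rule nn_integral_mono)
    fix x :: 'a
    have "weight x powr s \<le> weight x powr 1"
      using weight_pos[of x] weight_le_1[of x] assms by (intro powr_mono') auto
    then have "weight x powr s \<le> weight x" using weight_pos[of x] by simp
    then have "(C * weight x) powr s \<le> C powr s * weight x"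
      using assms weight_pos[of x] by (simp add: powr_mult mult_left_mono)
    then have "C * weight x + (C * weight x) powr s \<le> (C + C powr s) * weight x"
      by (simp add: algebra_simps)
    then have "ennreal (C * weight x + (C * weight x) powr s) \<le> ennreal ((C + C powr s) * weight x)"
      by (rule ennreal_leI)
    then show "ennreal (C * weight x + (C * weight x) powr s) \<le> ennreal (C + C powr s) * ennreal (weight x)"
      using assms weight_pos[of x] by (subst ennreal_mult[symmetric]) auto
  qed
  also have "\<dots> < \<infinity>"
    using nn_integral_weight[where ?'a='a]
    by (subst nn_integral_cmult) (auto simp: ennreal_mult_less_top)
  finally show ?thesis .
qed

lemma schwartz_strongly_measurable: "f \<in> schwartz \<Longrightarrow> strongly_measurable lebesgue f"
  by (intro strongly_measurable_continuous schwartz_continuous)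

lemma schwartz_L1_Lp_gauge_finite:
  fixes f :: "'a::euclidean_space \<Rightarrow> 'b::real_normed_vector"
  assumes f: "f \<in> schwartz" and s: "1 \<le> s"
  shows "L1_Lp_gauge s f < \<infinity>"
proof -
  obtain C where C: "C \<ge> 0" "\<And>x. norm (f x) \<le> C * weight x"
    using schwartz_le_weight[OF f] by blast
  have "L1_Lp_gauge s f \<le> (\<integral>\<^sup>+x. ennreal (C * weight (x::'a) + (C * weight x) powr s) \<partial>lebesgue)"
    unfolding L1_Lp_gauge_def using C s by (intro nn_integral_mono ennreal_leI add_mono powr_mono2) auto
  with weight_gauge_finite[OF C(1) s] show ?thesis by (rule le_less_trans[rotated])
qed

lemma schwartz_sintegrable: "f \<in> schwartz \<Longrightarrow> sintegrable f"
  using schwartz_L1_Lp_gauge_finite[of f 1] L1_Lp_gauge_finite_iff[OF schwartz_strongly_measurable] by auto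

lemma schwartz_dense:
  fixes f :: "'a::euclidean_space \<Rightarrow> 'b::real_normed_vector"
  assumes s: "1 \<le> s" and f: "strongly_measurable lebesgue f" "L1_Lp_gauge s f < \<infinity>"
  shows "\<exists>g. (\<forall>n::nat. g n \<in> schwartz) \<and> (\<lambda>n. L1_Lp_gauge s (\<lambda>x. g n x - f x)) \<longlonglongrightarrow> 0"
proof (rule L1_Lp_gauge_dense[OF s f])
  fix a b :: 'a and v :: 'b
  obtain \<phi> :: "nat \<Rightarrow> 'a \<Rightarrow> real" and C where C: "C \<ge> 0"
    and \<phi>: "\<And>n (v::'b). (\<lambda>x. \<phi> n x *\<^sub>R v) \<in> schwartz" "\<And>n x. 0 \<le> \<phi> n x" "\<And>n x. \<phi> n x \<le> C * weight x"
    "AE x in lebesgue. (\<lambda>n. \<phi> n x) \<longlonglongrightarrow> indicator (box a b) x"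
    by (rule box_bump[where ?'b='b and a=a and b=b]) (rule that)
  have "(\<lambda>n. L1_Lp_gauge s (\<lambda>x. \<phi> n x *\<^sub>R v - indicator (box a b) x *\<^sub>R v)) \<longlonglongrightarrow> 0"
  proof (rule L1_Lp_gauge_dominated(4)[OF s])
    show "strongly_measurable lebesgue (\<lambda>x. \<phi> n x *\<^sub>R v)" for n
      by (rule schwartz_strongly_measurable[OF \<phi>(1)])
    show "AE x in lebesgue. (\<lambda>n. \<phi> n x *\<^sub>R v) \<longlonglongrightarrow> indicator (box a b) x *\<^sub>R v"
      using \<phi>(4) by eventually_elim (intro tendsto_intros)
    have "norm (\<phi> n x *\<^sub>R v) \<le> (C * norm v) * weight x" for n x
      using mult_right_mono[OF \<phi>(3)[of n x], of "norm v"] \<phi>(2)[of n x] by (simp add: mult_ac)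
    then show "AE x in lebesgue. norm (\<phi> n x *\<^sub>R v) \<le> (C * norm v) * weight x" for n by simp
    show "(\<lambda>x. (C * norm v) * weight x) \<in> borel_measurable lebesgue"
      by (intro borel_measurable_times weight_lebesgue) auto
    show "(\<integral>\<^sup>+x. ennreal ((C * norm v) * weight (x::'a) + ((C * norm v) * weight x) powr s) \<partial>lebesgue) < \<infinity>"
      using C s by (intro weight_gauge_finite) auto
  qed
  then show "\<exists>g. (\<forall>n::nat. g n \<in> schwartz) \<and>
      (\<lambda>n. L1_Lp_gauge s (\<lambda>x. g n x - indicator (box a b) x *\<^sub>R v)) \<longlonglongrightarrow> 0"
    using \<phi>(1) by (intro exI[of _ "\<lambda>n x. \<phi> n x *\<^sub>R v"]) auto
qed (auto intro: schwartz_strongly_measurable schwartz_add)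

text \<open>One fixed weight is enough to make the pairing with every Schwartz function absolutely
  convergent. Sums of bounded functions and of \<open>L^s\<close> functions with
  \<open>s >= 1\<close> qualify, and the transforms below are built from these.\<close>

definition tempered :: "('a::euclidean_space \<Rightarrow> 'b::real_normed_vector) \<Rightarrow> bool"
  where "tempered g \<longleftrightarrow> strongly_measurable lebesgue g \<and>
    (\<integral>\<^sup>+x. ennreal (weight x * norm (g x)) \<partial>lebesgue) < \<infinity>"

lemma temperedD: "tempered g \<Longrightarrow> strongly_measurable lebesgue g"
  by (simp add: tempered_def)

lemma tempered_sintegrable:
  fixes g :: "'a::euclidean_space \<Rightarrow> 'b::real_normed_vector"
  assumes g: "tempered g" and h: "strongly_measurable lebesgue h" and C: "0 \<le> C"
    and bd: "AE x in lebesgue. norm (h x) \<le> C * weight x * norm (g x)"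
  shows "sintegrable h"
proof (rule sintegrable_bound[OF h, where w="\<lambda>x. ennreal C * ennreal (weight x * norm (g x))"])
  have "(\<lambda>x. weight x * norm (g x)) \<in> borel_measurable lebesgue"
    using strongly_measurable_norm[OF temperedD[OF g]] weight_lebesgue by (intro borel_measurable_times) auto
  then have "(\<integral>\<^sup>+x. ennreal C * ennreal (weight x * norm (g x)) \<partial>lebesgue) =
      ennreal C * (\<integral>\<^sup>+x. ennreal (weight x * norm (g x)) \<partial>lebesgue)"
    by (intro nn_integral_cmult) auto
  then show "(\<integral>\<^sup>+x. ennreal C * ennreal (weight x * norm (g x)) \<partial>lebesgue) < \<infinity>"
    using g by (auto simp: tempered_def ennreal_mult_less_top)
  show "AE x in lebesgue. ennreal (norm (h x)) \<le> ennreal C * ennreal (weight x * norm (g x))"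
    using bd
  proof eventually_elim
    case (elim x)
    then show ?case
      using C weight_pos[of x] by (subst ennreal_mult[symmetric]) (auto intro!: ennreal_leI simp: mult.assoc)
  qed
qed

lemma tempered_schwartz_sintegrable:
  fixes g :: "'a::euclidean_space \<Rightarrow> 'b::complex_banach"
  assumes g: "tempered g" and \<phi>: "\<phi> \<in> schwartz"
  shows "sintegrable (\<lambda>x. \<phi> x *\<^sub>C g x)"
proof -
  obtain C where C: "C \<ge> 0" "\<And>x. norm (\<phi> x) \<le> C * weight x"
    using schwartz_le_weight[OF \<phi>] by blast
  show ?thesis
    using C by (intro tempered_sintegrable[OF g _ C(1)] strongly_measurable_scaleC temperedD[OF g]
        strongly_measurable_borel[OF schwartz_strongly_measurable[OF \<phi>]])
      (auto simp: norm_scaleC intro!: mult_right_mono)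
qed

lemma tempered_indicator_box_sintegrable:
  fixes g :: "'a::euclidean_space \<Rightarrow> 'b::real_normed_vector"
  assumes g: "tempered g" and A: "A \<in> sets lebesgue"
  shows "sintegrable (\<lambda>x. indicator (A \<inter> box a b) x *\<^sub>R g x)"
proof -
  obtain R where R: "0 < R" "\<And>x. x \<in> box a b \<Longrightarrow> norm x \<le> R"
    using bounded_box[of a b] by (auto simp: bounded_pos)
  let ?C = "(1 + R\<^sup>2) ^ DIM('a)"
  show ?thesis
  proof (rule tempered_sintegrable[OF g, of _ ?C])
    show "strongly_measurable lebesgue (\<lambda>x. indicator (A \<inter> box a b) x *\<^sub>R g x)"
      using A by (intro strongly_measurable_indicator temperedD[OF g]) auto
    show "0 \<le> ?C" using R(1) by simp
    have "1 \<le> ?C * weight x" if "x \<in> box a b" for x :: 'a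
    proof -
      have "(1 + (norm x)\<^sup>2) ^ DIM('a) \<le> ?C"
        using R(1) R(2)[OF that] by (intro power_mono add_left_mono) auto
      then have "inverse ?C \<le> inverse ((1 + (norm x)\<^sup>2) ^ DIM('a))"
        by (intro le_imp_inverse_le) (auto simp: add_pos_nonneg)
      also have "\<dots> \<le> weight x" by (rule weight_ge)
      finally have "?C * inverse ?C \<le> ?C * weight x"
        by (intro mult_left_mono) (use R(1) in auto)
      moreover have "?C \<noteq> 0" by (simp add: add_nonneg_eq_0_iff)
      ultimately show ?thesis by simp
    qed
    then have "norm (indicator (A \<inter> box a b) x *\<^sub>R g x) \<le> ?C * weight x * norm (g x)" for x
      using weight_pos[of x] mult_right_mono[of 1 "?C * weight x" "norm (g x)"]
      using R(1) by (cases "x \<in> A \<inter> box a b") auto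
    then show "AE x in lebesgue. norm (indicator (A \<inter> box a b) x *\<^sub>R g x) \<le> ?C * weight x * norm (g x)"
      by simp
  qed
qed

text \<open>The fundamental lemma of the calculus of variations for vector values. Bumps turn the
  hypothesis into vanishing integrals over boxes, and hence over Borel subsets of boxes. Instead of
  functionals on the target, the points of a countable set that approximates almost all values are
  used to conclude.\<close>

lemma tempered_eq_0_AE:
  fixes g :: "'a::euclidean_space \<Rightarrow> 'b::complex_banach"
  assumes g: "tempered g" and z: "\<And>\<phi>. \<phi> \<in> schwartz \<Longrightarrow> strong_integral lebesgue (\<lambda>x. \<phi> x *\<^sub>C g x) = 0"
  shows "AE x in lebesgue. g x = 0"
proof -
  define H where "H = (\<lambda>A. strong_integral lebesgue (\<lambda>x. indicator A x *\<^sub>R g x))"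
  note gm = temperedD[OF g]
  note int = tempered_indicator_box_sintegrable[OF g]
  have box: "H (box a b) = 0" for a b
  proof -
    obtain \<phi> :: "nat \<Rightarrow> 'a \<Rightarrow> real" and C where C: "C \<ge> 0"
      and \<phi>: "\<And>n (v::complex). (\<lambda>x. \<phi> n x *\<^sub>R v) \<in> schwartz" "\<And>n x. 0 \<le> \<phi> n x" "\<And>n x. \<phi> n x \<le> C * weight x"
      "AE x in lebesgue. (\<lambda>n. \<phi> n x) \<longlonglongrightarrow> indicator (box a b) x" "\<And>n. continuous_on UNIV (\<phi> n)"
      by (rule box_bump[where ?'b=complex and a=a and b=b]) (rule that)
    have "(\<lambda>x. weight x * norm (g x)) \<in> borel_measurable lebesgue"
      using strongly_measurable_norm[OF gm] weight_lebesgue by (intro borel_measurable_times) auto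
    then have wm: "(\<lambda>x. ennreal (weight x * norm (g x))) \<in> borel_measurable lebesgue" by simp
    have "(\<lambda>n. strong_integral lebesgue (\<lambda>x. \<phi> n x *\<^sub>R g x)) \<longlonglongrightarrow> H (box a b)"
      unfolding H_def
    proof (rule strong_integral_dominated_convergence[where w="\<lambda>x. ennreal C * ennreal (weight x * norm (g x))"])
      show "strongly_measurable lebesgue (\<lambda>x. \<phi> n x *\<^sub>R g x)" for n
        by (intro strongly_measurable_scaleR gm strongly_measurable_borel strongly_measurable_continuous \<phi>)
      show "AE x in lebesgue. (\<lambda>n. \<phi> n x *\<^sub>R g x) \<longlonglongrightarrow> indicator (box a b) x *\<^sub>R g x"
        using \<phi>(4) by eventually_elim (intro tendsto_intros)
      have "norm (\<phi> n x *\<^sub>R g x) \<le> C * (weight x * norm (g x))" for n x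
        using mult_right_mono[OF \<phi>(3)[of n x], of "norm (g x)"] \<phi>(2)[of n x] by (simp add: mult.assoc)
      then show "AE x in lebesgue. ennreal (norm (\<phi> n x *\<^sub>R g x)) \<le> ennreal C * ennreal (weight x * norm (g x))" for n
        using C less_imp_le[OF weight_pos]
        by (subst ennreal_mult[symmetric]) (auto intro!: ennreal_leI mult_nonneg_nonneg)
      show "(\<integral>\<^sup>+x. ennreal C * ennreal (weight x * norm (g x)) \<partial>lebesgue) < \<infinity>"
        using g wm by (subst nn_integral_cmult) (auto simp: tempered_def ennreal_mult_less_top)
      show "(\<lambda>x. ennreal C * ennreal (weight x * norm (g x))) \<in> borel_measurable lebesgue"
        using wm by (intro borel_measurable_times_ennreal) auto
    qed
    moreover have "strong_integral lebesgue (\<lambda>x. \<phi> n x *\<^sub>R g x) = 0" for n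
      using z[OF \<phi>(1)[of n 1]] by (simp add: scaleR_scaleC scaleC_complex_def)
    ultimately show ?thesis by (simp add: LIMSEQ_const_iff)
  qed
  have bor: "\<forall>a b. H (A \<inter> box a b) = 0" if "A \<in> sets borel" for A
    using that
  proof (induction rule: borel_box_induct)
    case (box a b)
    show ?case using \<open>\<And>b a. H (box a b) = 0\<close> by (auto simp: box_Int_box)
  next
    case (compl A)
    show ?case
    proof (intro allI)
      fix a b
      have "H (- A \<inter> box a b) = H (UNIV \<inter> box a b) - H (A \<inter> box a b)"
        unfolding H_def using compl(1)
        by (subst strong_integral_diff[OF int int, symmetric])
          (auto intro!: arg_cong[where f="strong_integral lebesgue"] simp: indicator_def fun_eq_iff)
      then show "H (- A \<inter> box a b) = 0" using compl(2) box by simp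
    qed
  next
    case (union A)
    have A: "A i \<in> sets lebesgue" for i using union(2) by auto
    show ?case
    proof (intro allI)
      fix a b
      have 0: "H ((\<Union>i<n. A i) \<inter> box a b) = 0" for n
      proof (induction n)
        case 0
        then show ?case by (simp add: H_def)
      next
        case (Suc n)
        have d: "A n \<inter> A i = {}" if "i < n" for i
          using disjoint_family_onD[OF union(1), of n i] that by simp
        have *: "indicator ((\<Union>i<Suc n. A i) \<inter> box a b) x *\<^sub>R g x =
            indicator ((\<Union>i<n. A i) \<inter> box a b) x *\<^sub>R g x + indicator (A n \<inter> box a b) x *\<^sub>R g x" for x
          using d by (auto simp: indicator_def lessThan_Suc)
        have "H ((\<Union>i<Suc n. A i) \<inter> box a b) = H ((\<Union>i<n. A i) \<inter> box a b) + H (A n \<inter> box a b)"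
          unfolding H_def * using A by (intro strong_integral_add int) auto
        then show ?case using Suc union(3)[of n] by simp
      qed
      have "(\<lambda>n. H ((\<Union>i<n. A i) \<inter> box a b)) \<longlonglongrightarrow> H ((\<Union>i. A i) \<inter> box a b)"
        unfolding H_def
      proof (rule strong_integral_dominated_convergence[where w="\<lambda>x. ennreal (norm (indicator (UNIV \<inter> box a b) x *\<^sub>R g x))"])
        show "strongly_measurable lebesgue (\<lambda>x. indicator ((\<Union>i<n. A i) \<inter> box a b) x *\<^sub>R g x)" for n
          using A by (intro sintegrableD(1)[OF int]) auto
        show "AE x in lebesgue. (\<lambda>n. indicator ((\<Union>i<n. A i) \<inter> box a b) x *\<^sub>R g x) \<longlonglongrightarrow>
            indicator ((\<Union>i. A i) \<inter> box a b) x *\<^sub>R g x"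
        proof (rule AE_I2)
          fix x
          show "(\<lambda>n. indicator ((\<Union>i<n. A i) \<inter> box a b) x *\<^sub>R g x) \<longlonglongrightarrow>
            indicator ((\<Union>i. A i) \<inter> box a b) x *\<^sub>R g x"
          proof (cases "\<exists>i. x \<in> A i")
            case True
            then obtain i where "x \<in> A i" by blast
            then have "indicator ((\<Union>i<n. A i) \<inter> box a b) x = (indicator ((\<Union>i. A i) \<inter> box a b) x :: real)" if "n > i" for n
              using that by (auto simp: indicator_def)
            then show ?thesis
              by (intro tendsto_eventually eventually_sequentiallyI[of "Suc i"]) auto
          qed (auto simp: indicator_def)
        qed
        show "(\<integral>\<^sup>+x. ennreal (norm (indicator (UNIV \<inter> box a b) x *\<^sub>R g x)) \<partial>lebesgue) < \<infinity>"
          by (intro sintegrableD(2)[OF int]) auto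
        show "(\<lambda>x. ennreal (norm (indicator (UNIV \<inter> box a b) x *\<^sub>R g x))) \<in> borel_measurable lebesgue"
          by (intro measurable_compose[OF _ measurable_ennreal] strongly_measurable_norm sintegrableD(1)[OF int]) auto
      qed (auto simp: indicator_def)
      then show "H ((\<Union>i. A i) \<inter> box a b) = 0" by (simp add: 0 LIMSEQ_const_iff)
    qed
  qed
  obtain D where D: "countable D" "AE x in lebesgue. g x \<in> closure D" and gb: "g \<in> borel_measurable lebesgue"
    using gm unfolding strongly_measurable_iff by blast
  let ?Q = "\<lambda>n. box (- (real n *\<^sub>R One)) (real n *\<^sub>R One) :: 'a set"
  \<comment> \<open>\<open>N d n k\<close> is the part of a box on which \<open>g\<close> is within
    \<open>1 / (k + 1)\<close> of \<open>d\<close>. The integral of \<open>g\<close> over it is 0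
    although \<open>g\<close> stays close to \<open>d\<close>, so it is null as soon as
    \<open>norm d\<close> exceeds \<open>1 / (k + 1)\<close>.\<close>
  define N where "N = (\<lambda>d n k. (g -` ball d (1 / real (Suc k))) \<inter> ?Q n)"
  have null: "AE x in lebesgue. x \<notin> N d n k" if d: "norm d > 1 / real (Suc k)" for d n k
  proof -
    let ?e = "1 / real (Suc k)"
    have Nm': "g -` ball d ?e \<in> sets lebesgue"
      using measurable_sets[OF gb, of "ball d ?e"] by simp
    then have Nm: "N d n k \<in> sets lebesgue" by (auto simp: N_def)
    have "emeasure lebesgue (N d n k) \<le> emeasure lebesgue (?Q n)"
      unfolding N_def by (intro emeasure_mono) auto
    then have fin: "emeasure lebesgue (N d n k) < \<infinity>"
      using emeasure_lebesgue_box_finite by (rule le_less_trans)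
    obtain B where B: "B \<in> sets borel" "AE x in lebesgue. x \<in> g -` ball d ?e \<longleftrightarrow> x \<in> B"
      by (rule lebesgue_AE_borel[OF Nm'])
    have "H (N d n k) = H (B \<inter> ?Q n)"
      unfolding H_def N_def
      by (rule strong_integral_cong_AE) (use B(2) in \<open>eventually_elim, auto simp: indicator_def\<close>)
    then have H0: "H (N d n k) = 0" using bor B(1) by simp
    have ii: "integrable lebesgue (\<lambda>x. indicator (N d n k) x *\<^sub>R (1::complex))"
      using Nm fin by (intro integrable_scaleR_left integrable_real_indicator)
    have sc: "(indicator (N d n k) x *\<^sub>R (1::complex)) *\<^sub>C d = indicator (N d n k) x *\<^sub>R d" for x
      by (simp add: scaleR_scaleC scaleC_complex_def)
    have di: "sintegrable (\<lambda>x. indicator (N d n k) x *\<^sub>R d)"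
      "strong_integral lebesgue (\<lambda>x. indicator (N d n k) x *\<^sub>R d) = measure lebesgue (N d n k) *\<^sub>R d"
      using strong_integral_scaleC_left[OF ii, of d] Nm fin
      by (simp_all add: sc) (simp add: scaleR_scaleC scaleC_complex_def)
    have gi: "sintegrable (\<lambda>x. indicator (N d n k) x *\<^sub>R g x)"
      unfolding N_def by (rule int[OF Nm'])
    have "measure lebesgue (N d n k) *\<^sub>R d = strong_integral lebesgue (\<lambda>x. indicator (N d n k) x *\<^sub>R d - indicator (N d n k) x *\<^sub>R g x)"
      using H0 by (simp add: strong_integral_diff[OF di(1) gi] di(2) H_def)
    also have "ennreal (norm \<dots>) \<le> (\<integral>\<^sup>+x. ennreal (norm (indicator (N d n k) x *\<^sub>R d - indicator (N d n k) x *\<^sub>R g x)) \<partial>lebesgue)"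
      by (intro strong_integral_norm_le strongly_measurable_diff sintegrableD(1) di gi)
    also have "\<dots> \<le> (\<integral>\<^sup>+x. ennreal ?e * indicator (N d n k) x \<partial>lebesgue)"
      by (intro nn_integral_mono) (auto simp: indicator_def N_def dist_norm intro!: ennreal_leI)
    also have "\<dots> = ennreal (?e * measure lebesgue (N d n k))"
      using Nm fin by (subst ennreal_mult) (auto simp del: emeasure_completion of_nat_Suc simp: nn_integral_cmult_indicator emeasure_eq_ennreal_measure)
    finally have "measure lebesgue (N d n k) * norm d \<le> ?e * measure lebesgue (N d n k)"
      by (simp add: ennreal_le_iff)
    then have "measure lebesgue (N d n k) * (norm d - ?e) \<le> 0" by (simp add: algebra_simps)
    then have "measure lebesgue (N d n k) = 0"
      using d measure_nonneg[of lebesgue "N d n k"] by (simp add: mult_le_0_iff)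
    then have "N d n k \<in> null_sets lebesgue"
      using Nm fin by (simp add: null_sets_def emeasure_eq_ennreal_measure)
    then show ?thesis by (rule AE_not_in)
  qed
  have "AE x in lebesgue. \<forall>d\<in>D. \<forall>n k. norm d > 1 / real (Suc k) \<longrightarrow> x \<notin> N d n k"
    unfolding AE_ball_countable[OF D(1)] AE_all_countable using null by auto
  with D(2) show ?thesis
  proof eventually_elim
    case (elim x)
    show ?case
    proof (rule ccontr)
      assume "g x \<noteq> 0"
      then obtain k where k: "1 / real (Suc k) < norm (g x) / 2"
        using nat_approx_posE[of "norm (g x) / 2"] by auto
      obtain d where d: "d \<in> D" "dist d (g x) < 1 / real (Suc k)"
        using elim(1)[unfolded closure_approachable, rule_format, of "1 / real (Suc k)"] by auto
      have "norm (g x) \<le> norm d + dist d (g x)"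
        by (metis dist_norm norm_minus_commute norm_triangle_sub add.commute)
      with k d(2) have "norm d > 1 / real (Suc k)" by linarith
      moreover have "x \<in> (\<Union>n. ?Q n)" using UN_box_eq_UNIV by blast
      ultimately show False using elim(2) d by (auto simp: N_def)
    qed
  qed
qed

section \<open>The Fourier transform of integrable functions\<close>

text \<open>Sign \<open>- 1\<close> is the Fourier transform, sign \<open>1\<close> its inverse.\<close>

definition sfourier :: "real \<Rightarrow> ('a::euclidean_space \<Rightarrow> 'b::complex_banach) \<Rightarrow> 'a \<Rightarrow> 'b"
  where "sfourier \<sigma> f \<xi> = strong_integral lebesgue (\<lambda>t. cis (\<sigma> * (2 * pi * (\<xi> \<bullet> t))) *\<^sub>C f t)"

lemma fourier_eq_sfourier: "fourier = sfourier (- 1)"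
  by (simp add: fun_eq_iff fourier_def sfourier_def cis_conv_exp mult_ac)

lemma inv_fourier_eq_sfourier: "inv_fourier = sfourier 1"
  by (simp add: fun_eq_iff inv_fourier_def sfourier_def cis_conv_exp mult_ac inner_commute)

lemma borel_cis: "continuous_on UNIV h \<Longrightarrow> (\<lambda>t::'a::euclidean_space. cis (h t)) \<in> borel_measurable lebesgue"
  by (intro strongly_measurable_borel strongly_measurable_continuous continuous_intros)

lemma sintegrable_cis:
  fixes f :: "'a::euclidean_space \<Rightarrow> 'b::complex_banach"
  assumes "sintegrable f" "continuous_on UNIV h"
  shows "sintegrable (\<lambda>t. cis (h t) *\<^sub>C f t)"
  using assms
  by (auto simp: sintegrable_def norm_scaleC intro!: strongly_measurable_scaleC borel_cis)

lemma sintegrable_sfourier: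
  "sintegrable f \<Longrightarrow> sintegrable (\<lambda>t. cis (\<sigma> * (2 * pi * (\<xi> \<bullet> t))) *\<^sub>C f t)"
  by (rule sintegrable_cis) (auto intro!: continuous_intros)

lemma sfourier_norm_le:
  fixes f :: "'a::euclidean_space \<Rightarrow> 'b::complex_banach"
  assumes "strongly_measurable lebesgue f"
  shows "ennreal (norm (sfourier \<sigma> f \<xi>)) \<le> (\<integral>\<^sup>+x. ennreal (norm (f x)) \<partial>lebesgue)"
proof -
  have "strongly_measurable lebesgue (\<lambda>t. cis (\<sigma> * (2 * pi * (\<xi> \<bullet> t))) *\<^sub>C f t)"
    by (intro strongly_measurable_scaleC borel_cis assms continuous_intros)
  from strong_integral_norm_le[OF this] show ?thesis
    by (simp add: sfourier_def norm_scaleC)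
qed

lemma sfourier_add:
  "sintegrable f \<Longrightarrow> sintegrable g \<Longrightarrow> sfourier \<sigma> (\<lambda>x. f x + g x) \<xi> = sfourier \<sigma> f \<xi> + sfourier \<sigma> g \<xi>"
  unfolding sfourier_def scaleC_add_right by (intro strong_integral_add sintegrable_sfourier)

lemma sfourier_diff:
  "sintegrable f \<Longrightarrow> sintegrable g \<Longrightarrow> sfourier \<sigma> (\<lambda>x. f x - g x) \<xi> = sfourier \<sigma> f \<xi> - sfourier \<sigma> g \<xi>"
  unfolding sfourier_def scaleC.diff_right by (intro strong_integral_diff sintegrable_sfourier)

lemma sfourier_sum:
  "(\<And>i. i \<in> I \<Longrightarrow> sintegrable (f i)) \<Longrightarrow> sfourier \<sigma> (\<lambda>x. \<Sum>i\<in>I. f i x) \<xi> = (\<Sum>i\<in>I. sfourier \<sigma> (f i) \<xi>)"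
  unfolding sfourier_def scaleC.sum_right by (intro strong_integral_sum sintegrable_sfourier)

lemma sfourier_scaleC_left:
  fixes u :: "'a::euclidean_space \<Rightarrow> complex"
  assumes "sintegrable u"
  shows "sfourier \<sigma> (\<lambda>t. u t *\<^sub>C x) \<xi> = sfourier \<sigma> u \<xi> *\<^sub>C x"
  unfolding sfourier_def
  using strong_integral_bounded_linear[OF scaleC.bounded_linear_left sintegrable_sfourier[OF assms]]
  by (simp add: scaleC_scaleC scaleC_complex_def)

lemma sfourier_continuous:
  fixes f :: "'a::euclidean_space \<Rightarrow> 'b::complex_banach"
  assumes f: "sintegrable f"
  shows "continuous_on UNIV (sfourier \<sigma> f)"
  unfolding continuous_on_sequentially
proof (intro allI ballI impI, elim conjE)
  fix x :: "nat \<Rightarrow> 'a" and a assume x: "x \<longlonglongrightarrow> a"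
  show "(sfourier \<sigma> f \<circ> x) \<longlonglongrightarrow> sfourier \<sigma> f a"
    unfolding sfourier_def o_def
  proof (rule strong_integral_dominated_convergence)
    show "strongly_measurable lebesgue (\<lambda>t. cis (\<sigma> * (2 * pi * (x n \<bullet> t))) *\<^sub>C f t)" for n
      by (intro sintegrableD(1) sintegrable_sfourier f)
    show "AE t in lebesgue. (\<lambda>n. cis (\<sigma> * (2 * pi * (x n \<bullet> t))) *\<^sub>C f t) \<longlonglongrightarrow>
        cis (\<sigma> * (2 * pi * (a \<bullet> t))) *\<^sub>C f t"
      using x by (intro AE_I2 scaleC.tendsto tendsto_intros)
    show "AE t in lebesgue. ennreal (norm (cis (\<sigma> * (2 * pi * (x n \<bullet> t))) *\<^sub>C f t)) \<le> ennreal (norm (f t))" for n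
      by (simp add: norm_scaleC)
    show "(\<integral>\<^sup>+t. ennreal (norm (f t)) \<partial>lebesgue) < \<infinity>" using f by (rule sintegrableD)
    show "(\<lambda>t. ennreal (norm (f t))) \<in> borel_measurable lebesgue"
      using strongly_measurable_norm[OF sintegrableD(1)[OF f]] by simp
  qed
qed

lemma sfourier_strongly_measurable: "sintegrable f \<Longrightarrow> strongly_measurable lebesgue (sfourier \<sigma> f)"
  by (intro strongly_measurable_continuous sfourier_continuous)

lemma sintegrable_bounded_mult:
  fixes u :: "'a::euclidean_space \<Rightarrow> complex" and f :: "'a \<Rightarrow> 'b::complex_banach"
  assumes u: "u \<in> borel_measurable lebesgue" "\<And>x. norm (u x) \<le> C" and f: "sintegrable f"
  shows "sintegrable (\<lambda>x. u x *\<^sub>C f x)"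
proof (rule sintegrable_bound[where w="\<lambda>x. ennreal C * ennreal (norm (f x))"])
  show "strongly_measurable lebesgue (\<lambda>x. u x *\<^sub>C f x)"
    using u sintegrableD(1)[OF f] by (intro strongly_measurable_scaleC)
  show "(\<integral>\<^sup>+x. ennreal C * ennreal (norm (f x)) \<partial>lebesgue) < \<infinity>"
    using sintegrableD[OF f] strongly_measurable_norm[OF sintegrableD(1)[OF f]]
    by (subst nn_integral_cmult) (auto simp: ennreal_mult_less_top)
  have "0 \<le> C" using u(2)[of undefined] norm_ge_zero order_trans by blast
  then show "AE x in lebesgue. ennreal (norm (u x *\<^sub>C f x)) \<le> ennreal C * ennreal (norm (f x))"
    using u(2) by (intro AE_I2) (auto simp: norm_scaleC ennreal_mult[symmetric] intro!: ennreal_leI mult_right_mono)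
qed

lemma sintegrable_mult_bounded:
  fixes u :: "'a::euclidean_space \<Rightarrow> complex" and f :: "'a \<Rightarrow> 'b::complex_banach"
  assumes u: "sintegrable u" and f: "strongly_measurable lebesgue f" "\<And>x. norm (f x) \<le> C"
  shows "sintegrable (\<lambda>x. u x *\<^sub>C f x)"
proof (rule sintegrable_bound[where w="\<lambda>x. ennreal C * ennreal (norm (u x))"])
  show "strongly_measurable lebesgue (\<lambda>x. u x *\<^sub>C f x)"
    using sintegrableD(1)[OF u] f by (intro strongly_measurable_scaleC strongly_measurable_borel)
  show "(\<integral>\<^sup>+x. ennreal C * ennreal (norm (u x)) \<partial>lebesgue) < \<infinity>"
    using sintegrableD[OF u] strongly_measurable_norm[OF sintegrableD(1)[OF u]]
    by (subst nn_integral_cmult) (auto simp: ennreal_mult_less_top)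
  have "0 \<le> C" using f(2)[of undefined] norm_ge_zero order_trans by blast
  then show "AE x in lebesgue. ennreal (norm (u x *\<^sub>C f x)) \<le> ennreal C * ennreal (norm (u x))"
    using f(2) by (intro AE_I2) (auto simp: norm_scaleC mult.commute[of C] ennreal_mult[symmetric] intro!: ennreal_leI mult_left_mono)
qed

lemma sintegrable_norm_real:
  assumes "sintegrable f"
  obtains C where "0 \<le> C" "(\<integral>\<^sup>+x. ennreal (norm (f x)) \<partial>lebesgue) = ennreal C"
  using sintegrableD(2)[OF assms] by (cases "\<integral>\<^sup>+x. ennreal (norm (f x)) \<partial>lebesgue") auto

lemma sfourier_bounded:
  fixes f :: "'a::euclidean_space \<Rightarrow> 'b::complex_banach"
  assumes f: "sintegrable f" and C: "0 \<le> C" "(\<integral>\<^sup>+x. ennreal (norm (f x)) \<partial>lebesgue) \<le> ennreal C"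
  shows "norm (sfourier \<sigma> f \<xi>) \<le> C"
  using order_trans[OF sfourier_norm_le[OF sintegrableD(1)[OF f]] C(2)] C(1) by simp

lemma sfourier_mult_sintegrable:
  fixes f :: "'a::euclidean_space \<Rightarrow> 'b::complex_banach" and \<phi> :: "'a \<Rightarrow> complex"
  assumes "sintegrable \<phi>" "sintegrable f"
  shows "sintegrable (\<lambda>x. sfourier \<sigma> \<phi> x *\<^sub>C f x)" "sintegrable (\<lambda>x. \<phi> x *\<^sub>C sfourier \<sigma> f x)"
proof -
  obtain C where C: "0 \<le> C" "(\<integral>\<^sup>+x. ennreal (norm (\<phi> x)) \<partial>lebesgue) = ennreal C"
    using assms(1) by (rule sintegrable_norm_real)
  show "sintegrable (\<lambda>x. sfourier \<sigma> \<phi> x *\<^sub>C f x)"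
    by (rule sintegrable_bounded_mult[OF strongly_measurable_borel[OF sfourier_strongly_measurable[OF assms(1)]]
        sfourier_bounded[OF assms(1) C(1) eq_refl[OF C(2)]] assms(2)])
  obtain D where D: "0 \<le> D" "(\<integral>\<^sup>+x. ennreal (norm (f x)) \<partial>lebesgue) = ennreal D"
    using assms(2) by (rule sintegrable_norm_real)
  show "sintegrable (\<lambda>x. \<phi> x *\<^sub>C sfourier \<sigma> f x)"
    by (rule sintegrable_mult_bounded[OF assms(1) sfourier_strongly_measurable[OF assms(2)]
        sfourier_bounded[OF assms(2) D(1) eq_refl[OF D(2)]]])
qed

lemma integrable_indicator_complex:
  assumes "A \<in> sets M" "emeasure M A < \<infinity>"
  shows "integrable M (indicator A :: 'a \<Rightarrow> complex)"
proof -
  have "integrable M (\<lambda>x. indicator A x *\<^sub>R (1::complex))"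
    using assms by (intro integrable_scaleR_left integrable_real_indicator)
  moreover have "(\<lambda>x. indicator A x *\<^sub>R (1::complex)) = indicator A"
    by (auto simp: indicator_def)
  ultimately show ?thesis by simp
qed

text \<open>The scalar base case of the multiplication formula. It is proved over
  \<open>lborel\<close>, where joint measurability of the kernel is a Borel statement, and then
  moved to the completed measure.\<close>

lemma sfourier_indicator_fubini:
  fixes \<phi> :: "'a::euclidean_space \<Rightarrow> complex"
  assumes \<phi>: "continuous_on UNIV \<phi>" "sintegrable \<phi>"
  shows "(LINT x|lebesgue. indicator (box a b) x * sfourier \<sigma> \<phi> x) =
    (LINT \<xi>|lebesgue. \<phi> \<xi> * sfourier \<sigma> (indicator (box a b)) \<xi>)"
proof -
  let ?e = "\<lambda>x t :: 'a. cis (\<sigma> * (2 * pi * (x \<bullet> t)))" and ?I = "indicator (box a b) :: 'a \<Rightarrow> complex"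
  have \<phi>b[measurable]: "\<phi> \<in> borel_measurable borel" using \<phi>(1) by (rule borel_measurable_continuous_onI)
  have [measurable]: "cis \<in> borel_measurable borel"
    by (intro borel_measurable_continuous_onI continuous_intros)
  have e[measurable]: "(\<lambda>p. ?e (fst p) (snd p)) \<in> borel_measurable (borel \<Otimes>\<^sub>M borel)"
    by measurable
  have il: "integrable lebesgue \<phi>"
    using \<phi>(2) by (auto simp: integrable_iff_bounded sintegrable_def strongly_measurable_borel)
  have \<phi>i: "integrable lborel \<phi>"
    using il by (subst (asm) integrable_completion) auto
  have Ii: "integrable lborel ?I"
    using emeasure_lborel_box_finite[of a b] by (intro integrable_indicator_complex) auto
  have four1: "sfourier \<sigma> u x = (LINT t|lborel. ?e x t * u t)"
    if u: "u \<in> borel_measurable borel" "integrable lborel u" for u :: "'a \<Rightarrow> complex" and x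
  proof -
    have m: "(\<lambda>t. ?e x t * u t) \<in> borel_measurable lborel"
      using u(1) by measurable
    have "integrable lborel (\<lambda>t. ?e x t * u t)"
      by (rule Bochner_Integration.integrable_bound[OF u(2) m]) (simp add: norm_mult)
    then have "integrable lebesgue (\<lambda>t. ?e x t * u t)"
      using m by (subst integrable_completion) auto
    from integrable_sintegrable(2)[OF this] show ?thesis
      using m by (simp add: sfourier_def scaleC_complex_def integral_completion)
  qed
  have fI: "sfourier \<sigma> ?I = (\<lambda>x. LINT t|lborel. ?e x t * ?I t)"
    using four1[of ?I] Ii by (auto simp: fun_eq_iff)
  have f\<phi>: "sfourier \<sigma> \<phi> = (\<lambda>x. LINT t|lborel. ?e x t * \<phi> t)"
    using four1[of \<phi>] \<phi>i by (auto simp: fun_eq_iff)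
  have mb: "sfourier \<sigma> u \<in> borel_measurable borel" if "sintegrable u" for u :: "'a \<Rightarrow> complex"
    by (intro borel_measurable_continuous_onI sfourier_continuous that)
  have m1: "(\<lambda>x. ?I x * sfourier \<sigma> \<phi> x) \<in> borel_measurable lborel"
    using mb[OF \<phi>(2)] by measurable
  have "sintegrable ?I"
    using Ii by (intro integrable_sintegrable(1)) (auto simp: integrable_completion)
  then have m2: "(\<lambda>x. \<phi> x * sfourier \<sigma> ?I x) \<in> borel_measurable lborel"
    using mb[of ?I] by measurable
  have int: "integrable (lborel \<Otimes>\<^sub>M lborel) (case_prod (\<lambda>x t. ?e x t * (?I x * \<phi> t)))"
  proof (rule integrableI_bounded)
    show "case_prod (\<lambda>x t. ?e x t * (?I x * \<phi> t)) \<in> borel_measurable (lborel \<Otimes>\<^sub>M lborel)"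
      by measurable
    have "(\<integral>\<^sup>+p. ennreal (norm (case p of (x, t) \<Rightarrow> ?e x t * (?I x * \<phi> t))) \<partial>(lborel \<Otimes>\<^sub>M lborel)) =
        (\<integral>\<^sup>+x. \<integral>\<^sup>+t. ennreal (norm (?I x)) * ennreal (norm (\<phi> t)) \<partial>lborel \<partial>lborel)"
      by (subst lborel.nn_integral_fst[symmetric]) (auto simp: norm_mult ennreal_mult)
    also have "\<dots> = (\<integral>\<^sup>+x. ennreal (norm (?I x)) \<partial>lborel) * (\<integral>\<^sup>+t. ennreal (norm (\<phi> t)) \<partial>lborel)"
      by (simp add: nn_integral_cmult nn_integral_multc)
    also have "\<dots> < \<infinity>"
      using Ii \<phi>i by (auto simp: integrable_iff_bounded ennreal_mult_less_top)
    finally show "(\<integral>\<^sup>+p. ennreal (norm (case p of (x, t) \<Rightarrow> ?e x t * (?I x * \<phi> t))) \<partial>(lborel \<Otimes>\<^sub>M lborel)) < \<infinity>" .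
  qed
  have "(LINT x|lebesgue. ?I x * sfourier \<sigma> \<phi> x) = (LINT x|lborel. ?I x * sfourier \<sigma> \<phi> x)"
    using m1 by (rule integral_completion)
  also have "\<dots> = (LINT x|lborel. LINT t|lborel. ?e x t * (?I x * \<phi> t))"
    unfolding f\<phi> by (intro Bochner_Integration.integral_cong refl)
      (simp add: mult.left_commute flip: integral_mult_right_zero)
  also have "\<dots> = (LINT t|lborel. LINT x|lborel. ?e x t * (?I x * \<phi> t))"
    using lborel_pair.Fubini_integral[OF int] by simp
  also have "\<dots> = (LINT t|lborel. \<phi> t * sfourier \<sigma> ?I t)"
    unfolding fI by (intro Bochner_Integration.integral_cong refl)
      (simp add: mult_ac inner_commute flip: integral_mult_right_zero)
  also have "\<dots> = (LINT t|lebesgue. \<phi> t * sfourier \<sigma> ?I t)"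
    using m2 by (rule integral_completion[symmetric])
  finally show ?thesis .
qed

lemma indicator_scaleR_scaleC: "indicator A x *\<^sub>R v = (indicator A x :: complex) *\<^sub>C v"
  by (simp add: scaleR_scaleC indicator_def)

lemma indicator_box_sintegrable: "sintegrable (indicator (box a b) :: 'a::euclidean_space \<Rightarrow> complex)"
proof (rule integrable_sintegrable(1))
  show "integrable lebesgue (indicator (box a b) :: 'a \<Rightarrow> complex)"
    by (rule integrable_indicator_complex[OF _ emeasure_lebesgue_box_finite]) auto
qed

text \<open>Both sides are additive and \<open>L^1\<close>-continuous in \<open>f\<close>, so
  \<open>f\<close> may be taken to be a vector times the indicator of a box; there the integrals are
  scalar ones.\<close>

lemma sfourier_multiplication:
  fixes f :: "'a::euclidean_space \<Rightarrow> 'b::complex_banach" and \<phi> :: "'a \<Rightarrow> complex"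
  assumes \<phi>: "continuous_on UNIV \<phi>" "sintegrable \<phi>" and f: "sintegrable f"
  shows "strong_integral lebesgue (\<lambda>x. sfourier \<sigma> \<phi> x *\<^sub>C f x) =
    strong_integral lebesgue (\<lambda>x. \<phi> x *\<^sub>C sfourier \<sigma> f x)"
proof -
  have sm: "strongly_measurable lebesgue f" using f by (rule sintegrableD)
  \<comment> \<open>At exponent 1 the gauge is twice the \<open>L^1\<close> norm.\<close>
  have r1: "sintegrable g \<longleftrightarrow> L1_Lp_gauge 1 g < \<infinity>" if "strongly_measurable lebesgue g" for g :: "'a \<Rightarrow> 'b"
    using L1_Lp_gauge_finite_iff[OF that, of 1] by (auto simp: sintegrable_def)
  have "L1_Lp_gauge 1 f < \<infinity>" using f r1[OF sm] by simp
  with order_refl sm show ?thesis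
  proof (induction rule: L1_Lp_induct)
    case (box a b v)
    let ?I = "indicator (box a b) :: 'a \<Rightarrow> complex"
    note Is = indicator_box_sintegrable[of a b]
    have toint: "integrable lebesgue u" if "sintegrable u" for u :: "'a \<Rightarrow> complex"
      using that by (auto simp: integrable_iff_bounded sintegrable_def strongly_measurable_borel)
    have "strong_integral lebesgue (\<lambda>x. sfourier \<sigma> \<phi> x *\<^sub>C (indicator (box a b) x *\<^sub>R v)) =
        strong_integral lebesgue (\<lambda>x. (sfourier \<sigma> \<phi> x *\<^sub>C ?I x) *\<^sub>C v)"
      by (simp add: indicator_scaleR_scaleC scaleC_scaleC scaleC_complex_def)
    also have "\<dots> = (LINT x|lebesgue. sfourier \<sigma> \<phi> x *\<^sub>C ?I x) *\<^sub>C v"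
      by (rule strong_integral_scaleC_left(2)[OF toint[OF sfourier_mult_sintegrable(1)[OF \<phi>(2) Is]]])
    also have "(LINT x|lebesgue. sfourier \<sigma> \<phi> x *\<^sub>C ?I x) = (LINT x|lebesgue. \<phi> x *\<^sub>C sfourier \<sigma> ?I x)"
      using sfourier_indicator_fubini[OF \<phi>, of a b \<sigma>] by (simp add: scaleC_complex_def mult.commute)
    also have "\<dots> *\<^sub>C v = strong_integral lebesgue (\<lambda>x. (\<phi> x *\<^sub>C sfourier \<sigma> ?I x) *\<^sub>C v)"
      by (rule strong_integral_scaleC_left(2)[OF toint[OF sfourier_mult_sintegrable(2)[OF \<phi>(2) Is]], symmetric])
    also have "\<dots> = strong_integral lebesgue (\<lambda>x. \<phi> x *\<^sub>C sfourier \<sigma> (\<lambda>x. indicator (box a b) x *\<^sub>R v) x)"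
      by (simp add: indicator_scaleR_scaleC sfourier_scaleC_left[OF Is] scaleC_scaleC scaleC_complex_def)
    finally show ?case .
  next
    case (add f g)
    then have fg: "sintegrable f" "sintegrable g" using r1 by auto
    show ?case
      using add.IH fg
      by (simp add: sfourier_add scaleC_add_right strong_integral_add sfourier_mult_sintegrable[OF \<phi>(2)])
  next
    case (lim f g)
    then have fg: "sintegrable f" "\<And>n. sintegrable (g n)" using r1 by auto
    have L1: "(\<lambda>n. \<integral>\<^sup>+x. ennreal (norm (g n x - f x)) \<partial>lebesgue) \<longlonglongrightarrow> 0"
      by (rule tendsto_sandwich[OF _ _ tendsto_const lim.hyps(5)])
        (auto intro!: always_eventually nn_integral_norm_le_L1_Lp_gauge)
    obtain C where C: "0 \<le> C" "(\<integral>\<^sup>+x. ennreal (norm (\<phi> x)) \<partial>lebesgue) = ennreal C"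
      using \<phi>(2) by (rule sintegrable_norm_real)
    have C0: "(\<lambda>n. ennreal C * (\<integral>\<^sup>+x. ennreal (norm (g n x - f x)) \<partial>lebesgue)) \<longlonglongrightarrow> 0"
      using tendsto_mult_ennreal[OF tendsto_const L1, of "ennreal C"] by simp
    have dm: "(\<lambda>x. ennreal (norm (g n x - f x))) \<in> borel_measurable lebesgue" for n
      using strongly_measurable_norm[OF strongly_measurable_diff[OF lim.hyps(1,3)]] by simp
    have "(\<lambda>n. strong_integral lebesgue (\<lambda>x. sfourier \<sigma> \<phi> x *\<^sub>C g n x)) \<longlonglongrightarrow>
        strong_integral lebesgue (\<lambda>x. sfourier \<sigma> \<phi> x *\<^sub>C f x)"
    proof (rule tendsto_strong_integral_L1[OF sfourier_mult_sintegrable(1)[OF \<phi>(2) fg(2)] sfourier_mult_sintegrable(1)[OF \<phi>(2) fg(1)]])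
      show "(\<lambda>n. \<integral>\<^sup>+x. ennreal (norm (sfourier \<sigma> \<phi> x *\<^sub>C g n x - sfourier \<sigma> \<phi> x *\<^sub>C f x)) \<partial>lebesgue) \<longlonglongrightarrow> 0"
      proof (rule tendsto_sandwich[OF _ _ tendsto_const C0])
        show "\<forall>\<^sub>F n in sequentially. (\<integral>\<^sup>+x. ennreal (norm (sfourier \<sigma> \<phi> x *\<^sub>C g n x - sfourier \<sigma> \<phi> x *\<^sub>C f x)) \<partial>lebesgue) \<le>
            ennreal C * (\<integral>\<^sup>+x. ennreal (norm (g n x - f x)) \<partial>lebesgue)"
          unfolding nn_integral_cmult[OF dm, symmetric] scaleC.diff_right[symmetric] norm_scaleC
          using sfourier_bounded[OF \<phi>(2) C(1) eq_refl[OF C(2)]] C(1)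
          by (intro always_eventually allI nn_integral_mono)
            (auto simp: ennreal_mult[symmetric] intro!: ennreal_leI mult_right_mono)
      qed simp
    qed
    moreover have "(\<lambda>n. strong_integral lebesgue (\<lambda>x. \<phi> x *\<^sub>C sfourier \<sigma> (g n) x)) \<longlonglongrightarrow>
        strong_integral lebesgue (\<lambda>x. \<phi> x *\<^sub>C sfourier \<sigma> f x)"
    proof (rule tendsto_strong_integral_L1[OF sfourier_mult_sintegrable(2)[OF \<phi>(2) fg(2)] sfourier_mult_sintegrable(2)[OF \<phi>(2) fg(1)]])
      show "(\<lambda>n. \<integral>\<^sup>+x. ennreal (norm (\<phi> x *\<^sub>C sfourier \<sigma> (g n) x - \<phi> x *\<^sub>C sfourier \<sigma> f x)) \<partial>lebesgue) \<longlonglongrightarrow> 0"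
      proof (rule tendsto_sandwich[OF _ _ tendsto_const C0])
        show "\<forall>\<^sub>F n in sequentially. (\<integral>\<^sup>+x. ennreal (norm (\<phi> x *\<^sub>C sfourier \<sigma> (g n) x - \<phi> x *\<^sub>C sfourier \<sigma> f x)) \<partial>lebesgue) \<le>
            ennreal C * (\<integral>\<^sup>+x. ennreal (norm (g n x - f x)) \<partial>lebesgue)"
        proof (intro always_eventually allI)
          fix n
          have "(\<integral>\<^sup>+x. ennreal (norm (\<phi> x *\<^sub>C sfourier \<sigma> (g n) x - \<phi> x *\<^sub>C sfourier \<sigma> f x)) \<partial>lebesgue) \<le>
            (\<integral>\<^sup>+x. ennreal (norm (\<phi> x)) * (\<integral>\<^sup>+x. ennreal (norm (g n x - f x)) \<partial>lebesgue) \<partial>lebesgue)"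
          proof (rule nn_integral_mono)
            fix x
            have "norm (\<phi> x *\<^sub>C sfourier \<sigma> (g n) x - \<phi> x *\<^sub>C sfourier \<sigma> f x) =
                norm (\<phi> x) * norm (sfourier \<sigma> (\<lambda>x. g n x - f x) x)"
              using fg by (simp add: sfourier_diff scaleC.diff_right[symmetric] norm_scaleC)
            then show "ennreal (norm (\<phi> x *\<^sub>C sfourier \<sigma> (g n) x - \<phi> x *\<^sub>C sfourier \<sigma> f x)) \<le>
                ennreal (norm (\<phi> x)) * (\<integral>\<^sup>+x. ennreal (norm (g n x - f x)) \<partial>lebesgue)"
              using sfourier_norm_le[OF strongly_measurable_diff[OF lim.hyps(1,3)]]
              by (simp add: ennreal_mult mult_left_mono)
          qed
          also have "\<dots> = ennreal C * (\<integral>\<^sup>+x. ennreal (norm (g n x - f x)) \<partial>lebesgue)"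
            using strongly_measurable_norm[OF sintegrableD(1)[OF \<phi>(2)]] C(2)
            by (subst nn_integral_multc) auto
          finally show "(\<integral>\<^sup>+x. ennreal (norm (\<phi> x *\<^sub>C sfourier \<sigma> (g n) x - \<phi> x *\<^sub>C sfourier \<sigma> f x)) \<partial>lebesgue) \<le>
            ennreal C * (\<integral>\<^sup>+x. ennreal (norm (g n x - f x)) \<partial>lebesgue)" .
        qed
      qed simp
    qed
    ultimately show ?case
      unfolding lim.IH by (rule LIMSEQ_unique)
  qed
qed

section \<open>Examples, linearity and uniqueness of tempered functions\<close>

lemma tempered_bounded:
  fixes g :: "'a::euclidean_space \<Rightarrow> 'b::real_normed_vector"
  assumes g: "strongly_measurable lebesgue g" and C: "\<And>x. norm (g x) \<le> C"
  shows "tempered g"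
proof -
  have C0: "0 \<le> C" using C[of 0] norm_ge_zero order_trans by blast
  have "(\<integral>\<^sup>+x. ennreal (weight x * norm (g x)) \<partial>lebesgue) \<le> (\<integral>\<^sup>+x. ennreal C * ennreal (weight (x::'a)) \<partial>lebesgue)"
  proof (rule nn_integral_mono)
    fix x :: 'a
    have "weight x * norm (g x) \<le> C * weight x"
      using mult_left_mono[OF C[of x] less_imp_le[OF weight_pos[of x]]] by (simp add: mult.commute)
    then show "ennreal (weight x * norm (g x)) \<le> ennreal C * ennreal (weight x)"
      using C0 less_imp_le[OF weight_pos[of x]] by (subst ennreal_mult[symmetric]) (auto intro: ennreal_leI)
  qed
  also have "\<dots> < \<infinity>"
    using nn_integral_weight[where ?'a='a] by (subst nn_integral_cmult) (auto simp: ennreal_mult_less_top)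
  finally show ?thesis using g by (simp add: tempered_def)
qed

lemma le_one_plus_powr:
  fixes t :: real
  assumes "0 \<le> t" "1 \<le> s"
  shows "t \<le> 1 + t powr s"
proof (cases "t \<le> 1")
  case False
  then have "t powr 1 \<le> t powr s" using assms by (intro powr_mono) auto
  with False show ?thesis by simp
qed (use assms in \<open>auto intro: order_trans\<close>)

text \<open>In the pointwise bound \<open>t <= 1 + t powr s\<close> the term 1 is absorbed by
  integrability of the weight, the power by the weight being at most 1.\<close>

lemma tempered_Lp:
  fixes g :: "'a::euclidean_space \<Rightarrow> 'b::real_normed_vector"
  assumes g: "strongly_measurable lebesgue g" and s: "1 \<le> s"
    and f: "(\<integral>\<^sup>+x. ennreal (norm (g x) powr s) \<partial>lebesgue) < \<infinity>"
  shows "tempered g"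
proof -
  have m: "(\<lambda>x. norm (g x) powr s) \<in> borel_measurable lebesgue"
    using strongly_measurable_norm[OF g] by (intro powr_real_measurable) auto
  have "(\<integral>\<^sup>+x. ennreal (weight x * norm (g x)) \<partial>lebesgue) \<le>
      (\<integral>\<^sup>+x. ennreal (weight x) + ennreal (norm (g x) powr s) \<partial>lebesgue)"
  proof (rule nn_integral_mono)
    fix x
    have "weight x * norm (g x) \<le> weight x * (1 + norm (g x) powr s)"
      using le_one_plus_powr[OF norm_ge_zero s] less_imp_le[OF weight_pos] by (intro mult_left_mono) auto
    also have "\<dots> \<le> weight x + norm (g x) powr s"
      using weight_le_1[of x] mult_right_mono[of "weight x" 1 "norm (g x) powr s"] by (simp add: algebra_simps)
    finally show "ennreal (weight x * norm (g x)) \<le> ennreal (weight x) + ennreal (norm (g x) powr s)"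
      using less_imp_le[OF weight_pos[of x]] by (subst ennreal_plus[symmetric]) (auto intro!: ennreal_leI simp del: ennreal_plus)
  qed
  also have "\<dots> = (\<integral>\<^sup>+x. ennreal (weight (x::'a)) \<partial>lebesgue) + (\<integral>\<^sup>+x. ennreal (norm (g x) powr s) \<partial>lebesgue)"
    using m by (intro nn_integral_add) auto
  also have "\<dots> < \<infinity>" using f nn_integral_weight[where ?'a='a] by simp
  finally show ?thesis using g by (simp add: tempered_def)
qed

lemma tempered_add:
  assumes "tempered f" "tempered g"
  shows "tempered (\<lambda>x. f x + g x)"
proof -
  have m: "(\<lambda>x. ennreal (weight x * norm (h x))) \<in> borel_measurable lebesgue" if "tempered h" for h :: "'a \<Rightarrow> 'b"
    using strongly_measurable_norm[OF temperedD[OF that]] weight_lebesgue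
    by (intro measurable_compose[OF _ measurable_ennreal] borel_measurable_times) auto
  have "(\<integral>\<^sup>+x. ennreal (weight x * norm (f x + g x)) \<partial>lebesgue) \<le>
      (\<integral>\<^sup>+x. ennreal (weight x * norm (f x)) + ennreal (weight x * norm (g x)) \<partial>lebesgue)"
  proof (rule nn_integral_mono)
    fix x
    have "weight x * norm (f x + g x) \<le> weight x * norm (f x) + weight x * norm (g x)"
      using mult_left_mono[OF norm_triangle_ineq less_imp_le[OF weight_pos]] by (simp add: distrib_left)
    then show "ennreal (weight x * norm (f x + g x)) \<le> ennreal (weight x * norm (f x)) + ennreal (weight x * norm (g x))"
      using less_imp_le[OF weight_pos[of x]] by (subst ennreal_plus[symmetric]) (auto intro!: ennreal_leI simp del: ennreal_plus)
  qed
  also have "\<dots> < \<infinity>"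
    using assms m[OF assms(1)] m[OF assms(2)] by (subst nn_integral_add) (auto simp: tempered_def)
  finally show ?thesis using assms by (auto simp: tempered_def intro: strongly_measurable_add)
qed

lemma tempered_scaleC:
  fixes f :: "'a::euclidean_space \<Rightarrow> 'b::complex_banach"
  assumes "tempered f"
  shows "tempered (\<lambda>x. c *\<^sub>C f x)"
proof -
  have m: "(\<lambda>x. ennreal (weight x * norm (f x))) \<in> borel_measurable lebesgue"
    using strongly_measurable_norm[OF temperedD[OF assms]] weight_lebesgue
    by (intro measurable_compose[OF _ measurable_ennreal] borel_measurable_times) auto
  have "(\<integral>\<^sup>+x. ennreal (weight x * norm (c *\<^sub>C f x)) \<partial>lebesgue) =
      (\<integral>\<^sup>+x. ennreal (norm c) * ennreal (weight x * norm (f x)) \<partial>lebesgue)"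
    using less_imp_le[OF weight_pos]
    by (intro nn_integral_cong, subst ennreal_mult[symmetric]) (auto simp: norm_scaleC mult_ac intro!: mult_nonneg_nonneg)
  also have "\<dots> < \<infinity>"
    using assms m by (subst nn_integral_cmult) (auto simp: tempered_def ennreal_mult_less_top)
  finally show ?thesis
    using assms by (auto simp: tempered_def intro!: strongly_measurable_scaleC)
qed

lemma tempered_diff:
  fixes f g :: "'a::euclidean_space \<Rightarrow> 'b::complex_banach"
  assumes "tempered f" "tempered g"
  shows "tempered (\<lambda>x. f x - g x)"
proof -
  have "(- 1) *\<^sub>C x = - (x :: 'b)" for x
    using scaleR_scaleC[of "-1" x] by simp
  then show ?thesis using tempered_add[OF assms(1) tempered_scaleC[OF assms(2), of "-1"]] by simp
qed

lemma tempered_unique: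
  fixes f g :: "'a::euclidean_space \<Rightarrow> 'b::complex_banach"
  assumes "tempered f" "tempered g"
    and "\<And>\<phi>. \<phi> \<in> schwartz \<Longrightarrow> strong_integral lebesgue (\<lambda>x. \<phi> x *\<^sub>C f x) = strong_integral lebesgue (\<lambda>x. \<phi> x *\<^sub>C g x)"
  shows "AE x in lebesgue. f x = g x"
proof -
  have "AE x in lebesgue. f x - g x = 0"
    using assms(3) by (intro tempered_eq_0_AE tempered_diff assms(1,2))
      (simp add: scaleC.diff_right strong_integral_diff tempered_schwartz_sintegrable assms(1,2))
  then show ?thesis by simp
qed

lemma sfourier_tempered: "sintegrable f \<Longrightarrow> tempered (sfourier \<sigma> f)"
  using sfourier_bounded[of f] sintegrable_norm_real[of f]
  by (metis tempered_bounded sfourier_strongly_measurable order_refl)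

section \<open>Fourier type in terms of real exponents\<close>

lemma hoelder_conjugate_real:
  assumes "hoelder_conjugate p p'" "1 < p" "p < \<infinity>"
  obtains s where "p = ennreal s" "1 < s" "p' = ennreal (s / (s - 1))"
proof -
  obtain s where s: "p = ennreal s" "0 \<le> s" using assms(3) by (cases p) auto
  then have s1: "1 < s" using assms(2) by (simp add: ennreal_less_iff flip: ennreal_1)
  have *: "ennreal (1 / s) + 1 / p' = 1"
    using assms(1) s s1 by (simp add: hoelder_conjugate_def divide_ennreal flip: ennreal_1)
  have "p' \<noteq> \<infinity>"
  proof
    assume "p' = \<infinity>"
    then have "ennreal (1 / s) = ennreal 1" using * by simp
    then show False using s1 by (simp add: ennreal_inj del: ennreal_1)
  qed
  then obtain t where t: "p' = ennreal t" "0 \<le> t" by (cases p') auto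
  have "t \<noteq> 0"
  proof
    assume "t = 0"
    then have "1 / p' = \<infinity>" using t by (simp add: ennreal_divide_zero)
    with * show False by simp
  qed
  with t have "0 < t" by simp
  with * t have "ennreal (1 / s + 1 / t) = ennreal 1"
    using s1 by (simp add: divide_ennreal flip: ennreal_1 ennreal_plus)
  then have "1 / s + 1 / t = 1" using s1 \<open>0 < t\<close> by (subst (asm) ennreal_inj) auto
  then have "t = s / (s - 1)" using s1 \<open>0 < t\<close> by (simp add: field_simps)
  with s t s1 show ?thesis by (intro that[of s]) auto
qed

lemma Lp_norm_ennreal:
  assumes "0 < s"
  shows "Lp_norm (ennreal s) f = ennreal_powr (\<integral>\<^sup>+x. ennreal (norm (f x) powr s) \<partial>lebesgue) (1 / s)"
  using assms by (simp add: Lp_norm_def)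

lemma Lp_ennreal_iff:
  assumes "0 < s"
  shows "f \<in> Lp (ennreal s) \<longleftrightarrow> strongly_measurable lebesgue f \<and>
    (\<integral>\<^sup>+x. ennreal (norm (f x) powr s) \<partial>lebesgue) < \<infinity>"
  using assms by (auto simp: Lp_def Lp_norm_ennreal ennreal_powr_def less_top)

lemma Lp_norm_le_iff:
  assumes "0 < s" "0 \<le> M"
  shows "Lp_norm (ennreal s) f \<le> ennreal M \<longleftrightarrow>
    (\<integral>\<^sup>+x. ennreal (norm (f x) powr s) \<partial>lebesgue) \<le> ennreal (M powr s)"
proof (cases "\<integral>\<^sup>+x. ennreal (norm (f x) powr s) \<partial>lebesgue")
  case (real t)
  have "t powr (1 / s) \<le> M \<longleftrightarrow> t \<le> M powr s"
  proof
    assume "t powr (1 / s) \<le> M"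
    then have "(t powr (1 / s)) powr s \<le> M powr s" using assms by (intro powr_mono2) auto
    then show "t \<le> M powr s" using assms real by (simp add: powr_powr)
  next
    assume "t \<le> M powr s"
    then have "t powr (1 / s) \<le> (M powr s) powr (1 / s)" using assms real by (intro powr_mono2) auto
    then show "t powr (1 / s) \<le> M" using assms by (simp add: powr_powr)
  qed
  then show ?thesis using assms real by (simp add: Lp_norm_ennreal ennreal_powr_def)
next
  case top
  then show ?thesis using assms by (simp add: Lp_norm_ennreal ennreal_powr_def top_unique)
qed

text \<open>For \<open>f\<close> in both \<open>L^1\<close> and \<open>L^s\<close> the
  distributional transform is the integral one almost everywhere, by the multiplication formula and
  uniqueness of tempered representatives. The exponent \<open>1 / (s - 1)\<close> is the conjugate
  exponent divided by \<open>s\<close>; it appears because both norms enter through their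
  powers.\<close>

lemma fourier_type_bound:
  assumes ft: "fourier_type TYPE('k::euclidean_space) TYPE('x::complex_banach) p" and p: "1 < p"
  obtains s K where "p = ennreal s" "1 < s" "s \<le> 2" "0 \<le> K"
    "\<And>(f::'k \<Rightarrow> 'x) M. strongly_measurable lebesgue f \<Longrightarrow> L1_Lp_gauge s f < \<infinity> \<Longrightarrow> 0 \<le> M \<Longrightarrow>
      (\<integral>\<^sup>+x. ennreal (norm (f x) powr s) \<partial>lebesgue) \<le> ennreal M \<Longrightarrow>
      (\<integral>\<^sup>+x. ennreal (norm (sfourier (- 1) f x) powr (s / (s - 1))) \<partial>lebesgue) \<le> ennreal (K * M powr (1 / (s - 1)))"
proof -
  obtain p' C where p2: "p \<le> 2" and hc: "hoelder_conjugate p p'" and C: "0 \<le> (C::real)"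
    and F: "\<And>f::'k \<Rightarrow> 'x. f \<in> Lp p \<Longrightarrow> \<exists>g\<in>Lp p'.
         distribution_eq (fourier_distribution (regular_distribution f)) (regular_distribution g) \<and>
         Lp_norm p' g \<le> ennreal C * Lp_norm p f"
    using ft unfolding fourier_type_def by blast
  obtain s where s: "p = ennreal s" "1 < s" "p' = ennreal (s / (s - 1))"
    using hoelder_conjugate_real[OF hc p] p2 by (metis ennreal_less_top ennreal_numeral infinity_ennreal_def le_less_trans)
  have s2: "s \<le> 2" using p2 s by (simp add: ennreal_le_iff flip: ennreal_numeral)
  let ?s' = "s / (s - 1)"
  have s': "1 \<le> ?s'" using s(2) by (simp add: field_simps)
  show ?thesis
  proof (rule that[OF s(1,2) s2, of "C powr ?s'"])
    fix f :: "'k \<Rightarrow> 'x" and M :: real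
    assume f: "strongly_measurable lebesgue f" "L1_Lp_gauge s f < \<infinity>" and M: "0 \<le> M"
      "(\<integral>\<^sup>+x. ennreal (norm (f x) powr s) \<partial>lebesgue) \<le> ennreal M"
    have fi: "sintegrable f" and fp: "(\<integral>\<^sup>+x. ennreal (norm (f x) powr s) \<partial>lebesgue) < \<infinity>"
      using f L1_Lp_gauge_finite_iff by blast+
    have "f \<in> Lp p" using f(1) fp s by (simp add: Lp_ennreal_iff)
    from F[OF this] obtain g where g: "g \<in> Lp p'"
      "distribution_eq (fourier_distribution (regular_distribution f)) (regular_distribution g)"
      "Lp_norm p' g \<le> ennreal C * Lp_norm p f" by blast
    have gt: "tempered g"
      using g(1) s' s(2) by (intro tempered_Lp[OF _ s']) (auto simp: s(3) Lp_ennreal_iff)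
    have "AE x in lebesgue. sfourier (- 1) f x = g x"
    proof (rule tempered_unique[OF sfourier_tempered[OF fi] gt])
      fix \<phi> :: "'k \<Rightarrow> complex" assume \<phi>: "\<phi> \<in> schwartz"
      have "strong_integral lebesgue (\<lambda>x. fourier \<phi> x *\<^sub>C f x) = strong_integral lebesgue (\<lambda>x. \<phi> x *\<^sub>C g x)"
        using g(2) \<phi> by (simp add: distribution_eq_def fourier_distribution_def regular_distribution_def)
      then show "strong_integral lebesgue (\<lambda>x. \<phi> x *\<^sub>C sfourier (- 1) f x) = strong_integral lebesgue (\<lambda>x. \<phi> x *\<^sub>C g x)"
        using sfourier_multiplication[OF schwartz_continuous[OF \<phi>] schwartz_sintegrable[OF \<phi>] fi]
        by (simp add: fourier_eq_sfourier)
    qed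
    then have "(\<integral>\<^sup>+x. ennreal (norm (sfourier (- 1) f x) powr ?s') \<partial>lebesgue) = (\<integral>\<^sup>+x. ennreal (norm (g x) powr ?s') \<partial>lebesgue)"
      by (intro nn_integral_cong_AE) (auto elim: eventually_mono)
    also have "\<dots> \<le> ennreal ((C * M powr (1 / s)) powr ?s')"
    proof (subst Lp_norm_le_iff[symmetric])
      have "Lp_norm p f \<le> ennreal (M powr (1 / s))"
        using M s by (simp add: Lp_norm_le_iff powr_powr)
      then show "Lp_norm (ennreal ?s') g \<le> ennreal (C * M powr (1 / s))"
        using order_trans[OF g(3) mult_left_mono] C s(3) by (simp add: ennreal_mult)
    qed (use s' C in auto)
    also have "(C * M powr (1 / s)) powr ?s' = C powr ?s' * M powr (1 / (s - 1))"
      using s(2) C by (simp add: powr_mult powr_powr)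
    finally show "(\<integral>\<^sup>+x. ennreal (norm (sfourier (- 1) f x) powr ?s') \<partial>lebesgue) \<le> ennreal (C powr ?s' * M powr (1 / (s - 1)))" .
  qed simp
qed

section \<open>Step functions on translates of a set\<close>

definition step :: "'a::euclidean_space set \<Rightarrow> 'i set \<Rightarrow> ('i \<Rightarrow> 'a) \<Rightarrow> ('i \<Rightarrow> 'x::real_vector) \<Rightarrow> 'a \<Rightarrow> 'x"
  where "step B S \<tau> c t = (\<Sum>n\<in>S. indicator B (t - \<tau> n) *\<^sub>R c n)"

lemma nn_integral_lborel_shift:
  fixes f :: "'a::euclidean_space \<Rightarrow> ennreal"
  assumes "f \<in> borel_measurable borel"
  shows "(\<integral>\<^sup>+x. f (c + x) \<partial>lborel) = (\<integral>\<^sup>+x. f x \<partial>lborel)"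
  using assms by (subst (2) lborel_distr_plus[of c, symmetric]) (simp add: nn_integral_distr)

lemma integral_lborel_shift:
  fixes f :: "'a::euclidean_space \<Rightarrow> complex"
  assumes "f \<in> borel_measurable borel"
  shows "(LINT x|lborel. f (c + x)) = (LINT x|lborel. f x)"
  using assms by (subst (2) lborel_distr_plus[of c, symmetric]) (simp add: integral_distr)

lemma sfourier_complex_lborel:
  fixes u :: "'a::euclidean_space \<Rightarrow> complex"
  assumes u: "u \<in> borel_measurable borel" "integrable lborel u"
  shows "sfourier \<sigma> u x = (LINT t|lborel. cis (\<sigma> * (2 * pi * (x \<bullet> t))) * u t)"
    "integrable lborel (\<lambda>t. cis (\<sigma> * (2 * pi * (x \<bullet> t))) * u t)"
proof -
  have "(\<lambda>t. cis (\<sigma> * (2 * pi * (x \<bullet> t)))) \<in> borel_measurable borel"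
    by (intro borel_measurable_continuous_onI continuous_intros)
  then have m: "(\<lambda>t. cis (\<sigma> * (2 * pi * (x \<bullet> t))) * u t) \<in> borel_measurable lborel"
    using u(1) by simp
  show i: "integrable lborel (\<lambda>t. cis (\<sigma> * (2 * pi * (x \<bullet> t))) * u t)"
    by (rule Bochner_Integration.integrable_bound[OF u(2) m]) (simp add: norm_mult)
  then have "integrable lebesgue (\<lambda>t. cis (\<sigma> * (2 * pi * (x \<bullet> t))) * u t)"
    using m by (subst integrable_completion) auto
  from integrable_sintegrable(2)[OF this]
  show "sfourier \<sigma> u x = (LINT t|lborel. cis (\<sigma> * (2 * pi * (x \<bullet> t))) * u t)"
    using m by (simp add: sfourier_def scaleC_complex_def integral_completion)
qed

lemma indicator_shift_integrable:
  assumes B: "B \<in> sets borel" "emeasure lborel B < \<infinity>"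
  shows "integrable lborel (\<lambda>t. indicator B (t - \<tau>) :: complex)"
    "sintegrable (\<lambda>t::'a::euclidean_space. indicator B (t - \<tau>) :: complex)"
    "(\<lambda>t. indicator B (t - \<tau>) :: complex) \<in> borel_measurable borel"
proof -
  have m: "(\<lambda>t. t - \<tau>) \<in> borel_measurable borel" by simp
  have S: "(\<lambda>t. t - \<tau>) -` B \<in> sets borel" using measurable_sets[OF m B(1)] by simp
  have eq: "(\<lambda>t. indicator B (t - \<tau>) :: complex) = indicator ((\<lambda>t. t - \<tau>) -` B)"
    by (auto simp: indicator_def)
  have "emeasure lborel ((\<lambda>t. t - \<tau>) -` B) = (\<integral>\<^sup>+t. indicator ((\<lambda>t. t - \<tau>) -` B) t \<partial>lborel)"
    using S by simp
  also have "\<dots> = (\<integral>\<^sup>+t. indicator B (- \<tau> + t) \<partial>lborel)"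
    by (intro nn_integral_cong) (auto split: split_indicator)
  also have "\<dots> = emeasure lborel B"
    using B by (subst nn_integral_lborel_shift) auto
  finally have "emeasure lborel ((\<lambda>t. t - \<tau>) -` B) < \<infinity>" using B by simp
  then show i: "integrable lborel (\<lambda>t. indicator B (t - \<tau>) :: complex)"
    unfolding eq using S by (intro integrable_indicator_complex) auto
  show mm: "(\<lambda>t. indicator B (t - \<tau>) :: complex) \<in> borel_measurable borel"
    unfolding eq using S by auto
  show "sintegrable (\<lambda>t::'a. indicator B (t - \<tau>) :: complex)"
    using i mm by (intro integrable_sintegrable(1)) (auto simp: integrable_completion)
qed

lemma sfourier_indicator_shift:
  fixes B :: "'a::euclidean_space set"
  assumes B: "B \<in> sets borel" "emeasure lborel B < \<infinity>"
  shows "sfourier \<sigma> (\<lambda>t. indicator B (t - \<tau>) :: complex) \<xi> =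
    cis (\<sigma> * (2 * pi * (\<xi> \<bullet> \<tau>))) * sfourier \<sigma> (indicator B) \<xi>"
proof -
  let ?e = "\<lambda>t. cis (\<sigma> * (2 * pi * (\<xi> \<bullet> t)))"
  have [measurable]: "?e \<in> borel_measurable borel"
    by (intro borel_measurable_continuous_onI continuous_intros)
  note I = indicator_shift_integrable[OF B, of \<tau>] and I0 = indicator_shift_integrable[OF B, of 0]
  have "sfourier \<sigma> (\<lambda>t. indicator B (t - \<tau>) :: complex) \<xi> = (LINT t|lborel. ?e t * indicator B (t - \<tau>))"
    by (rule sfourier_complex_lborel(1)[OF I(3,1)])
  also have "\<dots> = (LINT t|lborel. ?e (\<tau> + t) * indicator B (\<tau> + t - \<tau>))"
    using I(3) by (subst integral_lborel_shift[of _ \<tau>, symmetric]) auto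
  also have "\<dots> = (LINT t|lborel. ?e \<tau> * (?e t * indicator B t))"
    by (simp add: inner_add_right distrib_left cis_mult[symmetric] mult.assoc)
  also have "\<dots> = ?e \<tau> * (LINT t|lborel. ?e t * indicator B t)"
    by (rule integral_mult_right_zero)
  also have "(LINT t|lborel. ?e t * indicator B t) = sfourier \<sigma> (indicator B) \<xi>"
    using sfourier_complex_lborel(1)[OF I0(3,1)] by simp
  finally show ?thesis .
qed

text \<open>Disjointness makes the \<open>L^s\<close> norm depend only on the coefficients, while
  translation turns the transform into that of \<open>B\<close> times a trigonometric sum. The
  exchange is used in both directions: from step functions to sums on the space of the hypothesis,
  and back on the space of the conclusion.\<close>

lemma step_props:
  fixes c :: "'i \<Rightarrow> 'x::complex_banach" and B :: "'a::euclidean_space set"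
  assumes B: "B \<in> sets borel" "emeasure lborel B < \<infinity>" and S: "finite S"
    and dj: "\<And>n m t. n \<in> S \<Longrightarrow> m \<in> S \<Longrightarrow> t - \<tau> n \<in> B \<Longrightarrow> t - \<tau> m \<in> B \<Longrightarrow> n = m"
  shows "sintegrable (step B S \<tau> c)"
    "sfourier \<sigma> (step B S \<tau> c) \<xi> =
      sfourier \<sigma> (indicator B) \<xi> *\<^sub>C (\<Sum>n\<in>S. cis (\<sigma> * (2 * pi * (\<xi> \<bullet> \<tau> n))) *\<^sub>C c n)"
    "s > 0 \<Longrightarrow> (\<integral>\<^sup>+t. ennreal (norm (step B S \<tau> c t) powr s) \<partial>lebesgue) =
      ennreal (measure lborel B * (\<Sum>n\<in>S. norm (c n) powr s))"
proof -
  have eq: "step B S \<tau> c = (\<lambda>t. \<Sum>n\<in>S. (indicator B (t - \<tau> n) :: complex) *\<^sub>C c n)"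
    by (simp add: step_def fun_eq_iff indicator_scaleR_scaleC)
  note I = indicator_shift_integrable[OF B]
  have i: "sintegrable (\<lambda>t. (indicator B (t - \<tau> n) :: complex) *\<^sub>C c n)" for n
    by (rule sintegrable_bounded_linear[OF scaleC.bounded_linear_left I(2)])
  show "sintegrable (step B S \<tau> c)"
    unfolding eq by (intro sintegrable_sum i)
  show "sfourier \<sigma> (step B S \<tau> c) \<xi> =
      sfourier \<sigma> (indicator B) \<xi> *\<^sub>C (\<Sum>n\<in>S. cis (\<sigma> * (2 * pi * (\<xi> \<bullet> \<tau> n))) *\<^sub>C c n)"
    unfolding eq
    by (simp add: sfourier_sum[OF i] sfourier_scaleC_left[OF I(2)] sfourier_indicator_shift[OF B] scaleC.sum_right scaleC_scaleC mult.commute)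
  assume s: "s > 0"
  have pw: "norm (step B S \<tau> c t) powr s = (\<Sum>n\<in>S. indicator B (t - \<tau> n) * norm (c n) powr s)" for t
  proof (cases "\<exists>n\<in>S. t - \<tau> n \<in> B")
    case True
    then obtain n where n: "n \<in> S" "t - \<tau> n \<in> B" by blast
    have z: "m \<in> S - {n} \<Longrightarrow> t - \<tau> m \<notin> B" for m using dj[of m n t] n by auto
    have "step B S \<tau> c t = c n"
      unfolding step_def using S n z by (subst sum.remove[of _ n]) (auto intro!: sum.neutral)
    moreover have "(\<Sum>n\<in>S. indicator B (t - \<tau> n) * norm (c n) powr s) = norm (c n) powr s"
      using S n z by (subst sum.remove[of _ n]) (auto intro!: sum.neutral)
    ultimately show ?thesis by simp
  next
    case False
    then have "step B S \<tau> c t = 0" "(\<Sum>n\<in>S. indicator B (t - \<tau> n) * norm (c n) powr s) = 0"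
      unfolding step_def by (auto intro!: sum.neutral)
    then show ?thesis by simp
  qed
  have mi: "(\<lambda>t. indicator B (t - \<tau> n) :: ennreal) \<in> borel_measurable borel" for n
    using B(1) by measurable
  have "(\<integral>\<^sup>+t. ennreal (norm (step B S \<tau> c t) powr s) \<partial>lebesgue) =
      (\<integral>\<^sup>+t. (\<Sum>n\<in>S. ennreal (norm (c n) powr s) * indicator B (t - \<tau> n)) \<partial>lborel)"
    unfolding pw nn_integral_completion
    by (intro nn_integral_cong) (auto simp flip: sum_ennreal intro!: sum.cong simp: indicator_def)
  also have "\<dots> = (\<Sum>n\<in>S. ennreal (norm (c n) powr s) * (\<integral>\<^sup>+t. indicator B (t - \<tau> n) \<partial>lborel))"
    using mi by (subst nn_integral_sum) (auto simp: nn_integral_cmult)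
  also have "\<dots> = (\<Sum>n\<in>S. ennreal (norm (c n) powr s) * ennreal (measure lborel B))"
  proof (intro sum.cong refl)
    fix n
    have "(\<integral>\<^sup>+t. indicator B (t - \<tau> n) \<partial>lborel) = (\<integral>\<^sup>+t. indicator B (- \<tau> n + t) \<partial>lborel)"
      by simp
    also have "\<dots> = emeasure lborel B"
      using B(1) by (subst nn_integral_lborel_shift) auto
    finally show "ennreal (norm (c n) powr s) * (\<integral>\<^sup>+t. indicator B (t - \<tau> n) \<partial>lborel) =
        ennreal (norm (c n) powr s) * ennreal (measure lborel B)"
      using B(2) by (simp add: emeasure_eq_ennreal_measure)
  qed
  also have "\<dots> = ennreal (measure lborel B * (\<Sum>n\<in>S. norm (c n) powr s))"
    by (simp add: ennreal_mult'[symmetric] sum_distrib_left mult.commute)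
  finally show "(\<integral>\<^sup>+t. ennreal (norm (step B S \<tau> c t) powr s) \<partial>lebesgue) =
      ennreal (measure lborel B * (\<Sum>n\<in>S. norm (c n) powr s))" .
qed

section \<open>Trigonometric sums and transference of Fourier type\<close>

text \<open>Half-open, so that the integer translates tile the space exactly.\<close>

definition unit_cube :: "'a::euclidean_space set"
  where "unit_cube = {x. \<forall>i\<in>Basis. 0 \<le> x \<bullet> i \<and> x \<bullet> i < 1}"

lemma borel_unit_cube[measurable]: "unit_cube \<in> sets (borel :: 'a::euclidean_space measure)"
proof -
  have "unit_cube = (\<Inter>i\<in>Basis. {x::'a. 0 \<le> x \<bullet> i} \<inter> {x. x \<bullet> i < 1})"
    by (auto simp: unit_cube_def)
  also have "\<dots> \<in> sets borel"
    by (intro sets.finite_INT sets.Int) (auto intro!: borel_closed borel_open closed_Collect_le open_Collect_less continuous_intros)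
  finally show ?thesis .
qed

lemma One_inner: "i \<in> Basis \<Longrightarrow> One \<bullet> i = (1::real)" for i :: "'a::euclidean_space"
  by (simp add: inner_sum_left inner_Basis)

lemma emeasure_unit_cube: "emeasure lborel (unit_cube :: 'a::euclidean_space set) = 1"
proof (rule antisym)
  have "emeasure lborel (unit_cube :: 'a set) \<le> emeasure lborel (cbox 0 One :: 'a set)"
    by (intro emeasure_mono) (auto simp: unit_cube_def mem_box One_inner less_imp_le)
  also have "\<dots> = 1" by (subst emeasure_lborel_cbox_eq) (auto simp: One_inner)
  finally show "emeasure lborel (unit_cube :: 'a set) \<le> 1" .
  have "1 = emeasure lborel (box 0 One :: 'a set)"
    by (subst emeasure_lborel_box_eq) (auto simp: One_inner)
  also have "\<dots> \<le> emeasure lborel (unit_cube :: 'a set)"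
    by (intro emeasure_mono) (auto simp: unit_cube_def mem_box One_inner less_imp_le)
  finally show "1 \<le> emeasure lborel (unit_cube :: 'a set)" .
qed

text \<open>A trigonometric sum with frequencies on a line is, on the unit cube, comparable to the
  Fourier transform of a step function on translates of a small cube \<open>B\<close>: the transform of
  \<open>B\<close> itself is bounded below there because all phases stay in \<open>[0, \<pi>/3]\<close>.\<close>

lemma trig_bound_line:
  fixes b :: "'k::euclidean_space"
  assumes s: "1 < s" and K: "0 \<le> K" and b: "b \<in> Basis"
    and F: "\<And>(f::'k \<Rightarrow> 'x::complex_banach) M. strongly_measurable lebesgue f \<Longrightarrow> L1_Lp_gauge s f < \<infinity> \<Longrightarrow> 0 \<le> M \<Longrightarrow>
      (\<integral>\<^sup>+x. ennreal (norm (f x) powr s) \<partial>lebesgue) \<le> ennreal M \<Longrightarrow>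
      (\<integral>\<^sup>+x. ennreal (norm (sfourier (- 1) f x) powr (s / (s - 1))) \<partial>lebesgue) \<le> ennreal (K * M powr (1 / (s - 1)))"
  obtains K' where "0 \<le> K'" "\<And>\<sigma> J (x :: int \<Rightarrow> 'x). \<sigma> \<in> {1, - 1} \<Longrightarrow> finite J \<Longrightarrow>
    (\<integral>\<^sup>+\<zeta>. indicator unit_cube \<zeta> * ennreal (norm (\<Sum>j\<in>J. cis (\<sigma> * (2 * pi * (\<zeta> \<bullet> b) * j)) *\<^sub>C x j) powr (s / (s - 1))) \<partial>lborel)
      \<le> ennreal (K' * (\<Sum>j\<in>J. norm (x j) powr s) powr (1 / (s - 1)))"
proof -
  let ?s' = "s / (s - 1)"
  have s': "1 \<le> ?s'" using s by (simp add: field_simps)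
  \<comment> \<open>A side of \<open>1 / (6 * DIM)\<close> keeps inner products with points of the
    unit cube below \<open>1 / 6\<close>, so the cosine of the phase is at least
    \<open>1 / 2\<close>. Being at most 1, it also makes the integer translates of \<open>B\<close>
    along \<open>b\<close> disjoint.\<close>
  define \<eta> where "\<eta> = 1 / (6 * real DIM('k))"
  have "real 1 \<le> real DIM('k)" by (intro of_nat_mono Suc_leI[of 0, simplified One_nat_def[symmetric]]) simp
  then have "1 \<le> 6 * real DIM('k)" by linarith
  then have \<eta>: "0 < \<eta>" "\<eta> \<le> 1" by (auto simp: \<eta>_def)
  define B where "B = (box 0 (\<eta> *\<^sub>R One) :: 'k set)"
  have memB: "t \<in> B \<longleftrightarrow> (\<forall>i\<in>Basis. 0 < t \<bullet> i \<and> t \<bullet> i < \<eta>)" for t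
    by (auto simp: B_def mem_box One_inner)
  have B: "B \<in> sets borel" "emeasure lborel B < \<infinity>"
    using emeasure_lborel_box_finite[of 0 "\<eta> *\<^sub>R One :: 'k"] by (auto simp: B_def)
  define m where "m = measure lborel B"
  have m: "0 < m" using \<eta>
    by (simp add: m_def B_def measure_lborel_box_eq One_inner prod_pos)
  note I0 = indicator_shift_integrable[OF B, of 0, simplified]
  have u: "m / 2 \<le> norm (sfourier (- 1) (indicator B) \<xi> :: complex)" if \<xi>: "\<xi> \<in> unit_cube" for \<xi> :: 'k
  proof -
    let ?g = "\<lambda>t. cis (- 1 * (2 * pi * (\<xi> \<bullet> t))) * indicator B t"
    note gi = sfourier_complex_lborel(2)[OF I0(3,1), of "-1" \<xi>]
    have "m / 2 = (LINT t|lborel. 1 / 2 * indicator B t)"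
      using B by (simp add: m_def)
    also have "\<dots> \<le> (LINT t|lborel. Re (?g t))"
    proof (rule integral_mono)
      show "integrable lborel (\<lambda>t. 1 / 2 * indicat_real B t)" using B by simp
      show "integrable lborel (\<lambda>t. Re (?g t))" using gi by (rule integrable_Re)
      fix t
      show "1 / 2 * indicator B t \<le> Re (?g t)"
      proof (cases "t \<in> B")
        case True
        have "0 \<le> \<xi> \<bullet> t" unfolding euclidean_inner[of \<xi> t]
          using \<xi> True by (intro sum_nonneg mult_nonneg_nonneg) (auto simp: unit_cube_def memB less_imp_le)
        moreover have "\<xi> \<bullet> t \<le> (\<Sum>i\<in>(Basis::'k set). 1 * \<eta>)" unfolding euclidean_inner[of \<xi> t]
          using \<xi> True \<eta> by (intro sum_mono mult_mono) (auto simp: unit_cube_def memB less_imp_le)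
        then have "\<xi> \<bullet> t \<le> 1 / 6" by (simp add: \<eta>_def)
        then have "2 * pi * (\<xi> \<bullet> t) \<le> 2 * pi * (1 / 6)" by (intro mult_left_mono) auto
        ultimately have "cos (pi / 3) \<le> cos (2 * pi * (\<xi> \<bullet> t))"
          by (intro cos_monotone_0_pi_le) auto
        with True show ?thesis by (simp add: cos_60)
      qed simp
    qed
    also have "\<dots> = Re (sfourier (- 1) (indicator B) \<xi>)"
      unfolding sfourier_complex_lborel(1)[OF I0(3,1)] by (rule integral_Re[OF gi])
    also have "\<dots> \<le> norm (sfourier (- 1) (indicator B) \<xi> :: complex)" by (rule complex_Re_le_cmod)
    finally show ?thesis .
  qed
  \<comment> \<open>The factor \<open>(2 / m) powr ?s'\<close> undoes the lower bound on the
    transform of \<open>B\<close>; the power of \<open>m\<close> comes from the measure of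
    \<open>B\<close> in the \<open>L^s\<close> norm of the step function.\<close>
  define K' where "K' = (2 / m) powr ?s' * (K * m powr (1 / (s - 1)))"
  have K': "0 \<le> K'" using K by (simp add: K'_def)
  have neg: "(\<integral>\<^sup>+\<zeta>. indicator unit_cube \<zeta> * ennreal (norm (\<Sum>j\<in>J. cis (- 1 * (2 * pi * (\<zeta> \<bullet> b) * j)) *\<^sub>C x j) powr ?s') \<partial>lborel)
      \<le> ennreal (K' * (\<Sum>j\<in>J. norm (x j) powr s) powr (1 / (s - 1)))"
    if J: "finite J" for J and x :: "int \<Rightarrow> 'x"
  proof -
    define f where "f = step B J (\<lambda>j. of_int j *\<^sub>R b) x"
    have dj: "j = l" if "t - of_int j *\<^sub>R b \<in> B" "t - of_int l *\<^sub>R b \<in> B" for j l :: int and t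
    proof -
      have "0 < t \<bullet> b - j" "t \<bullet> b - j < \<eta>" "0 < t \<bullet> b - l" "t \<bullet> b - l < \<eta>"
        using that b by (auto simp: memB inner_diff_left)
      then have "real_of_int j < real_of_int l + 1" "real_of_int l < real_of_int j + 1" using \<eta>(2) by linarith+
      then show ?thesis by linarith
    qed
    have sp: "sintegrable f"
      "\<And>\<xi>. sfourier (- 1) f \<xi> = sfourier (- 1) (indicator B) \<xi> *\<^sub>C (\<Sum>j\<in>J. cis (- 1 * (2 * pi * (\<xi> \<bullet> b) * j)) *\<^sub>C x j)"
      "(\<integral>\<^sup>+t. ennreal (norm (f t) powr s) \<partial>lebesgue) = ennreal (m * (\<Sum>j\<in>J. norm (x j) powr s))"
      unfolding f_def m_def using s
        step_props[OF B J, where \<tau>="\<lambda>j. of_int j *\<^sub>R b" and c=x] dj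
      by (auto simp: mult_ac)
    have S0: "0 \<le> (\<Sum>j\<in>J. norm (x j) powr s)" by (intro sum_nonneg) auto
    have "L1_Lp_gauge s f < \<infinity>" using sp L1_Lp_gauge_finite_iff[OF sintegrableD(1)[OF sp(1)]] by simp
    from F[OF sintegrableD(1)[OF sp(1)] this _ eq_refl[OF sp(3)]] m S0
    have Ff: "(\<integral>\<^sup>+x. ennreal (norm (sfourier (- 1) f x) powr ?s') \<partial>lebesgue) \<le>
        ennreal (K * (m * (\<Sum>j\<in>J. norm (x j) powr s)) powr (1 / (s - 1)))" by simp
    have "(\<integral>\<^sup>+\<zeta>. indicator unit_cube \<zeta> * ennreal (norm (\<Sum>j\<in>J. cis (- 1 * (2 * pi * (\<zeta> \<bullet> b) * j)) *\<^sub>C x j) powr ?s') \<partial>lborel)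
      \<le> (\<integral>\<^sup>+\<zeta>. ennreal ((2 / m) powr ?s') * ennreal (norm (sfourier (- 1) f \<zeta>) powr ?s') \<partial>lborel)"
    proof (rule nn_integral_mono)
      fix \<zeta> :: 'k
      let ?P = "\<Sum>j\<in>J. cis (- 1 * (2 * pi * (\<zeta> \<bullet> b) * j)) *\<^sub>C x j"
      show "indicator unit_cube \<zeta> * ennreal (norm ?P powr ?s') \<le>
          ennreal ((2 / m) powr ?s') * ennreal (norm (sfourier (- 1) f \<zeta>) powr ?s')"
      proof (cases "\<zeta> \<in> unit_cube")
        case True
        have "norm ?P \<le> 2 / m * norm (sfourier (- 1) f \<zeta>)"
          using mult_right_mono[OF u[OF True] norm_ge_zero[of ?P]] m unfolding sp(2) norm_scaleC
          by (simp add: field_simps)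
        then have "norm ?P powr ?s' \<le> (2 / m * norm (sfourier (- 1) f \<zeta>)) powr ?s'"
          using s' by (intro powr_mono2) auto
        also have "\<dots> = (2 / m) powr ?s' * norm (sfourier (- 1) f \<zeta>) powr ?s'"
          by (simp only: powr_mult)
        finally show ?thesis using True by (simp add: ennreal_mult[symmetric] ennreal_leI)
      qed simp
    qed
    also have "\<dots> = ennreal ((2 / m) powr ?s') * (\<integral>\<^sup>+\<zeta>. ennreal (norm (sfourier (- 1) f \<zeta>) powr ?s') \<partial>lebesgue)"
      unfolding nn_integral_completion
      using borel_measurable_continuous_onI[OF sfourier_continuous[OF sp(1)]]
      by (intro nn_integral_cmult measurable_compose[OF _ measurable_ennreal] powr_real_measurable
          measurable_compose[OF _ borel_measurable_norm]) auto
    also have "\<dots> \<le> ennreal ((2 / m) powr ?s') * ennreal (K * (m * (\<Sum>j\<in>J. norm (x j) powr s)) powr (1 / (s - 1)))"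
      using Ff by (intro mult_left_mono) auto
    also have "\<dots> = ennreal (K' * (\<Sum>j\<in>J. norm (x j) powr s) powr (1 / (s - 1)))"
      using m S0 K by (simp add: K'_def powr_mult ennreal_mult[symmetric] mult_ac)
    finally show ?thesis .
  qed
  show ?thesis
  proof (rule that[OF K'])
    fix \<sigma> :: real and J :: "int set" and x :: "int \<Rightarrow> 'x"
    assume \<sigma>: "\<sigma> \<in> {1, - 1}" and J: "finite J"
    show "(\<integral>\<^sup>+\<zeta>. indicator unit_cube \<zeta> * ennreal (norm (\<Sum>j\<in>J. cis (\<sigma> * (2 * pi * (\<zeta> \<bullet> b) * j)) *\<^sub>C x j) powr ?s') \<partial>lborel)
      \<le> ennreal (K' * (\<Sum>j\<in>J. norm (x j) powr s) powr (1 / (s - 1)))"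
    proof (cases "\<sigma> = -1")
      case True
      then show ?thesis using neg[OF J, of x] by simp
    next
      \<comment> \<open>The opposite sign is obtained by reflecting the index set, so the bound for
        the inverse transform follows from the one for the transform.\<close>
      case False
      then have "\<sigma> = 1" using \<sigma> by auto
      moreover have "inj_on uminus J" by (simp add: inj_on_def)
      ultimately show ?thesis
        using neg[of "uminus ` J" "\<lambda>j. x (- j)"] J by (simp add: sum.reindex o_def)
    qed
  qed
qed

section \<open>The integer lattice and periodic functions\<close>

definition int_vectors :: "'a::euclidean_space set"
  where "int_vectors = {n. \<forall>i\<in>Basis. n \<bullet> i \<in> \<int>}"

definition floor_vec :: "'a::euclidean_space \<Rightarrow> 'a"
  where "floor_vec x = (\<Sum>i\<in>Basis. of_int \<lfloor>x \<bullet> i\<rfloor> *\<^sub>R i)"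

lemma floor_vec_inner: "i \<in> Basis \<Longrightarrow> floor_vec x \<bullet> i = of_int \<lfloor>x \<bullet> i\<rfloor>"
  by (simp add: floor_vec_def inner_sum_left_Basis)

lemma floor_vec_int_vectors: "floor_vec x \<in> int_vectors"
  by (auto simp: int_vectors_def floor_vec_inner)

lemma sub_mem_unit_cube_iff:
  assumes "n \<in> int_vectors"
  shows "x - n \<in> unit_cube \<longleftrightarrow> n = floor_vec x"
proof -
  have *: "0 \<le> (x - n) \<bullet> i \<and> (x - n) \<bullet> i < 1 \<longleftrightarrow> n \<bullet> i = floor_vec x \<bullet> i" if "i \<in> Basis" for i
  proof -
    have "n \<bullet> i \<in> \<int>" using assms that by (auto simp: int_vectors_def)
    then obtain k where "n \<bullet> i = of_int k" by (rule Ints_cases)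
    moreover have "k = \<lfloor>x \<bullet> i\<rfloor> \<longleftrightarrow> of_int k \<le> x \<bullet> i \<and> x \<bullet> i < of_int k + 1"
      using floor_eq_iff[of "x \<bullet> i" k] by (simp add: eq_commute[of k])
    ultimately show ?thesis using that by (simp add: inner_diff_left floor_vec_inner algebra_simps)
  qed
  show ?thesis unfolding unit_cube_def using * by (auto simp: euclidean_eq_iff[of n])
qed

lemma int_vectors_add: "m \<in> int_vectors \<Longrightarrow> n \<in> int_vectors \<Longrightarrow> m + n \<in> int_vectors"
  and int_vectors_uminus: "n \<in> int_vectors \<Longrightarrow> - n \<in> int_vectors"
  and int_vectors_scaleR: "n \<in> int_vectors \<Longrightarrow> real_of_int k *\<^sub>R n \<in> int_vectors"
  by (auto simp: int_vectors_def inner_add_left)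

lemma int_vectors_inner: "m \<in> int_vectors \<Longrightarrow> n \<in> int_vectors \<Longrightarrow> m \<bullet> n \<in> \<int>"
  unfolding euclidean_inner[of m n] by (intro Ints_sum Ints_mult) (auto simp: int_vectors_def)

text \<open>In coordinates, lattice points come from a finite product of sets of integers; this
  gives countability of the lattice and finiteness of its bounded parts.\<close>

lemma int_vectors_subset_image: "int_vectors \<inter> {x. \<forall>i\<in>Basis. x \<bullet> i \<in> C i} \<subseteq>
    (\<lambda>f. \<Sum>i\<in>Basis. f i *\<^sub>R i) ` (PiE Basis (\<lambda>i. \<int> \<inter> C i))" for C :: "'a::euclidean_space \<Rightarrow> real set"
proof
  fix n :: 'a assume n: "n \<in> int_vectors \<inter> {x. \<forall>i\<in>Basis. x \<bullet> i \<in> C i}"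
  then show "n \<in> (\<lambda>f. \<Sum>i\<in>Basis. f i *\<^sub>R i) ` (PiE Basis (\<lambda>i. \<int> \<inter> C i))"
    by (intro image_eqI[of _ _ "restrict (\<lambda>i. n \<bullet> i) Basis"]) (auto simp: int_vectors_def euclidean_representation)
qed

lemma countable_int_vectors: "countable (int_vectors :: 'a::euclidean_space set)"
proof -
  have "countable (PiE (Basis :: 'a set) (\<lambda>i. \<int> \<inter> (UNIV :: real set)))"
    by (intro countable_PiE) (auto simp: Ints_def)
  then show ?thesis
    using int_vectors_subset_image[of "\<lambda>i::'a. UNIV"] by (auto intro: countable_subset countable_image)
qed

lemma finite_int_vectors_bounded: "finite (int_vectors \<inter> {x::'a::euclidean_space. norm x \<le> R})"
proof -
  have "finite (\<int> \<inter> {- R..R})"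
  proof (rule finite_subset)
    show "\<int> \<inter> {- R..R} \<subseteq> real_of_int ` {\<lfloor>- R\<rfloor>..\<lceil>R\<rceil>}"
    proof
      fix x assume "x \<in> \<int> \<inter> {- R..R}"
      then obtain k where k: "x = of_int k" "- R \<le> of_int k" "of_int k \<le> R" by (auto elim: Ints_cases)
      have "\<lfloor>- R\<rfloor> \<le> k" "k \<le> \<lceil>R\<rceil>" using floor_mono[OF k(2)] ceiling_mono[OF k(3)] by auto
      with k(1) show "x \<in> real_of_int ` {\<lfloor>- R\<rfloor>..\<lceil>R\<rceil>}" by auto
    qed
  qed simp
  then have "finite (PiE (Basis :: 'a set) (\<lambda>i. \<int> \<inter> {- R..R}))"
    by (intro finite_PiE) auto
  moreover have "int_vectors \<inter> {x::'a. norm x \<le> R} \<subseteq> int_vectors \<inter> {x. \<forall>i\<in>Basis. x \<bullet> i \<in> {- R..R}}"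
  proof safe
    fix x i :: 'a assume "norm x \<le> R" "i \<in> Basis"
    then have "\<bar>x \<bullet> i\<bar> \<le> R" using Basis_le_norm[of i x] by linarith
    then show "x \<bullet> i \<in> {- R..R}" by (simp add: abs_le_iff)
  qed
  ultimately show ?thesis
    using int_vectors_subset_image[of "\<lambda>i::'a. {- R..R}"] by (meson finite_imageI finite_subset)
qed

lemma infinite_int_vectors: "infinite (int_vectors :: 'a::euclidean_space set)"
proof
  assume "finite (int_vectors :: 'a set)"
  obtain b :: 'a where b: "b \<in> Basis" using nonempty_Basis by blast
  have "range (\<lambda>n::nat. real n *\<^sub>R b) \<subseteq> int_vectors"
    using b by (auto simp: int_vectors_def inner_Basis)
  with \<open>finite int_vectors\<close> have "finite (range (\<lambda>n::nat. real n *\<^sub>R b))" by (rule rev_finite_subset)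
  moreover have "inj (\<lambda>n::nat. real n *\<^sub>R b)" using b by (auto simp: inj_def)
  ultimately show False using finite_imageD infinite_UNIV_nat by blast
qed

lemma suminf_indicator_unit_cube:
  fixes y :: "'a::euclidean_space"
  assumes e: "bij_betw e (UNIV :: nat set) int_vectors"
  shows "(\<Sum>i. indicator unit_cube (y - e i)) = (1::ennreal)"
proof -
  have "floor_vec y \<in> range e" using e floor_vec_int_vectors[of y] by (simp add: bij_betw_def)
  then obtain i where i: "e i = floor_vec y" by (metis imageE)
  have "indicator unit_cube (y - e k) = (if k = i then 1 else 0 :: ennreal)" for k
  proof -
    have "e k \<in> int_vectors" using e by (auto simp: bij_betw_def)
    moreover have "e k = e i \<longleftrightarrow> k = i" using e by (auto simp: bij_betw_def inj_eq)
    ultimately show ?thesis using i by (auto simp: indicator_def sub_mem_unit_cube_iff)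
  qed
  then show ?thesis using sums_unique[OF sums_single[of i "\<lambda>_. 1::ennreal"]] by simp
qed

text \<open>Cutting a translate of the unit cube along the integer grid and moving the pieces back.\<close>

lemma nn_integral_unit_cube_periodic:
  fixes G :: "'a::euclidean_space \<Rightarrow> ennreal"
  assumes G[measurable]: "G \<in> borel_measurable borel" and per: "\<And>x n. n \<in> int_vectors \<Longrightarrow> G (x + n) = G x"
  shows "(\<integral>\<^sup>+x. indicator unit_cube x * G (x + w) \<partial>lborel) = (\<integral>\<^sup>+x. indicator unit_cube x * G x \<partial>lborel)"
proof -
  define e where "e = from_nat_into (int_vectors :: 'a set)"
  have e: "bij_betw e UNIV int_vectors"
    unfolding e_def by (rule bij_betw_from_nat_into[OF countable_int_vectors infinite_int_vectors])
  have en: "e i \<in> int_vectors" for i using e by (auto simp: bij_betw_def)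
  \<comment> \<open>Moving the pieces back replaces \<open>e i\<close> by \<open>- e i\<close>,
    which enumerates the lattice as well.\<close>
  have e': "bij_betw (\<lambda>i. - e i) UNIV int_vectors"
  proof -
    have "bij_betw uminus (int_vectors :: 'a set) int_vectors"
      by (rule bij_betwI[of _ _ _ uminus]) (auto intro: int_vectors_uminus)
    from bij_betw_trans[OF e this] show ?thesis by (simp add: o_def)
  qed
  have "(\<integral>\<^sup>+x. indicator unit_cube x * G (x + w) \<partial>lborel) = (\<integral>\<^sup>+x. indicator unit_cube ((w + x) - w) * G (w + x) \<partial>lborel)"
    by (simp add: add.commute)
  also have "\<dots> = (\<integral>\<^sup>+x. indicator unit_cube (x - w) * G x \<partial>lborel)"
    by (rule nn_integral_lborel_shift) measurable
  also have "\<dots> = (\<integral>\<^sup>+x. (\<Sum>i. indicator unit_cube (x - e i)) * (indicator unit_cube (x - w) * G x) \<partial>lborel)"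
    by (simp add: suminf_indicator_unit_cube[OF e])
  also have "\<dots> = (\<Sum>i. \<integral>\<^sup>+x. indicator unit_cube (x - e i) * (indicator unit_cube (x - w) * G x) \<partial>lborel)"
    by (subst nn_integral_suminf[symmetric]) auto
  also have "\<dots> = (\<Sum>i. \<integral>\<^sup>+x. indicator unit_cube x * (indicator unit_cube ((x - w) - (- e i)) * G x) \<partial>lborel)"
  proof (rule suminf_cong)
    fix i
    have "(\<integral>\<^sup>+x. indicator unit_cube (x - e i) * (indicator unit_cube (x - w) * G x) \<partial>lborel) =
        (\<integral>\<^sup>+x. indicator unit_cube ((e i + x) - e i) * (indicator unit_cube ((e i + x) - w) * G (e i + x)) \<partial>lborel)"
      by (rule nn_integral_lborel_shift[symmetric]) measurable
    then show "(\<integral>\<^sup>+x. indicator unit_cube (x - e i) * (indicator unit_cube (x - w) * G x) \<partial>lborel) =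
        (\<integral>\<^sup>+x. indicator unit_cube x * (indicator unit_cube ((x - w) - (- e i)) * G x) \<partial>lborel)"
      using per[OF en] by (simp add: add.commute algebra_simps)
  qed
  also have "\<dots> = (\<integral>\<^sup>+x. (\<Sum>i. indicator unit_cube ((x - w) - (- e i))) * (indicator unit_cube x * G x) \<partial>lborel)"
    by (subst nn_integral_suminf[symmetric]) (auto simp: mult_ac)
  also have "\<dots> = (\<integral>\<^sup>+x. indicator unit_cube x * G x \<partial>lborel)"
    by (simp only: suminf_indicator_unit_cube[OF e'] mult_1)
  finally show ?thesis .
qed

text \<open>One vector \<open>z\<close> is added at a time. If the current \<open>v\<close> is
  orthogonal to it, \<open>v\<close> is replaced by \<open>M v + z\<close>: the product with
  \<open>z\<close> becomes the squared norm of \<open>z\<close>, and each earlier \<open>d\<close>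
  excludes at most one integer \<open>M\<close>.\<close>

lemma separating_int_vector:
  fixes D :: "'a::euclidean_space set"
  assumes "finite D" "D \<subseteq> int_vectors" "0 \<notin> D"
  shows "\<exists>v\<in>int_vectors. \<forall>d\<in>D. d \<bullet> v \<noteq> 0"
  using assms
proof (induction D)
  case empty
  show ?case by (intro bexI[of _ 0]) (auto simp: int_vectors_def)
next
  case (insert z D)
  then obtain v where v: "v \<in> int_vectors" "\<And>d. d \<in> D \<Longrightarrow> d \<bullet> v \<noteq> 0" by auto
  show ?case
  proof (cases "z \<bullet> v = 0")
    case False
    with v show ?thesis by auto
  next
    case True
    have "finite (\<Union>d\<in>D. {M::int. of_int M * (d \<bullet> v) + d \<bullet> z = 0})"
    proof (intro finite_UN_I insert.hyps)
      fix d assume "d \<in> D"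
      then have "{M::int. of_int M * (d \<bullet> v) + d \<bullet> z = 0} \<subseteq> {\<lfloor>- (d \<bullet> z) / (d \<bullet> v)\<rfloor>}"
        using v(2) by (auto simp: field_simps eq_neg_iff_add_eq_0[symmetric])
      then show "finite {M::int. of_int M * (d \<bullet> v) + d \<bullet> z = 0}" by (rule finite_subset) simp
    qed
    then obtain M where M: "M \<notin> (\<Union>d\<in>D. {M::int. of_int M * (d \<bullet> v) + d \<bullet> z = 0})"
      using ex_new_if_finite[OF infinite_UNIV_int] by blast
    have "z \<noteq> 0" "z \<in> int_vectors" using insert.prems by auto
    then show ?thesis
      using v M True
      by (intro bexI[of _ "of_int M *\<^sub>R v + z"] int_vectors_add int_vectors_scaleR) (auto simp: inner_add_right)
  qed
qed

text \<open>From frequencies on a line to arbitrary frequencies: average \<open>P(\<xi> + (\<zeta> \<bullet> b) v)\<close> over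
  \<open>\<zeta>\<close>, where \<open>v\<close> is an integer vector that separates the frequencies of \<open>P\<close>.\<close>

lemma trig_bound_cube:
  fixes b :: "'k::euclidean_space" and S :: "'d::euclidean_space set" and c :: "'d \<Rightarrow> 'x::complex_banach"
  assumes s: "1 < s" and K: "0 \<le> K"
    and L: "\<And>J (x :: int \<Rightarrow> 'x). finite J \<Longrightarrow>
    (\<integral>\<^sup>+\<zeta>. indicator unit_cube \<zeta> * ennreal (norm (\<Sum>j\<in>J. cis (\<sigma> * (2 * pi * (\<zeta> \<bullet> b) * j)) *\<^sub>C x j) powr (s / (s - 1))) \<partial>lborel)
      \<le> ennreal (K * (\<Sum>j\<in>J. norm (x j) powr s) powr (1 / (s - 1)))"
    and \<sigma>: "\<sigma> \<in> {1, - 1}" and S: "finite S" "S \<subseteq> int_vectors"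
  shows "(\<integral>\<^sup>+\<xi>. indicator unit_cube \<xi> * ennreal (norm (\<Sum>n\<in>S. cis (\<sigma> * (2 * pi * (\<xi> \<bullet> n))) *\<^sub>C c n) powr (s / (s - 1))) \<partial>lborel)
      \<le> ennreal (K * (\<Sum>n\<in>S. norm (c n) powr s) powr (1 / (s - 1)))"
proof -
  let ?s' = "s / (s - 1)"
  define P where "P = (\<lambda>\<xi>. \<Sum>n\<in>S. cis (\<sigma> * (2 * pi * (\<xi> \<bullet> n))) *\<^sub>C c n)"
  define G where "G = (\<lambda>\<xi>. ennreal (norm (P \<xi>) powr ?s'))"
  define R where "R = ennreal (K * (\<Sum>n\<in>S. norm (c n) powr s) powr (1 / (s - 1)))"
  have "continuous_on UNIV P" unfolding P_def
    by (intro continuous_on_sum scaleC.continuous_on continuous_intros)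
  then have "(\<lambda>\<xi>. norm (P \<xi>)) \<in> borel_measurable borel"
    by (intro borel_measurable_continuous_onI continuous_intros)
  then have G[measurable]: "G \<in> borel_measurable borel"
    unfolding G_def by (intro measurable_compose[OF _ measurable_ennreal] powr_real_measurable) auto
  have per: "G (x + n) = G x" if "n \<in> int_vectors" for x n
  proof -
    have "cis (\<sigma> * (2 * pi * ((x + n) \<bullet> m))) = cis (\<sigma> * (2 * pi * (x \<bullet> m)))" if "m \<in> S" for m
    proof -
      have "n \<bullet> m \<in> \<int>" using that S \<open>n \<in> int_vectors\<close> by (auto intro: int_vectors_inner)
      then have "\<sigma> * (n \<bullet> m) \<in> \<int>" using \<sigma> by auto
      then have "cis (2 * pi * (\<sigma> * (n \<bullet> m))) = 1"
        by (rule cis_multiple_2pi)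
      then show ?thesis
        by (simp add: inner_add_left distrib_left cis_mult[symmetric] mult_ac)
    qed
    then show ?thesis by (simp add: G_def P_def)
  qed
  have "finite ((\<lambda>(n, m). n - m) ` (S \<times> S) - {0})" using S by auto
  moreover have "(\<lambda>(n, m). n - m) ` (S \<times> S) - {0} \<subseteq> int_vectors"
    using S int_vectors_add[OF _ int_vectors_uminus] by fastforce
  ultimately obtain v where v: "v \<in> int_vectors" "\<And>d. d \<in> (\<lambda>(n, m). n - m) ` (S \<times> S) - {0} \<Longrightarrow> d \<bullet> v \<noteq> 0"
    using separating_int_vector[of "(\<lambda>(n, m). n - m) ` (S \<times> S) - {0}"] by auto
  \<comment> \<open>The frequencies become the distinct integers \<open>n \<bullet> v\<close>; the
    floor changes the type of a number that is already an integer.\<close>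
  define N where "N = (\<lambda>n. \<lfloor>n \<bullet> v\<rfloor>)"
  have N: "real_of_int (N n) = n \<bullet> v" if "n \<in> S" for n
  proof -
    have "n \<bullet> v \<in> \<int>" using int_vectors_inner that S v(1) by blast
    then obtain k where "n \<bullet> v = of_int k" by (rule Ints_cases)
    then show ?thesis by (simp add: N_def)
  qed
  have inj: "inj_on N S"
  proof
    fix n m assume nm: "n \<in> S" "m \<in> S" "N n = N m"
    then have "(n - m) \<bullet> v = 0" using N by (metis inner_diff_left right_minus_eq)
    then show "n = m" using v(2)[of "n - m"] nm by force
  qed
  have avg: "(\<integral>\<^sup>+\<zeta>. indicator unit_cube \<zeta> * G (\<xi> + (\<zeta> \<bullet> b) *\<^sub>R v) \<partial>lborel) \<le> R" for \<xi>
  proof -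
    define x where "x = (\<lambda>j. cis (\<sigma> * (2 * pi * (\<xi> \<bullet> inv_into S N j))) *\<^sub>C c (inv_into S N j))"
    have "P (\<xi> + (\<zeta> \<bullet> b) *\<^sub>R v) = (\<Sum>j\<in>N ` S. cis (\<sigma> * (2 * pi * (\<zeta> \<bullet> b) * j)) *\<^sub>C x j)" for \<zeta>
      unfolding P_def sum.reindex[OF inj] o_def
    proof (rule sum.cong[OF refl])
      fix n assume n: "n \<in> S"
      show "cis (\<sigma> * (2 * pi * ((\<xi> + (\<zeta> \<bullet> b) *\<^sub>R v) \<bullet> n))) *\<^sub>C c n =
          cis (\<sigma> * (2 * pi * (\<zeta> \<bullet> b) * (N n))) *\<^sub>C x (N n)"
        using n inj by (simp add: x_def N scaleC_scaleC cis_mult inner_add_left inner_commute[of v n] algebra_simps)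
    qed
    moreover have "(\<Sum>j\<in>N ` S. norm (x j) powr s) = (\<Sum>n\<in>S. norm (c n) powr s)"
      unfolding sum.reindex[OF inj] using inj by (simp add: x_def norm_scaleC)
    ultimately show ?thesis using L[of "N ` S" x] S by (simp add: G_def R_def)
  qed
  have [measurable]: "(\<lambda>p::'d \<times> 'k. G (fst p + (snd p \<bullet> b) *\<^sub>R v)) \<in> borel_measurable (borel \<Otimes>\<^sub>M borel)"
    by measurable
  \<comment> \<open>Since the cube has measure 1, a second integration over a cube in \<zeta> can be
    inserted for free. Periodicity lets the inner integral be shifted by a vector depending on
    \<zeta>, and after exchanging the integrals the estimate \<open>avg\<close> applies for every
    \<xi>.\<close>
  have shift: "(\<integral>\<^sup>+x. indicator unit_cube x * G (x + w) \<partial>lborel) = (\<integral>\<^sup>+x. indicator unit_cube x * G x \<partial>lborel)" for w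
    by (rule nn_integral_unit_cube_periodic[OF G]) (rule per)
  have "(\<integral>\<^sup>+\<xi>. indicator unit_cube \<xi> * G \<xi> \<partial>lborel) = (\<integral>\<^sup>+\<xi>. indicator unit_cube \<xi> * G \<xi> \<partial>lborel) * emeasure lborel (unit_cube :: 'k set)"
    by (simp add: emeasure_unit_cube)
  also have "\<dots> = (\<integral>\<^sup>+\<zeta>. indicator unit_cube \<zeta> * (\<integral>\<^sup>+\<xi>. indicator unit_cube \<xi> * G (\<xi> + (\<zeta> \<bullet> b) *\<^sub>R v) \<partial>lborel) \<partial>lborel)"
    unfolding shift by (subst nn_integral_multc) (auto simp: mult.commute)
  also have "\<dots> = (\<integral>\<^sup>+\<zeta>. \<integral>\<^sup>+\<xi>. indicator unit_cube \<zeta> * (indicator unit_cube \<xi> * G (\<xi> + (\<zeta> \<bullet> b) *\<^sub>R v)) \<partial>lborel \<partial>lborel)"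
    by (intro nn_integral_cong nn_integral_cmult[symmetric]) measurable
  also have "\<dots> = (\<integral>\<^sup>+\<xi>. \<integral>\<^sup>+\<zeta>. indicator unit_cube \<zeta> * (indicator unit_cube \<xi> * G (\<xi> + (\<zeta> \<bullet> b) *\<^sub>R v)) \<partial>lborel \<partial>lborel)"
    by (rule lborel_pair.Fubini') measurable
  also have "\<dots> = (\<integral>\<^sup>+\<xi>. indicator unit_cube \<xi> * (\<integral>\<^sup>+\<zeta>. indicator unit_cube \<zeta> * G (\<xi> + (\<zeta> \<bullet> b) *\<^sub>R v) \<partial>lborel) \<partial>lborel)"
    by (intro nn_integral_cong, subst nn_integral_cmult[symmetric]) (auto simp: mult_ac)
  also have "\<dots> \<le> (\<integral>\<^sup>+\<xi>. indicator (unit_cube :: 'd set) \<xi> * R \<partial>lborel)"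
    using avg by (intro nn_integral_mono mult_left_mono) auto
  also have "\<dots> = R" by (simp add: nn_integral_multc emeasure_unit_cube)
  finally show ?thesis by (simp add: G_def P_def R_def)
qed

text \<open>Fatou's lemma with bounds that may vary along the sequence; the transforms of
  approximating functions are only known to converge pointwise.\<close>

lemma nn_integral_le_of_tendsto:
  fixes u :: "nat \<Rightarrow> 'a \<Rightarrow> ennreal"
  assumes u: "\<And>n. u n \<in> borel_measurable M" and lim: "AE x in M. (\<lambda>n. u n x) \<longlonglongrightarrow> v x"
    and B: "\<And>n. integral\<^sup>N M (u n) \<le> B n" "B \<longlonglongrightarrow> b"
  shows "integral\<^sup>N M v \<le> b"
proof -
  have "integral\<^sup>N M v = (\<integral>\<^sup>+x. liminf (\<lambda>n. u n x) \<partial>M)"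
    using lim by (intro nn_integral_cong_AE, eventually_elim) (simp add: lim_imp_Liminf)
  also have "\<dots> \<le> liminf (\<lambda>n. integral\<^sup>N M (u n))" by (rule nn_integral_liminf[OF u])
  also have "\<dots> \<le> liminf B" using B(1) by (intro Liminf_mono always_eventually) auto
  also have "\<dots> = b" using B(2) by (intro lim_imp_Liminf) auto
  finally show ?thesis .
qed

section \<open>Dyadic step functions\<close>

lemma nn_integral_lborel_scale:
  fixes F :: "'a::euclidean_space \<Rightarrow> ennreal"
  assumes F[measurable]: "F \<in> borel_measurable borel" and c: "0 < c"
  shows "(\<integral>\<^sup>+x. F (t + c *\<^sub>R x) \<partial>lborel) = ennreal (1 / c ^ DIM('a)) * (\<integral>\<^sup>+x. F x \<partial>lborel)"
proof -
  have "(\<integral>\<^sup>+x. F x \<partial>lborel) = (\<integral>\<^sup>+x. F x \<partial>density (distr lborel borel (\<lambda>x. t + c *\<^sub>R x)) (\<lambda>_. ennreal (\<bar>c\<bar> ^ DIM('a))))"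
    using lborel_affine[of c t] c by simp
  also have "\<dots> = (\<integral>\<^sup>+x. ennreal (c ^ DIM('a)) * F (t + c *\<^sub>R x) \<partial>lborel)"
    using c by (subst nn_integral_density) (auto simp: nn_integral_distr)
  also have "\<dots> = ennreal (c ^ DIM('a)) * (\<integral>\<^sup>+x. F (t + c *\<^sub>R x) \<partial>lborel)"
    by (rule nn_integral_cmult) measurable
  finally have "ennreal (1 / c ^ DIM('a)) * (\<integral>\<^sup>+x. F x \<partial>lborel) =
      (ennreal (1 / c ^ DIM('a)) * ennreal (c ^ DIM('a))) * (\<integral>\<^sup>+x. F (t + c *\<^sub>R x) \<partial>lborel)"
    by (simp add: mult.assoc)
  also have "ennreal (1 / c ^ DIM('a)) * ennreal (c ^ DIM('a)) = 1"
    using c by (simp flip: ennreal_mult)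
  finally show ?thesis by simp
qed

text \<open>The lower corner of the half-open dyadic cube of side \<open>1 / 2 ^ N\<close>
  containing \<open>x\<close>.\<close>

definition dyadic_floor :: "nat \<Rightarrow> 'a::euclidean_space \<Rightarrow> 'a"
  where "dyadic_floor N x = (1 / 2 ^ N) *\<^sub>R floor_vec (2 ^ N *\<^sub>R x)"

text \<open>The integer part of \<open>u\<close> cannot be lost by rounding \<open>p * u\<close>
  down first, since \<open>p * \<lfloor>u\<rfloor>\<close> is itself an integer. This is why the
  dyadic grids are nested.\<close>

lemma floor_divide_floor_mult:
  fixes u :: real
  assumes "0 < (p::int)"
  shows "\<lfloor>real_of_int \<lfloor>of_int p * u\<rfloor> / of_int p\<rfloor> = \<lfloor>u\<rfloor>"
proof (rule floor_unique)
  have "of_int p * of_int \<lfloor>u\<rfloor> \<le> of_int p * u" using assms by (intro mult_left_mono) auto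
  then have "p * \<lfloor>u\<rfloor> \<le> \<lfloor>of_int p * u\<rfloor>" by (simp add: le_floor_iff)
  then have "real_of_int (p * \<lfloor>u\<rfloor>) \<le> of_int \<lfloor>of_int p * u\<rfloor>" by linarith
  then show "of_int \<lfloor>u\<rfloor> \<le> of_int \<lfloor>of_int p * u\<rfloor> / real_of_int p" using assms by (simp add: field_simps)
  have "of_int \<lfloor>of_int p * u\<rfloor> / real_of_int p \<le> u"
    using assms by (simp add: divide_le_eq mult.commute)
  then show "of_int \<lfloor>of_int p * u\<rfloor> / real_of_int p < of_int \<lfloor>u\<rfloor> + 1" by linarith
qed

lemma dyadic_floor_dyadic_floor: "N \<le> M \<Longrightarrow> dyadic_floor N (dyadic_floor M x) = dyadic_floor N x"
proof -
  assume NM: "N \<le> M"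
  have "\<lfloor>(2 ^ N *\<^sub>R dyadic_floor M x) \<bullet> i\<rfloor> = \<lfloor>(2 ^ N *\<^sub>R x) \<bullet> i\<rfloor>" if i: "i \<in> Basis" for i
  proof -
    have M: "2 ^ M = (2 ^ (M - N) * 2 ^ N :: real)" using NM by (simp flip: power_add)
    have "(2 ^ N *\<^sub>R dyadic_floor M x) \<bullet> i = of_int \<lfloor>of_int (2 ^ (M - N)) * (2 ^ N * (x \<bullet> i))\<rfloor> / of_int (2 ^ (M - N))"
      using i by (simp add: dyadic_floor_def floor_vec_inner M mult.assoc)
    then show ?thesis
      using floor_divide_floor_mult[of "2 ^ (M - N)" "2 ^ N * (x \<bullet> i)"] by simp
  qed
  then have "floor_vec (2 ^ N *\<^sub>R dyadic_floor M x) = floor_vec (2 ^ N *\<^sub>R x)" by (simp add: euclidean_eq_iff[where 'a='a] floor_vec_inner)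
  then show ?thesis by (simp add: dyadic_floor_def)
qed

lemma dyadic_floor_dist: "norm (dyadic_floor N x - x) \<le> real DIM('a) / 2 ^ N" for x :: "'a::euclidean_space"
proof -
  have "norm (dyadic_floor N x - x) \<le> (\<Sum>i\<in>Basis. \<bar>(dyadic_floor N x - x) \<bullet> i\<bar>)" by (rule norm_le_l1)
  also have "\<dots> \<le> (\<Sum>i\<in>(Basis::'a set). 1 / 2 ^ N)"
  proof (rule sum_mono)
    fix i :: 'a assume i: "i \<in> Basis"
    have "(dyadic_floor N x - x) \<bullet> i = (of_int \<lfloor>2 ^ N * (x \<bullet> i)\<rfloor> - 2 ^ N * (x \<bullet> i)) / 2 ^ N"
      using i by (simp add: dyadic_floor_def inner_diff_left floor_vec_inner diff_divide_distrib)
    moreover have "\<bar>of_int \<lfloor>2 ^ N * (x \<bullet> i)\<rfloor> - 2 ^ N * (x \<bullet> i)\<bar> \<le> 1" by linarith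
    ultimately show "\<bar>(dyadic_floor N x - x) \<bullet> i\<bar> \<le> 1 / 2 ^ N" by (simp add: abs_divide divide_right_mono)
  qed
  finally show ?thesis by simp
qed

text \<open>Constancy on the cubes of a level is expressed as invariance under
  \<open>dyadic_floor\<close>, so that refining the level, for instance in a sum of two such
  functions, is one use of \<open>dyadic_floor_dyadic_floor\<close>. Bounded support leaves finitely
  many cubes.\<close>

definition dyadic :: "('a::euclidean_space \<Rightarrow> 'b::zero) set"
  where "dyadic = {f. \<exists>N R. (\<forall>x. f (dyadic_floor N x) = f x) \<and> (\<forall>x. f x \<noteq> 0 \<longrightarrow> norm x \<le> R)}"

lemma dyadic_level_mono: "(\<forall>x. f (dyadic_floor N x) = f x) \<Longrightarrow> N \<le> M \<Longrightarrow> f (dyadic_floor M x) = f x"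
  by (metis dyadic_floor_dyadic_floor)

lemma dyadic_add:
  fixes f g :: "'a::euclidean_space \<Rightarrow> 'b::real_normed_vector"
  assumes "f \<in> dyadic" "g \<in> dyadic"
  shows "(\<lambda>x. f x + g x) \<in> dyadic"
proof -
  obtain N R where N: "\<forall>x. f (dyadic_floor N x) = f x" "\<And>x. f x \<noteq> 0 \<Longrightarrow> norm x \<le> R"
    using assms(1) unfolding dyadic_def by blast
  obtain M Q where M: "\<forall>x. g (dyadic_floor M x) = g x" "\<And>x. g x \<noteq> 0 \<Longrightarrow> norm x \<le> Q"
    using assms(2) unfolding dyadic_def by blast
  have "f (dyadic_floor (max N M) x) + g (dyadic_floor (max N M) x) = f x + g x" for x
    using dyadic_level_mono[OF N(1), of "max N M" x] dyadic_level_mono[OF M(1), of "max N M" x] by simp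
  moreover have "norm x \<le> max R Q" if "f x + g x \<noteq> 0" for x
    using N(2)[of x] M(2)[of x] that by (cases "f x = 0") (auto simp: le_max_iff_disj)
  ultimately show ?thesis unfolding dyadic_def by blast
qed

definition dyadic_cube :: "nat \<Rightarrow> 'a::euclidean_space set"
  where "dyadic_cube N = {x. 2 ^ N *\<^sub>R x \<in> unit_cube}"

lemma dyadic_cube_borel: "dyadic_cube N \<in> sets (borel :: 'a::euclidean_space measure)"
proof -
  have "(\<lambda>x::'a. 2 ^ N *\<^sub>R x) \<in> borel_measurable borel" by simp
  from measurable_sets[OF this borel_unit_cube] show ?thesis by (simp add: dyadic_cube_def vimage_def)
qed

lemma emeasure_dyadic_cube: "emeasure lborel (dyadic_cube N :: 'a::euclidean_space set) = ennreal ((1 / 2 ^ N) ^ DIM('a))"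
proof -
  have "emeasure lborel (dyadic_cube N :: 'a set) = (\<integral>\<^sup>+x. indicator (dyadic_cube N :: 'a set) x \<partial>lborel)"
    using dyadic_cube_borel[of N] by (subst nn_integral_indicator) simp_all
  also have "\<dots> = (\<integral>\<^sup>+x. indicator unit_cube (0 + 2 ^ N *\<^sub>R (x :: 'a)) \<partial>lborel)"
    by (intro nn_integral_cong) (simp add: dyadic_cube_def indicator_def)
  also have "\<dots> = ennreal (1 / (2 ^ N) ^ DIM('a))"
    by (subst nn_integral_lborel_scale) (auto simp: emeasure_unit_cube)
  finally show ?thesis by (simp add: power_divide)
qed

lemma dyadic_step:
  fixes f :: "'a::euclidean_space \<Rightarrow> 'b::real_normed_vector"
  assumes N: "\<forall>x. f (dyadic_floor N x) = f x" and R: "\<And>x. f x \<noteq> 0 \<Longrightarrow> norm x \<le> R"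
  obtains S where "finite S" "S \<subseteq> int_vectors" "f = step (dyadic_cube N) S (\<lambda>n. (1 / 2 ^ N) *\<^sub>R n) (\<lambda>n. f ((1 / 2 ^ N) *\<^sub>R n))"
proof -
  \<comment> \<open>The lattice points whose cube may carry a nonzero value; those that do not
    simply get coefficient 0.\<close>
  define S where "S = int_vectors \<inter> {x::'a. norm x \<le> 2 ^ N * R}"
  have S: "finite S" "S \<subseteq> int_vectors" using finite_int_vectors_bounded by (auto simp: S_def)
  have mem: "x - (1 / 2 ^ N) *\<^sub>R n \<in> dyadic_cube N \<longleftrightarrow> n = floor_vec (2 ^ N *\<^sub>R x)" if "n \<in> S" for x n
    using sub_mem_unit_cube_iff[of n "2 ^ N *\<^sub>R x"] that S by (auto simp: dyadic_cube_def scaleR_diff_right)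
  have "f x = step (dyadic_cube N) S (\<lambda>n. (1 / 2 ^ N) *\<^sub>R n) (\<lambda>n. f ((1 / 2 ^ N) *\<^sub>R n)) x" for x
  proof -
    let ?n = "floor_vec (2 ^ N *\<^sub>R x)"
    have "step (dyadic_cube N) S (\<lambda>n. (1 / 2 ^ N) *\<^sub>R n) (\<lambda>n. f ((1 / 2 ^ N) *\<^sub>R n)) x = (\<Sum>n\<in>S. if n = ?n then f (dyadic_floor N x) else 0)"
      unfolding step_def by (intro sum.cong refl) (auto simp: mem dyadic_floor_def)
    also have "\<dots> = (if ?n \<in> S then f x else 0)"
      using S(1) N by (simp add: sum.delta')
    also have "\<dots> = f x"
    proof (cases "f x = 0")
      case False
      then have "norm (dyadic_floor N x) \<le> R" using R[of "dyadic_floor N x"] N by simp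
      then have "?n \<in> S" by (simp add: S_def floor_vec_int_vectors dyadic_floor_def field_simps)
      then show ?thesis by simp
    qed simp
    finally show ?thesis ..
  qed
  then show ?thesis by (intro that[OF S]) (rule ext)
qed

text \<open>On the cube of side \<open>2 ^ N\<close> the transform of a step function of level \<open>N\<close> is controlled by
  one period of a trigonometric sum. A step function is one of every higher level, and the
  bound does not depend on the level.\<close>

lemma dyadic_fourier_bound:
  fixes f :: "'d::euclidean_space \<Rightarrow> 'x::complex_banach"
  assumes s: "1 < s" and K: "0 \<le> K"
    and L: "\<And>(S :: 'd set) (c :: 'd \<Rightarrow> 'x). finite S \<Longrightarrow> S \<subseteq> int_vectors \<Longrightarrow>
      (\<integral>\<^sup>+\<xi>. indicator unit_cube \<xi> * ennreal (norm (\<Sum>n\<in>S. cis (\<sigma> * (2 * pi * (\<xi> \<bullet> n))) *\<^sub>C c n) powr (s / (s - 1))) \<partial>lborel)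
      \<le> ennreal (K * (\<Sum>n\<in>S. norm (c n) powr s) powr (1 / (s - 1)))"
    and f: "f \<in> dyadic"
  shows "sintegrable f" "(\<integral>\<^sup>+x. ennreal (norm (f x) powr s) \<partial>lebesgue) < \<infinity>"
    "0 \<le> M \<Longrightarrow> (\<integral>\<^sup>+x. ennreal (norm (f x) powr s) \<partial>lebesgue) \<le> ennreal M \<Longrightarrow>
      (\<integral>\<^sup>+x. ennreal (norm (sfourier \<sigma> f x) powr (s / (s - 1))) \<partial>lebesgue) \<le> ennreal (K * M powr (1 / (s - 1)))"
proof -
  let ?s' = "s / (s - 1)"
  have s': "1 \<le> ?s'" "?s' - 1 = 1 / (s - 1)" using s by (simp_all add: field_simps)
  obtain N0 R where N0: "\<forall>x. f (dyadic_floor N0 x) = f x" and R: "\<And>x. f x \<noteq> 0 \<Longrightarrow> norm x \<le> R"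
    using f unfolding dyadic_def by blast
  \<comment> \<open>The shift by half the diagonal centres the cubes: \<open>C N\<close> is the
    half-open cube of side \<open>2 ^ N\<close> around 0, so these cubes exhaust the space.\<close>
  define w where "w = (1 / 2) *\<^sub>R (One :: 'd)"
  define C where "C = (\<lambda>N. {\<xi>::'d. w + (1 / 2 ^ N) *\<^sub>R \<xi> \<in> unit_cube})"
  have level: "sintegrable f \<and> (\<integral>\<^sup>+x. ennreal (norm (f x) powr s) \<partial>lebesgue) < \<infinity> \<and>
    (0 \<le> M \<longrightarrow> (\<integral>\<^sup>+x. ennreal (norm (f x) powr s) \<partial>lebesgue) \<le> ennreal M \<longrightarrow>
      (\<integral>\<^sup>+\<xi>. indicator (C N) \<xi> * ennreal (norm (sfourier \<sigma> f \<xi>) powr ?s') \<partial>lborel) \<le> ennreal (K * M powr (1 / (s - 1))))"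
    if N: "N0 \<le> N" for N M
  proof -
    have inv: "\<forall>x. f (dyadic_floor N x) = f x" using dyadic_level_mono[OF N0 N] by blast
    define c where "c = (\<lambda>n. f ((1 / 2 ^ N) *\<^sub>R n))"
    obtain S where S: "finite S" "S \<subseteq> int_vectors" and fs: "f = step (dyadic_cube N) S (\<lambda>n. (1 / 2 ^ N) *\<^sub>R n) c"
      unfolding c_def using dyadic_step[OF inv R] by blast
    define m where "m = (1 / 2 ^ N :: real) ^ DIM('d)"
    have m: "0 < m" by (simp add: m_def)
    have B: "(dyadic_cube N :: 'd set) \<in> sets borel" "emeasure lborel (dyadic_cube N :: 'd set) < \<infinity>"
      by (simp_all add: dyadic_cube_borel emeasure_dyadic_cube)
    have mm: "measure lborel (dyadic_cube N :: 'd set) = m"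
      by (simp add: measure_def emeasure_dyadic_cube m_def)
    have dj: "n = k" if "n \<in> S" "k \<in> S" "t - (1 / 2 ^ N) *\<^sub>R n \<in> dyadic_cube N" "t - (1 / 2 ^ N) *\<^sub>R k \<in> dyadic_cube N" for n k t
      using sub_mem_unit_cube_iff[of n "2 ^ N *\<^sub>R t"] sub_mem_unit_cube_iff[of k "2 ^ N *\<^sub>R t"] that S
      by (auto simp: dyadic_cube_def scaleR_diff_right)
    define P where "P = (\<lambda>y. \<Sum>n\<in>S. cis (\<sigma> * (2 * pi * (y \<bullet> n))) *\<^sub>C c n)"
    have sp: "sintegrable f"
      "\<And>\<xi>. sfourier \<sigma> f \<xi> = sfourier \<sigma> (indicator (dyadic_cube N)) \<xi> *\<^sub>C P ((1 / 2 ^ N) *\<^sub>R \<xi>)"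
      "(\<integral>\<^sup>+t. ennreal (norm (f t) powr s) \<partial>lebesgue) = ennreal (m * (\<Sum>n\<in>S. norm (c n) powr s))"
      unfolding fs P_def
      using step_props[OF B S(1), where \<tau>="\<lambda>n. (1 / 2 ^ N) *\<^sub>R n" and c=c] dj s
      by (auto simp: mm)
    have S0: "0 \<le> (\<Sum>n\<in>S. norm (c n) powr s)" by (intro sum_nonneg) auto
    have u: "norm (sfourier \<sigma> (indicator (dyadic_cube N)) \<xi> :: complex) \<le> m" for \<xi> :: 'd
    proof -
      have "ennreal (norm (sfourier \<sigma> (indicator (dyadic_cube N)) \<xi> :: complex)) \<le> (\<integral>\<^sup>+x. ennreal (norm (indicator (dyadic_cube N :: 'd set) x :: complex)) \<partial>lebesgue)"
        using indicator_shift_integrable(2)[OF B, of 0] by (intro sfourier_norm_le sintegrableD(1)) simp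
      also have "\<dots> = (\<integral>\<^sup>+x. indicator (dyadic_cube N :: 'd set) x \<partial>lborel)"
        unfolding nn_integral_completion by (intro nn_integral_cong) (auto simp: indicator_def)
      also have "\<dots> = ennreal m" using B(1) by (simp add: emeasure_dyadic_cube m_def)
      finally show ?thesis using m by simp
    qed
    define F where "F = (\<lambda>y. indicator unit_cube y * ennreal (norm (P (y - w)) powr ?s'))"
    have "continuous_on UNIV (\<lambda>y. norm (P (y - w)))" unfolding P_def
      by (intro continuous_on_norm continuous_on_sum scaleC.continuous_on continuous_intros)
    then have "(\<lambda>y. norm (P (y - w))) \<in> borel_measurable borel" by (rule borel_measurable_continuous_onI)
    then have F: "F \<in> borel_measurable borel" unfolding F_def
      by (intro borel_measurable_times_ennreal borel_measurable_indicator borel_unit_cube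
          measurable_compose[OF _ measurable_ennreal] powr_real_measurable) auto
    have "(\<integral>\<^sup>+\<xi>. indicator (C N) \<xi> * ennreal (norm (sfourier \<sigma> f \<xi>) powr ?s') \<partial>lborel) \<le> ennreal (K * M powr (1 / (s - 1)))"
      if M: "0 \<le> M" "(\<integral>\<^sup>+x. ennreal (norm (f x) powr s) \<partial>lebesgue) \<le> ennreal M"
    proof -
      have "(\<integral>\<^sup>+\<xi>. indicator (C N) \<xi> * ennreal (norm (sfourier \<sigma> f \<xi>) powr ?s') \<partial>lborel) \<le>
          (\<integral>\<^sup>+\<xi>. ennreal (m powr ?s') * F (w + (1 / 2 ^ N) *\<^sub>R \<xi>) \<partial>lborel)"
      proof (rule nn_integral_mono)
        fix \<xi> :: 'd
        have "norm (sfourier \<sigma> f \<xi>) \<le> m * norm (P ((1 / 2 ^ N) *\<^sub>R \<xi>))"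
          unfolding sp(2) norm_scaleC using u by (intro mult_right_mono) auto
        then have "norm (sfourier \<sigma> f \<xi>) powr ?s' \<le> (m * norm (P ((1 / 2 ^ N) *\<^sub>R \<xi>))) powr ?s'"
          using s' by (intro powr_mono2) auto
        also have "\<dots> = m powr ?s' * norm (P ((1 / 2 ^ N) *\<^sub>R \<xi>)) powr ?s'" by (rule powr_mult)
        finally show "indicator (C N) \<xi> * ennreal (norm (sfourier \<sigma> f \<xi>) powr ?s') \<le> ennreal (m powr ?s') * F (w + (1 / 2 ^ N) *\<^sub>R \<xi>)"
          by (cases "\<xi> \<in> C N") (auto simp: C_def F_def ennreal_mult[symmetric] intro!: ennreal_leI)
      qed
      also have "\<dots> = ennreal (m powr ?s') * (\<integral>\<^sup>+\<xi>. F (w + (1 / 2 ^ N) *\<^sub>R \<xi>) \<partial>lborel)"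
        by (intro nn_integral_cmult measurable_compose[OF _ F, where M=lborel]) simp
      also have "(\<integral>\<^sup>+\<xi>. F (w + (1 / 2 ^ N) *\<^sub>R \<xi>) \<partial>lborel) = ennreal (1 / m) * (\<integral>\<^sup>+y. F y \<partial>lborel)"
        unfolding m_def by (rule nn_integral_lborel_scale[OF F]) simp
      also have "(\<integral>\<^sup>+y. F y \<partial>lborel) \<le> ennreal (K * (\<Sum>n\<in>S. norm (c n) powr s) powr (1 / (s - 1)))"
      proof -
        \<comment> \<open>The shift by \<open>w\<close> multiplies the coefficients by numbers of
          modulus 1, which the bound for trigonometric sums does not see.\<close>
        have "P (y - w) = (\<Sum>n\<in>S. cis (\<sigma> * (2 * pi * (y \<bullet> n))) *\<^sub>C cis (- (\<sigma> * (2 * pi * (w \<bullet> n)))) *\<^sub>C c n)" for y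
          unfolding P_def by (intro sum.cong refl) (simp add: scaleC_scaleC cis_mult inner_diff_left algebra_simps)
        then show ?thesis
          using L[OF S, of "\<lambda>n. cis (- (\<sigma> * (2 * pi * (w \<bullet> n)))) *\<^sub>C c n"] by (simp add: F_def norm_scaleC)
      qed
      \<comment> \<open>The measure \<open>m\<close> of a cube enters as \<open>m powr ?s'\<close>
        from its transform and as \<open>1 / m\<close> from rescaling. Together this is
        \<open>m powr (1 / (s - 1))\<close>, exactly what turns the sum of coefficients back into
        the \<open>L^s\<close> integral of \<open>f\<close>; hence the bound is independent of
        \<open>N\<close>.\<close>
      also have "ennreal (m powr ?s') * (ennreal (1 / m) * ennreal (K * (\<Sum>n\<in>S. norm (c n) powr s) powr (1 / (s - 1)))) =
          ennreal (K * (m powr (?s' - 1) * (\<Sum>n\<in>S. norm (c n) powr s) powr (1 / (s - 1))))"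
        using m K by (simp add: ennreal_mult[symmetric] powr_diff mult_ac)
      also have "m powr (?s' - 1) * (\<Sum>n\<in>S. norm (c n) powr s) powr (1 / (s - 1)) =
          (m * (\<Sum>n\<in>S. norm (c n) powr s)) powr (1 / (s - 1))"
        unfolding s'(2) by (rule powr_mult[symmetric])
      also have "ennreal (K * (m * (\<Sum>n\<in>S. norm (c n) powr s)) powr (1 / (s - 1))) \<le> ennreal (K * M powr (1 / (s - 1)))"
        using M sp(3) K m S0 s by (intro ennreal_leI mult_left_mono powr_mono2) auto
      finally show ?thesis by (simp add: mult_left_mono)
    qed
    then show ?thesis using sp by auto
  qed
  from level[of N0] show fi: "sintegrable f" and "(\<integral>\<^sup>+x. ennreal (norm (f x) powr s) \<partial>lebesgue) < \<infinity>" by auto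
  assume M: "0 \<le> M" "(\<integral>\<^sup>+x. ennreal (norm (f x) powr s) \<partial>lebesgue) \<le> ennreal M"
  have Cm: "C N \<in> sets borel" for N
  proof -
    have "(\<lambda>\<xi>. w + (1 / 2 ^ N) *\<^sub>R \<xi>) \<in> borel_measurable borel" by simp
    from measurable_sets[OF this borel_unit_cube] show ?thesis by (simp add: C_def vimage_def)
  qed
  have "(\<lambda>\<xi>. norm (sfourier \<sigma> f \<xi>)) \<in> borel_measurable borel"
    by (intro borel_measurable_continuous_onI continuous_on_norm sfourier_continuous fi)
  then have fm: "(\<lambda>\<xi>. ennreal (norm (sfourier \<sigma> f \<xi>) powr ?s')) \<in> borel_measurable borel"
    by (intro measurable_compose[OF _ measurable_ennreal] powr_real_measurable) auto
  have "(\<integral>\<^sup>+\<xi>. ennreal (norm (sfourier \<sigma> f \<xi>) powr ?s') \<partial>lborel) \<le> ennreal (K * M powr (1 / (s - 1)))"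
  proof (rule nn_integral_le_of_tendsto)
    show "(\<lambda>\<xi>. indicator (C (N0 + n)) \<xi> * ennreal (norm (sfourier \<sigma> f \<xi>) powr ?s')) \<in> borel_measurable lborel" for n
      using fm Cm[of "N0 + n"] by simp
    show "(\<integral>\<^sup>+\<xi>. indicator (C (N0 + n)) \<xi> * ennreal (norm (sfourier \<sigma> f \<xi>) powr ?s') \<partial>lborel) \<le> ennreal (K * M powr (1 / (s - 1)))" for n
      using level[of "N0 + n" M] M by simp
    show "AE \<xi> in lborel. (\<lambda>n. indicator (C (N0 + n)) \<xi> * ennreal (norm (sfourier \<sigma> f \<xi>) powr ?s')) \<longlonglongrightarrow> ennreal (norm (sfourier \<sigma> f \<xi>) powr ?s')"
    proof (rule AE_I2)
      fix \<xi> :: 'd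
      obtain n0 :: nat where n0: "2 * norm \<xi> < real n0" using reals_Archimedean2 by blast
      have "\<xi> \<in> C (N0 + n)" if "n0 \<le> n" for n
      proof -
        have "n \<le> N0 + n" by simp
        also have "N0 + n < 2 ^ (N0 + n)" by (rule less_exp)
        finally have "real n < real (2 ^ (N0 + n))" by (simp only: of_nat_less_iff)
        then have "real n < 2 ^ (N0 + n)" unfolding of_nat_power of_nat_numeral .
        moreover have "real n0 \<le> real n" using that by simp
        ultimately have *: "2 * norm \<xi> < 2 ^ (N0 + n)" using n0 by linarith
        show ?thesis
          unfolding C_def unit_cube_def
        proof (intro CollectI ballI)
          fix i :: 'd assume i: "i \<in> Basis"
          have "\<bar>\<xi> \<bullet> i\<bar> < 2 ^ (N0 + n) / 2" using Basis_le_norm[OF i, of \<xi>] * by simp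
          then have "\<bar>(\<xi> \<bullet> i) / 2 ^ (N0 + n)\<bar> < 1 / 2" by (simp add: abs_divide field_simps)
          then have "- (1 / 2) < (\<xi> \<bullet> i) / 2 ^ (N0 + n) \<and> (\<xi> \<bullet> i) / 2 ^ (N0 + n) < 1 / 2"
            unfolding abs_less_iff by linarith
          moreover have "(w + (1 / 2 ^ (N0 + n)) *\<^sub>R \<xi>) \<bullet> i = 1 / 2 + (\<xi> \<bullet> i) / 2 ^ (N0 + n)"
            using i by (simp add: w_def inner_add_left One_inner)
          ultimately show "0 \<le> (w + (1 / 2 ^ (N0 + n)) *\<^sub>R \<xi>) \<bullet> i \<and> (w + (1 / 2 ^ (N0 + n)) *\<^sub>R \<xi>) \<bullet> i < 1"
            by linarith
        qed
      qed
      then show "(\<lambda>n. indicator (C (N0 + n)) \<xi> * ennreal (norm (sfourier \<sigma> f \<xi>) powr ?s')) \<longlonglongrightarrow> ennreal (norm (sfourier \<sigma> f \<xi>) powr ?s')"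
        by (intro tendsto_eventually eventually_sequentiallyI[of n0]) simp
    qed
  qed auto
  then show "(\<integral>\<^sup>+x. ennreal (norm (sfourier \<sigma> f x) powr ?s') \<partial>lebesgue) \<le> ennreal (K * M powr (1 / (s - 1)))"
    by (simp add: nn_integral_completion)
qed

section \<open>Density of dyadic functions and the bound for general functions\<close>

lemma dyadic_sintegrable:
  fixes f :: "'d::euclidean_space \<Rightarrow> 'x::complex_banach"
  assumes "f \<in> dyadic"
  shows "sintegrable f"
proof -
  obtain N R where N: "\<forall>x. f (dyadic_floor N x) = f x" "\<And>x. f x \<noteq> 0 \<Longrightarrow> norm x \<le> R"
    using assms unfolding dyadic_def by blast
  obtain S where S: "finite S" "S \<subseteq> int_vectors" "f = step (dyadic_cube N) S (\<lambda>n. (1 / 2 ^ N) *\<^sub>R n) (\<lambda>n. f ((1 / 2 ^ N) *\<^sub>R n))"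
    using dyadic_step[OF N] by blast
  have "sintegrable (\<lambda>t. \<Sum>n\<in>S. (indicator (dyadic_cube N) (t - (1 / 2 ^ N) *\<^sub>R n) :: complex) *\<^sub>C f ((1 / 2 ^ N) *\<^sub>R n))"
    by (intro sintegrable_sum sintegrable_bounded_linear[OF scaleC.bounded_linear_left]
        indicator_shift_integrable(2) dyadic_cube_borel) (simp add: emeasure_dyadic_cube)
  then show ?thesis by (subst S(3)) (simp add: step_def[abs_def] indicator_scaleR_scaleC)
qed

lemma tendsto_dyadic_floor: "(\<lambda>n. dyadic_floor n x) \<longlonglongrightarrow> x" for x :: "'a::euclidean_space"
proof -
  have "(\<lambda>n. real DIM('a) * (1 / 2) ^ n) \<longlonglongrightarrow> real DIM('a) * 0"
    by (intro tendsto_mult tendsto_const LIMSEQ_power_zero) simp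
  then have lim: "(\<lambda>n. real DIM('a) * (1 / 2) ^ n) \<longlonglongrightarrow> 0" by simp
  have "norm (dyadic_floor n x - x) \<le> real DIM('a) * (1 / 2) ^ n" for n
    using dyadic_floor_dist[of n x] by (simp add: power_divide)
  from Lim_null_comparison[OF always_eventually[OF allI[OF this]] lim]
  have "(\<lambda>n. dyadic_floor n x - x) \<longlonglongrightarrow> 0" .
  then show ?thesis by (simp add: LIM_zero_iff)
qed

text \<open>The approximants sample the indicator of the box at the corners of the dyadic cubes. Off
  the boundary of the box they are eventually equal to it, and their supports stay in a common
  ball.\<close>

lemma dyadic_dense:
  fixes f :: "'d::euclidean_space \<Rightarrow> 'x::complex_banach"
  assumes s: "1 \<le> s" and f: "strongly_measurable lebesgue f" "L1_Lp_gauge s f < \<infinity>"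
  shows "\<exists>g. (\<forall>n::nat. g n \<in> dyadic) \<and> (\<lambda>n. L1_Lp_gauge s (\<lambda>x. g n x - f x)) \<longlonglongrightarrow> 0"
proof (rule L1_Lp_gauge_dense[OF s f])
  show "strongly_measurable lebesgue u" if "u \<in> dyadic" for u :: "'d \<Rightarrow> 'x"
    by (rule sintegrableD(1)[OF dyadic_sintegrable[OF that]])
  show "(\<lambda>x. u x + v x) \<in> dyadic" if "u \<in> dyadic" "v \<in> dyadic" for u v :: "'d \<Rightarrow> 'x"
    using that by (rule dyadic_add)
  fix a b :: 'd and v :: 'x
  define g where "g = (\<lambda>n x. indicator (box a b) (dyadic_floor n x) *\<^sub>R v)"
  obtain R where R: "\<And>x. x \<in> box a b \<Longrightarrow> norm x \<le> R"
    using bounded_box[of a b] by (auto simp: bounded_iff)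
  have bd: "norm x \<le> R + real DIM('d)" if "dyadic_floor n x \<in> box a b" for n x
  proof -
    have "real DIM('d) / 2 ^ n \<le> real DIM('d) / 1" by (intro divide_left_mono) auto
    with R[OF that] dyadic_floor_dist[of n x] norm_triangle_sub[of x "dyadic_floor n x"] show ?thesis
      by (simp add: norm_minus_commute)
  qed
  have gd: "g n \<in> dyadic" for n
    unfolding dyadic_def g_def
    by (intro CollectI exI[of _ n] exI[of _ "R + real DIM('d)"]) (auto simp: dyadic_floor_dyadic_floor bd indicator_def)
  let ?B = "cball 0 (R + real DIM('d)) :: 'd set"
  have "cbox a b - box a b \<in> null_sets lebesgue"
    using negligible_frontier_interval[of a b] by (simp add: negligible_iff_null_sets)
  then have "AE x in lebesgue. x \<notin> cbox a b - box a b" by (rule AE_not_in)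
  then have lim: "AE x in lebesgue. (\<lambda>n. g n x) \<longlonglongrightarrow> indicator (box a b) x *\<^sub>R v"
  proof eventually_elim
    case (elim x)
    have "eventually (\<lambda>n. (dyadic_floor n x \<in> box a b) = (x \<in> box a b)) sequentially"
    proof (cases "x \<in> box a b")
      case True
      then show ?thesis using topological_tendstoD[OF tendsto_dyadic_floor open_box True] by simp
    next
      case False
      with elim have "x \<in> - cbox a b" by simp
      from topological_tendstoD[OF tendsto_dyadic_floor open_Compl[OF closed_cbox] this] have "eventually (\<lambda>n. dyadic_floor n x \<in> - cbox a b) sequentially"
        by simp
      then show ?thesis using False box_subset_cbox[of a b] by (auto elim!: eventually_mono)
    qed
    then show ?case
      unfolding g_def by (intro tendsto_eventually) (auto elim!: eventually_mono simp: indicator_def)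
  qed
  have "(\<lambda>n. L1_Lp_gauge s (\<lambda>x. g n x - indicator (box a b) x *\<^sub>R v)) \<longlonglongrightarrow> 0"
  proof (rule L1_Lp_gauge_dominated(4)[OF s _ lim])
    show "strongly_measurable lebesgue (g n)" for n
      by (rule sintegrableD(1)[OF dyadic_sintegrable[OF gd]])
    show "AE x in lebesgue. norm (g n x) \<le> norm v * indicator ?B x" for n
      using bd by (intro AE_I2) (auto simp: g_def indicator_def)
    show "(\<lambda>x. norm v * indicator ?B x) \<in> borel_measurable lebesgue"
      by (intro borel_measurable_times borel_measurable_const borel_measurable_indicator fmeasurableD lmeasurable_cball)
    show "(\<integral>\<^sup>+x. ennreal (norm v * indicator ?B x + (norm v * indicator ?B x) powr s) \<partial>lebesgue) < \<infinity>"
      using lmeasurable_cball[of 0 "R + real DIM('d)"]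
      by (intro L1_Lp_gauge_indicator_finite) (auto simp: fmeasurable_def)
  qed
  then show "\<exists>g. (\<forall>n::nat. g n \<in> dyadic) \<and> (\<lambda>n. L1_Lp_gauge s (\<lambda>x. g n x - indicator (box a b) x *\<^sub>R v)) \<longlonglongrightarrow> 0"
    using gd by blast
qed

text \<open>Restricted to functions in both \<open>L^1\<close> and \<open>L^s\<close>, where the
  transform is an integral. Both signs are included because the multiplier needs the transform on
  one space and its inverse on the other. Powers of norms with a real majorant \<open>M\<close>
  avoid roots of extended reals.\<close>

definition fourier_bounded :: "'d::euclidean_space itself \<Rightarrow> 'x::complex_banach itself \<Rightarrow> real \<Rightarrow> real \<Rightarrow> bool"
  where "fourier_bounded _ _ s K \<longleftrightarrow> (\<forall>\<sigma>\<in>{1, - 1}. \<forall>(f :: 'd \<Rightarrow> 'x) M.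
    strongly_measurable lebesgue f \<longrightarrow> L1_Lp_gauge s f < \<infinity> \<longrightarrow> 0 \<le> M \<longrightarrow>
    (\<integral>\<^sup>+x. ennreal (norm (f x) powr s) \<partial>lebesgue) \<le> ennreal M \<longrightarrow>
    (\<integral>\<^sup>+x. ennreal (norm (sfourier \<sigma> f x) powr (s / (s - 1))) \<partial>lebesgue) \<le> ennreal (K * M powr (1 / (s - 1))))"

lemma fourier_boundedD:
  assumes "fourier_bounded TYPE('d::euclidean_space) TYPE('x::complex_banach) s K" "\<sigma> \<in> {1, - 1}"
    "strongly_measurable lebesgue (f :: 'd \<Rightarrow> 'x)" "L1_Lp_gauge s f < \<infinity>" "0 \<le> M"
    "(\<integral>\<^sup>+x. ennreal (norm (f x) powr s) \<partial>lebesgue) \<le> ennreal M"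
  shows "(\<integral>\<^sup>+x. ennreal (norm (sfourier \<sigma> f x) powr (s / (s - 1))) \<partial>lebesgue) \<le> ennreal (K * M powr (1 / (s - 1)))"
  using assms unfolding fourier_bounded_def by blast

lemma nn_integral_powr_add_le:
  fixes f g :: "'a::euclidean_space \<Rightarrow> 'b::real_normed_vector"
  assumes "strongly_measurable lebesgue f" "strongly_measurable lebesgue g" "s > 0"
  shows "(\<integral>\<^sup>+x. ennreal (norm (f x + g x) powr s) \<partial>lebesgue) \<le>
    ennreal (2 powr s) * ((\<integral>\<^sup>+x. ennreal (norm (f x) powr s) \<partial>lebesgue) + (\<integral>\<^sup>+x. ennreal (norm (g x) powr s) \<partial>lebesgue))"
proof -
  have m: "(\<lambda>x. ennreal (norm (h x) powr s)) \<in> borel_measurable lebesgue" if "strongly_measurable lebesgue h" for h :: "'a \<Rightarrow> 'b"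
    using strongly_measurable_norm[OF that] by (intro measurable_compose[OF _ measurable_ennreal] powr_real_measurable) auto
  have "(\<integral>\<^sup>+x. ennreal (norm (f x + g x) powr s) \<partial>lebesgue) \<le>
      (\<integral>\<^sup>+x. ennreal (2 powr s) * (ennreal (norm (f x) powr s) + ennreal (norm (g x) powr s)) \<partial>lebesgue)"
  proof (rule nn_integral_mono)
    fix x
    have "norm (f x + g x) powr s \<le> (norm (f x) + norm (g x)) powr s"
      using assms by (intro powr_mono2 norm_triangle_ineq) auto
    also have "\<dots> \<le> 2 powr s * (norm (f x) powr s + norm (g x) powr s)"
      using assms by (intro powr_add_le) auto
    finally show "ennreal (norm (f x + g x) powr s) \<le> ennreal (2 powr s) * (ennreal (norm (f x) powr s) + ennreal (norm (g x) powr s))"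
      by (simp flip: ennreal_plus ennreal_mult add: ennreal_leI)
  qed
  also have "\<dots> = ennreal (2 powr s) * ((\<integral>\<^sup>+x. ennreal (norm (f x) powr s) \<partial>lebesgue) + (\<integral>\<^sup>+x. ennreal (norm (g x) powr s) \<partial>lebesgue))"
    using m[OF assms(1)] m[OF assms(2)] by (subst nn_integral_cmult) (auto simp: nn_integral_add)
  finally show ?thesis .
qed

lemma borel_measurable_norm_powr:
  "strongly_measurable lebesgue f \<Longrightarrow> (\<lambda>x. ennreal (norm (f x) powr s)) \<in> borel_measurable lebesgue"
  by (intro measurable_compose[OF _ measurable_ennreal] powr_real_measurable strongly_measurable_norm) auto

text \<open>Convergence in the gauge contains convergence in \<open>L^1\<close>, hence uniform
  convergence of the transforms, and at the same time controls the \<open>L^s\<close> integrals, so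
  Fatou's lemma applies. The additional factor is that of the quasi-triangle inequality
  \<open>powr_add_le\<close>.\<close>

lemma fourier_bounded_dyadicI:
  assumes s: "1 < s" and K: "0 \<le> K"
    and D: "\<And>\<sigma> (f :: 'd::euclidean_space \<Rightarrow> 'x::complex_banach) M. \<sigma> \<in> {1, - 1} \<Longrightarrow> f \<in> dyadic \<Longrightarrow> 0 \<le> M \<Longrightarrow>
      (\<integral>\<^sup>+x. ennreal (norm (f x) powr s) \<partial>lebesgue) \<le> ennreal M \<Longrightarrow>
      (\<integral>\<^sup>+x. ennreal (norm (sfourier \<sigma> f x) powr (s / (s - 1))) \<partial>lebesgue) \<le> ennreal (K * M powr (1 / (s - 1)))"
  shows "fourier_bounded TYPE('d) TYPE('x) s (K * (2 powr s) powr (1 / (s - 1)))"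
  unfolding fourier_bounded_def
proof (intro ballI allI impI)
  fix \<sigma> :: real and f :: "'d \<Rightarrow> 'x" and M :: real
  assume \<sigma>: "\<sigma> \<in> {1, - 1}" and f: "strongly_measurable lebesgue f" "L1_Lp_gauge s f < \<infinity>"
    and M: "0 \<le> M" "(\<integral>\<^sup>+x. ennreal (norm (f x) powr s) \<partial>lebesgue) \<le> ennreal M"
  let ?s' = "s / (s - 1)"
  have s1: "1 \<le> s" using s by simp
  have fi: "sintegrable f" using f L1_Lp_gauge_finite_iff by blast
  obtain u where u: "\<And>k::nat. u k \<in> dyadic" "(\<lambda>k. L1_Lp_gauge s (\<lambda>x. u k x - f x)) \<longlonglongrightarrow> 0"
    using dyadic_dense[OF s1 f] by blast
  have "\<exists>k. L1_Lp_gauge s (\<lambda>x. u k x - f x) < ennreal (inverse (real (Suc n)))" for n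
  proof -
    have "0 < ennreal (inverse (real (Suc n)))" by simp
    from order_tendstoD(2)[OF u(2) this] show ?thesis by (auto simp: eventually_sequentially)
  qed
  then obtain k where k: "\<And>n. L1_Lp_gauge s (\<lambda>x. u (k n) x - f x) < ennreal (inverse (real (Suc n)))" by metis
  define g where "g = (\<lambda>n. u (k n))"
  have g: "g n \<in> dyadic" "sintegrable (g n)" "L1_Lp_gauge s (\<lambda>x. g n x - f x) \<le> ennreal (inverse (real (Suc n)))" for n
    using u(1) k[of n] by (auto simp: g_def dyadic_sintegrable less_imp_le)
  show "(\<integral>\<^sup>+x. ennreal (norm (sfourier \<sigma> f x) powr ?s') \<partial>lebesgue) \<le> ennreal (K * (2 powr s) powr (1 / (s - 1)) * M powr (1 / (s - 1)))"
  proof (rule nn_integral_le_of_tendsto)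
    show "(\<lambda>x. ennreal (norm (sfourier \<sigma> (g n) x) powr ?s')) \<in> borel_measurable lebesgue" for n
      by (intro borel_measurable_norm_powr sfourier_strongly_measurable g)
    show "AE x in lebesgue. (\<lambda>n. ennreal (norm (sfourier \<sigma> (g n) x) powr ?s')) \<longlonglongrightarrow> ennreal (norm (sfourier \<sigma> f x) powr ?s')"
    proof (rule AE_I2)
      fix x
      have "norm (sfourier \<sigma> (g n) x - sfourier \<sigma> f x) \<le> inverse (real (Suc n))" for n
      proof -
        have "norm (sfourier \<sigma> (\<lambda>x. g n x - f x) x) \<le> inverse (real (Suc n))"
          using order_trans[OF nn_integral_norm_le_L1_Lp_gauge g(3)] by (intro sfourier_bounded sintegrable_diff g fi) auto
        then show ?thesis by (simp add: sfourier_diff[OF g(2) fi])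
      qed
      then have "(\<lambda>n. norm (sfourier \<sigma> (g n) x - sfourier \<sigma> f x)) \<longlonglongrightarrow> 0"
        by (intro tendsto_sandwich[OF _ _ tendsto_const LIMSEQ_inverse_real_of_nat]) auto
      then have "(\<lambda>n. sfourier \<sigma> (g n) x) \<longlonglongrightarrow> sfourier \<sigma> f x" by (simp add: tendsto_norm_zero_iff LIM_zero_iff)
      then show "(\<lambda>n. ennreal (norm (sfourier \<sigma> (g n) x) powr ?s')) \<longlonglongrightarrow> ennreal (norm (sfourier \<sigma> f x) powr ?s')"
        using s by (intro tendsto_ennrealI tendsto_powr' tendsto_norm tendsto_const) auto
    qed
    show "(\<integral>\<^sup>+x. ennreal (norm (sfourier \<sigma> (g n) x) powr ?s') \<partial>lebesgue) \<le>
        ennreal (K * (2 powr s * (inverse (real (Suc n)) + M)) powr (1 / (s - 1)))" for n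
    proof (rule D[OF \<sigma> g(1)])
      have "(\<integral>\<^sup>+x. ennreal (norm ((g n x - f x) + f x) powr s) \<partial>lebesgue) \<le>
        ennreal (2 powr s) * ((\<integral>\<^sup>+x. ennreal (norm (g n x - f x) powr s) \<partial>lebesgue) + (\<integral>\<^sup>+x. ennreal (norm (f x) powr s) \<partial>lebesgue))"
        using s by (intro nn_integral_powr_add_le strongly_measurable_diff sintegrableD(1) g fi) auto
      also have "\<dots> \<le> ennreal (2 powr s) * (ennreal (inverse (real (Suc n))) + ennreal M)"
        using order_trans[OF nn_integral_powr_le_L1_Lp_gauge g(3)] M by (intro mult_left_mono add_mono) auto
      also have "\<dots> = ennreal (2 powr s * (inverse (real (Suc n)) + M))"
        using M by (simp flip: ennreal_plus ennreal_mult)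
      finally show "(\<integral>\<^sup>+x. ennreal (norm (g n x) powr s) \<partial>lebesgue) \<le> ennreal (2 powr s * (inverse (real (Suc n)) + M))"
        by simp
    qed (use M in auto)
    have "(\<lambda>n. 2 powr s * (inverse (real (Suc n)) + M)) \<longlonglongrightarrow> 2 powr s * (0 + M)"
      by (intro tendsto_intros LIMSEQ_inverse_real_of_nat)
    then have "(\<lambda>n. ennreal (K * (2 powr s * (inverse (real (Suc n)) + M)) powr (1 / (s - 1)))) \<longlonglongrightarrow>
        ennreal (K * (2 powr s * (0 + M)) powr (1 / (s - 1)))"
      using s M by (intro tendsto_ennrealI tendsto_mult tendsto_const tendsto_powr') (auto intro!: always_eventually)
    then show "(\<lambda>n. ennreal (K * (2 powr s * (inverse (real (Suc n)) + M)) powr (1 / (s - 1)))) \<longlonglongrightarrow>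
        ennreal (K * (2 powr s) powr (1 / (s - 1)) * M powr (1 / (s - 1)))"
      by (simp add: powr_mult mult.assoc)
  qed
qed

text \<open>Here the domain changes from the \<open>'k\<close> of the hypothesis to an arbitrary
  \<open>'d\<close>: a single coordinate direction of \<open>'k\<close> carries all the information
  that is transferred.\<close>

lemma fourier_type_bounded:
  assumes "fourier_type TYPE('k::euclidean_space) TYPE('x::complex_banach) p" "1 < p"
  obtains s K where "p = ennreal s" "1 < s" "s \<le> 2" "0 \<le> K" "fourier_bounded TYPE('d::euclidean_space) TYPE('x) s K"
proof -
  obtain s K where s: "p = ennreal s" "1 < s" "s \<le> 2" and K: "0 \<le> K"
    and F: "\<And>(f::'k \<Rightarrow> 'x) M. strongly_measurable lebesgue f \<Longrightarrow> L1_Lp_gauge s f < \<infinity> \<Longrightarrow> 0 \<le> M \<Longrightarrow>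
      (\<integral>\<^sup>+x. ennreal (norm (f x) powr s) \<partial>lebesgue) \<le> ennreal M \<Longrightarrow>
      (\<integral>\<^sup>+x. ennreal (norm (sfourier (- 1) f x) powr (s / (s - 1))) \<partial>lebesgue) \<le> ennreal (K * M powr (1 / (s - 1)))"
    using assms by (rule fourier_type_bound) (rule that)
  obtain b :: 'k where b: "b \<in> Basis" using nonempty_Basis by blast
  obtain K' where K': "0 \<le> K'" "\<And>\<sigma> J (x :: int \<Rightarrow> 'x). \<sigma> \<in> {1, - 1} \<Longrightarrow> finite J \<Longrightarrow>
    (\<integral>\<^sup>+\<zeta>. indicator unit_cube \<zeta> * ennreal (norm (\<Sum>j\<in>J. cis (\<sigma> * (2 * pi * (\<zeta> \<bullet> b) * j)) *\<^sub>C x j) powr (s / (s - 1))) \<partial>lborel)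
      \<le> ennreal (K' * (\<Sum>j\<in>J. norm (x j) powr s) powr (1 / (s - 1)))"
    using trig_bound_line[OF s(2) K b F] by blast
  have "fourier_bounded TYPE('d) TYPE('x) s (K' * (2 powr s) powr (1 / (s - 1)))"
  proof (rule fourier_bounded_dyadicI[OF s(2) K'(1)])
    fix \<sigma> :: real and f :: "'d \<Rightarrow> 'x" and M :: real
    assume \<sigma>: "\<sigma> \<in> {1, - 1}" and f: "f \<in> dyadic" "0 \<le> M" "(\<integral>\<^sup>+x. ennreal (norm (f x) powr s) \<partial>lebesgue) \<le> ennreal M"
    show "(\<integral>\<^sup>+x. ennreal (norm (sfourier \<sigma> f x) powr (s / (s - 1))) \<partial>lebesgue) \<le> ennreal (K' * M powr (1 / (s - 1)))"
      by (rule dyadic_fourier_bound(3)[OF s(2) K'(1) trig_bound_cube[OF s(2) K'(1) K'(2)[OF \<sigma>] \<sigma>] f])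
  qed
  then show ?thesis using s K'(1) by (intro that[of s "K' * (2 powr s) powr (1 / (s - 1))"]) auto
qed

section \<open>The Fourier transform of tempered functions\<close>

text \<open>\<open>has_fourier \<sigma> f g\<close>: \<open>g\<close> represents the distributional Fourier transform of \<open>f\<close>
  (\<open>\<sigma> = - 1\<close>) or its inverse (\<open>\<sigma> = 1\<close>).\<close>

definition has_fourier :: "real \<Rightarrow> ('a::euclidean_space \<Rightarrow> 'b::complex_banach) \<Rightarrow> ('a \<Rightarrow> 'b) \<Rightarrow> bool"
  where "has_fourier \<sigma> f g \<longleftrightarrow> strongly_measurable lebesgue f \<and> tempered g \<and>
    (\<forall>\<phi>\<in>schwartz. sintegrable (\<lambda>x. sfourier \<sigma> \<phi> x *\<^sub>C f x) \<and>
      strong_integral lebesgue (\<lambda>x. sfourier \<sigma> \<phi> x *\<^sub>C f x) = strong_integral lebesgue (\<lambda>x. \<phi> x *\<^sub>C g x))"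

lemma has_fourierD:
  assumes "has_fourier \<sigma> f g"
  shows "strongly_measurable lebesgue f" "tempered g" "strongly_measurable lebesgue g"
    "\<phi> \<in> schwartz \<Longrightarrow> sintegrable (\<lambda>x. sfourier \<sigma> \<phi> x *\<^sub>C f x)"
    "\<phi> \<in> schwartz \<Longrightarrow> strong_integral lebesgue (\<lambda>x. sfourier \<sigma> \<phi> x *\<^sub>C f x) = strong_integral lebesgue (\<lambda>x. \<phi> x *\<^sub>C g x)"
  using assms by (auto simp: has_fourier_def temperedD)

lemma has_fourier_unique:
  assumes "has_fourier \<sigma> f g" "has_fourier \<sigma> f' g'" "AE x in lebesgue. f x = f' x"
  shows "AE x in lebesgue. g x = g' x"
proof (rule tempered_unique)
  fix \<phi> :: "'a \<Rightarrow> complex" assume \<phi>: "\<phi> \<in> schwartz"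
  have "strong_integral lebesgue (\<lambda>x. sfourier \<sigma> \<phi> x *\<^sub>C f x) = strong_integral lebesgue (\<lambda>x. sfourier \<sigma> \<phi> x *\<^sub>C f' x)"
    by (rule strong_integral_cong_AE) (use assms(3) in \<open>eventually_elim, simp\<close>)
  then show "strong_integral lebesgue (\<lambda>x. \<phi> x *\<^sub>C g x) = strong_integral lebesgue (\<lambda>x. \<phi> x *\<^sub>C g' x)"
    using has_fourierD(5)[OF assms(1) \<phi>] has_fourierD(5)[OF assms(2) \<phi>] by simp
qed (use assms in \<open>auto dest: has_fourierD(2)\<close>)

lemma has_fourier_add:
  assumes "has_fourier \<sigma> f g" "has_fourier \<sigma> f' g'"
  shows "has_fourier \<sigma> (\<lambda>x. f x + f' x) (\<lambda>x. g x + g' x)"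
  using has_fourierD[OF assms(1)] has_fourierD[OF assms(2)] unfolding has_fourier_def
  by (auto simp: scaleC_add_right strong_integral_add tempered_schwartz_sintegrable
      intro!: strongly_measurable_add tempered_add sintegrable_add)

lemma scaleC_commute: "b *\<^sub>C c *\<^sub>C x = c *\<^sub>C b *\<^sub>C (x :: 'b::complex_banach)"
  by (simp add: scaleC_scaleC mult.commute)

lemma has_fourier_scaleC:
  assumes "has_fourier \<sigma> f g"
  shows "has_fourier \<sigma> (\<lambda>x. c *\<^sub>C f x) (\<lambda>x. c *\<^sub>C g x)"
  using has_fourierD[OF assms] unfolding has_fourier_def
  by (auto simp: scaleC_commute[of _ c] strong_integral_bounded_linear[OF scaleC.bounded_linear_right] tempered_schwartz_sintegrable
      intro!: strongly_measurable_scaleC tempered_scaleC sintegrable_bounded_linear[OF scaleC.bounded_linear_right])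

lemma has_fourier_L1:
  assumes "sintegrable f"
  shows "has_fourier \<sigma> f (sfourier \<sigma> f)"
  unfolding has_fourier_def
  using sintegrableD(1)[OF assms] sfourier_tempered[OF assms]
    sfourier_mult_sintegrable(1)[OF schwartz_sintegrable assms]
    sfourier_multiplication[OF schwartz_continuous schwartz_sintegrable assms] by blast

section \<open>The transform of functions in \<open>L^s\<close>\<close>

lemma young_le:
  fixes a b :: real
  assumes "0 \<le> a" "0 \<le> b" "1 < s"
  shows "a * b \<le> a powr (s / (s - 1)) + b powr s"
proof (cases "b = 0 \<or> a = 0")
  case False
  with assms have ab: "0 < a" "0 < b" by auto
  have e: "s / (s - 1) = 1 / (s - 1) + 1" using assms by (simp add: field_simps)
  show ?thesis
  proof (cases "b \<le> a powr (1 / (s - 1))")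
    case True
    then have "a * b \<le> a * a powr (1 / (s - 1))" using ab by simp
    also have "\<dots> = a powr (s / (s - 1))" unfolding e using ab by (simp add: powr_add mult.commute)
    finally show ?thesis using powr_ge_zero[of b s] by linarith
  next
    case False
    then have "(a powr (1 / (s - 1))) powr (s - 1) \<le> b powr (s - 1)" using assms ab by (intro powr_mono2) auto
    then have "a \<le> b powr (s - 1)" using assms ab by (simp add: powr_powr)
    then have "a * b \<le> b powr (s - 1) * b" using ab by simp
    also have "\<dots> = b powr s" using ab by (simp add: powr_diff)
    finally show ?thesis using powr_ge_zero[of a "s / (s - 1)"] by linarith
  qed
qed auto

text \<open>Completeness of \<open>L^q\<close> without Minkowski's inequality. The
  \<open>n\<close>-th difference is multiplied by \<open>2 ^ n\<close> before the
  \<open>q\<close>-th powers are summed; the sum is still integrable, and its finiteness at a point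
  bounds the differences there by a geometric sequence.\<close>

lemma Lq_Cauchy_convergent_AE:
  fixes G :: "nat \<Rightarrow> 'a::euclidean_space \<Rightarrow> 'b::banach"
  assumes G: "\<And>n. strongly_measurable lebesgue (G n)" and q: "1 \<le> q"
    and C: "\<And>n. (\<integral>\<^sup>+x. ennreal (norm (G (Suc n) x - G n x) powr q) \<partial>lebesgue) \<le> ennreal (((1 / 4) ^ n) powr q)"
  shows "AE x in lebesgue. convergent (\<lambda>n. G n x)"
proof -
  let ?D = "\<lambda>n x. norm (G (Suc n) x - G n x)"
  have m: "(\<lambda>x. ennreal (?D n x powr q)) \<in> borel_measurable lebesgue" for n
    by (intro borel_measurable_norm_powr strongly_measurable_diff G)
  have r: "0 \<le> (1 / 2) powr q" "(1 / 2) powr q < (1::real)"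
    using q powr_less_mono2[of q "1 / 2" 1] by auto
  have "(\<integral>\<^sup>+x. (\<Sum>n. ennreal ((2 ^ n) powr q) * ennreal (?D n x powr q)) \<partial>lebesgue) =
      (\<Sum>n. ennreal ((2 ^ n) powr q) * (\<integral>\<^sup>+x. ennreal (?D n x powr q) \<partial>lebesgue))"
    using m by (subst nn_integral_suminf) (auto simp: nn_integral_cmult)
  also have "\<dots> \<le> (\<Sum>n. ennreal ((2 ^ n) powr q) * ennreal (((1 / 4) ^ n) powr q))"
    using C by (intro suminf_le mult_left_mono summableI) auto
  also have "\<dots> = (\<Sum>n. ennreal (((1 / 2) powr q) ^ n))"
  proof (rule suminf_cong)
    fix n
    have "(2 ^ n) powr q * ((1 / 4) ^ n) powr q = (2 ^ n * (1 / 4) ^ n) powr q" by (rule powr_mult[symmetric])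
    also have "2 ^ n * (1 / 4) ^ n = ((1 / 2) ^ n :: real)" by (simp flip: power_mult_distrib)
    also have "((1 / 2) ^ n) powr q = ((1 / 2) powr q) ^ n"
      by (simp add: powr_realpow[symmetric] powr_powr mult.commute)
    finally show "ennreal ((2 ^ n) powr q) * ennreal (((1 / 4) ^ n) powr q) = ennreal (((1 / 2) powr q) ^ n)"
      by (simp flip: ennreal_mult)
  qed
  also have "\<dots> < \<infinity>"
  proof -
    have "summable (\<lambda>n. ((1 / 2) powr q) ^ n :: real)" using r by (intro summable_geometric) simp
    then show ?thesis using r by (subst suminf_ennreal2) auto
  qed
  finally have "AE x in lebesgue. (\<Sum>n. ennreal ((2 ^ n) powr q) * ennreal (?D n x powr q)) \<noteq> \<infinity>"
    using m by (intro nn_integral_PInf_AE) (auto intro!: borel_measurable_suminf_order borel_measurable_times_ennreal)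
  then show ?thesis
  proof eventually_elim
    case (elim x)
    let ?S = "\<Sum>n. ennreal ((2 ^ n) powr q) * ennreal (?D n x powr q)"
    obtain C where C: "0 \<le> C" "?S = ennreal C" using elim by (cases ?S) auto
    have bd: "?D n x \<le> C powr (1 / q) * (1 / 2) ^ n" for n
    proof -
      have "ennreal ((2 ^ n) powr q) * ennreal (?D n x powr q) \<le> ?S"
        using sum_le_suminf[of "\<lambda>n. ennreal ((2 ^ n) powr q) * ennreal (?D n x powr q)" "{n}"] by simp
      then have "ennreal ((2 ^ n * ?D n x) powr q) \<le> ennreal C"
        unfolding C(2) by (simp add: powr_mult ennreal_mult)
      then have "((2 ^ n * ?D n x) powr q) powr (1 / q) \<le> C powr (1 / q)"
        using C(1) q by (intro powr_mono2) auto
      then have "2 ^ n * ?D n x \<le> C powr (1 / q)" using q by (simp add: powr_powr)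
      then show ?thesis by (simp add: power_divide field_simps)
    qed
    have "summable (\<lambda>n. C powr (1 / q) * (1 / 2) ^ n)" by (intro summable_mult summable_geometric) simp
    then have "summable (\<lambda>n. ?D n x)" by (rule summable_comparison_test'[where N=0]) (simp add: bd)
    then have "summable (\<lambda>n. G (Suc n) x - G n x)" by (rule summable_norm_cancel)
    then have "(\<lambda>n. \<Sum>k<n. G (Suc k) x - G k x) \<longlonglongrightarrow> (\<Sum>n. G (Suc n) x - G n x)" by (rule summable_LIMSEQ)
    then have "(\<lambda>n. G n x - G 0 x) \<longlonglongrightarrow> (\<Sum>n. G (Suc n) x - G n x)" by (simp add: sum_lessThan_telescope[of "\<lambda>k. G k x"])
    from tendsto_add[OF this tendsto_const[of "G 0 x"]] show ?case by (auto simp: convergent_def)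
  qed
qed

text \<open>Applying \<open>t <= 1 + t powr q\<close> to \<open>norm (h x) / \<eta>\<close> makes
  both resulting terms linear in \<eta>.\<close>

lemma tempered_small_Lq:
  fixes h :: "'a::euclidean_space \<Rightarrow> 'b::real_normed_vector"
  assumes h: "strongly_measurable lebesgue h" and q: "1 \<le> q" and \<eta>: "0 < \<eta>"
    and b: "(\<integral>\<^sup>+x. ennreal (norm (h x) powr q) \<partial>lebesgue) \<le> ennreal (\<eta> powr q)"
  shows "(\<integral>\<^sup>+x. ennreal (weight x * norm (h x)) \<partial>lebesgue) \<le>
    ennreal \<eta> * ((\<integral>\<^sup>+x. ennreal (weight (x::'a)) \<partial>lebesgue) + 1)"
proof -
  have "(\<integral>\<^sup>+x. ennreal (weight x * norm (h x)) \<partial>lebesgue) \<le>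
      (\<integral>\<^sup>+x. ennreal \<eta> * ennreal (weight x) + ennreal (\<eta> powr (1 - q)) * ennreal (norm (h x) powr q) \<partial>lebesgue)"
  proof (rule nn_integral_mono)
    fix x
    have "norm (h x) / \<eta> \<le> 1 + (norm (h x) / \<eta>) powr q"
      using \<eta> q by (intro le_one_plus_powr) auto
    then have "norm (h x) \<le> \<eta> + \<eta> * ((norm (h x) / \<eta>) powr q)"
      using \<eta> by (simp add: field_simps)
    also have "\<eta> * ((norm (h x) / \<eta>) powr q) = \<eta> powr (1 - q) * norm (h x) powr q"
      using \<eta> by (simp add: powr_divide powr_diff)
    finally have "weight x * norm (h x) \<le> weight x * (\<eta> + \<eta> powr (1 - q) * norm (h x) powr q)"
      using weight_pos[of x] by (intro mult_left_mono) auto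
    also have "\<dots> \<le> \<eta> * weight x + \<eta> powr (1 - q) * norm (h x) powr q"
      using weight_le_1[of x] mult_right_mono[of "weight x" 1 "\<eta> powr (1 - q) * norm (h x) powr q"]
      by (simp add: algebra_simps)
    finally show "ennreal (weight x * norm (h x)) \<le> ennreal \<eta> * ennreal (weight x) + ennreal (\<eta> powr (1 - q)) * ennreal (norm (h x) powr q)"
      using \<eta> less_imp_le[OF weight_pos[of x]] by (simp flip: ennreal_plus ennreal_mult add: ennreal_leI)
  qed
  also have "\<dots> = ennreal \<eta> * (\<integral>\<^sup>+x. ennreal (weight (x::'a)) \<partial>lebesgue) + ennreal (\<eta> powr (1 - q)) * (\<integral>\<^sup>+x. ennreal (norm (h x) powr q) \<partial>lebesgue)"
    using borel_measurable_norm_powr[OF h, of q] weight_lebesgue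
    by (subst nn_integral_add) (auto simp: nn_integral_cmult intro!: borel_measurable_times_ennreal)
  also have "\<dots> \<le> ennreal \<eta> * (\<integral>\<^sup>+x. ennreal (weight (x::'a)) \<partial>lebesgue) + ennreal (\<eta> powr (1 - q)) * ennreal (\<eta> powr q)"
    using b by (intro add_left_mono mult_left_mono) auto
  also have "ennreal (\<eta> powr (1 - q)) * ennreal (\<eta> powr q) = ennreal \<eta> * 1"
    using \<eta> by (simp flip: ennreal_mult powr_add)
  finally show ?thesis by (simp add: distrib_left)
qed

text \<open>The scalar transform inherits the bound of the space through the functions
  \<open>\<phi> x *\<^sub>C x0\<close>; this is where a nonzero vector is used. With Young's
  inequality, the pairing of the transform of \<phi> with an \<open>L^s\<close> function is then
  integrable without any estimate of how fast that transform decays.\<close>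

lemma sfourier_schwartz_Lq:
  fixes \<phi> :: "'d::euclidean_space \<Rightarrow> complex"
  assumes F: "fourier_bounded TYPE('d) TYPE('x::complex_banach) s K" and s: "1 < s" and x0: "(x0::'x) \<noteq> 0"
    and \<sigma>: "\<sigma> \<in> {1, - 1}" and \<phi>: "\<phi> \<in> schwartz"
  shows "(\<integral>\<^sup>+x. ennreal (norm (sfourier \<sigma> \<phi> x) powr (s / (s - 1))) \<partial>lebesgue) < \<infinity>"
proof -
  let ?q = "s / (s - 1)"
  obtain C where C: "C \<ge> 0" "\<And>x. norm (\<phi> x) \<le> C * weight x" using schwartz_le_weight[OF \<phi>] by blast
  define f where "f = (\<lambda>x. \<phi> x *\<^sub>C x0)"
  have fm: "strongly_measurable lebesgue f"
    unfolding f_def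
    by (rule strongly_measurable_scaleC[OF strongly_measurable_borel[OF schwartz_strongly_measurable[OF \<phi>]]]) simp
  have fb: "norm (f x) \<le> (C * norm x0) * weight x" for x
    using mult_right_mono[OF C(2)[of x], of "norm x0"] by (simp add: f_def norm_scaleC mult_ac)
  have "L1_Lp_gauge s f \<le> (\<integral>\<^sup>+x. ennreal ((C * norm x0) * weight (x::'d) + ((C * norm x0) * weight x) powr s) \<partial>lebesgue)"
    unfolding L1_Lp_gauge_def using fb s by (intro nn_integral_mono ennreal_leI add_mono powr_mono2) auto
  also have "\<dots> < \<infinity>" using C s by (intro weight_gauge_finite) auto
  finally have r: "L1_Lp_gauge s f < \<infinity>" .
  then obtain M where M: "0 \<le> M" "L1_Lp_gauge s f = ennreal M" by (cases "L1_Lp_gauge s f") auto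
  have "(\<integral>\<^sup>+x. ennreal (norm (sfourier \<sigma> f x) powr ?q) \<partial>lebesgue) \<le> ennreal (K * M powr (1 / (s - 1)))"
    using nn_integral_powr_le_L1_Lp_gauge[of f s] M by (intro fourier_boundedD[OF F \<sigma> fm r]) auto
  moreover have "norm (sfourier \<sigma> f x) powr ?q = norm (sfourier \<sigma> \<phi> x) powr ?q * norm x0 powr ?q" for x
    by (simp add: f_def sfourier_scaleC_left[OF schwartz_sintegrable[OF \<phi>]] norm_scaleC powr_mult)
  ultimately have "(\<integral>\<^sup>+x. ennreal (norm (sfourier \<sigma> \<phi> x) powr ?q) \<partial>lebesgue) * ennreal (norm x0 powr ?q) < \<infinity>"
    using borel_measurable_norm_powr[OF sfourier_strongly_measurable[OF schwartz_sintegrable[OF \<phi>]], of \<sigma> ?q]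
    by (subst nn_integral_multc[symmetric]) (auto simp: ennreal_mult intro: le_less_trans)
  then show ?thesis using x0 by (auto simp: ennreal_mult_less_top)
qed

text \<open>Truncations of \<open>f\<close> to balls have an integral transform and tend to
  \<open>f\<close> in \<open>L^s\<close>. Along a fast subsequence the transforms converge almost
  everywhere and in \<open>L^q\<close>. In the multiplication formula, the side of \<open>f\<close>
  passes to the limit by domination with Young's inequality, the side of \<open>g\<close> by
  smallness of the error against the weight.\<close>

lemma has_fourier_Ls:
  fixes f :: "'d::euclidean_space \<Rightarrow> 'x::complex_banach"
  assumes F: "fourier_bounded TYPE('d) TYPE('x) s K" and s: "1 < s" and K: "0 \<le> K" and x0: "(x0::'x) \<noteq> 0"
    and \<sigma>: "\<sigma> \<in> {1, - 1}" and f: "strongly_measurable lebesgue f"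
    and M: "0 \<le> M" "(\<integral>\<^sup>+x. ennreal (norm (f x) powr s) \<partial>lebesgue) \<le> ennreal M"
  obtains g where "has_fourier \<sigma> f g"
    "(\<integral>\<^sup>+x. ennreal (norm (g x) powr (s / (s - 1))) \<partial>lebesgue) \<le> ennreal (K * M powr (1 / (s - 1)))"
proof -
  let ?q = "s / (s - 1)"
  have q: "1 \<le> ?q" using s by (simp add: field_simps)
  define A where "A = (\<lambda>n. cball 0 (real n) :: 'd set)"
  have Am: "A n \<in> sets lebesgue" for n unfolding A_def by (intro fmeasurableD lmeasurable_cball)
  define h where "h = (\<lambda>n x. indicator (A n) x *\<^sub>R f x)"
  have hm: "strongly_measurable lebesgue (h n)" for n
    unfolding h_def by (intro strongly_measurable_indicator Am f)
  have pm: "(\<lambda>x. ennreal (norm (f x) powr s)) \<in> borel_measurable lebesgue" by (rule borel_measurable_norm_powr[OF f])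
  have hrho: "L1_Lp_gauge s (h n) < \<infinity>" for n
  proof -
    have "L1_Lp_gauge s (h n) \<le> (\<integral>\<^sup>+x. indicator (A n) x + 2 * ennreal (norm (f x) powr s) \<partial>lebesgue)"
      unfolding L1_Lp_gauge_def
    proof (rule nn_integral_mono)
      fix x
      have "norm (f x) + norm (f x) powr s \<le> 1 + 2 * norm (f x) powr s"
        using le_one_plus_powr[of "norm (f x)" s] s by simp
      then have "ennreal (norm (f x) + norm (f x) powr s) \<le> ennreal 1 + ennreal 2 * ennreal (norm (f x) powr s)"
        by (simp flip: ennreal_plus ennreal_mult del: ennreal_1 ennreal_numeral add: ennreal_leI)
      then show "ennreal (norm (h n x) + norm (h n x) powr s) \<le> indicator (A n) x + 2 * ennreal (norm (f x) powr s)"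
        by (cases "x \<in> A n") (auto simp: h_def)
    qed
    also have "\<dots> = emeasure lebesgue (A n) + 2 * (\<integral>\<^sup>+x. ennreal (norm (f x) powr s) \<partial>lebesgue)"
      using pm Am by (subst nn_integral_add) (auto simp: nn_integral_cmult intro!: borel_measurable_times_ennreal)
    also have "\<dots> < \<infinity>"
      using M lmeasurable_cball[of 0 "real n"]
      by (auto simp: fmeasurable_def A_def ennreal_mult_less_top intro: le_less_trans)
    finally show ?thesis .
  qed
  have hi: "sintegrable (h n)" for n using hrho hm L1_Lp_gauge_finite_iff by blast
  have "(\<lambda>n. \<integral>\<^sup>+x. ennreal (norm (f x - h n x) powr s) \<partial>lebesgue) \<longlonglongrightarrow> (\<integral>\<^sup>+x. 0 \<partial>(lebesgue :: 'd measure))"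
  proof (rule nn_integral_dominated_convergence[where w="\<lambda>x. ennreal (norm (f x) powr s)"])
    show "(\<lambda>x. ennreal (norm (f x - h n x) powr s)) \<in> borel_measurable lebesgue" for n
      by (intro borel_measurable_norm_powr strongly_measurable_diff f hm)
    show "(\<integral>\<^sup>+x. ennreal (norm (f x) powr s) \<partial>lebesgue) < \<infinity>" using M by (auto intro: le_less_trans)
    show "AE x in lebesgue. ennreal (norm (f x - h n x) powr s) \<le> ennreal (norm (f x) powr s)" for n
      by (intro AE_I2) (auto simp: h_def indicator_def)
    show "AE x in lebesgue. (\<lambda>n. ennreal (norm (f x - h n x) powr s)) \<longlonglongrightarrow> 0"
    proof (rule AE_I2)
      fix x :: 'd
      obtain n0 :: nat where "norm x \<le> real n0" using real_arch_simple by blast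
      then have "f x - h n x = 0" if "n0 \<le> n" for n using that by (simp add: h_def A_def indicator_def)
      then show "(\<lambda>n. ennreal (norm (f x - h n x) powr s)) \<longlonglongrightarrow> 0"
        by (intro tendsto_eventually eventually_sequentiallyI[of n0]) simp
    qed
  qed (use pm in auto)
  then have e0: "(\<lambda>n. \<integral>\<^sup>+x. ennreal (norm (f x - h n x) powr s) \<partial>lebesgue) \<longlonglongrightarrow> 0" by simp
  \<comment> \<open>Solved from the rate of convergence required of the transforms, in the second
    part of the next claim; \<open>K + 1\<close> is in the denominator because \<open>K\<close> may
    be 0.\<close>
  define \<epsilon> where "\<epsilon> = (\<lambda>j::nat. (((1 / 4) ^ j) powr ?q / (K + 1)) powr (s - 1) :: real)"
  have \<epsilon>: "0 < \<epsilon> j" "K * \<epsilon> j powr (1 / (s - 1)) \<le> ((1 / 4) ^ j) powr ?q" for j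
  proof -
    show "0 < \<epsilon> j" using K by (simp add: \<epsilon>_def)
    have "\<epsilon> j powr (1 / (s - 1)) = ((1 / 4) ^ j) powr ?q / (K + 1)" using K s by (simp add: \<epsilon>_def powr_powr)
    moreover have "K * (((1 / 4) ^ j) powr ?q / (K + 1)) \<le> ((1 / 4) ^ j) powr ?q"
      using K by (simp add: field_simps)
    ultimately show "K * \<epsilon> j powr (1 / (s - 1)) \<le> ((1 / 4) ^ j) powr ?q" by simp
  qed
  have "\<exists>n0. \<forall>n\<ge>n0. (\<integral>\<^sup>+x. ennreal (norm (f x - h n x) powr s) \<partial>lebesgue) < ennreal (\<epsilon> j)" for j
    using order_tendstoD(2)[OF e0, of "ennreal (\<epsilon> j)"] \<epsilon>(1)[of j] by (simp add: eventually_sequentially)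
  then obtain n0 where n0: "\<And>j n. n0 j \<le> n \<Longrightarrow> (\<integral>\<^sup>+x. ennreal (norm (f x - h n x) powr s) \<partial>lebesgue) < ennreal (\<epsilon> j)"
    by metis
  \<comment> \<open>Summing all thresholds gives an increasing sequence, and the summand
    \<open>j\<close> makes the balls exhaust the space.\<close>
  define k where "k = (\<lambda>j. j + (\<Sum>i\<le>j. n0 i))"
  have kn: "n0 j \<le> k j" for j
    using member_le_sum[of j "{..j}" n0] by (simp add: k_def trans_le_add2)
  have kmono: "k i \<le> k j" if "i \<le> j" for i j
    unfolding k_def using that by (intro add_mono sum_mono2) auto
  define G where "G = (\<lambda>j. sfourier \<sigma> (h (k j)))"
  have Gm: "strongly_measurable lebesgue (G j)" for j unfolding G_def by (rule sfourier_strongly_measurable[OF hi])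
  have GC: "(\<integral>\<^sup>+x. ennreal (norm (G i x - G j x) powr ?q) \<partial>lebesgue) \<le> ennreal (((1 / 4) ^ j) powr ?q)" if "j \<le> i" for i j
  proof -
    \<comment> \<open>The balls increase, so this difference is dominated by
      \<open>f - h (k j)\<close>; the smallness for \<open>k j\<close> alone therefore controls all
      later truncations.\<close>
    let ?d = "\<lambda>x. h (k i) x - h (k j) x"
    have dm: "strongly_measurable lebesgue ?d" by (intro strongly_measurable_diff hm)
    have dr: "L1_Lp_gauge s ?d < \<infinity>"
      using L1_Lp_gauge_add_finite[where g="\<lambda>x. - h (k j) x", OF hm strongly_measurable_compose[OF hm] _ hrho] s hrho
      by (simp add: L1_Lp_gauge_minus continuous_on_minus)
    have "(\<integral>\<^sup>+x. ennreal (norm (?d x) powr s) \<partial>lebesgue) \<le> (\<integral>\<^sup>+x. ennreal (norm (f x - h (k j) x) powr s) \<partial>lebesgue)"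
      using kmono[OF that] by (intro nn_integral_mono) (auto simp: h_def A_def indicator_def)
    also have "\<dots> \<le> ennreal (\<epsilon> j)" using n0[OF kn] by (rule less_imp_le)
    finally have "(\<integral>\<^sup>+x. ennreal (norm (sfourier \<sigma> ?d x) powr ?q) \<partial>lebesgue) \<le> ennreal (K * \<epsilon> j powr (1 / (s - 1)))"
      using \<epsilon>(1)[of j] by (intro fourier_boundedD[OF F \<sigma> dm dr]) auto
    also have "\<dots> \<le> ennreal (((1 / 4) ^ j) powr ?q)" using \<epsilon>(2) by (rule ennreal_leI)
    finally show ?thesis by (simp add: G_def sfourier_diff[OF hi hi])
  qed
  have conv: "AE x in lebesgue. convergent (\<lambda>n. G n x)"
    by (rule Lq_Cauchy_convergent_AE[OF Gm q]) (rule GC, simp)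
  define g where "g = (\<lambda>x. lim (\<lambda>n. G n x))"
  have lim: "AE x in lebesgue. (\<lambda>n. G n x) \<longlonglongrightarrow> g x"
    using conv unfolding g_def by eventually_elim (simp add: convergent_LIMSEQ_iff)
  have gm: "strongly_measurable lebesgue g" by (rule strongly_measurable_LIMSEQ_AE[OF Gm lim])
  have plim: "(\<lambda>n. ennreal (norm (u n) powr ?q)) \<longlonglongrightarrow> ennreal (norm v powr ?q)" if "u \<longlonglongrightarrow> v" for u and v :: 'x
    using that s by (intro tendsto_ennrealI tendsto_powr' tendsto_norm tendsto_const) auto
  have gb: "(\<integral>\<^sup>+x. ennreal (norm (g x) powr ?q) \<partial>lebesgue) \<le> ennreal (K * M powr (1 / (s - 1)))"
  proof (rule nn_integral_le_of_tendsto[where B="\<lambda>_. ennreal (K * M powr (1 / (s - 1)))"])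
    show "AE x in lebesgue. (\<lambda>n. ennreal (norm (G n x) powr ?q)) \<longlonglongrightarrow> ennreal (norm (g x) powr ?q)"
      using lim by eventually_elim (rule plim)
    show "(\<integral>\<^sup>+x. ennreal (norm (G n x) powr ?q) \<partial>lebesgue) \<le> ennreal (K * M powr (1 / (s - 1)))" for n
      unfolding G_def
    proof (rule fourier_boundedD[OF F \<sigma> hm hrho M(1)])
      have "(\<integral>\<^sup>+x. ennreal (norm (h (k n) x) powr s) \<partial>lebesgue) \<le> (\<integral>\<^sup>+x. ennreal (norm (f x) powr s) \<partial>lebesgue)"
        by (intro nn_integral_mono) (auto simp: h_def indicator_def)
      then show "(\<integral>\<^sup>+x. ennreal (norm (h (k n) x) powr s) \<partial>lebesgue) \<le> ennreal M" using M(2) by (rule order_trans)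
    qed
    show "(\<lambda>x. ennreal (norm (G n x) powr ?q)) \<in> borel_measurable lebesgue" for n
      by (rule borel_measurable_norm_powr[OF Gm])
  qed simp
  have gG: "(\<integral>\<^sup>+x. ennreal (norm (G j x - g x) powr ?q) \<partial>lebesgue) \<le> ennreal (((1 / 4) ^ j) powr ?q)" for j
  proof (rule nn_integral_le_of_tendsto[where u="\<lambda>n x. ennreal (norm (G (n + j) x - G j x) powr ?q)" and B="\<lambda>_. ennreal (((1 / 4) ^ j) powr ?q)"])
    show "AE x in lebesgue. (\<lambda>n. ennreal (norm (G (n + j) x - G j x) powr ?q)) \<longlonglongrightarrow> ennreal (norm (G j x - g x) powr ?q)"
      using lim
    proof eventually_elim
      case (elim x)
      from plim[OF tendsto_diff[OF LIMSEQ_ignore_initial_segment[OF elim, of j] tendsto_const[of "G j x"]]]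
      show ?case by (simp add: norm_minus_commute)
    qed
    show "(\<lambda>x. ennreal (norm (G (n + j) x - G j x) powr ?q)) \<in> borel_measurable lebesgue" for n
      by (intro borel_measurable_norm_powr strongly_measurable_diff Gm)
  qed (simp_all add: GC)
  have gt: "tempered g"
    using gb by (intro tempered_Lp[OF gm q]) (auto intro: le_less_trans)
  have "has_fourier \<sigma> f g"
    unfolding has_fourier_def
  proof (intro conjI ballI f gt)
    fix \<phi> :: "'d \<Rightarrow> complex" assume \<phi>: "\<phi> \<in> schwartz"
    note \<phi>i = schwartz_sintegrable[OF \<phi>]
    have fm: "strongly_measurable lebesgue (\<lambda>x. sfourier \<sigma> \<phi> x *\<^sub>C h n x)" for n
      by (intro strongly_measurable_scaleC strongly_measurable_borel sfourier_strongly_measurable \<phi>i hm)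
    let ?w = "\<lambda>x. ennreal (norm (sfourier \<sigma> \<phi> x) powr ?q) + ennreal (norm (f x) powr s)"
    have wm: "?w \<in> borel_measurable lebesgue"
      by (intro borel_measurable_add borel_measurable_norm_powr sfourier_strongly_measurable \<phi>i f)
    have wi: "(\<integral>\<^sup>+x. ?w x \<partial>lebesgue) < \<infinity>"
      unfolding nn_integral_add[OF borel_measurable_norm_powr[OF sfourier_strongly_measurable[OF \<phi>i]] borel_measurable_norm_powr[OF f]]
      using sfourier_schwartz_Lq[OF F s x0 \<sigma> \<phi>] M by (auto intro: le_less_trans)
    have young: "ennreal (norm (sfourier \<sigma> \<phi> x *\<^sub>C h n x)) \<le> ?w x" for n x
    proof -
      have "norm (sfourier \<sigma> \<phi> x *\<^sub>C h n x) \<le> norm (sfourier \<sigma> \<phi> x) * norm (f x)"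
        by (auto simp: norm_scaleC h_def indicator_def)
      also have "\<dots> \<le> norm (sfourier \<sigma> \<phi> x) powr ?q + norm (f x) powr s"
        using s by (intro young_le) auto
      finally show ?thesis by (simp flip: ennreal_plus add: ennreal_leI)
    qed
    have kl: "AE x in lebesgue. (\<lambda>j. sfourier \<sigma> \<phi> x *\<^sub>C h (k j) x) \<longlonglongrightarrow> sfourier \<sigma> \<phi> x *\<^sub>C f x"
    proof (rule AE_I2)
      fix x :: 'd
      obtain m :: nat where "norm x \<le> real m" using real_arch_simple by blast
      moreover have "real n \<le> real (k n)" for n
        unfolding of_nat_le_iff by (simp add: k_def)
      ultimately have "norm x \<le> real (k n)" if "m \<le> n" for n
        using that by (meson of_nat_le_iff order_trans)
      then have "h (k n) x = f x" if "m \<le> n" for n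
        using that by (simp add: h_def A_def indicator_def)
      then show "(\<lambda>j. sfourier \<sigma> \<phi> x *\<^sub>C h (k j) x) \<longlonglongrightarrow> sfourier \<sigma> \<phi> x *\<^sub>C f x"
        by (intro tendsto_eventually eventually_sequentiallyI[of m]) simp
    qed
    note dom = nn_integral_norm_diff_tendsto_0[OF fm kl AE_I2[OF young] wi wm]
    show "sintegrable (\<lambda>x. sfourier \<sigma> \<phi> x *\<^sub>C f x)" by (rule dom(1))
    have l1: "(\<lambda>j. strong_integral lebesgue (\<lambda>x. sfourier \<sigma> \<phi> x *\<^sub>C h (k j) x)) \<longlonglongrightarrow> strong_integral lebesgue (\<lambda>x. sfourier \<sigma> \<phi> x *\<^sub>C f x)"
      by (rule strong_integral_dominated_convergence[OF fm kl AE_I2[OF young] wi wm])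
    obtain C where C: "C \<ge> 0" "\<And>x. norm (\<phi> x) \<le> C * weight x" using schwartz_le_weight[OF \<phi>] by blast
    let ?W = "(\<integral>\<^sup>+x. ennreal (weight (x::'d)) \<partial>lebesgue) + 1"
    have l2: "(\<lambda>j. strong_integral lebesgue (\<lambda>x. \<phi> x *\<^sub>C G j x)) \<longlonglongrightarrow> strong_integral lebesgue (\<lambda>x. \<phi> x *\<^sub>C g x)"
    proof (rule tendsto_strong_integral_L1)
      show "sintegrable (\<lambda>x. \<phi> x *\<^sub>C G j x)" for j
        unfolding G_def by (rule tempered_schwartz_sintegrable[OF sfourier_tempered[OF hi] \<phi>])
      show "sintegrable (\<lambda>x. \<phi> x *\<^sub>C g x)" by (rule tempered_schwartz_sintegrable[OF gt \<phi>])
      show "(\<lambda>j. \<integral>\<^sup>+x. ennreal (norm (\<phi> x *\<^sub>C G j x - \<phi> x *\<^sub>C g x)) \<partial>lebesgue) \<longlonglongrightarrow> 0"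
      proof (rule tendsto_sandwich[OF _ _ tendsto_const])
        show "\<forall>\<^sub>F j in sequentially. (\<integral>\<^sup>+x. ennreal (norm (\<phi> x *\<^sub>C G j x - \<phi> x *\<^sub>C g x)) \<partial>lebesgue) \<le> ennreal C * (ennreal ((1 / 4) ^ j) * ?W)"
        proof (intro always_eventually allI)
          fix j
          have hw: "(\<lambda>x. ennreal (weight x * norm (G j x - g x))) \<in> borel_measurable lebesgue"
            by (intro measurable_compose[OF _ measurable_ennreal] borel_measurable_times weight_lebesgue strongly_measurable_norm strongly_measurable_diff Gm gm)
          have "(\<integral>\<^sup>+x. ennreal (norm (\<phi> x *\<^sub>C G j x - \<phi> x *\<^sub>C g x)) \<partial>lebesgue) \<le>
              (\<integral>\<^sup>+x. ennreal C * ennreal (weight x * norm (G j x - g x)) \<partial>lebesgue)"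
          proof (rule nn_integral_mono)
            fix x
            have "norm (\<phi> x *\<^sub>C G j x - \<phi> x *\<^sub>C g x) \<le> C * (weight x * norm (G j x - g x))"
              using mult_right_mono[OF C(2)[of x] norm_ge_zero[of "G j x - g x"]]
              by (simp add: scaleC.diff_right[symmetric] norm_scaleC mult.assoc)
            then show "ennreal (norm (\<phi> x *\<^sub>C G j x - \<phi> x *\<^sub>C g x)) \<le> ennreal C * ennreal (weight x * norm (G j x - g x))"
              using C(1) less_imp_le[OF weight_pos[of x]] by (simp flip: ennreal_mult add: ennreal_leI)
          qed
          also have "\<dots> = ennreal C * (\<integral>\<^sup>+x. ennreal (weight x * norm (G j x - g x)) \<partial>lebesgue)"
            by (rule nn_integral_cmult[OF hw])
          also have "\<dots> \<le> ennreal C * (ennreal ((1 / 4) ^ j) * ?W)"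
            by (intro mult_left_mono tempered_small_Lq[OF _ q _ gG] strongly_measurable_diff Gm gm) auto
          finally show "(\<integral>\<^sup>+x. ennreal (norm (\<phi> x *\<^sub>C G j x - \<phi> x *\<^sub>C g x)) \<partial>lebesgue) \<le> ennreal C * (ennreal ((1 / 4) ^ j) * ?W)" .
        qed
        have W: "?W < \<infinity>" using nn_integral_weight[where ?'a='d] by simp
        have "(\<lambda>j. ennreal ((1 / 4) ^ j)) \<longlonglongrightarrow> ennreal 0" by (intro tendsto_ennrealI LIMSEQ_power_zero) simp
        then have "(\<lambda>j. ennreal C * (ennreal ((1 / 4) ^ j) * ?W)) \<longlonglongrightarrow> ennreal C * (ennreal 0 * ?W)"
          using W by (intro tendsto_mult_ennreal tendsto_const) auto
        then show "(\<lambda>j. ennreal C * (ennreal ((1 / 4) ^ j) * ?W)) \<longlonglongrightarrow> 0" by simp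
      qed simp
    qed
    have "strong_integral lebesgue (\<lambda>x. sfourier \<sigma> \<phi> x *\<^sub>C h (k j) x) = strong_integral lebesgue (\<lambda>x. \<phi> x *\<^sub>C G j x)" for j
      unfolding G_def by (rule sfourier_multiplication[OF schwartz_continuous[OF \<phi>] \<phi>i hi])
    with l1 l2 show "strong_integral lebesgue (\<lambda>x. sfourier \<sigma> \<phi> x *\<^sub>C f x) = strong_integral lebesgue (\<lambda>x. \<phi> x *\<^sub>C g x)"
      using LIMSEQ_unique by simp
  qed
  then show ?thesis using gb by (rule that)
qed

section \<open>Weak type estimates\<close>

text \<open>Level sets of strongly measurable functions are only Lebesgue measurable, so Tonelli's
  theorem is needed with the completed measure in the space variable.\<close>

interpretation lebesgue: sigma_finite_measure "lebesgue :: 'a::euclidean_space measure"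
proof
  let ?A = "range (\<lambda>n::nat. box (- (real n *\<^sub>R One)) (real n *\<^sub>R One) :: 'a set)"
  show "\<exists>A. countable A \<and> A \<subseteq> sets (lebesgue :: 'a measure) \<and> \<Union> A = space lebesgue \<and> (\<forall>a\<in>A. emeasure lebesgue a \<noteq> \<infinity>)"
  proof (intro exI[of _ ?A] conjI)
    show "\<Union> ?A = space lebesgue" using UN_box_eq_UNIV[where 'a='a] by simp
    show "\<forall>a\<in>?A. emeasure lebesgue a \<noteq> \<infinity>"
      using emeasure_lebesgue_box_finite[where 'a='a] by (simp add: less_top[symmetric])
  qed auto
qed

interpretation lebesgue_pair: pair_sigma_finite "lebesgue :: 'a::euclidean_space measure" "lborel :: real measure" ..

lemma nn_integral_powr_from_0:
  assumes "0 \<le> c" "- 1 < e"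
  shows "(\<integral>\<^sup>+\<alpha>. indicator {0..<c} \<alpha> * ennreal (\<alpha> powr e) \<partial>lborel) = ennreal (c powr (e + 1) / (e + 1))"
proof -
  have "(\<integral>\<^sup>+\<alpha>. indicator {0..<c} \<alpha> * ennreal (\<alpha> powr e) \<partial>lborel) = (\<integral>\<^sup>+\<alpha>. ennreal (if \<alpha> \<in> {0..c} then \<alpha> powr e else 0) \<partial>lborel)"
    by (rule nn_integral_cong_AE) (use AE_lborel_singleton[of c] in \<open>eventually_elim, auto simp: indicator_def\<close>)
  also have "\<dots> = ennreal (c powr (e + 1) / (e + 1))"
    by (rule nn_integral_has_integral_lborel) (use has_integral_powr_from_0[OF assms(2,1)] in \<open>simp_all only: has_integral_restrict_UNIV\<close>, auto)
  finally show ?thesis .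
qed

lemma nn_integral_powr_to_inf:
  assumes "0 < c" "e < - 1"
  shows "(\<integral>\<^sup>+\<alpha>. indicator {c..} \<alpha> * ennreal (\<alpha> powr e) \<partial>lborel) = ennreal (c powr (e + 1) / - (e + 1))"
proof -
  have "(\<integral>\<^sup>+\<alpha>. indicator {c..} \<alpha> * ennreal (\<alpha> powr e) \<partial>lborel) = (\<integral>\<^sup>+\<alpha>. ennreal (if \<alpha> \<in> {c..} then \<alpha> powr e else 0) \<partial>lborel)"
    by (intro nn_integral_cong) (auto simp: indicator_def)
  also have "\<dots> = ennreal (- (c powr (e + 1)) / (e + 1))"
    by (rule nn_integral_has_integral_lborel) (use has_integral_powr_to_inf[OF assms(2,1)] in \<open>simp_all only: has_integral_restrict_UNIV\<close>, auto)
  also have "- (c powr (e + 1)) / (e + 1) = c powr (e + 1) / - (e + 1)" using assms by (simp add: field_simps)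
  finally show ?thesis .
qed

lemma tonelli_indicator:
  fixes h :: "'a::euclidean_space \<Rightarrow> ennreal" and w :: "real \<Rightarrow> ennreal"
  assumes h: "h \<in> borel_measurable lebesgue" and w: "w \<in> borel_measurable lborel"
    and E: "E \<in> sets (lebesgue \<Otimes>\<^sub>M lborel)"
  shows "(\<integral>\<^sup>+\<alpha>. w \<alpha> * (\<integral>\<^sup>+x. h x * indicator E (x, \<alpha>) \<partial>lebesgue) \<partial>lborel) =
    (\<integral>\<^sup>+x. h x * (\<integral>\<^sup>+\<alpha>. w \<alpha> * indicator E (x, \<alpha>) \<partial>lborel) \<partial>lebesgue)"
proof -
  have i: "indicator E \<in> borel_measurable (lebesgue \<Otimes>\<^sub>M lborel)" using E by (rule borel_measurable_indicator)
  have s: "(\<lambda>x. indicator E (x, \<alpha>)) \<in> borel_measurable lebesgue" "(\<lambda>\<alpha>. indicator E (x, \<alpha>)) \<in> borel_measurable lborel" for x \<alpha>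
    using measurable_compose[OF measurable_Pair2' i, of \<alpha>] measurable_compose[OF measurable_Pair1' i, of x] by auto
  have "(\<integral>\<^sup>+\<alpha>. w \<alpha> * (\<integral>\<^sup>+x. h x * indicator E (x, \<alpha>) \<partial>lebesgue) \<partial>lborel) =
      (\<integral>\<^sup>+\<alpha>. \<integral>\<^sup>+x. h x * (w \<alpha> * indicator E (x, \<alpha>)) \<partial>lebesgue \<partial>lborel)"
    by (intro nn_integral_cong, subst nn_integral_cmult[symmetric])
      (auto simp: mult_ac intro!: borel_measurable_times_ennreal h s)
  also have "\<dots> = (\<integral>\<^sup>+x. \<integral>\<^sup>+\<alpha>. h x * (w \<alpha> * indicator E (x, \<alpha>)) \<partial>lborel \<partial>lebesgue)"
    by (rule lebesgue_pair.Fubini')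
      (auto simp: split_beta' intro!: borel_measurable_times_ennreal i measurable_compose[OF measurable_fst h] measurable_compose[OF measurable_snd w])
  also have "\<dots> = (\<integral>\<^sup>+x. h x * (\<integral>\<^sup>+\<alpha>. w \<alpha> * indicator E (x, \<alpha>) \<partial>lborel) \<partial>lebesgue)"
    by (intro nn_integral_cong nn_integral_cmult borel_measurable_times_ennreal w s)
  finally show ?thesis .
qed

lemma powr_weight_measurable: "(\<lambda>\<alpha>. indicator {0..} \<alpha> * ennreal (a * \<alpha> powr e)) \<in> borel_measurable (lborel :: real measure)"
  by (intro borel_measurable_times_ennreal measurable_compose[OF _ measurable_ennreal] borel_measurable_times powr_real_measurable) auto

text \<open>Tonelli's theorem applied to \<open>h x powr a\<close> as the integral of
  \<open>a * \<alpha> powr (a - 1)\<close> over the heights below \<open>h x\<close>.\<close>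

lemma layer_cake:
  fixes h :: "'a::euclidean_space \<Rightarrow> real"
  assumes h: "h \<in> borel_measurable lebesgue" "\<And>x. 0 \<le> h x" and a: "0 < a"
  shows "(\<integral>\<^sup>+x. ennreal (h x powr a) \<partial>lebesgue) =
    (\<integral>\<^sup>+\<alpha>. (indicator {0..} \<alpha> * ennreal (a * \<alpha> powr (a - 1))) * emeasure lebesgue {x. \<alpha> < h x} \<partial>lborel)"
proof -
  let ?w = "\<lambda>\<alpha>. indicator {0..} \<alpha> * ennreal (a * \<alpha> powr (a - 1))"
  let ?E = "{p \<in> space (lebesgue \<Otimes>\<^sub>M lborel). snd p < h (fst p)}"
  have E: "?E \<in> sets (lebesgue \<Otimes>\<^sub>M lborel)"
    by (intro borel_measurable_less measurable_compose[OF measurable_fst h(1)]) measurable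
  have sets: "{x. \<alpha> < h x} \<in> sets lebesgue" for \<alpha>
    using borel_measurable_less[OF borel_measurable_const h(1), of \<alpha>] by simp
  have "(\<integral>\<^sup>+\<alpha>. ?w \<alpha> * emeasure lebesgue {x. \<alpha> < h x} \<partial>lborel) =
      (\<integral>\<^sup>+\<alpha>. ?w \<alpha> * (\<integral>\<^sup>+x. 1 * indicator ?E (x, \<alpha>) \<partial>lebesgue) \<partial>lborel)"
  proof (intro nn_integral_cong arg_cong2[where f = "(*)"] refl)
    fix \<alpha>
    have "(\<integral>\<^sup>+x. 1 * indicator ?E (x, \<alpha>) \<partial>lebesgue) = (\<integral>\<^sup>+x. indicator {x. \<alpha> < h x} x \<partial>lebesgue)"
      by (intro nn_integral_cong) (auto simp: indicator_def space_pair_measure)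
    then show "emeasure lebesgue {x. \<alpha> < h x} = (\<integral>\<^sup>+x. 1 * indicator ?E (x, \<alpha>) \<partial>lebesgue)"
      using nn_integral_indicator[OF sets] by simp
  qed
  also have "\<dots> = (\<integral>\<^sup>+x. 1 * (\<integral>\<^sup>+\<alpha>. ?w \<alpha> * indicator ?E (x, \<alpha>) \<partial>lborel) \<partial>lebesgue)"
    by (rule tonelli_indicator[OF borel_measurable_const powr_weight_measurable E])
  also have "\<dots> = (\<integral>\<^sup>+x. ennreal (h x powr a) \<partial>lebesgue)"
  proof (rule nn_integral_cong)
    fix x
    have "1 * (\<integral>\<^sup>+\<alpha>. ?w \<alpha> * indicator ?E (x, \<alpha>) \<partial>lborel) =
        (\<integral>\<^sup>+\<alpha>. ennreal a * (indicator {0..<h x} \<alpha> * ennreal (\<alpha> powr (a - 1))) \<partial>lborel)"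
      using a by (simp, intro nn_integral_cong) (auto simp: indicator_def ennreal_mult space_pair_measure)
    also have "\<dots> = ennreal a * ennreal (h x powr a / a)"
      using a h(2)[of x] nn_integral_powr_from_0[of "h x" "a - 1"]
      by (subst nn_integral_cmult) (auto intro!: borel_measurable_times_ennreal)
    also have "\<dots> = ennreal (h x powr a)" using a by (simp flip: ennreal_mult)
    finally show "1 * (\<integral>\<^sup>+\<alpha>. ?w \<alpha> * indicator ?E (x, \<alpha>) \<partial>lborel) = ennreal (h x powr a)" .
  qed
  finally show ?thesis ..
qed

text \<open>\<open>B\<close> is a real bound for the weak \<open>L^t\<close> quasinorm. Writing it
  level by level lets it be used, and proved, at a single height.\<close>

definition weak_bounded :: "real \<Rightarrow> real \<Rightarrow> ('a::euclidean_space \<Rightarrow> 'b::real_normed_vector) \<Rightarrow> bool"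
  where "weak_bounded t B f \<longleftrightarrow> (\<forall>\<alpha>>0. emeasure lebesgue {x. \<alpha> < norm (f x)} \<le> ennreal ((B / \<alpha>) powr t))"

lemma weak_boundedD: "weak_bounded t B f \<Longrightarrow> 0 < \<alpha> \<Longrightarrow> emeasure lebesgue {x. \<alpha> < norm (f x)} \<le> ennreal ((B / \<alpha>) powr t)"
  by (simp add: weak_bounded_def)

lemma sets_norm_less:
  assumes "strongly_measurable lebesgue f"
  shows "{x. \<alpha> < norm (f x)} \<in> sets lebesgue" "{x. norm (f x) \<le> \<alpha>} \<in> sets lebesgue"
  using borel_measurable_less[OF borel_measurable_const strongly_measurable_norm[OF assms], of \<alpha>]
    borel_measurable_le[OF strongly_measurable_norm[OF assms] borel_measurable_const, of \<alpha>] by simp_all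

lemma chebyshev:
  fixes f :: "'a::euclidean_space \<Rightarrow> 'b::real_normed_vector"
  assumes f: "strongly_measurable lebesgue f" and \<delta>: "0 < \<delta>" and q: "0 < q"
    and M: "0 \<le> M" "(\<integral>\<^sup>+x. ennreal (norm (f x) powr q) \<partial>lebesgue) \<le> ennreal M"
  shows "emeasure lebesgue {x. \<delta> < norm (f x)} \<le> ennreal (M * (1 / \<delta>) powr q)"
proof -
  have "ennreal (\<delta> powr q) * emeasure lebesgue {x. \<delta> < norm (f x)} =
      (\<integral>\<^sup>+x. ennreal (\<delta> powr q) * indicator {x. \<delta> < norm (f x)} x \<partial>lebesgue)"
    by (rule nn_integral_cmult_indicator[symmetric, OF sets_norm_less(1)[OF f]])
  also have "\<dots> \<le> (\<integral>\<^sup>+x. ennreal (norm (f x) powr q) \<partial>lebesgue)"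
    using \<delta> q by (intro nn_integral_mono) (auto simp: indicator_def intro!: ennreal_leI powr_mono2)
  finally have *: "ennreal (\<delta> powr q) * emeasure lebesgue {x. \<delta> < norm (f x)} \<le> ennreal M"
    using M(2) by (rule order_trans)
  have "emeasure lebesgue {x. \<delta> < norm (f x)} =
      ennreal ((1 / \<delta>) powr q) * (ennreal (\<delta> powr q) * emeasure lebesgue {x. \<delta> < norm (f x)})"
    unfolding mult.assoc[symmetric] using \<delta> by (simp add: powr_mult[symmetric] flip: ennreal_mult)
  also have "\<dots> \<le> ennreal ((1 / \<delta>) powr q) * ennreal M" using * by (rule mult_left_mono) simp
  finally show ?thesis using M(1) by (simp add: ennreal_mult[symmetric] mult.commute)
qed

text \<open>Up to height \<kappa> the distribution function is bounded by its bound at \<kappa>,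
  which contributes \<open>B powr t * \<kappa> powr (1 - t)\<close>. The tail contributes
  \<open>1 / (t - 1)\<close> times the same, whence the factor \<open>t / (t - 1)\<close>.\<close>

lemma weak_large_part:
  fixes f :: "'a::euclidean_space \<Rightarrow> 'b::real_normed_vector"
  assumes f: "strongly_measurable lebesgue f" and w: "weak_bounded t B f" and t: "1 < t" and B: "0 < B" and \<kappa>: "0 < \<kappa>"
  shows "(\<integral>\<^sup>+x. ennreal (norm (indicator {x. \<kappa> < norm (f x)} x *\<^sub>R f x)) \<partial>lebesgue) \<le>
    ennreal (t / (t - 1) * B powr t * \<kappa> powr (1 - t))"
proof -
  let ?h = "\<lambda>x. norm (indicator {x. \<kappa> < norm (f x)} x *\<^sub>R f x)"
  have hm: "?h \<in> borel_measurable lebesgue"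
    by (intro strongly_measurable_norm strongly_measurable_indicator sets_norm_less f)
  have "(\<integral>\<^sup>+x. ennreal (?h x) \<partial>lebesgue) = (\<integral>\<^sup>+x. ennreal (?h x powr 1) \<partial>lebesgue)" by simp
  also have "\<dots> = (\<integral>\<^sup>+\<alpha>. (indicator {0..} \<alpha> * ennreal (1 * \<alpha> powr (1 - 1))) * emeasure lebesgue {x. \<alpha> < ?h x} \<partial>lborel)"
    by (rule layer_cake[OF hm]) auto
  also have "\<dots> \<le> (\<integral>\<^sup>+\<alpha>. ennreal ((B / \<kappa>) powr t) * indicator {0..<\<kappa>} \<alpha> + ennreal (B powr t) * (indicator {\<kappa>..} \<alpha> * ennreal (\<alpha> powr - t)) \<partial>lborel)"
  proof (rule nn_integral_mono)
    fix \<alpha> :: real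
    show "(indicator {0..} \<alpha> * ennreal (1 * \<alpha> powr (1 - 1))) * emeasure lebesgue {x. \<alpha> < ?h x} \<le>
        ennreal ((B / \<kappa>) powr t) * indicator {0..<\<kappa>} \<alpha> + ennreal (B powr t) * (indicator {\<kappa>..} \<alpha> * ennreal (\<alpha> powr - t))"
    proof (cases "0 < \<alpha>")
      case True
      have "emeasure lebesgue {x. \<alpha> < ?h x} \<le> emeasure lebesgue {x. max \<alpha> \<kappa> < norm (f x)}"
        using True by (intro emeasure_mono sets_norm_less f) (auto simp: indicator_def split: if_splits)
      also have "\<dots> \<le> ennreal ((B / max \<alpha> \<kappa>) powr t)" using True by (intro weak_boundedD[OF w]) auto
      finally have *: "emeasure lebesgue {x. \<alpha> < ?h x} \<le> ennreal ((B / max \<alpha> \<kappa>) powr t)" .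
      show ?thesis
      proof (cases "\<alpha> < \<kappa>")
        case True
        then show ?thesis using * \<open>0 < \<alpha>\<close> by (simp add: max_def)
      next
        case False
        then have "(B / max \<alpha> \<kappa>) powr t = B powr t * \<alpha> powr - t"
          using B \<open>0 < \<alpha>\<close> by (simp add: max_def powr_divide powr_minus_divide)
        with * have "emeasure lebesgue {x. \<alpha> < ?h x} \<le> ennreal (B powr t) * ennreal (\<alpha> powr - t)"
          by (simp only: ennreal_mult powr_ge_zero)
        then show ?thesis using False \<open>0 < \<alpha>\<close> by (simp del: indicator_simps add: indicator_def)
      qed
    next
      case False
      then show ?thesis by (cases "\<alpha> = 0") (simp_all add: indicator_def)
    qed
  qed
  also have "\<dots> = ennreal ((B / \<kappa>) powr t) * ennreal \<kappa> + ennreal (B powr t) * ennreal (\<kappa> powr (- t + 1) / - (- t + 1))"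
    using nn_integral_powr_to_inf[of \<kappa> "- t"] \<kappa> t
    by (subst nn_integral_add) (auto simp: nn_integral_cmult nn_integral_cmult_indicator intro!: borel_measurable_times_ennreal)
  also have "\<dots> = ennreal ((B / \<kappa>) powr t * \<kappa> + B powr t * (\<kappa> powr (- t + 1) / - (- t + 1)))"
    using \<kappa> t by (simp flip: ennreal_plus ennreal_mult)
  also have "(B / \<kappa>) powr t * \<kappa> + B powr t * (\<kappa> powr (- t + 1) / - (- t + 1)) = t / (t - 1) * B powr t * \<kappa> powr (1 - t)"
  proof -
    have "(B / \<kappa>) powr t * \<kappa> = B powr t * \<kappa> powr (1 - t)" using B \<kappa> by (simp add: powr_divide powr_diff)
    then show ?thesis using t by (simp add: field_simps)
  qed
  finally show ?thesis .
qed

text \<open>Level sets at heights above \<kappa> are empty, and below \<kappa> the weak bound leaves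
  the power \<open>s - t - 1\<close>, which is integrable at 0 because \<open>t < s\<close>.\<close>

lemma weak_small_part:
  fixes f :: "'a::euclidean_space \<Rightarrow> 'b::real_normed_vector"
  assumes f: "strongly_measurable lebesgue f" and w: "weak_bounded t B f" and t: "0 < t" "t < s" and B: "0 < B" and \<kappa>: "0 < \<kappa>"
  shows "(\<integral>\<^sup>+x. ennreal (norm (indicator {x. norm (f x) \<le> \<kappa>} x *\<^sub>R f x) powr s) \<partial>lebesgue) \<le>
    ennreal (s / (s - t) * B powr t * \<kappa> powr (s - t))"
proof -
  let ?h = "\<lambda>x. norm (indicator {x. norm (f x) \<le> \<kappa>} x *\<^sub>R f x)"
  have hm: "?h \<in> borel_measurable lebesgue"
    by (intro strongly_measurable_norm strongly_measurable_indicator sets_norm_less f)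
  have "(\<integral>\<^sup>+x. ennreal (?h x powr s) \<partial>lebesgue) = (\<integral>\<^sup>+\<alpha>. (indicator {0..} \<alpha> * ennreal (s * \<alpha> powr (s - 1))) * emeasure lebesgue {x. \<alpha> < ?h x} \<partial>lborel)"
    by (rule layer_cake[OF hm]) (use t in auto)
  also have "\<dots> \<le> (\<integral>\<^sup>+\<alpha>. ennreal (s * B powr t) * (indicator {0..<\<kappa>} \<alpha> * ennreal (\<alpha> powr (s - t - 1))) \<partial>lborel)"
  proof (rule nn_integral_mono)
    fix \<alpha> :: real
    show "(indicator {0..} \<alpha> * ennreal (s * \<alpha> powr (s - 1))) * emeasure lebesgue {x. \<alpha> < ?h x} \<le>
        ennreal (s * B powr t) * (indicator {0..<\<kappa>} \<alpha> * ennreal (\<alpha> powr (s - t - 1)))"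
    proof (cases "0 < \<alpha> \<and> \<alpha> < \<kappa>")
      case True
      have "emeasure lebesgue {x. \<alpha> < ?h x} \<le> emeasure lebesgue {x. \<alpha> < norm (f x)}"
        using True by (intro emeasure_mono sets_norm_less f) (auto simp: indicator_def split: if_splits)
      also have "\<dots> \<le> ennreal ((B / \<alpha>) powr t)" using True by (intro weak_boundedD[OF w]) auto
      finally have "ennreal (s * \<alpha> powr (s - 1)) * emeasure lebesgue {x. \<alpha> < ?h x} \<le> ennreal (s * \<alpha> powr (s - 1)) * ennreal ((B / \<alpha>) powr t)"
        by (rule mult_left_mono) simp
      also have "\<dots> = ennreal (s * B powr t) * ennreal (\<alpha> powr (s - t - 1))"
        using True B t by (simp flip: ennreal_mult) (simp add: powr_divide powr_diff powr_add field_simps)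
      finally have *: "ennreal (s * \<alpha> powr (s - 1)) * emeasure lebesgue {x. \<alpha> < ?h x} \<le> \<dots>" .
      have "indicator {0..} \<alpha> = (1 :: ennreal)" "indicator {0..<\<kappa>} \<alpha> = (1 :: ennreal)" using True by auto
      then show ?thesis using * by (simp only: mult_1)
    next
      case False
      have "{x. \<alpha> < ?h x} = {}" if "\<kappa> \<le> \<alpha>" using that \<kappa> by (auto simp: indicator_def)
      with False show ?thesis by (cases "\<alpha> = 0") (auto simp: indicator_def not_less)
    qed
  qed
  also have "\<dots> = ennreal (s * B powr t) * ennreal (\<kappa> powr (s - t) / (s - t))"
    using nn_integral_powr_from_0[of \<kappa> "s - t - 1"] \<kappa> t
    by (subst nn_integral_cmult) (auto intro!: borel_measurable_times_ennreal)
  also have "\<dots> = ennreal (s / (s - t) * B powr t * \<kappa> powr (s - t))"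
  proof -
    have "s * B powr t * (\<kappa> powr (s - t) / (s - t)) = s / (s - t) * B powr t * \<kappa> powr (s - t)" by (simp add: mult_ac)
    then show ?thesis using t by (simp flip: ennreal_mult)
  qed
  finally show ?thesis .
qed

lemma weak_bounded_split_large_integrable:
  fixes f :: "'a::euclidean_space \<Rightarrow> 'b::real_normed_vector"
  assumes "strongly_measurable lebesgue f" "weak_bounded t B f" "1 < t" "0 < B" "0 < \<kappa>"
  shows "sintegrable (\<lambda>x. indicator {x. \<kappa> < norm (f x)} x *\<^sub>R f x)"
  using weak_large_part[OF assms] assms(1)
  by (auto simp: sintegrable_def intro!: strongly_measurable_indicator sets_norm_less intro: le_less_trans)

text \<open>The result of inserting the cut height of \<open>weak_fourier\<close> into Chebyshev's
  bound for the small part. In logarithms the identity is linear, and the powers of \<open>B\<close>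
  and of \<open>L\<close> come out as \<open>t / (t - 1)\<close> with opposite signs.\<close>

lemma weak_fourier_exponents:
  fixes s t B L K a c :: real
  assumes "1 < t" "t < s" "0 < B" "0 < L" "0 < K" "0 < a" "0 < c"
  shows "K * (c * B powr t * ((2 * a * B powr t / L) powr (1 / (t - 1))) powr (s - t)) powr (1 / (s - 1)) * (2 / L) powr (s / (s - 1)) =
    (K * c powr (1 / (s - 1)) * (2 * a) powr ((s - t) / ((s - 1) * (t - 1))) * 2 powr (s / (s - 1))) * (B / L) powr (t / (t - 1))"
proof -
  define b l k d where "b = ln B" and "l = ln L" and "k = ln (2 * a)" and "d = ln c"
  have e: "B = exp b" "L = exp l" "2 * a = exp k" "c = exp d" "2 = exp (ln 2 :: real)"
    using assms by (auto simp: b_def l_def k_def d_def)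
  have p: "exp u powr v = exp (u * v)" for u v :: real by (simp add: powr_def mult.commute)
  have q: "exp u / exp v = exp (u - v)" for u v :: real by (simp add: exp_diff)
  have 1: "((2 * a * B powr t / L) powr (1 / (t - 1))) powr (s - t) = exp ((k + b * t - l) * (1 / (t - 1)) * (s - t))"
    unfolding e(1-4) p q exp_add[symmetric] ..
  have 2: "c * B powr t * exp ((k + b * t - l) * (1 / (t - 1)) * (s - t)) = exp (d + b * t + (k + b * t - l) * (1 / (t - 1)) * (s - t))"
    unfolding e(1,4) p exp_add ..
  have 3: "(2 / L) powr (s / (s - 1)) = exp ((ln 2 - l) * (s / (s - 1)))" "2 powr (s / (s - 1)) = exp (ln 2 * (s / (s - 1)))"
    using p[of "ln 2 - l" "s / (s - 1)"] p[of "ln 2" "s / (s - 1)"] by (simp_all add: e(2) exp_diff)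
  have 4: "c powr (1 / (s - 1)) = exp (d * (1 / (s - 1)))" "(2 * a) powr ((s - t) / ((s - 1) * (t - 1))) = exp (k * ((s - t) / ((s - 1) * (t - 1))))"
    "(B / L) powr (t / (t - 1)) = exp ((b - l) * (t / (t - 1)))"
    unfolding e(1-4) p q by simp_all
  have "(d + b * t + (k + b * t - l) * (1 / (t - 1)) * (s - t)) * (1 / (s - 1)) + (ln 2 - l) * (s / (s - 1)) =
      d * (1 / (s - 1)) + k * ((s - t) / ((s - 1) * (t - 1))) + ln 2 * (s / (s - 1)) + (b - l) * (t / (t - 1))"
    using assms(1,2) by (simp add: divide_simps) algebra
  then show ?thesis
    unfolding 1 2 3 4 p by (simp add: mult.assoc exp_add[symmetric])
qed

text \<open>Splitting \<open>f\<close> at the height at which the transform of the large part is at most half the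
  level in question.\<close>

lemma weak_fourier:
  assumes F: "fourier_bounded TYPE('d::euclidean_space) TYPE('x::complex_banach) s K" and st: "1 < t" "t < s" and K: "0 \<le> K" and x0: "(x0::'x) \<noteq> 0"
  obtains c where "0 < c" "\<And>(\<sigma> :: real) (f :: 'd \<Rightarrow> 'x) B. \<sigma> \<in> {1, - 1} \<Longrightarrow> strongly_measurable lebesgue f \<Longrightarrow> 0 < B \<Longrightarrow> weak_bounded t B f \<Longrightarrow>
    \<exists>g. has_fourier \<sigma> f g \<and> weak_bounded (t / (t - 1)) (c * B) g"
proof -
  let ?q = "s / (s - 1)" and ?t' = "t / (t - 1)"
  have s: "1 < s" using st by simp
  define a where "a = t / (t - 1)"
  define b where "b = s / (s - t)"
  have ab: "0 < a" "0 < b" using st by (auto simp: a_def b_def)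
  \<comment> \<open>Read off from \<open>weak_fourier_exponents\<close> with \<open>b\<close> in
    place of \<open>c\<close> and with \<open>K + 1\<close> in place of \<open>K\<close>, which has
    to be positive there.\<close>
  define C0 where "C0 = (K + 1) * b powr (1 / (s - 1)) * (2 * a) powr ((s - t) / ((s - 1) * (t - 1))) * 2 powr ?q"
  have C0: "0 < C0" using K ab by (auto simp: C0_def)
  \<comment> \<open>Taking the root moves the constant inside the power in
    \<open>weak_bounded\<close>.\<close>
  define c where "c = C0 powr (1 / ?t')"
  have c: "0 < c" using C0 by (simp add: c_def)
  have ct: "c powr ?t' = C0" using C0 st by (simp add: c_def powr_powr)
  show ?thesis
  proof (rule that[OF c])
    fix \<sigma> :: real and f :: "'d \<Rightarrow> 'x" and B :: real
    assume \<sigma>: "\<sigma> \<in> {1, - 1}" and f: "strongly_measurable lebesgue f" and B: "0 < B" and w: "weak_bounded t B f"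
    define fl where "fl = (\<lambda>\<kappa> x. indicator {x. \<kappa> < norm (f x)} x *\<^sub>R f x)"
    define fs where "fs = (\<lambda>\<kappa> x. indicator {x. norm (f x) \<le> \<kappa>} x *\<^sub>R f x)"
    have fli: "sintegrable (fl \<kappa>)" if "0 < \<kappa>" for \<kappa>
      unfolding fl_def by (rule weak_bounded_split_large_integrable[OF f w st(1) B that])
    have fsm: "strongly_measurable lebesgue (fs \<kappa>)" for \<kappa>
      unfolding fs_def by (intro strongly_measurable_indicator sets_norm_less f)
    have sum: "f = (\<lambda>x. fl \<kappa> x + fs \<kappa> x)" for \<kappa>
      by (auto simp: fl_def fs_def indicator_def fun_eq_iff not_le)
    have dec: "\<exists>g2. has_fourier \<sigma> f (\<lambda>x. sfourier \<sigma> (fl \<kappa>) x + g2 x) \<and> strongly_measurable lebesgue g2 \<and>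
      (\<integral>\<^sup>+x. ennreal (norm (g2 x) powr ?q) \<partial>lebesgue) \<le> ennreal (K * (b * B powr t * \<kappa> powr (s - t)) powr (1 / (s - 1)))"
      if \<kappa>: "0 < \<kappa>" for \<kappa>
    proof -
      have b0: "0 \<le> b * B powr t * \<kappa> powr (s - t)" using ab by simp
      have "(\<integral>\<^sup>+x. ennreal (norm (fs \<kappa> x) powr s) \<partial>lebesgue) \<le> ennreal (b * B powr t * \<kappa> powr (s - t))"
        unfolding fs_def b_def using st by (intro weak_small_part[OF f w _ _ B \<kappa>]) auto
      from has_fourier_Ls[OF F s K x0 \<sigma> fsm b0 this]
      obtain g2 where g2: "has_fourier \<sigma> (fs \<kappa>) g2"
        "(\<integral>\<^sup>+x. ennreal (norm (g2 x) powr ?q) \<partial>lebesgue) \<le> ennreal (K * (b * B powr t * \<kappa> powr (s - t)) powr (1 / (s - 1)))" by blast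
      have "has_fourier \<sigma> (\<lambda>x. fl \<kappa> x + fs \<kappa> x) (\<lambda>x. sfourier \<sigma> (fl \<kappa>) x + g2 x)"
        by (intro has_fourier_add has_fourier_L1 fli \<kappa> g2)
      then show ?thesis using g2 sum[of \<kappa>] by (auto dest: has_fourierD(3))
    qed
    \<comment> \<open>Any height produces the transform. Here it is fixed once; by uniqueness the
      decompositions at all other heights represent the same function almost everywhere.\<close>
    obtain g where g: "has_fourier \<sigma> f g" using dec[of 1] by auto
    have "weak_bounded ?t' (c * B) g"
      unfolding weak_bounded_def
    proof (intro allI impI)
      fix \<delta> :: real assume \<delta>: "0 < \<delta>"
      \<comment> \<open>The solution of
        \<open>a * B powr t * \<kappa> powr (1 - t) = \<delta> / 2\<close>: the left side bounds the
        \<open>L^1\<close> norm of the large part and so its transform.\<close>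
      define \<kappa> where "\<kappa> = (2 * a * B powr t / \<delta>) powr (1 / (t - 1))"
      have \<kappa>: "0 < \<kappa>" using ab B \<delta> by (simp add: \<kappa>_def)
      obtain g2 where g2: "has_fourier \<sigma> f (\<lambda>x. sfourier \<sigma> (fl \<kappa>) x + g2 x)" "strongly_measurable lebesgue g2"
        "(\<integral>\<^sup>+x. ennreal (norm (g2 x) powr ?q) \<partial>lebesgue) \<le> ennreal (K * (b * B powr t * \<kappa> powr (s - t)) powr (1 / (s - 1)))"
        using dec[OF \<kappa>] by blast
      have "\<kappa> powr (1 - t) = (2 * a * B powr t / \<delta>) powr (- 1)"
      proof -
        have "1 / (t - 1) * (1 - t) = - 1" using st by (simp add: divide_simps)
        then show ?thesis by (simp only: \<kappa>_def powr_powr)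
      qed
      also have "\<dots> = \<delta> / (2 * a * B powr t)"
        using ab B \<delta> by (simp add: powr_minus_divide)
      finally have "a * B powr t * \<kappa> powr (1 - t) = \<delta> / 2" using ab B by simp
      then have "(\<integral>\<^sup>+x. ennreal (norm (fl \<kappa> x)) \<partial>lebesgue) \<le> ennreal (\<delta> / 2)"
        using weak_large_part[OF f w st(1) B \<kappa>] by (simp only: fl_def a_def)
      then have g1: "norm (sfourier \<sigma> (fl \<kappa>) x) \<le> \<delta> / 2" for x
        using \<delta> by (intro sfourier_bounded fli \<kappa>) auto
      have ae: "AE x in lebesgue. g x = sfourier \<sigma> (fl \<kappa>) x + g2 x"
        by (rule has_fourier_unique[OF g g2(1)]) simp
      have "emeasure lebesgue {x. \<delta> < norm (g x)} \<le> emeasure lebesgue {x. \<delta> / 2 < norm (g2 x)}"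
      proof (rule emeasure_mono_AE)
        show "AE x in lebesgue. x \<in> {x. \<delta> < norm (g x)} \<longrightarrow> x \<in> {x. \<delta> / 2 < norm (g2 x)}"
          using ae
        proof eventually_elim
          case (elim x)
          show ?case using g1[of x] norm_triangle_ineq[of "sfourier \<sigma> (fl \<kappa>) x" "g2 x"] by (auto simp: elim)
        qed
      qed (rule sets_norm_less[OF g2(2)])
      also have "\<dots> \<le> ennreal (K * (b * B powr t * \<kappa> powr (s - t)) powr (1 / (s - 1)) * (1 / (\<delta> / 2)) powr ?q)"
        using \<delta> s K by (intro chebyshev[OF g2(2) _ _ _ g2(3)]) auto
      also have "\<dots> \<le> ennreal ((K + 1) * (b * B powr t * \<kappa> powr (s - t)) powr (1 / (s - 1)) * (2 / \<delta>) powr ?q)"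
        by (intro ennreal_leI) (auto intro!: mult_right_mono)
      also have "(K + 1) * (b * B powr t * \<kappa> powr (s - t)) powr (1 / (s - 1)) * (2 / \<delta>) powr ?q = C0 * (B / \<delta>) powr ?t'"
        unfolding \<kappa>_def C0_def using K by (intro weak_fourier_exponents st B \<delta> ab) simp
      also have "\<dots> = (c * B / \<delta>) powr ?t'"
        using powr_mult[of c "B / \<delta>" ?t'] by (simp add: ct)
      finally show "emeasure lebesgue {x. \<delta> < norm (g x)} \<le> ennreal ((c * B / \<delta>) powr ?t')" .
    qed
    with g show "\<exists>g. has_fourier \<sigma> f g \<and> weak_bounded ?t' (c * B) g" by blast
  qed
qed

text \<open>If the product exceeds \<alpha>, then one factor is large: \<open>norm (m \<xi>)\<close>
  exceeds \<open>\<alpha> / \<beta>\<close> or \<open>norm (g \<xi>)\<close> exceeds \<beta>. The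
  exponent is the one with \<open>1 / u = 1 / r + 1 / t\<close>, and \<open>1 <= u\<close> allows
  the factor 2 for the two level sets to be drawn into the power.\<close>

lemma weak_hoelder:
  fixes m :: "'a::euclidean_space \<Rightarrow> 'x::real_normed_vector \<Rightarrow>\<^sub>L 'y::real_normed_vector"
  assumes m: "(\<lambda>\<xi>. norm (m \<xi>)) \<in> borel_measurable lebesgue"
      "\<And>\<alpha>. 0 < \<alpha> \<Longrightarrow> emeasure lebesgue {\<xi>. \<alpha> < norm (m \<xi>)} \<le> ennreal ((A / \<alpha>) powr r)"
    and g: "strongly_measurable lebesgue g" "weak_bounded t D g"
    and pos: "0 < A" "0 < D" "0 < r" "0 < t" and u: "u = r * t / (r + t)" "1 \<le> u"
  shows "weak_bounded u (2 * (A * D)) (\<lambda>\<xi>. blinfun_apply (m \<xi>) (g \<xi>))"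
  unfolding weak_bounded_def
proof (intro allI impI)
  fix \<alpha> :: real assume \<alpha>: "0 < \<alpha>"
  \<comment> \<open>Chosen so that both level sets receive the same bound
    \<open>(A * D / \<alpha>) powr u\<close>.\<close>
  define \<beta> where "\<beta> = (D powr t * (\<alpha> / A) powr r) powr (1 / (r + t))"
  have \<beta>: "0 < \<beta>" using pos \<alpha> by (simp add: \<beta>_def)
  have sm: "{\<xi>. \<alpha> / \<beta> < norm (m \<xi>)} \<in> sets lebesgue"
    using borel_measurable_less[OF borel_measurable_const m(1), of "\<alpha> / \<beta>"] by simp
  have e1: "(A / (\<alpha> / \<beta>)) powr r = (A * D / \<alpha>) powr u" and e2: "(D / \<beta>) powr t = (A * D / \<alpha>) powr u"
  proof -
    define a d x where "a = ln A" and "d = ln D" and "x = ln \<alpha>"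
    have e: "A = exp a" "D = exp d" "\<alpha> = exp x" using pos \<alpha> by (auto simp: a_def d_def x_def)
    have p: "exp u powr v = exp (u * v)" for u v :: real by (simp add: powr_def mult.commute)
    have q: "exp u / exp v = exp (u - v)" for u v :: real by (simp add: exp_diff)
    have b: "\<beta> = exp ((d * t + (x - a) * r) / (r + t))"
      unfolding \<beta>_def e p q exp_add[symmetric] by simp
    have "(a - (x - (d * t + (x - a) * r) / (r + t))) * r = (a + d - x) * u"
      using pos by (simp add: u(1) divide_simps) algebra
    then show "(A / (\<alpha> / \<beta>)) powr r = (A * D / \<alpha>) powr u"
      unfolding b e q p exp_add[symmetric] by simp
    have "(d - (d * t + (x - a) * r) / (r + t)) * t = (a + d - x) * u"
      using pos by (simp add: u(1) divide_simps) algebra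
    then show "(D / \<beta>) powr t = (A * D / \<alpha>) powr u"
      unfolding b e q p exp_add[symmetric] by simp
  qed
  have "emeasure lebesgue {\<xi>. \<alpha> < norm (m \<xi> (g \<xi>))} \<le> emeasure lebesgue ({\<xi>. \<alpha> / \<beta> < norm (m \<xi>)} \<union> {\<xi>. \<beta> < norm (g \<xi>)})"
  proof (intro emeasure_mono sets.Un sm sets_norm_less g subsetI)
    fix \<xi> assume "\<xi> \<in> {\<xi>. \<alpha> < norm (m \<xi> (g \<xi>))}"
    then have *: "\<alpha> < norm (m \<xi>) * norm (g \<xi>)" using norm_blinfun[of "m \<xi>" "g \<xi>"] by simp
    show "\<xi> \<in> {\<xi>. \<alpha> / \<beta> < norm (m \<xi>)} \<union> {\<xi>. \<beta> < norm (g \<xi>)}"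
    proof (rule ccontr)
      assume "\<xi> \<notin> {\<xi>. \<alpha> / \<beta> < norm (m \<xi>)} \<union> {\<xi>. \<beta> < norm (g \<xi>)}"
      then have "norm (m \<xi>) * norm (g \<xi>) \<le> (\<alpha> / \<beta>) * \<beta>" using \<alpha> \<beta> by (intro mult_mono) auto
      with * \<beta> show False by simp
    qed
  qed
  also have "\<dots> \<le> emeasure lebesgue {\<xi>. \<alpha> / \<beta> < norm (m \<xi>)} + emeasure lebesgue {\<xi>. \<beta> < norm (g \<xi>)}"
    by (intro emeasure_subadditive sm sets_norm_less g)
  also have "\<dots> \<le> ennreal ((A * D / \<alpha>) powr u) + ennreal ((A * D / \<alpha>) powr u)"
    using m(2)[of "\<alpha> / \<beta>"] weak_boundedD[OF g(2) \<beta>] \<alpha> \<beta> unfolding e1 e2 by (intro add_mono) auto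
  also have "\<dots> = ennreal (2 * (A * D / \<alpha>) powr u)" by (simp flip: ennreal_plus)
  also have "\<dots> \<le> ennreal ((2 * (A * D) / \<alpha>) powr u)"
  proof (rule ennreal_leI)
    have "2 powr 1 \<le> 2 powr u" using u(2) by (intro powr_mono) auto
    then show "2 * (A * D / \<alpha>) powr u \<le> (2 * (A * D) / \<alpha>) powr u"
      using powr_mult[of 2 "A * D / \<alpha>" u] by (simp add: mult_right_mono)
  qed
  finally show "emeasure lebesgue {\<xi>. \<alpha> < norm (m \<xi> (g \<xi>))} \<le> ennreal ((2 * (A * D) / \<alpha>) powr u)" .
qed

section \<open>Marcinkiewicz interpolation\<close>

lemma powr_less_iff:
  fixes \<alpha> h a :: real
  assumes "0 \<le> \<alpha>" "0 \<le> h" "0 < a"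
  shows "\<alpha> powr a < h \<longleftrightarrow> \<alpha> < h powr (1 / a)"
proof
  assume "\<alpha> powr a < h"
  then have "(\<alpha> powr a) powr (1 / a) < h powr (1 / a)" using assms by (intro powr_less_mono2) auto
  then show "\<alpha> < h powr (1 / a)" using assms by (simp add: powr_powr)
next
  assume "\<alpha> < h powr (1 / a)"
  then have "\<alpha> powr a < (h powr (1 / a)) powr a" using assms by (intro powr_less_mono2) auto
  then show "\<alpha> powr a < h" using assms by (simp add: powr_powr)
qed

text \<open>By Tonelli, the cut at value \<open>\<alpha> powr (q / p)\<close> becomes, at a fixed
  \<open>x\<close>, a cut of the \<alpha>-axis at \<open>norm (f x) powr (p / q)\<close>; the
  condition on \<open>e\<close> makes the powers add up to \<open>norm (f x) powr p\<close>. The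
  large part needs integrability at 0, hence \<open>a < p\<close>, the small part at infinity, hence
  \<open>p < a\<close>.\<close>

lemma nn_integral_cut:
  fixes f :: "'a::euclidean_space \<Rightarrow> 'b::real_normed_vector"
  assumes f: "strongly_measurable lebesgue f" and pq: "0 < p" "0 < q" "0 < a" and e: "e + 1 = q / p * (p - a)"
  shows "a < p \<Longrightarrow> (\<integral>\<^sup>+\<alpha>. (indicator {0..} \<alpha> * ennreal (c * \<alpha> powr e)) *
        (\<integral>\<^sup>+x. ennreal (norm (indicator {x. \<alpha> powr (q / p) < norm (f x)} x *\<^sub>R f x) powr a) \<partial>lebesgue) \<partial>lborel) =
      ennreal c * ennreal (1 / \<bar>e + 1\<bar>) * (\<integral>\<^sup>+x. ennreal (norm (f x) powr p) \<partial>lebesgue)" (is "_ \<Longrightarrow> ?thesis1")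
    and "p < a \<Longrightarrow> (\<integral>\<^sup>+\<alpha>. (indicator {0..} \<alpha> * ennreal (c * \<alpha> powr e)) *
        (\<integral>\<^sup>+x. ennreal (norm (indicator {x. norm (f x) \<le> \<alpha> powr (q / p)} x *\<^sub>R f x) powr a) \<partial>lebesgue) \<partial>lborel) =
      ennreal c * ennreal (1 / \<bar>e + 1\<bar>) * (\<integral>\<^sup>+x. ennreal (norm (f x) powr p) \<partial>lebesgue)" (is "_ \<Longrightarrow> ?thesis2")
proof -
  let ?w = "\<lambda>\<alpha>. indicator {0..} \<alpha> * ennreal (c * \<alpha> powr e)"
  let ?h = "\<lambda>x. ennreal (norm (f x) powr a)"
  let ?M = "lebesgue \<Otimes>\<^sub>M lborel :: ('a \<times> real) measure"
  have hm: "?h \<in> borel_measurable lebesgue" by (rule borel_measurable_norm_powr[OF f])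
  have nm: "(\<lambda>p. norm (f (fst p))) \<in> borel_measurable ?M" by (rule measurable_compose[OF measurable_fst strongly_measurable_norm[OF f]])
  have sm: "(\<lambda>x. snd x powr (q / p)) \<in> borel_measurable ?M" by (intro powr_real_measurable) measurable
  have E: "{x \<in> space ?M. snd x powr (q / p) < norm (f (fst x))} \<in> sets ?M" "{x \<in> space ?M. norm (f (fst x)) \<le> snd x powr (q / p)} \<in> sets ?M"
    by (intro borel_measurable_less borel_measurable_le nm sm)+
  \<comment> \<open>Both cuts at once: \<open>Q\<close> is the condition on the value at
    \<open>x\<close>, and \<open>S x\<close> the corresponding interval of heights.\<close>
  have key: "(\<integral>\<^sup>+\<alpha>. ?w \<alpha> * (\<integral>\<^sup>+x. ennreal (norm (indicator {x. Q \<alpha> x} x *\<^sub>R f x) powr a) \<partial>lebesgue) \<partial>lborel) =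
      ennreal c * ennreal (1 / \<bar>e + 1\<bar>) * (\<integral>\<^sup>+x. ennreal (norm (f x) powr p) \<partial>lebesgue)"
    if Q: "{x \<in> space ?M. Q (snd x) (fst x)} \<in> sets ?M"
      and I: "\<And>x. 0 < norm (f x) \<Longrightarrow> (\<integral>\<^sup>+\<alpha>. indicator (S x) \<alpha> * ennreal (\<alpha> powr e) \<partial>lborel) = ennreal ((norm (f x) powr (p / q)) powr (e + 1) / \<bar>e + 1\<bar>)"
      and S: "\<And>x \<alpha>. \<alpha> \<in> S x \<longleftrightarrow> 0 \<le> \<alpha> \<and> Q \<alpha> x" and Sm: "\<And>x. S x \<in> sets borel" for Q S
  proof -
    let ?E = "{x \<in> space ?M. Q (snd x) (fst x)}"
    have "(\<integral>\<^sup>+\<alpha>. ?w \<alpha> * (\<integral>\<^sup>+x. ennreal (norm (indicator {x. Q \<alpha> x} x *\<^sub>R f x) powr a) \<partial>lebesgue) \<partial>lborel) =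
        (\<integral>\<^sup>+\<alpha>. ?w \<alpha> * (\<integral>\<^sup>+x. ?h x * indicator ?E (x, \<alpha>) \<partial>lebesgue) \<partial>lborel)"
      by (intro nn_integral_cong arg_cong2[where f = "(*)"] refl) (auto simp: indicator_def space_pair_measure)
    also have "\<dots> = (\<integral>\<^sup>+x. ?h x * (\<integral>\<^sup>+\<alpha>. ?w \<alpha> * indicator ?E (x, \<alpha>) \<partial>lborel) \<partial>lebesgue)"
      by (rule tonelli_indicator[OF hm powr_weight_measurable Q])
    also have "\<dots> = (\<integral>\<^sup>+x. (ennreal c * ennreal (1 / \<bar>e + 1\<bar>)) * ennreal (norm (f x) powr p) \<partial>lebesgue)"
    proof (rule nn_integral_cong)
      fix x
      show "?h x * (\<integral>\<^sup>+\<alpha>. ?w \<alpha> * indicator ?E (x, \<alpha>) \<partial>lborel) = (ennreal c * ennreal (1 / \<bar>e + 1\<bar>)) * ennreal (norm (f x) powr p)"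
      proof (cases "f x = 0")
        case False
        then have n: "0 < norm (f x)" by simp
        have "(\<integral>\<^sup>+\<alpha>. ?w \<alpha> * indicator ?E (x, \<alpha>) \<partial>lborel) = (\<integral>\<^sup>+\<alpha>. ennreal c * (indicator (S x) \<alpha> * ennreal (\<alpha> powr e)) \<partial>lborel)"
          by (intro nn_integral_cong) (auto simp: indicator_def S space_pair_measure ennreal_mult'')
        also have "\<dots> = ennreal c * ennreal ((norm (f x) powr (p / q)) powr (e + 1) / \<bar>e + 1\<bar>)"
          using Sm[of x] by (subst nn_integral_cmult) (auto simp: I[OF n] intro!: borel_measurable_times_ennreal)
        also have "(norm (f x) powr (p / q)) powr (e + 1) = norm (f x) powr (p - a)"
          using pq by (simp add: powr_powr e)
        finally have "?h x * (\<integral>\<^sup>+\<alpha>. ?w \<alpha> * indicator ?E (x, \<alpha>) \<partial>lborel) =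
            ennreal c * (ennreal (norm (f x) powr a) * ennreal (norm (f x) powr (p - a) / \<bar>e + 1\<bar>))"
          by (simp only: mult.left_commute)
        also have "ennreal (norm (f x) powr a) * ennreal (norm (f x) powr (p - a) / \<bar>e + 1\<bar>) = ennreal (1 / \<bar>e + 1\<bar>) * ennreal (norm (f x) powr p)"
        proof -
          have "norm (f x) powr a * norm (f x) powr (p - a) = norm (f x) powr p" using n by (simp flip: powr_add)
          then show ?thesis by (simp flip: ennreal_mult)
        qed
        finally show ?thesis by (simp only: mult.assoc)
      qed (use pq in simp)
    qed
    also have "\<dots> = (ennreal c * ennreal (1 / \<bar>e + 1\<bar>)) * (\<integral>\<^sup>+x. ennreal (norm (f x) powr p) \<partial>lebesgue)"
      by (rule nn_integral_cmult[OF borel_measurable_norm_powr[OF f]])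
    finally show ?thesis .
  qed
  have L: "\<alpha> powr (q / p) < norm (f x) \<longleftrightarrow> \<alpha> < norm (f x) powr (p / q)" if "0 \<le> \<alpha>" for \<alpha> x
    using powr_less_iff[OF that norm_ge_zero, of "q / p" "f x"] pq by simp
  show ?thesis1 if "a < p"
  proof (rule key[where S = "\<lambda>x. {0..<norm (f x) powr (p / q)}"])
    have "0 < e + 1" unfolding e using pq that by simp
    then show "(\<integral>\<^sup>+\<alpha>. indicator {0..<norm (f x) powr (p / q)} \<alpha> * ennreal (\<alpha> powr e) \<partial>lborel) = ennreal ((norm (f x) powr (p / q)) powr (e + 1) / \<bar>e + 1\<bar>)" for x
      by (subst nn_integral_powr_from_0) auto
  qed (use E L in auto)
  show ?thesis2 if "p < a"
  proof (rule key[where S = "\<lambda>x. {norm (f x) powr (p / q)..}"])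
    have "e + 1 < 0" unfolding e using pq that by (intro mult_pos_neg) auto
    then show "(\<integral>\<^sup>+\<alpha>. indicator {norm (f x) powr (p / q)..} \<alpha> * ennreal (\<alpha> powr e) \<partial>lborel) = ennreal ((norm (f x) powr (p / q)) powr (e + 1) / \<bar>e + 1\<bar>)"
      if "0 < norm (f x)" for x
      using that by (subst nn_integral_powr_to_inf) auto
    show "\<alpha> \<in> {norm (f x) powr (p / q)..} \<longleftrightarrow> 0 \<le> \<alpha> \<and> norm (f x) \<le> \<alpha> powr (q / p)" for x \<alpha>
      using L[of \<alpha> x] order_trans[of 0 "norm (f x) powr (p / q)" \<alpha>] by (auto simp: not_less[symmetric])
  qed (use E in auto)
qed

lemma nn_integral_cut_measurable:
  fixes f :: "'a::euclidean_space \<Rightarrow> 'b::real_normed_vector"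
  assumes f: "strongly_measurable lebesgue f"
  shows "(\<lambda>\<alpha>. \<integral>\<^sup>+x. ennreal (norm (indicator {x. \<alpha> powr e < norm (f x)} x *\<^sub>R f x) powr a) \<partial>lebesgue) \<in> borel_measurable lborel"
    and "(\<lambda>\<alpha>. \<integral>\<^sup>+x. ennreal (norm (indicator {x. norm (f x) \<le> \<alpha> powr e} x *\<^sub>R f x) powr a) \<partial>lebesgue) \<in> borel_measurable lborel"
proof -
  let ?M = "lborel \<Otimes>\<^sub>M lebesgue :: (real \<times> 'a) measure"
  have nm: "(\<lambda>p. norm (f (snd p))) \<in> borel_measurable ?M" by (rule measurable_compose[OF measurable_snd strongly_measurable_norm[OF f]])
  have hm: "(\<lambda>p. ennreal (norm (f (snd p)) powr a)) \<in> borel_measurable ?M" by (rule measurable_compose[OF measurable_snd borel_measurable_norm_powr[OF f]])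
  have sm: "(\<lambda>x. fst x powr e) \<in> borel_measurable ?M" by (intro powr_real_measurable) measurable
  have E: "{x \<in> space ?M. fst x powr e < norm (f (snd x))} \<in> sets ?M" "{x \<in> space ?M. norm (f (snd x)) \<le> fst x powr e} \<in> sets ?M"
    by (intro borel_measurable_less borel_measurable_le nm sm)+
  have key: "(\<lambda>\<alpha>. \<integral>\<^sup>+x. ennreal (norm (indicator {x. Q \<alpha> x} x *\<^sub>R f x) powr a) \<partial>lebesgue) \<in> borel_measurable lborel"
    if Q: "{x \<in> space ?M. Q (fst x) (snd x)} \<in> sets ?M" for Q
  proof (rule lebesgue.borel_measurable_nn_integral)
    have "(\<lambda>p. if Q (fst p) (snd p) then ennreal (norm (f (snd p)) powr a) else 0) \<in> borel_measurable ?M"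
      by (intro measurable_If hm borel_measurable_const Q)
    also have "(\<lambda>p. if Q (fst p) (snd p) then ennreal (norm (f (snd p)) powr a) else 0) =
        (\<lambda>(\<alpha>, x). ennreal (norm (indicator {x. Q \<alpha> x} x *\<^sub>R f x) powr a))"
      by (auto simp: indicator_def)
    finally show "(\<lambda>(\<alpha>, x). ennreal (norm (indicator {x. Q \<alpha> x} x *\<^sub>R f x) powr a)) \<in> borel_measurable ?M" .
  qed
  from key[OF E(1)] key[OF E(2)]
  show "(\<lambda>\<alpha>. \<integral>\<^sup>+x. ennreal (norm (indicator {x. \<alpha> powr e < norm (f x)} x *\<^sub>R f x) powr a) \<partial>lebesgue) \<in> borel_measurable lborel"
    "(\<lambda>\<alpha>. \<integral>\<^sup>+x. ennreal (norm (indicator {x. norm (f x) \<le> \<alpha> powr e} x *\<^sub>R f x) powr a) \<partial>lebesgue) \<in> borel_measurable lborel" .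
qed

text \<open>On either cut \<open>norm (f x) powr (a - p)\<close> is at most
  \<open>\<kappa> powr (a - p)\<close> where \<open>f x\<close> is nonzero, since the sign of
  \<open>a - p\<close> changes together with the side of the cut.\<close>

lemma nn_integral_cut_le:
  fixes f :: "'a::euclidean_space \<Rightarrow> 'b::real_normed_vector"
  assumes f: "strongly_measurable lebesgue f" "(\<integral>\<^sup>+x. ennreal (norm (f x) powr p) \<partial>lebesgue) \<le> 1" and pos: "0 < \<kappa>" "0 < a"
    and S: "a < p \<and> S = {x. \<kappa> < norm (f x)} \<or> p < a \<and> S = {x. norm (f x) \<le> \<kappa>}"
  shows "(\<integral>\<^sup>+x. ennreal (norm (indicator S x *\<^sub>R f x) powr a) \<partial>lebesgue) \<le> ennreal (\<kappa> powr (a - p))"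
proof -
  have "(\<integral>\<^sup>+x. ennreal (norm (indicator S x *\<^sub>R f x) powr a) \<partial>lebesgue) \<le>
      (\<integral>\<^sup>+x. ennreal (\<kappa> powr (a - p)) * ennreal (norm (f x) powr p) \<partial>lebesgue)"
  proof (rule nn_integral_mono)
    fix x
    show "ennreal (norm (indicator S x *\<^sub>R f x) powr a) \<le> ennreal (\<kappa> powr (a - p)) * ennreal (norm (f x) powr p)"
    proof (cases "x \<in> S \<and> f x \<noteq> 0")
      case True
      have "norm (f x) powr a = norm (f x) powr (a - p) * norm (f x) powr p"
        using True by (simp flip: powr_add)
      also have "norm (f x) powr (a - p) \<le> \<kappa> powr (a - p)"
        using S True pos by (auto intro: powr_mono2 powr_mono2')
      finally have "norm (f x) powr a \<le> \<kappa> powr (a - p) * norm (f x) powr p" by (simp add: mult_right_mono)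
      with True show ?thesis by (simp flip: ennreal_mult)
    next
      case False
      then have "indicator S x *\<^sub>R f x = 0" by (auto simp: indicator_def)
      then have "norm (indicator S x *\<^sub>R f x) powr a = 0" by simp
      then show ?thesis by (simp only: ennreal_0 zero_le)
    qed
  qed
  also have "\<dots> = ennreal (\<kappa> powr (a - p)) * (\<integral>\<^sup>+x. ennreal (norm (f x) powr p) \<partial>lebesgue)"
    by (rule nn_integral_cmult[OF borel_measurable_norm_powr[OF f(1)]])
  also have "\<dots> \<le> ennreal (\<kappa> powr (a - p)) * 1" by (intro mult_left_mono f) simp
  finally show ?thesis by simp
qed

text \<open>The point at which the off-diagonal case \<open>a < b\<close> is handled. The weak bound
  contains \<open>M powr (b / a)\<close>; the power beyond the first is estimated by the cut height,
  and the remaining linear factor \<open>M\<close> is an integral over the cut to which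
  \<open>nn_integral_cut\<close> applies. The powers of \<delta> are collected in
  \<open>d\<close>.\<close>

lemma weak_bounded_cut:
  fixes u :: "'a::euclidean_space \<Rightarrow> 'b::real_normed_vector"
  assumes w: "weak_bounded b (c * M powr (1 / a)) u" and M: "0 \<le> M" "M \<le> (\<delta> powr (q / p)) powr (a - p)"
    and pos: "0 < \<delta>" "0 < c" "0 < a" "a \<le> b"
    and d: "d = q / p * (a - p) * (b / a - 1) - b"
  shows "emeasure lebesgue {x. \<delta> / 2 < norm (u x)} \<le> ennreal ((2 * c) powr b * \<delta> powr d) * ennreal M"
proof -
  have "emeasure lebesgue {x. \<delta> / 2 < norm (u x)} \<le> ennreal ((c * M powr (1 / a) / (\<delta> / 2)) powr b)"
    by (rule weak_boundedD[OF w]) (use pos in simp)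
  also have "\<dots> \<le> ennreal ((2 * c) powr b * \<delta> powr d * M)"
  proof (rule ennreal_leI)
    have "c * M powr (1 / a) / (\<delta> / 2) = 2 * c * (M powr (1 / a) * (1 / \<delta>))" by simp
    then have "(c * M powr (1 / a) / (\<delta> / 2)) powr b = (2 * c) powr b * (M powr (b / a) * \<delta> powr - b)"
      using pos by (simp only: powr_mult powr_powr) (simp add: powr_divide powr_minus_divide)
    also have "M powr (b / a) \<le> (\<delta> powr (q / p)) powr ((a - p) * (b / a - 1)) * M"
    proof (cases "M = 0")
      case False
      then have "M powr (b / a) = M powr (b / a - 1) * M powr 1" unfolding powr_add[symmetric] by simp
      also have "M powr (b / a - 1) \<le> ((\<delta> powr (q / p)) powr (a - p)) powr (b / a - 1)"
        using M pos by (intro powr_mono2) auto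
      finally show ?thesis using M(1) by (simp add: powr_powr mult_right_mono mult.assoc)
    qed simp
    finally have "(c * M powr (1 / a) / (\<delta> / 2)) powr b \<le> (2 * c) powr b * ((\<delta> powr (q / p)) powr ((a - p) * (b / a - 1)) * M * \<delta> powr - b)"
      by (simp add: mult_left_mono mult_right_mono)
    also have "\<dots> = (2 * c) powr b * \<delta> powr d * M"
      by (simp add: powr_powr d powr_diff powr_minus_divide mult_ac)
    finally show "(c * M powr (1 / a) / (\<delta> / 2)) powr b \<le> (2 * c) powr b * \<delta> powr d * M" .
  qed
  finally show ?thesis using M(1) by (simp add: ennreal_mult)
qed

text \<open>The operator is given as a relation, additive and single-valued almost everywhere,
  because it acts on two spaces at once. Here the sign indexes the endpoints: 1 belongs to the large
  part, with exponent below \<open>p\<close>, and - 1 to the small part. The condition on the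
  reciprocals puts both endpoints on a line of slope 1 through \<open>(1 / p, 1 / q)\<close>; the
  matching cut height at level \<delta> is \<open>\<delta> powr (q / p)\<close>.\<close>

lemma marcinkiewicz:
  fixes R :: "('a::euclidean_space \<Rightarrow> 'x::real_normed_vector) \<Rightarrow> ('a \<Rightarrow> 'y::real_normed_vector) \<Rightarrow> bool"
    and a b :: "real \<Rightarrow> real"
  assumes unique: "\<And>f u f' u'. R f u \<Longrightarrow> R f' u' \<Longrightarrow> AE x in lebesgue. f x = f' x \<Longrightarrow> AE x in lebesgue. u x = u' x"
    and add: "\<And>f u f' u'. R f u \<Longrightarrow> R f' u' \<Longrightarrow> R (\<lambda>x. f x + f' x) (\<lambda>x. u x + u' x)"
    and meas: "\<And>f u. R f u \<Longrightarrow> strongly_measurable lebesgue u"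
    and weak: "\<And>\<sigma> f M. \<sigma> \<in> {1, - 1} \<Longrightarrow> strongly_measurable lebesgue f \<Longrightarrow> 0 < M \<Longrightarrow>
      (\<integral>\<^sup>+x. ennreal (norm (f x) powr a \<sigma>) \<partial>lebesgue) \<le> ennreal M \<Longrightarrow>
      \<exists>u. R f u \<and> weak_bounded (b \<sigma>) (c * M powr (1 / a \<sigma>)) u"
    and ab: "\<And>\<sigma>. \<sigma> \<in> {1, - 1} \<Longrightarrow> 0 < a \<sigma> \<and> a \<sigma> \<le> b \<sigma> \<and> 1 / a \<sigma> - 1 / p = 1 / b \<sigma> - 1 / q" "a 1 < p" "p < a (- 1)"
    and pos: "0 < c" "0 < p" "0 < q"
    and f: "strongly_measurable lebesgue f" "(\<integral>\<^sup>+x. ennreal (norm (f x) powr p) \<partial>lebesgue) \<le> 1"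
  shows "\<exists>u. R f u \<and> (\<integral>\<^sup>+x. ennreal (norm (u x) powr q) \<partial>lebesgue) \<le>
    ennreal (\<Sum>\<sigma>\<in>{1, - 1}. q * (2 * c) powr b \<sigma> / \<bar>q / p * (p - a \<sigma>)\<bar>)"
proof -
  define S where "S \<sigma> \<kappa> = (if \<sigma> = 1 then {x. \<kappa> < norm (f x)} else {x. norm (f x) \<le> \<kappa>})" for \<sigma> \<kappa> :: real
  define F where "F \<sigma> \<kappa> = (\<lambda>x. indicator (S \<sigma> \<kappa>) x *\<^sub>R f x)" for \<sigma> \<kappa>
  define N where "N \<sigma> \<kappa> = (\<integral>\<^sup>+x. ennreal (norm (F \<sigma> \<kappa> x) powr a \<sigma>) \<partial>lebesgue)" for \<sigma> \<kappa>
  define d where "d \<sigma> = q / p * (a \<sigma> - p) * (b \<sigma> / a \<sigma> - 1) - b \<sigma>" for \<sigma>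
  define k where "k \<sigma> = (2 * c) powr b \<sigma>" for \<sigma>
  have Fm: "strongly_measurable lebesgue (F \<sigma> \<kappa>)" for \<sigma> \<kappa>
    unfolding F_def S_def by (cases "\<sigma> = 1") (simp_all add: strongly_measurable_indicator sets_norm_less f)
  have fF: "f = (\<lambda>x. F 1 \<kappa> x + F (- 1) \<kappa> x)" for \<kappa> by (auto simp: F_def S_def indicator_def)
  have N: "N \<sigma> \<kappa> \<le> ennreal (\<kappa> powr (a \<sigma> - p))" if "\<sigma> \<in> {1, - 1}" "0 < \<kappa>" for \<sigma> \<kappa>
    unfolding N_def F_def using that ab by (intro nn_integral_cut_le f) (auto simp: S_def)
  have piece: "\<exists>u. R (F \<sigma> (\<delta> powr (q / p))) u \<and>
      emeasure lebesgue {x. \<delta> / 2 < norm (u x)} \<le> ennreal (k \<sigma> * \<delta> powr d \<sigma>) * N \<sigma> (\<delta> powr (q / p))"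
    if \<sigma>: "\<sigma> \<in> {1, - 1}" and \<delta>: "0 < \<delta>" for \<sigma> \<delta>
  proof -
    let ?\<kappa> = "\<delta> powr (q / p)"
    have \<kappa>: "0 < ?\<kappa>" using \<delta> by simp
    have a: "0 < a \<sigma>" "a \<sigma> \<le> b \<sigma>" using ab(1)[OF \<sigma>] by auto
    define M where "M = enn2real (N \<sigma> ?\<kappa>)"
    have fin: "N \<sigma> ?\<kappa> < \<infinity>" using N[OF \<sigma> \<kappa>] by (rule order.strict_trans1) simp
    then have M: "N \<sigma> ?\<kappa> = ennreal M" "0 \<le> M" by (auto simp: M_def)
    have M2: "M \<le> ?\<kappa> powr (a \<sigma> - p)" using N[OF \<sigma> \<kappa>] unfolding M(1) by (simp add: ennreal_le_iff)
    show ?thesis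
    proof (cases "M = 0")
      case False
      then obtain u where u: "R (F \<sigma> ?\<kappa>) u" "weak_bounded (b \<sigma>) (c * M powr (1 / a \<sigma>)) u"
        using weak[OF \<sigma> Fm, of M \<sigma> ?\<kappa>] M by (auto simp: N_def)
      show ?thesis
        unfolding M(1) k_def using u(1) weak_bounded_cut[OF u(2) M(2) M2 \<delta> pos(1) a d_def] by blast
    next
      \<comment> \<open>The hypothesis \<open>weak\<close> requires a positive bound. If the cut
        integral is 0, the part agrees almost everywhere with its double, so additivity and
        uniqueness force \<open>u = u + u\<close>, that is \<open>u = 0\<close>, almost
        everywhere.\<close>
      case True
      obtain u where u: "R (F \<sigma> ?\<kappa>) u"
        using weak[OF \<sigma> Fm, of 1 \<sigma> ?\<kappa>] M True by (auto simp: N_def)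
      have "AE x in lebesgue. ennreal (norm (F \<sigma> ?\<kappa> x) powr a \<sigma>) = 0"
        using M(1) True by (subst nn_integral_0_iff_AE[symmetric]) (simp_all add: N_def borel_measurable_norm_powr[OF Fm])
      then have "AE x in lebesgue. F \<sigma> ?\<kappa> x = F \<sigma> ?\<kappa> x + F \<sigma> ?\<kappa> x"
        by eventually_elim simp
      from unique[OF u add[OF u u] this] have "AE x in lebesgue. \<not> \<delta> / 2 < norm (u x)"
        by eventually_elim (use \<delta> in simp)
      then have "emeasure lebesgue {x. \<delta> / 2 < norm (u x)} = 0"
        using AE_iff_measurable[OF sets_norm_less(1)[OF meas[OF u], where \<alpha> = "\<delta> / 2"], of "\<lambda>x. \<not> \<delta> / 2 < norm (u x)"] by simp
      with u show ?thesis by (intro exI[of _ u]) simp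
    qed
  qed
  \<comment> \<open>The height 1 is arbitrary; decompositions at other heights give the same
    function almost everywhere.\<close>
  obtain u where u: "R f u"
  proof -
    obtain u1 where u1: "R (F 1 (1 powr (q / p))) u1" using piece[of 1 1] by auto
    obtain u2 where u2: "R (F (- 1) (1 powr (q / p))) u2" using piece[of "- 1" 1] by auto
    show ?thesis using that add[OF u1 u2] fF[of "1 powr (q / p)"] by simp
  qed
  have level: "emeasure lebesgue {x. \<delta> < norm (u x)} \<le> (\<Sum>\<sigma>\<in>{1, - 1}. ennreal (k \<sigma> * \<delta> powr d \<sigma>) * N \<sigma> (\<delta> powr (q / p)))"
    if \<delta>: "0 < \<delta>" for \<delta>
  proof -
    let ?\<kappa> = "\<delta> powr (q / p)"
    obtain u1 where u1: "R (F 1 ?\<kappa>) u1"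
      "emeasure lebesgue {x. \<delta> / 2 < norm (u1 x)} \<le> ennreal (k 1 * \<delta> powr d 1) * N 1 ?\<kappa>" using piece[of 1 \<delta>] \<delta> by auto
    obtain u2 where u2: "R (F (- 1) ?\<kappa>) u2"
      "emeasure lebesgue {x. \<delta> / 2 < norm (u2 x)} \<le> ennreal (k (- 1) * \<delta> powr d (- 1)) * N (- 1) ?\<kappa>" using piece[of "- 1" \<delta>] \<delta> by auto
    have "AE x in lebesgue. f x = F 1 ?\<kappa> x + F (- 1) ?\<kappa> x" by (rule AE_I2) (rule fun_cong[OF fF])
    from unique[OF u add[OF u1(1) u2(1)] this] have ae: "AE x in lebesgue. u x = u1 x + u2 x" .
    have sets: "{x. \<delta> / 2 < norm (u1 x)} \<in> sets lebesgue" "{x. \<delta> / 2 < norm (u2 x)} \<in> sets lebesgue"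
      by (intro sets_norm_less meas[OF u1(1)] meas[OF u2(1)])+
    have "emeasure lebesgue {x. \<delta> < norm (u x)} \<le> emeasure lebesgue ({x. \<delta> / 2 < norm (u1 x)} \<union> {x. \<delta> / 2 < norm (u2 x)})"
    proof (rule emeasure_mono_AE)
      show "AE x in lebesgue. x \<in> {x. \<delta> < norm (u x)} \<longrightarrow> x \<in> {x. \<delta> / 2 < norm (u1 x)} \<union> {x. \<delta> / 2 < norm (u2 x)}"
        using ae
      proof eventually_elim
        case (elim x)
        show ?case using norm_triangle_ineq[of "u1 x" "u2 x"] by (auto simp: elim)
      qed
    qed (use sets in auto)
    also have "\<dots> \<le> emeasure lebesgue {x. \<delta> / 2 < norm (u1 x)} + emeasure lebesgue {x. \<delta> / 2 < norm (u2 x)}"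
      by (intro emeasure_subadditive sets)
    also have "\<dots> \<le> (\<Sum>\<sigma>\<in>{1, - 1}. ennreal (k \<sigma> * \<delta> powr d \<sigma>) * N \<sigma> ?\<kappa>)"
      using add_mono[OF u1(2) u2(2)] by simp
    finally show ?thesis .
  qed
  let ?w = "\<lambda>\<sigma> \<alpha>. indicator {0..} \<alpha> * ennreal (q * k \<sigma> * \<alpha> powr (q / p * (p - a \<sigma>) - 1))"
  have int: "(\<integral>\<^sup>+\<alpha>. ?w \<sigma> \<alpha> * N \<sigma> (\<alpha> powr (q / p)) \<partial>lborel) \<le> ennreal (q * k \<sigma> / \<bar>q / p * (p - a \<sigma>)\<bar>)" if "\<sigma> \<in> {1, - 1}" for \<sigma>
  proof -
    have "0 < a \<sigma>" using ab(1)[OF that] by simp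
    then have "(\<integral>\<^sup>+\<alpha>. ?w \<sigma> \<alpha> * N \<sigma> (\<alpha> powr (q / p)) \<partial>lborel) =
        ennreal (q * k \<sigma>) * ennreal (1 / \<bar>q / p * (p - a \<sigma>) - 1 + 1\<bar>) * (\<integral>\<^sup>+x. ennreal (norm (f x) powr p) \<partial>lebesgue)"
      using that ab(2,3) nn_integral_cut[OF f(1) pos(2,3), of "a \<sigma>" "q / p * (p - a \<sigma>) - 1" "q * k \<sigma>"]
      by (auto simp: N_def F_def S_def)
    also have "\<dots> \<le> ennreal (q * k \<sigma>) * ennreal (1 / \<bar>q / p * (p - a \<sigma>) - 1 + 1\<bar>) * 1" by (intro mult_left_mono f) simp
    also have "\<dots> = ennreal (q * k \<sigma> / \<bar>q / p * (p - a \<sigma>)\<bar>)"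
      using pos by (simp add: k_def flip: ennreal_mult)
    finally show ?thesis .
  qed
  have "(\<integral>\<^sup>+x. ennreal (norm (u x) powr q) \<partial>lebesgue) =
      (\<integral>\<^sup>+\<alpha>. (indicator {0..} \<alpha> * ennreal (q * \<alpha> powr (q - 1))) * emeasure lebesgue {x. \<alpha> < norm (u x)} \<partial>lborel)"
    by (rule layer_cake[OF strongly_measurable_norm[OF meas[OF u]] norm_ge_zero pos(3)])
  also have "\<dots> \<le> (\<integral>\<^sup>+\<alpha>. (\<Sum>\<sigma>\<in>{1, - 1}. ?w \<sigma> \<alpha> * N \<sigma> (\<alpha> powr (q / p))) \<partial>lborel)"
  proof (rule nn_integral_mono)
    fix \<alpha> :: real
    show "(indicator {0..} \<alpha> * ennreal (q * \<alpha> powr (q - 1))) * emeasure lebesgue {x. \<alpha> < norm (u x)} \<le>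
        (\<Sum>\<sigma>\<in>{1, - 1}. ?w \<sigma> \<alpha> * N \<sigma> (\<alpha> powr (q / p)))"
    proof (cases "0 < \<alpha>")
      case True
      have "ennreal (q * \<alpha> powr (q - 1)) * emeasure lebesgue {x. \<alpha> < norm (u x)} \<le>
          ennreal (q * \<alpha> powr (q - 1)) * (\<Sum>\<sigma>\<in>{1, - 1}. ennreal (k \<sigma> * \<alpha> powr d \<sigma>) * N \<sigma> (\<alpha> powr (q / p)))"
        by (intro mult_left_mono level True) simp
      also have "\<dots> = (\<Sum>\<sigma>\<in>{1, - 1}. ennreal (q * k \<sigma> * \<alpha> powr (q / p * (p - a \<sigma>) - 1)) * N \<sigma> (\<alpha> powr (q / p)))"
        unfolding sum_distrib_left mult.assoc[symmetric]
      proof (intro sum.cong refl arg_cong2[where f = "(*)"])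
        fix \<sigma> :: real assume \<sigma>: "\<sigma> \<in> {1, - 1}"
        have "0 < a \<sigma>" "0 < b \<sigma>" "1 / a \<sigma> - 1 / p = 1 / b \<sigma> - 1 / q" using ab(1)[OF \<sigma>] by auto
        \<comment> \<open>By the condition on the reciprocals, the powers of \<alpha> collapse to
          the weight for which \<open>nn_integral_cut\<close> returns the \<open>L^p\<close>
          integral of \<open>f\<close>.\<close>
        then have "q - 1 + d \<sigma> = q / p * (p - a \<sigma>) - 1"
          using pos by (simp add: d_def field_simps) algebra
        then have "\<alpha> powr (q - 1) * \<alpha> powr d \<sigma> = \<alpha> powr (q / p * (p - a \<sigma>) - 1)" by (simp only: powr_add[symmetric])
        then have "q * \<alpha> powr (q - 1) * (k \<sigma> * \<alpha> powr d \<sigma>) = q * k \<sigma> * \<alpha> powr (q / p * (p - a \<sigma>) - 1)" by (simp add: mult_ac)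
        moreover have "0 \<le> q * \<alpha> powr (q - 1)" "0 \<le> k \<sigma> * \<alpha> powr d \<sigma>" using pos by (auto simp: k_def)
        ultimately show "ennreal (q * \<alpha> powr (q - 1)) * ennreal (k \<sigma> * \<alpha> powr d \<sigma>) = ennreal (q * k \<sigma> * \<alpha> powr (q / p * (p - a \<sigma>) - 1))"
          by (simp only: ennreal_mult[symmetric])
      qed
      finally have *: "ennreal (q * \<alpha> powr (q - 1)) * emeasure lebesgue {x. \<alpha> < norm (u x)} \<le> \<dots>" .
      have "indicator {0..} \<alpha> = (1 :: ennreal)" using True by auto
      then show ?thesis using * by (simp only: mult_1)
    next
      case False
      then show ?thesis by (cases "\<alpha> = 0") (simp_all add: indicator_def)
    qed
  qed
  also have "\<dots> = (\<Sum>\<sigma>\<in>{1, - 1}. \<integral>\<^sup>+\<alpha>. ?w \<sigma> \<alpha> * N \<sigma> (\<alpha> powr (q / p)) \<partial>lborel)"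
  proof (rule nn_integral_sum)
    fix \<sigma> :: real assume "\<sigma> \<in> {1, - 1}"
    then have "(\<lambda>\<alpha>. N \<sigma> (\<alpha> powr (q / p))) \<in> borel_measurable lborel"
      by (cases "\<sigma> = 1") (simp_all only: N_def F_def S_def nn_integral_cut_measurable[OF f(1)] if_True if_False simp_thms)
    then show "(\<lambda>\<alpha>. ?w \<sigma> \<alpha> * N \<sigma> (\<alpha> powr (q / p))) \<in> borel_measurable lborel"
      by (rule borel_measurable_times_ennreal[OF powr_weight_measurable])
  qed
  also have "\<dots> \<le> (\<Sum>\<sigma>\<in>{1, - 1}. ennreal (q * k \<sigma> / \<bar>q / p * (p - a \<sigma>)\<bar>))" by (rule sum_mono) (rule int)
  also have "\<dots> = ennreal (\<Sum>\<sigma>\<in>{1, - 1}. q * k \<sigma> / \<bar>q / p * (p - a \<sigma>)\<bar>)"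
    using pos by (intro sum_ennreal) (auto simp: k_def)
  finally show ?thesis using u unfolding k_def by blast
qed

section \<open>Fourier multipliers\<close>

text \<open>A relation makes sense on every space on which the transforms exist, in particular at
  both endpoints of the interpolation, and inherits additivity and uniqueness from
  \<open>has_fourier\<close>.\<close>

definition multiplier_rel :: "('a::euclidean_space \<Rightarrow> 'x::complex_banach \<Rightarrow>\<^sub>L 'y::complex_banach) \<Rightarrow> ('a \<Rightarrow> 'x) \<Rightarrow> ('a \<Rightarrow> 'y) \<Rightarrow> bool"
  where "multiplier_rel m f u \<longleftrightarrow> (\<exists>g. has_fourier (- 1) f g \<and> has_fourier 1 (\<lambda>\<xi>. blinfun_apply (m \<xi>) (g \<xi>)) u)"

lemma multiplier_rel_unique:
  assumes "multiplier_rel m f u" "multiplier_rel m f' u'" "AE x in lebesgue. f x = f' x"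
  shows "AE x in lebesgue. u x = u' x"
proof -
  obtain g where g: "has_fourier (- 1) f g" "has_fourier 1 (\<lambda>\<xi>. blinfun_apply (m \<xi>) (g \<xi>)) u"
    using assms(1) unfolding multiplier_rel_def by blast
  obtain g' where g': "has_fourier (- 1) f' g'" "has_fourier 1 (\<lambda>\<xi>. blinfun_apply (m \<xi>) (g' \<xi>)) u'"
    using assms(2) unfolding multiplier_rel_def by blast
  have "AE \<xi> in lebesgue. blinfun_apply (m \<xi>) (g \<xi>) = blinfun_apply (m \<xi>) (g' \<xi>)"
    using has_fourier_unique[OF g(1) g'(1) assms(3)] by eventually_elim simp
  then show ?thesis by (rule has_fourier_unique[OF g(2) g'(2)])
qed

lemma multiplier_rel_add:
  assumes "multiplier_rel m f u" "multiplier_rel m f' u'"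
  shows "multiplier_rel m (\<lambda>x. f x + f' x) (\<lambda>x. u x + u' x)"
proof -
  obtain g where g: "has_fourier (- 1) f g" "has_fourier 1 (\<lambda>\<xi>. blinfun_apply (m \<xi>) (g \<xi>)) u"
    using assms(1) unfolding multiplier_rel_def by blast
  obtain g' where g': "has_fourier (- 1) f' g'" "has_fourier 1 (\<lambda>\<xi>. blinfun_apply (m \<xi>) (g' \<xi>)) u'"
    using assms(2) unfolding multiplier_rel_def by blast
  show ?thesis
    unfolding multiplier_rel_def using has_fourier_add[OF g(1) g'(1)] has_fourier_add[OF g(2) g'(2)]
    by (intro exI[of _ "\<lambda>x. g x + g' x"]) (simp add: blinfun.add_right)
qed

lemma multiplier_rel_scaleC:
  assumes "\<And>\<xi>. complex_linear (blinfun_apply (m \<xi>))" "multiplier_rel m f u"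
  shows "multiplier_rel m (\<lambda>x. c *\<^sub>C f x) (\<lambda>x. c *\<^sub>C u x)"
proof -
  obtain g where g: "has_fourier (- 1) f g" "has_fourier 1 (\<lambda>\<xi>. blinfun_apply (m \<xi>) (g \<xi>)) u"
    using assms(2) unfolding multiplier_rel_def by blast
  have "blinfun_apply (m \<xi>) (c *\<^sub>C g \<xi>) = c *\<^sub>C blinfun_apply (m \<xi>) (g \<xi>)" for \<xi>
    using assms(1)[of \<xi>] by (simp add: complex_linear_def)
  then show ?thesis
    unfolding multiplier_rel_def using has_fourier_scaleC[OF g(1), of c] has_fourier_scaleC[OF g(2), of c]
    by (intro exI[of _ "\<lambda>x. c *\<^sub>C g x"]) simp
qed

lemma multiplier_rel_measurable: "multiplier_rel m f u \<Longrightarrow> strongly_measurable lebesgue u"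
  unfolding multiplier_rel_def by (auto dest: has_fourierD(3))

lemma multiplier_rel_schwartz:
  assumes "multiplier_rel m f u" "f \<in> schwartz"
  shows "distribution_eq (regular_distribution u) (fourier_multiplier m f)"
  unfolding distribution_eq_def
proof
  fix \<phi> :: "'a \<Rightarrow> complex" assume \<phi>: "\<phi> \<in> schwartz"
  obtain g where g: "has_fourier (- 1) f g" "has_fourier 1 (\<lambda>\<xi>. blinfun_apply (m \<xi>) (g \<xi>)) u"
    using assms(1) unfolding multiplier_rel_def by blast
  have "AE \<xi> in lebesgue. g \<xi> = fourier f \<xi>"
    unfolding fourier_eq_sfourier
    by (rule has_fourier_unique[OF g(1) has_fourier_L1[OF schwartz_sintegrable[OF assms(2)]]]) simp
  then have "AE \<xi> in lebesgue. sfourier 1 \<phi> \<xi> *\<^sub>C blinfun_apply (m \<xi>) (g \<xi>) = inv_fourier \<phi> \<xi> *\<^sub>C blinfun_apply (m \<xi>) (fourier f \<xi>)"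
    by eventually_elim (simp add: inv_fourier_eq_sfourier)
  from strong_integral_cong_AE[OF this] has_fourierD(5)[OF g(2) \<phi>]
  show "regular_distribution u \<phi> = fourier_multiplier m f \<phi>"
    by (simp add: regular_distribution_def fourier_multiplier_def inv_fourier_distribution_def)
qed

text \<open>The hypothesis on \<open>m\<close> in the form in which it is used: \<open>A\<close> bounds the weak \<open>L\<^sup>r\<close> norm.\<close>

definition weak_multiplier :: "real \<Rightarrow> real \<Rightarrow> ('a::euclidean_space \<Rightarrow> 'x::complex_banach \<Rightarrow>\<^sub>L 'y::complex_banach) \<Rightarrow> bool"
  where "weak_multiplier r A m \<longleftrightarrow> (\<forall>\<xi>. complex_linear (blinfun_apply (m \<xi>))) \<and>
    (\<forall>x. strongly_measurable lebesgue (\<lambda>\<xi>. blinfun_apply (m \<xi>) x)) \<and>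
    (\<lambda>\<xi>. norm (m \<xi>)) \<in> borel_measurable lebesgue \<and>
    (\<forall>\<alpha>>0. emeasure lebesgue {\<xi>. \<alpha> < norm (m \<xi>)} \<le> ennreal ((A / \<alpha>) powr r))"

lemma chebyshev_weak_bounded:
  assumes "strongly_measurable lebesgue f" "0 < a" "0 < M" "(\<integral>\<^sup>+x. ennreal (norm (f x) powr a) \<partial>lebesgue) \<le> ennreal M"
  shows "weak_bounded a (M powr (1 / a)) f"
  unfolding weak_bounded_def
proof (intro allI impI)
  fix \<alpha> :: real assume \<alpha>: "0 < \<alpha>"
  have "(M powr (1 / a) / \<alpha>) powr a = M * (1 / \<alpha>) powr a"
    using assms \<alpha> by (simp add: powr_divide powr_powr)
  then show "emeasure lebesgue {x. \<alpha> < norm (f x)} \<le> ennreal ((M powr (1 / a) / \<alpha>) powr a)"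
    using chebyshev[OF assms(1) \<alpha> assms(2) _ assms(4)] assms(3) by simp
qed

text \<open>The chain is \<open>L^a\<close>, weak \<open>L^a\<close>, weak \<open>L^a'\<close>,
  multiplication by \<open>m\<close>, weak \<open>L^b'\<close>, weak \<open>L^b\<close>, with
  \<open>b' = b / (b - 1)\<close>. The condition on \<open>r\<close> is equivalent to the Hoelder
  relation \<open>1 / b' = 1 / r + 1 / a'\<close>. The constant is chosen before \<open>m\<close>,
  and \<open>A\<close> stays a separate factor.\<close>

lemma multiplier_weak_type:
  fixes x0 :: "'x::complex_banach" and y0 :: "'y::complex_banach"
  assumes F: "fourier_bounded TYPE('d::euclidean_space) TYPE('x) s K" "0 \<le> K" "x0 \<noteq> 0"
    and G: "fourier_bounded TYPE('d) TYPE('y) t L" "0 \<le> L" "y0 \<noteq> 0"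
    and a: "1 < a" "a < s" and b: "1 < b / (b - 1)" "b / (b - 1) < t" and r: "0 < r" "1 / r = 1 / a - 1 / b"
  obtains c where "0 < c" "\<And>(m :: 'd \<Rightarrow> 'x \<Rightarrow>\<^sub>L 'y) A f M. weak_multiplier r A m \<Longrightarrow> 0 < A \<Longrightarrow> strongly_measurable lebesgue f \<Longrightarrow>
    0 < M \<Longrightarrow> (\<integral>\<^sup>+x. ennreal (norm (f x) powr a) \<partial>lebesgue) \<le> ennreal M \<Longrightarrow>
    \<exists>u. multiplier_rel m f u \<and> weak_bounded b (A * (c * M powr (1 / a))) u"
proof -
  obtain c1 where c1: "0 < c1" "\<And>(\<sigma>::real) (f :: 'd \<Rightarrow> 'x) B. \<sigma> \<in> {1, - 1} \<Longrightarrow> strongly_measurable lebesgue f \<Longrightarrow> 0 < B \<Longrightarrow> weak_bounded a B f \<Longrightarrow>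
    \<exists>g. has_fourier \<sigma> f g \<and> weak_bounded (a / (a - 1)) (c1 * B) g"
    using weak_fourier[OF F(1) a F(2,3)] by blast
  obtain c2 where c2: "0 < c2" "\<And>(\<sigma>::real) (f :: 'd \<Rightarrow> 'y) B. \<sigma> \<in> {1, - 1} \<Longrightarrow> strongly_measurable lebesgue f \<Longrightarrow> 0 < B \<Longrightarrow> weak_bounded (b / (b - 1)) B f \<Longrightarrow>
    \<exists>g. has_fourier \<sigma> f g \<and> weak_bounded (b / (b - 1) / (b / (b - 1) - 1)) (c2 * B) g"
    using weak_fourier[OF G(1) b G(2,3)] by blast
  have b1: "1 < b" using b(1) by (cases "1 < b") (auto simp: divide_simps split: if_splits)
  have bb: "b / (b - 1) / (b / (b - 1) - 1) = b" using b1 by (simp add: divide_simps)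
  \<comment> \<open>The Hoelder relation solved for the conjugate of \<open>b\<close>, in the form
    that \<open>weak_hoelder\<close> expects.\<close>
  have u: "b / (b - 1) = r * (a / (a - 1)) / (r + a / (a - 1))"
  proof -
    have 1: "a * b = r * (b - a)" using a(1) b1 r by (simp add: field_simps)
    have "0 < r * (a - 1)" using a(1) r(1) by simp
    then have d: "0 < r * (a - 1) + a" using a(1) by linarith
    have "r + a / (a - 1) = (r * (a - 1) + a) / (a - 1)" using a(1) by (simp add: add_divide_distrib)
    then have "r * (a / (a - 1)) / (r + a / (a - 1)) = (r * a) / (r * (a - 1) + a)" using a(1) by simp
    also have "\<dots> = b / (b - 1)"
    proof (subst frac_eq_eq)
      show "r * a * (b - 1) = b * (r * (a - 1) + a)" using 1 by (simp add: algebra_simps)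
    qed (use d b1 in auto)
    finally show ?thesis ..
  qed
  show ?thesis
  proof (rule that[of "c2 * 2 * c1"])
    fix m :: "'d \<Rightarrow> 'x \<Rightarrow>\<^sub>L 'y" and A M and f :: "'d \<Rightarrow> 'x"
    assume m: "weak_multiplier r A m" and A: "0 < A" and f: "strongly_measurable lebesgue f" and M: "0 < M"
      "(\<integral>\<^sup>+x. ennreal (norm (f x) powr a) \<partial>lebesgue) \<le> ennreal M"
    have m': "\<And>x. strongly_measurable lebesgue (\<lambda>\<xi>. blinfun_apply (m \<xi>) x)" "(\<lambda>\<xi>. norm (m \<xi>)) \<in> borel_measurable lebesgue"
      "\<And>\<alpha>. 0 < \<alpha> \<Longrightarrow> emeasure lebesgue {\<xi>. \<alpha> < norm (m \<xi>)} \<le> ennreal ((A / \<alpha>) powr r)"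
      using m by (simp_all add: weak_multiplier_def)
    have B: "0 < M powr (1 / a)" using M by simp
    obtain g where g: "has_fourier (- 1) f g" "weak_bounded (a / (a - 1)) (c1 * M powr (1 / a)) g"
      using c1(2)[of "- 1", OF _ f B chebyshev_weak_bounded[OF f _ M]] a by auto
    have gm: "strongly_measurable lebesgue g" by (rule has_fourierD(3)[OF g(1)])
    have D: "0 < c1 * M powr (1 / a)" using c1 B by simp
    have w: "weak_bounded (b / (b - 1)) (2 * (A * (c1 * M powr (1 / a)))) (\<lambda>\<xi>. blinfun_apply (m \<xi>) (g \<xi>))"
      by (rule weak_hoelder[OF m'(2,3) gm g(2) A D r(1) _ u]) (use a b in auto)
    have E: "0 < 2 * (A * (c1 * M powr (1 / a)))" using A D by simp
    obtain u where u: "has_fourier 1 (\<lambda>\<xi>. blinfun_apply (m \<xi>) (g \<xi>)) u" "weak_bounded b (c2 * (2 * (A * (c1 * M powr (1 / a))))) u"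
      using c2(2)[of 1, OF _ strongly_measurable_apply[OF m'(1) gm] E w] unfolding bb by auto
    have "c2 * (2 * (A * (c1 * M powr (1 / a)))) = A * (c2 * 2 * c1 * M powr (1 / a))" by simp
    with g(1) u show "\<exists>u. multiplier_rel m f u \<and> weak_bounded b (A * (c2 * 2 * c1 * M powr (1 / a))) u"
      unfolding multiplier_rel_def by auto
  qed (use c1 c2 in simp)
qed

text \<open>The two endpoints arise by adding the same amount, positive or negative, to
  \<open>1 / p\<close> and \<open>1 / q\<close>. This preserves the difference \<open>1 / r\<close>,
  so the weak-type bound holds at both for the same multipliers.\<close>

lemma multiplier_strong_type:
  fixes x0 :: "'x::complex_banach" and y0 :: "'y::complex_banach"
  assumes F: "fourier_bounded TYPE('d::euclidean_space) TYPE('x) s K" "0 \<le> K" "x0 \<noteq> 0"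
    and G: "fourier_bounded TYPE('d) TYPE('y) t L" "0 \<le> L" "y0 \<noteq> 0"
    and p: "1 < p" "p < s" and t: "1 < t" and q: "t / (t - 1) < q" and r: "0 < r" "1 / r = 1 / p - 1 / q"
  obtains C where "0 \<le> C" "\<And>(m :: 'd \<Rightarrow> 'x \<Rightarrow>\<^sub>L 'y) A f. weak_multiplier r A m \<Longrightarrow> 0 < A \<Longrightarrow> strongly_measurable lebesgue f \<Longrightarrow>
    (\<integral>\<^sup>+x. ennreal (norm (f x) powr p) \<partial>lebesgue) \<le> 1 \<Longrightarrow>
    \<exists>u. multiplier_rel m f u \<and> (\<integral>\<^sup>+x. ennreal (norm (u x) powr q) \<partial>lebesgue) \<le> ennreal ((C * A) powr q)"
proof -
  have q0: "1 < t / (t - 1)" using t by simp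
  then have q1: "1 < q" using q by simp
  have tq: "1 / q < 1 - 1 / t"
  proof -
    have "1 / q < 1 / (t / (t - 1))" using q q0 q1 by (intro divide_strict_left_mono mult_pos_pos) auto
    then show ?thesis using t by (simp add: divide_simps)
  qed
  have ps: "1 / s < 1 / p" using p by (intro divide_strict_left_mono) auto
  \<comment> \<open>Half of the smallest gap: after the shift \<open>1 / p\<close> has to remain
    between \<open>1 / s\<close> and 1, and \<open>1 / q\<close> between 0 and
    \<open>1 - 1 / t\<close>.\<close>
  define \<epsilon> where "\<epsilon> = min (min (1 - 1 / p) (1 - 1 / t - 1 / q)) (min (1 / p - 1 / s) (1 / q)) / 2"
  have \<epsilon>: "0 < \<epsilon>" "1 / p + \<epsilon> < 1" "1 / q + \<epsilon> < 1 - 1 / t" "1 / s < 1 / p - \<epsilon>" "0 < 1 / q - \<epsilon>"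
  proof -
    have pos: "0 < 1 - 1 / p" "0 < 1 - 1 / t - 1 / q" "0 < 1 / p - 1 / s" "0 < 1 / q" using p q1 tq ps by auto
    then show "0 < \<epsilon>" by (simp add: \<epsilon>_def)
    have "2 * \<epsilon> \<le> 1 - 1 / p" "2 * \<epsilon> \<le> 1 - 1 / t - 1 / q" "2 * \<epsilon> \<le> 1 / p - 1 / s" "2 * \<epsilon> \<le> 1 / q" by (auto simp: \<epsilon>_def)
    with pos \<open>0 < \<epsilon>\<close> show "1 / p + \<epsilon> < 1" "1 / q + \<epsilon> < 1 - 1 / t" "1 / s < 1 / p - \<epsilon>" "0 < 1 / q - \<epsilon>" by linarith+
  qed
  define a b where "a \<sigma> = 1 / (1 / p + \<sigma> * \<epsilon>)" and "b \<sigma> = 1 / (1 / q + \<sigma> * \<epsilon>)" for \<sigma>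
  have s1: "0 < 1 / s" "0 < 1 / t" using p t by auto
  have ai: "1 / a \<sigma> = 1 / p + \<sigma> * \<epsilon>" and bi: "1 / b \<sigma> = 1 / q + \<sigma> * \<epsilon>" for \<sigma> by (auto simp: a_def b_def)
  have ar: "1 / s < 1 / a \<sigma>" "1 / a \<sigma> < 1" "0 < 1 / b \<sigma>" "1 / b \<sigma> < 1 - 1 / t" if "\<sigma> \<in> {1, - 1}" for \<sigma>
    using that \<epsilon> s1 unfolding ai bi by auto
  have a: "1 < a \<sigma>" "a \<sigma> < s" and b: "1 < b \<sigma> / (b \<sigma> - 1)" "b \<sigma> / (b \<sigma> - 1) < t" "0 < b \<sigma>" if \<sigma>: "\<sigma> \<in> {1, - 1}" for \<sigma>
  proof -
    have "0 < 1 / a \<sigma>" using ar(1)[OF \<sigma>] s1 by linarith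
    then have a0: "0 < a \<sigma>" by (simp add: zero_less_divide_iff)
    then show "1 < a \<sigma>" using ar(2)[OF \<sigma>] by (simp add: divide_simps)
    show "a \<sigma> < s" using ar(1)[OF \<sigma>] a0 p by (simp add: divide_simps)
    show b0: "0 < b \<sigma>" using ar(3)[OF \<sigma>] by (simp add: zero_less_divide_iff)
    have "1 / b \<sigma> < 1" using ar(4)[OF \<sigma>] s1 by linarith
    then have b1: "1 < b \<sigma>" using b0 by (simp add: divide_simps)
    then show "1 < b \<sigma> / (b \<sigma> - 1)" by simp
    show "b \<sigma> / (b \<sigma> - 1) < t" using ar(4)[OF \<sigma>] b1 t by (simp add: divide_simps) (simp add: algebra_simps)
  qed
  have rr: "1 / r = 1 / a \<sigma> - 1 / b \<sigma>" for \<sigma> by (simp add: ai bi r(2))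
  have "\<exists>c>0. \<forall>(m :: 'd \<Rightarrow> 'x \<Rightarrow>\<^sub>L 'y) A f M. weak_multiplier r A m \<longrightarrow> 0 < A \<longrightarrow> strongly_measurable lebesgue f \<longrightarrow>
    0 < M \<longrightarrow> (\<integral>\<^sup>+x. ennreal (norm (f x) powr a \<sigma>) \<partial>lebesgue) \<le> ennreal M \<longrightarrow>
    (\<exists>u. multiplier_rel m f u \<and> weak_bounded (b \<sigma>) (A * (c * M powr (1 / a \<sigma>))) u)" if "\<sigma> \<in> {1, - 1}" for \<sigma>
    by (rule multiplier_weak_type[OF F G a[OF that] b(1,2)[OF that] r(1) rr[of \<sigma>]]) blast
  then obtain c where c: "\<And>\<sigma>. \<sigma> \<in> {1, - 1} \<Longrightarrow> 0 < c \<sigma>" "\<And>\<sigma> (m :: 'd \<Rightarrow> 'x \<Rightarrow>\<^sub>L 'y) A f M. \<sigma> \<in> {1, - 1} \<Longrightarrow> weak_multiplier r A m \<Longrightarrow> 0 < A \<Longrightarrow>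
    strongly_measurable lebesgue f \<Longrightarrow> 0 < M \<Longrightarrow> (\<integral>\<^sup>+x. ennreal (norm (f x) powr a \<sigma>) \<partial>lebesgue) \<le> ennreal M \<Longrightarrow>
    \<exists>u. multiplier_rel m f u \<and> weak_bounded (b \<sigma>) (A * (c \<sigma> * M powr (1 / a \<sigma>))) u"
    by metis
  define c' where "c' = max (c 1) (c (- 1))"
  have c': "0 < c'" "\<And>\<sigma>. \<sigma> \<in> {1, - 1} \<Longrightarrow> c \<sigma> \<le> c'" using c(1)[of 1] by (auto simp: c'_def)
  define C0 where "C0 = (\<Sum>\<sigma>\<in>{1, - 1}. q * (2 * c') powr b \<sigma> / \<bar>q / p * (p - a \<sigma>)\<bar>)"
  have C0: "0 \<le> C0" unfolding C0_def using q1 by (intro sum_nonneg) auto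
  show ?thesis
  proof (rule that[of "C0 powr (1 / q)"])
    fix m :: "'d \<Rightarrow> 'x \<Rightarrow>\<^sub>L 'y" and A and f :: "'d \<Rightarrow> 'x"
    assume m: "weak_multiplier r A m" and A: "0 < A" and f: "strongly_measurable lebesgue f"
      "(\<integral>\<^sup>+x. ennreal (norm (f x) powr p) \<partial>lebesgue) \<le> 1"
    \<comment> \<open>The constant of the interpolation mixes two different powers of the weak-type
      constant. Dividing the output by \<open>A\<close> first makes that constant independent of
      \<open>m\<close>, and the final bound linear in \<open>A\<close>.\<close>
    define R where "R f v \<longleftrightarrow> multiplier_rel m f (\<lambda>x. A *\<^sub>R v x)" for f v
    have "\<exists>v. R f v \<and> (\<integral>\<^sup>+x. ennreal (norm (v x) powr q) \<partial>lebesgue) \<le> ennreal C0"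
      unfolding C0_def
    proof (rule marcinkiewicz[where R = R])
      fix f u f' u' assume "R f u" "R f' u'"
      then have R: "multiplier_rel m f (\<lambda>x. A *\<^sub>R u x)" "multiplier_rel m f' (\<lambda>x. A *\<^sub>R u' x)" by (simp_all add: R_def)
      show "R (\<lambda>x. f x + f' x) (\<lambda>x. u x + u' x)"
        using multiplier_rel_add[OF R] by (simp add: R_def scaleR_add_right)
      assume "AE x in lebesgue. f x = f' x"
      from multiplier_rel_unique[OF R this] show "AE x in lebesgue. u x = u' x"
        by eventually_elim (use A in simp)
    next
      fix f u assume "R f u"
      then have "strongly_measurable lebesgue (\<lambda>x. A *\<^sub>R u x)" by (simp add: R_def multiplier_rel_measurable)
      from strongly_measurable_scaleR[OF borel_measurable_const this, of "1 / A"]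
      show "strongly_measurable lebesgue u" using A by simp
    next
      fix \<sigma> M and f :: "'d \<Rightarrow> 'x"
      assume *: "\<sigma> \<in> {1, - 1 :: real}" "strongly_measurable lebesgue f" "0 < M" "(\<integral>\<^sup>+x. ennreal (norm (f x) powr a \<sigma>) \<partial>lebesgue) \<le> ennreal M"
      obtain u where u: "multiplier_rel m f u" "weak_bounded (b \<sigma>) (A * (c \<sigma> * M powr (1 / a \<sigma>))) u"
        using c(2)[OF *(1) m A *(2-4)] by blast
      show "\<exists>v. R f v \<and> weak_bounded (b \<sigma>) (c' * M powr (1 / a \<sigma>)) v"
      proof (intro exI[of _ "\<lambda>x. (1 / A) *\<^sub>R u x"] conjI)
        show "R f (\<lambda>x. (1 / A) *\<^sub>R u x)" using u(1) A by (simp add: R_def)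
        show "weak_bounded (b \<sigma>) (c' * M powr (1 / a \<sigma>)) (\<lambda>x. (1 / A) *\<^sub>R u x)"
          unfolding weak_bounded_def
        proof (intro allI impI)
          fix \<alpha> :: real assume \<alpha>: "0 < \<alpha>"
          have "{x. \<alpha> < norm ((1 / A) *\<^sub>R u x)} = {x. A * \<alpha> < norm (u x)}" using A by (auto simp: field_simps)
          then have "emeasure lebesgue {x. \<alpha> < norm ((1 / A) *\<^sub>R u x)} \<le> ennreal ((A * (c \<sigma> * M powr (1 / a \<sigma>)) / (A * \<alpha>)) powr b \<sigma>)"
            using weak_boundedD[OF u(2), of "A * \<alpha>"] A \<alpha> by simp
          also have "\<dots> \<le> ennreal ((c' * M powr (1 / a \<sigma>) / \<alpha>) powr b \<sigma>)"
            using A \<alpha> c(1)[OF *(1)] c'(2)[OF *(1)] b(3)[OF *(1)]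
            by (intro ennreal_leI powr_mono2) (auto intro!: divide_right_mono mult_right_mono)
          finally show "emeasure lebesgue {x. \<alpha> < norm ((1 / A) *\<^sub>R u x)} \<le> ennreal ((c' * M powr (1 / a \<sigma>) / \<alpha>) powr b \<sigma>)" .
        qed
      qed
    next
      fix \<sigma> :: real assume \<sigma>: "\<sigma> \<in> {1, - 1}"
      have "0 < 1 / r" using r(1) by simp
      then have "1 / b \<sigma> < 1 / a \<sigma>" using rr[of \<sigma>] by linarith
      then have "a \<sigma> < b \<sigma>" using a(1)[OF \<sigma>] b(3)[OF \<sigma>] by (simp add: divide_simps)
      then show "0 < a \<sigma> \<and> a \<sigma> \<le> b \<sigma> \<and> 1 / a \<sigma> - 1 / p = 1 / b \<sigma> - 1 / q"
        using a(1)[OF \<sigma>] by (simp add: ai bi)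
    next
      have "1 / p < 1 / a 1" "1 / a (- 1) < 1 / p" using \<epsilon> by (auto simp: ai)
      then show "a 1 < p" "p < a (- 1)" using a(1)[of 1] a(1)[of "- 1"] p by (simp_all add: divide_simps)
    qed (use c' p q1 f in auto)
    then obtain v where v: "R f v" "(\<integral>\<^sup>+x. ennreal (norm (v x) powr q) \<partial>lebesgue) \<le> ennreal C0" by blast
    have vm: "strongly_measurable lebesgue v"
      using strongly_measurable_scaleR[OF borel_measurable_const multiplier_rel_measurable[OF v(1)[unfolded R_def]], of "1 / A"] A by simp
    have "(\<integral>\<^sup>+x. ennreal (norm (A *\<^sub>R v x) powr q) \<partial>lebesgue) = (\<integral>\<^sup>+x. ennreal (A powr q) * ennreal (norm (v x) powr q) \<partial>lebesgue)"
      using A by (intro nn_integral_cong) (simp add: powr_mult flip: ennreal_mult)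
    also have "\<dots> = ennreal (A powr q) * (\<integral>\<^sup>+x. ennreal (norm (v x) powr q) \<partial>lebesgue)"
      by (rule nn_integral_cmult[OF borel_measurable_norm_powr[OF vm]])
    also have "\<dots> \<le> ennreal (A powr q) * ennreal C0" by (intro mult_left_mono v) simp
    also have "\<dots> = ennreal ((C0 powr (1 / q) * A) powr q)"
      using C0 q1 by (simp add: powr_mult powr_powr mult.commute flip: ennreal_mult)
    finally show "\<exists>u. multiplier_rel m f u \<and> (\<integral>\<^sup>+x. ennreal (norm (u x) powr q) \<partial>lebesgue) \<le> ennreal ((C0 powr (1 / q) * A) powr q)"
      using v(1) unfolding R_def by blast
  qed simp
qed

section \<open>From the estimate to the unique bounded extension\<close>

lemma weak_Lp_multiplier:
  assumes m: "\<And>\<xi>. complex_linear (blinfun_apply (m \<xi>))" "\<And>x. strongly_measurable lebesgue (\<lambda>\<xi>. blinfun_apply (m \<xi>) x)"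
    and w: "(\<lambda>\<xi>. norm (m \<xi>)) \<in> weak_Lp (ennreal r)" and r: "0 < r"
    and A: "0 \<le> A" "weak_Lp_norm (ennreal r) (\<lambda>\<xi>. norm (m \<xi>)) \<le> ennreal A"
  shows "weak_multiplier r A m"
  unfolding weak_multiplier_def
proof (intro conjI allI impI m)
  show "(\<lambda>\<xi>. norm (m \<xi>)) \<in> borel_measurable lebesgue" using w by (simp add: weak_Lp_def)
  fix \<alpha> :: real assume \<alpha>: "0 < \<alpha>"
  let ?e = "emeasure lebesgue {\<xi>. \<alpha> < norm (m \<xi>)}"
  have "ennreal \<alpha> * ennreal_powr (emeasure lebesgue {\<xi>. \<alpha> < \<bar>norm (m \<xi>)\<bar>}) (1 / enn2real (ennreal r)) \<le> weak_Lp_norm (ennreal r) (\<lambda>\<xi>. norm (m \<xi>))"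
    unfolding weak_Lp_norm_def using \<alpha> by (auto intro!: SUP_upper2)
  then have *: "ennreal \<alpha> * ennreal_powr ?e (1 / r) \<le> ennreal A"
    using A(2) r by simp
  show "?e \<le> ennreal ((A / \<alpha>) powr r)"
  proof (cases ?e)
    case (real t)
    then have "ennreal (\<alpha> * t powr (1 / r)) \<le> ennreal A" using * \<alpha> by (simp add: ennreal_powr_def ennreal_mult)
    then have "\<alpha> * t powr (1 / r) \<le> A" using A(1) by (simp add: ennreal_le_iff)
    then have "t powr (1 / r) \<le> A / \<alpha>" using \<alpha> by (simp add: field_simps)
    then have "(t powr (1 / r)) powr r \<le> (A / \<alpha>) powr r" using r by (intro powr_mono2) auto
    then show ?thesis using real r by (simp add: powr_powr ennreal_leI)
  next
    \<comment> \<open>\<open>ennreal_powr\<close> keeps the value infinity, so a level set of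
      infinite measure would contradict the finite bound on the weak norm.\<close>
    case top
    then show ?thesis using * \<alpha> by (simp add: ennreal_powr_def ennreal_mult_top top_unique)
  qed
qed

text \<open>The gauge also measures the \<open>L^1\<close> norm, which may be infinite for an
  \<open>L^p\<close> function; cutting off to a ball comes first.\<close>

lemma Lp_schwartz_dense:
  fixes f :: "'a::euclidean_space \<Rightarrow> 'b::real_normed_vector"
  assumes f: "strongly_measurable lebesgue f" "(\<integral>\<^sup>+x. ennreal (norm (f x) powr p) \<partial>lebesgue) < \<infinity>" and p: "1 \<le> p" and M: "0 < M"
  obtains g where "g \<in> schwartz" "(\<integral>\<^sup>+x. ennreal (norm (f x - g x) powr p) \<partial>lebesgue) \<le> ennreal M"
proof -
  define h where "h = (\<lambda>(n::nat) x. indicator (ball 0 (real n)) x *\<^sub>R f x)"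
  have bm: "ball 0 (real n) \<in> sets lebesgue" for n :: nat by simp
  have hm: "strongly_measurable lebesgue (h n)" for n unfolding h_def by (intro strongly_measurable_indicator bm f)
  have hi: "L1_Lp_gauge p (h n) < \<infinity>" for n
  proof -
    have "L1_Lp_gauge p (h n) \<le> (\<integral>\<^sup>+x. indicator (ball 0 (real n)) x + 2 * ennreal (norm (f x) powr p) \<partial>lebesgue)"
      unfolding L1_Lp_gauge_def
    proof (rule nn_integral_mono)
      fix x
      have "norm (f x) \<le> 1 + norm (f x) powr p"
        using powr_mono[of 1 p "norm (f x)"] p by (cases "norm (f x) \<le> 1") (auto intro: add_increasing2)
      then have "norm (f x) + norm (f x) powr p \<le> 1 + 2 * norm (f x) powr p" by simp
      then have "ennreal (norm (f x) + norm (f x) powr p) \<le> 1 + 2 * ennreal (norm (f x) powr p)"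
        by (simp flip: ennreal_plus ennreal_mult ennreal_1 ennreal_numeral add: ennreal_leI)
      then show "ennreal (norm (h n x) + norm (h n x) powr p) \<le> indicator (ball 0 (real n)) x + 2 * ennreal (norm (f x) powr p)"
        by (cases "x \<in> ball 0 (real n)") (simp_all add: h_def)
    qed
    also have "\<dots> = emeasure lebesgue (ball (0::'a) (real n)) + 2 * (\<integral>\<^sup>+x. ennreal (norm (f x) powr p) \<partial>lebesgue)"
      using borel_measurable_norm_powr[OF f(1), of p] bm
      by (subst nn_integral_add) (auto simp: nn_integral_cmult intro!: borel_measurable_times_ennreal borel_measurable_indicator)
    also have "\<dots> < \<infinity>"
      using f(2) emeasure_lborel_ball_finite[of "0::'a" "real n"]
      by (simp add: ennreal_mult_less_top less_top)
    finally show ?thesis .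
  qed
  have lim: "(\<lambda>n. \<integral>\<^sup>+x. ennreal (norm (f x - h n x) powr p) \<partial>lebesgue) \<longlonglongrightarrow> (\<integral>\<^sup>+(x::'a). 0 \<partial>lebesgue)"
  proof (rule nn_integral_dominated_convergence[where w = "\<lambda>x. ennreal (norm (f x) powr p)"])
    show "AE x in lebesgue. (\<lambda>n. ennreal (norm (f x - h n x) powr p)) \<longlonglongrightarrow> 0"
    proof (rule AE_I2)
      fix x :: 'a
      have "eventually (\<lambda>n. norm x < real n) sequentially"
        by (rule eventually_compose_filterlim[OF eventually_gt_at_top filterlim_real_sequentially])
      then have "eventually (\<lambda>n. ennreal (norm (f x - h n x) powr p) = 0) sequentially"
        by eventually_elim (simp add: h_def)
      then show "(\<lambda>n. ennreal (norm (f x - h n x) powr p)) \<longlonglongrightarrow> 0" by (rule tendsto_eventually)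
    qed
    show "AE x in lebesgue. ennreal (norm (f x - h n x) powr p) \<le> ennreal (norm (f x) powr p)" for n
      by (rule AE_I2) (auto simp: h_def indicator_def)
    show "(\<lambda>x. ennreal (norm (f x - h n x) powr p)) \<in> borel_measurable lebesgue" for n
      by (rule borel_measurable_norm_powr[OF strongly_measurable_diff[OF f(1) hm]])
  qed (rule borel_measurable_norm_powr[OF f(1)] f(2) borel_measurable_const)+
  \<comment> \<open>Each of the two errors may be as large as \<open>e\<close>; the quasi-triangle
    inequality multiplies their sum by \<open>2 powr p\<close>.\<close>
  define e where "e = M / (2 powr p * 2)"
  have e: "0 < e" using M by (simp add: e_def)
  from lim have "eventually (\<lambda>n. (\<integral>\<^sup>+x. ennreal (norm (f x - h n x) powr p) \<partial>lebesgue) < ennreal e) sequentially"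
    by (rule order_tendstoD(2)) (simp add: e)
  then obtain n where n: "(\<integral>\<^sup>+x. ennreal (norm (f x - h n x) powr p) \<partial>lebesgue) < ennreal e"
    unfolding eventually_sequentially by blast
  obtain g where g: "\<And>k::nat. g k \<in> schwartz" "(\<lambda>k. L1_Lp_gauge p (\<lambda>x. g k x - h n x)) \<longlonglongrightarrow> 0"
    using schwartz_dense[OF p hm hi] by blast
  from g(2) have "eventually (\<lambda>k. L1_Lp_gauge p (\<lambda>x. g k x - h n x) < ennreal e) sequentially"
    by (rule order_tendstoD(2)) (simp add: e)
  then obtain k where k: "L1_Lp_gauge p (\<lambda>x. g k x - h n x) < ennreal e"
    unfolding eventually_sequentially by blast
  have "(\<integral>\<^sup>+x. ennreal (norm (h n x - g k x) powr p) \<partial>lebesgue) \<le> ennreal e"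
    using nn_integral_powr_le_L1_Lp_gauge[of "\<lambda>x. g k x - h n x" p] k by (simp add: norm_minus_commute)
  with n have "(\<integral>\<^sup>+x. ennreal (norm (f x - h n x) powr p) \<partial>lebesgue) + (\<integral>\<^sup>+x. ennreal (norm (h n x - g k x) powr p) \<partial>lebesgue) \<le> ennreal e + ennreal e"
    by (intro add_mono) auto
  then have "ennreal (2 powr p) * ((\<integral>\<^sup>+x. ennreal (norm (f x - h n x) powr p) \<partial>lebesgue) + (\<integral>\<^sup>+x. ennreal (norm (h n x - g k x) powr p) \<partial>lebesgue))
      \<le> ennreal (2 powr p) * (ennreal e + ennreal e)"
    by (rule mult_left_mono) simp
  also have "\<dots> = ennreal M" using e by (simp flip: ennreal_plus ennreal_mult) (simp add: e_def)
  finally have "(\<integral>\<^sup>+x. ennreal (norm (f x - g k x) powr p) \<partial>lebesgue) \<le> ennreal M"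
    using nn_integral_powr_add_le[OF strongly_measurable_diff[OF f(1) hm[of n]] strongly_measurable_diff[OF hm[of n] schwartz_strongly_measurable[OF g(1)[of k]]], of p] p
    by (simp add: order_trans)
  with g(1) that show thesis by blast
qed

lemma nn_integral_scaleC_powr:
  assumes "strongly_measurable lebesgue h" "0 < c"
  shows "(\<integral>\<^sup>+x. ennreal (norm (of_real c *\<^sub>C h x) powr s) \<partial>lebesgue) = ennreal (c powr s) * (\<integral>\<^sup>+x. ennreal (norm (h x) powr s) \<partial>lebesgue)"
  using assms(2) by (subst nn_integral_cmult[symmetric])
    (auto simp: norm_scaleC powr_mult ennreal_mult borel_measurable_norm_powr[OF assms(1)])

text \<open>Rescaling by \<open>M powr - (1 / p)\<close> brings \<open>f\<close> into the unit ball.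
  A positive majorant \<open>M\<close> in place of the norm itself avoids division by 0.\<close>

lemma Lp_operator_bound:
  fixes T :: "('a::euclidean_space \<Rightarrow> 'x::complex_banach) \<Rightarrow> ('a \<Rightarrow> 'y::complex_banach)"
  assumes T: "bounded_Lp_operator (ennreal p) (ennreal q) T" and pq: "0 < p" "0 < q"
  obtains K where "0 \<le> K" "\<And>f M. strongly_measurable lebesgue f \<Longrightarrow> 0 < M \<Longrightarrow> (\<integral>\<^sup>+x. ennreal (norm (f x) powr p) \<partial>lebesgue) \<le> ennreal M \<Longrightarrow>
    (\<integral>\<^sup>+x. ennreal (norm (T f x) powr q) \<partial>lebesgue) \<le> ennreal (K * M powr (q / p))"
proof -
  define B where "B = enn2real (Lp_opnorm (ennreal p) (ennreal q) T)"
  have B: "Lp_opnorm (ennreal p) (ennreal q) T = ennreal B" "0 \<le> B"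
    using T by (auto simp: B_def bounded_Lp_operator_def)
  show ?thesis
  proof (rule that[of "B powr q"])
    fix f :: "'a \<Rightarrow> 'x" and M :: real
    assume f: "strongly_measurable lebesgue f" "0 < M" "(\<integral>\<^sup>+x. ennreal (norm (f x) powr p) \<partial>lebesgue) \<le> ennreal M"
    define c where "c = M powr - (1 / p)"
    have "c powr p = M powr (- 1)" unfolding c_def powr_powr using pq by simp
    then have c: "0 < c" "c powr p = 1 / M" using f(2) by (auto simp: c_def powr_minus_divide)
    have fL: "f \<in> Lp (ennreal p)" using f pq by (simp add: Lp_ennreal_iff le_less_trans)
    have "(\<integral>\<^sup>+x. ennreal (norm (of_real c *\<^sub>C f x) powr p) \<partial>lebesgue) \<le> ennreal (1 / M) * ennreal M"
      unfolding nn_integral_scaleC_powr[OF f(1) c(1)] c(2) by (intro mult_left_mono f) simp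
    also have "\<dots> = 1" using f(2) by (simp flip: ennreal_mult)
    finally have c1: "(\<integral>\<^sup>+x. ennreal (norm (of_real c *\<^sub>C f x) powr p) \<partial>lebesgue) \<le> 1" .
    have cL: "(\<lambda>x. of_real c *\<^sub>C f x) \<in> Lp (ennreal p)"
      using c1 pq strongly_measurable_scaleC[OF borel_measurable_const f(1)] by (simp add: Lp_ennreal_iff le_less_trans)
    have "Lp_norm (ennreal p) (\<lambda>x. of_real c *\<^sub>C f x) \<le> 1"
      using c1 Lp_norm_le_iff[of p 1 "\<lambda>x. of_real c *\<^sub>C f x"] pq by simp
    then have "Lp_norm (ennreal q) (T (\<lambda>x. of_real c *\<^sub>C f x)) \<le> ennreal B"
      unfolding B(1)[symmetric] Lp_opnorm_def using cL by (intro SUP_upper) auto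
    then have Tc: "(\<integral>\<^sup>+x. ennreal (norm (T (\<lambda>x. of_real c *\<^sub>C f x) x) powr q) \<partial>lebesgue) \<le> ennreal (B powr q)"
      using Lp_norm_le_iff[OF pq(2) B(2), of "T (\<lambda>x. of_real c *\<^sub>C f x)"] by simp
    have Tf: "strongly_measurable lebesgue (T f)" using T fL pq by (auto simp: bounded_Lp_operator_def Lp_ennreal_iff)
    have ae: "AE x in lebesgue. T (\<lambda>x. of_real c *\<^sub>C f x) x = of_real c *\<^sub>C T f x"
      using T fL by (simp add: bounded_Lp_operator_def)
    have "(\<integral>\<^sup>+x. ennreal (norm (T (\<lambda>x. of_real c *\<^sub>C f x) x) powr q) \<partial>lebesgue) = (\<integral>\<^sup>+x. ennreal (norm (of_real c *\<^sub>C T f x) powr q) \<partial>lebesgue)"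
      by (rule nn_integral_cong_AE) (use ae in \<open>eventually_elim, simp only:\<close>)
    with Tc have "ennreal (c powr q) * (\<integral>\<^sup>+x. ennreal (norm (T f x) powr q) \<partial>lebesgue) \<le> ennreal (B powr q)"
      unfolding nn_integral_scaleC_powr[OF Tf c(1)] by simp
    then have "ennreal (M powr (q / p)) * (ennreal (c powr q) * (\<integral>\<^sup>+x. ennreal (norm (T f x) powr q) \<partial>lebesgue)) \<le> ennreal (M powr (q / p)) * ennreal (B powr q)"
      by (rule mult_left_mono) simp
    moreover have "ennreal (M powr (q / p)) * ennreal (c powr q) = 1"
      using f(2) by (simp add: c_def powr_powr flip: ennreal_mult powr_add)
    ultimately show "(\<integral>\<^sup>+x. ennreal (norm (T f x) powr q) \<partial>lebesgue) \<le> ennreal (B powr q * M powr (q / p))"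
      by (simp add: mult.assoc[symmetric] ennreal_mult mult.commute)
  qed simp
qed

text \<open>On a Schwartz function \<open>g\<close> both images are tempered functions with the same
  pairings, hence equal almost everywhere. So the difference of the images of \<open>f\<close> is
  that of the images of \<open>f - g\<close>, which boundedness makes arbitrarily small.\<close>

lemma bounded_extension_unique:
  fixes T T' :: "('a::euclidean_space \<Rightarrow> 'x::complex_banach) \<Rightarrow> ('a \<Rightarrow> 'y::complex_banach)"
  assumes T: "bounded_extension (ennreal p) (ennreal q) m T" "bounded_extension (ennreal p) (ennreal q) m T'"
    and pq: "1 \<le> p" "1 \<le> q" and f: "f \<in> Lp (ennreal p)"
  shows "AE x in lebesgue. T' f x = T f x"
proof -
  have pos: "0 < p" "0 < q" using pq by auto
  have f': "strongly_measurable lebesgue f" "(\<integral>\<^sup>+x. ennreal (norm (f x) powr p) \<partial>lebesgue) < \<infinity>"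
    using f pos by (simp_all add: Lp_ennreal_iff)
  note b = T[unfolded bounded_extension_def, THEN conjunct1]
  obtain K where K: "0 \<le> K" "\<And>f M. strongly_measurable lebesgue f \<Longrightarrow> 0 < M \<Longrightarrow> (\<integral>\<^sup>+x. ennreal (norm (f x) powr p) \<partial>lebesgue) \<le> ennreal M \<Longrightarrow>
    (\<integral>\<^sup>+x. ennreal (norm (T f x) powr q) \<partial>lebesgue) \<le> ennreal (K * M powr (q / p))"
    using Lp_operator_bound[OF b(1) pos] by blast
  obtain K' where K': "0 \<le> K'" "\<And>f M. strongly_measurable lebesgue f \<Longrightarrow> 0 < M \<Longrightarrow> (\<integral>\<^sup>+x. ennreal (norm (f x) powr p) \<partial>lebesgue) \<le> ennreal M \<Longrightarrow>
    (\<integral>\<^sup>+x. ennreal (norm (T' f x) powr q) \<partial>lebesgue) \<le> ennreal (K' * M powr (q / p))"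
    using Lp_operator_bound[OF b(2) pos] by blast
  let ?D = "\<integral>\<^sup>+x. ennreal (norm (T' f x - T f x) powr q) \<partial>lebesgue"
  have m: "strongly_measurable lebesgue (T h)" "strongly_measurable lebesgue (T' h)" "tempered (T h)" "tempered (T' h)" if "h \<in> Lp (ennreal p)" for h
  proof -
    have "T h \<in> Lp (ennreal q)" "T' h \<in> Lp (ennreal q)" using b that by (auto simp: bounded_Lp_operator_def)
    then show "strongly_measurable lebesgue (T h)" "strongly_measurable lebesgue (T' h)" "tempered (T h)" "tempered (T' h)"
      using tempered_Lp[OF _ pq(2)] pos by (auto simp: Lp_ennreal_iff)
  qed
  have key: "?D \<le> ennreal (2 powr q * (K' + K) * M powr (q / p))" if M: "0 < M" for M
  proof -
    obtain g where g: "g \<in> schwartz" "(\<integral>\<^sup>+x. ennreal (norm (f x - g x) powr p) \<partial>lebesgue) \<le> ennreal M"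
      by (rule Lp_schwartz_dense[OF f' pq(1) M])
    have gL: "g \<in> Lp (ennreal p)"
      using schwartz_L1_Lp_gauge_finite[OF g(1) pq(1)] L1_Lp_gauge_finite_iff[OF schwartz_strongly_measurable[OF g(1)]] schwartz_strongly_measurable[OF g(1)] pos
      by (simp add: Lp_ennreal_iff)
    have fg: "strongly_measurable lebesgue (\<lambda>x. f x - g x)"
      by (intro strongly_measurable_diff f' schwartz_strongly_measurable g)
    have fgL: "(\<lambda>x. f x - g x) \<in> Lp (ennreal p)"
      using fg g(2) pos by (simp add: Lp_ennreal_iff le_less_trans)
    have sum: "AE x in lebesgue. S f x = S (\<lambda>x. f x - g x) x + S g x"
      if "bounded_Lp_operator (ennreal p) (ennreal q) S" for S :: "('a \<Rightarrow> 'x) \<Rightarrow> ('a \<Rightarrow> 'y)"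
    proof -
      have "\<forall>f\<in>Lp (ennreal p). \<forall>g\<in>Lp (ennreal p). AE x in lebesgue. S (\<lambda>t. f t + g t) x = S f x + S g x"
        using that unfolding bounded_Lp_operator_def by (elim conjE)
      from bspec[OF bspec[OF this fgL] gL] show ?thesis by simp
    qed
    have "AE x in lebesgue. T' g x = T g x"
    proof (rule tempered_unique[OF m(4,3)[OF gL]])
      fix \<phi> :: "'a \<Rightarrow> complex" assume "\<phi> \<in> schwartz"
      then show "strong_integral lebesgue (\<lambda>x. \<phi> x *\<^sub>C T' g x) = strong_integral lebesgue (\<lambda>x. \<phi> x *\<^sub>C T g x)"
        using T g(1) by (simp add: bounded_extension_def distribution_eq_def regular_distribution_def)
    qed
    then have ae: "AE x in lebesgue. T' f x - T f x = T' (\<lambda>x. f x - g x) x + - T (\<lambda>x. f x - g x) x"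
      using sum[OF b(1)] sum[OF b(2)] by eventually_elim simp
    have "?D = (\<integral>\<^sup>+x. ennreal (norm (T' (\<lambda>x. f x - g x) x + - T (\<lambda>x. f x - g x) x) powr q) \<partial>lebesgue)"
      by (rule nn_integral_cong_AE) (use ae in \<open>eventually_elim, simp only:\<close>)
    also have "\<dots> \<le> ennreal (2 powr q) * ((\<integral>\<^sup>+x. ennreal (norm (T' (\<lambda>x. f x - g x) x) powr q) \<partial>lebesgue) + (\<integral>\<^sup>+x. ennreal (norm (- T (\<lambda>x. f x - g x) x) powr q) \<partial>lebesgue))"
      using strongly_measurable_diff[OF strongly_measurable_const[of 0] m(1)[OF fgL]]
      by (intro nn_integral_powr_add_le m fgL pos) simp
    also have "\<dots> \<le> ennreal (2 powr q) * (ennreal (K' * M powr (q / p)) + ennreal (K * M powr (q / p)))"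
      unfolding norm_minus_cancel by (intro mult_left_mono add_mono K(2)[OF fg M g(2)] K'(2)[OF fg M g(2)]) simp
    also have "\<dots> = ennreal (2 powr q * (K' + K) * M powr (q / p))"
      using K K' by (simp add: algebra_simps flip: ennreal_plus ennreal_mult)
    finally show ?thesis .
  qed
  have small: "?D \<le> 0 + ennreal e" if e: "0 < e" for e
  proof -
    \<comment> \<open>The summand 1 makes \<open>k\<close> positive. The majorant is then
      \<open>(e / k) powr (p / q)\<close>, whose power \<open>q / p\<close> is
      \<open>e / k\<close>.\<close>
    define k where "k = 2 powr q * (K' + K) + 1"
    have k: "0 < k" "2 powr q * (K' + K) \<le> k" using K K' by (auto simp: k_def add_nonneg_pos)
    have "?D \<le> ennreal (2 powr q * (K' + K) * ((e / k) powr (p / q)) powr (q / p))" using e k by (intro key) simp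
    also have "((e / k) powr (p / q)) powr (q / p) = e / k" using e k pos by (simp add: powr_powr)
    also have "2 powr q * (K' + K) * (e / k) \<le> k * (e / k)" using k e by (intro mult_right_mono) auto
    finally show ?thesis using k by (simp add: ennreal_leI)
  qed
  have "?D \<le> 0" by (rule ennreal_le_epsilon) (rule small)
  then have "AE x in lebesgue. ennreal (norm (T' f x - T f x) powr q) = 0"
    by (subst nn_integral_0_iff_AE[OF borel_measurable_norm_powr[OF strongly_measurable_diff[OF m(2,1)[OF f]]], symmetric]) simp
  then show ?thesis by eventually_elim simp
qed


text \<open>The choice operator picks an arbitrary representative. Since the relation is
  single-valued almost everywhere, the picked function has the bound of every other one, and
  additivity and homogeneity hold almost everywhere, as \<open>bounded_Lp_operator\<close>
  demands.\<close>

lemma multiplier_extension: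
  fixes m :: "'a::euclidean_space \<Rightarrow> 'x::complex_banach \<Rightarrow>\<^sub>L 'y::complex_banach"
  assumes lin: "\<And>\<xi>. complex_linear (blinfun_apply (m \<xi>))" and pq: "0 < p" "0 < q" and B: "0 \<le> B"
    and ex: "\<And>f. strongly_measurable lebesgue f \<Longrightarrow> (\<integral>\<^sup>+x. ennreal (norm (f x) powr p) \<partial>lebesgue) \<le> 1 \<Longrightarrow>
      \<exists>u. multiplier_rel m f u \<and> (\<integral>\<^sup>+x. ennreal (norm (u x) powr q) \<partial>lebesgue) \<le> ennreal (B powr q)"
    and p1: "1 \<le> p"
  defines "T \<equiv> \<lambda>f. SOME u. multiplier_rel m f u"
  shows "bounded_extension (ennreal p) (ennreal q) m T" "Lp_opnorm (ennreal p) (ennreal q) T \<le> ennreal B"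
proof -
  have T: "multiplier_rel m f (T f)" if "multiplier_rel m f u" for f u
    using someI[of "multiplier_rel m f" u] that by (simp add: T_def)
  have bd: "(\<integral>\<^sup>+x. ennreal (norm (T f x) powr q) \<partial>lebesgue) = (\<integral>\<^sup>+x. ennreal (norm (u x) powr q) \<partial>lebesgue)"
    if u: "multiplier_rel m f u" for f u
  proof (rule nn_integral_cong_AE)
    have "AE x in lebesgue. T f x = u x" by (rule multiplier_rel_unique[OF T[OF u] u]) simp
    then show "AE x in lebesgue. ennreal (norm (T f x) powr q) = ennreal (norm (u x) powr q)"
      by eventually_elim simp
  qed
  have rel: "\<exists>u. multiplier_rel m f u \<and> (\<integral>\<^sup>+x. ennreal (norm (u x) powr q) \<partial>lebesgue) < \<infinity>" if f: "f \<in> Lp (ennreal p)" for f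
  proof -
    have f': "strongly_measurable lebesgue f" "(\<integral>\<^sup>+x. ennreal (norm (f x) powr p) \<partial>lebesgue) < \<infinity>"
      using f pq by (simp_all add: Lp_ennreal_iff)
    \<comment> \<open>The summand 1 keeps \<open>M\<close> positive when \<open>f\<close> vanishes
      almost everywhere.\<close>
    define M where "M = enn2real (\<integral>\<^sup>+x. ennreal (norm (f x) powr p) \<partial>lebesgue) + 1"
    have M: "0 < M" by (simp add: M_def add_nonneg_pos)
    have "(\<integral>\<^sup>+x. ennreal (norm (f x) powr p) \<partial>lebesgue) = ennreal (M - 1)" using f'(2) by (simp add: M_def)
    then have Mf: "(\<integral>\<^sup>+x. ennreal (norm (f x) powr p) \<partial>lebesgue) \<le> ennreal M" by (simp add: ennreal_leI)
    define c where "c = M powr - (1 / p)"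
    have "c powr p = M powr (- 1)" unfolding c_def powr_powr using pq by simp
    then have c: "0 < c" "c powr p = 1 / M" using M by (auto simp: c_def powr_minus_divide)
    have "(\<integral>\<^sup>+x. ennreal (norm (of_real c *\<^sub>C f x) powr p) \<partial>lebesgue) = ennreal (1 / M) * (\<integral>\<^sup>+x. ennreal (norm (f x) powr p) \<partial>lebesgue)"
      unfolding nn_integral_scaleC_powr[OF f'(1) c(1)] c(2) ..
    also have "\<dots> \<le> ennreal (1 / M) * ennreal M" by (intro mult_left_mono Mf) simp
    also have "\<dots> = 1" using M by (simp flip: ennreal_mult)
    finally obtain u where u: "multiplier_rel m (\<lambda>x. of_real c *\<^sub>C f x) u" "(\<integral>\<^sup>+x. ennreal (norm (u x) powr q) \<partial>lebesgue) \<le> ennreal (B powr q)"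
      using ex[OF strongly_measurable_scaleC[OF borel_measurable_const f'(1)]] by blast
    have "multiplier_rel m f (\<lambda>x. of_real (1 / c) *\<^sub>C u x)"
      using multiplier_rel_scaleC[OF lin u(1), of "of_real (1 / c)"] c by (simp add: scaleC_scaleC)
    moreover have "(\<integral>\<^sup>+x. ennreal (norm (of_real (1 / c) *\<^sub>C u x) powr q) \<partial>lebesgue) = ennreal ((1 / c) powr q) * (\<integral>\<^sup>+x. ennreal (norm (u x) powr q) \<partial>lebesgue)"
      using c by (intro nn_integral_scaleC_powr multiplier_rel_measurable[OF u(1)]) simp
    moreover have "\<dots> < \<infinity>" using u(2) by (simp add: ennreal_mult_less_top le_less_trans)
    ultimately show ?thesis by auto
  qed
  have TL: "T f \<in> Lp (ennreal q)" and Trel: "multiplier_rel m f (T f)" if "f \<in> Lp (ennreal p)" for f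
  proof -
    obtain u where u: "multiplier_rel m f u" "(\<integral>\<^sup>+x. ennreal (norm (u x) powr q) \<partial>lebesgue) < \<infinity>" using rel[OF \<open>f \<in> _\<close>] by blast
    show "multiplier_rel m f (T f)" by (rule T[OF u(1)])
    then show "T f \<in> Lp (ennreal q)" using bd[OF u(1)] u(2) pq by (simp add: Lp_ennreal_iff multiplier_rel_measurable)
  qed
  show op: "Lp_opnorm (ennreal p) (ennreal q) T \<le> ennreal B"
    unfolding Lp_opnorm_def
  proof (rule SUP_least)
    fix f :: "'a \<Rightarrow> 'x" assume "f \<in> {f \<in> Lp (ennreal p). Lp_norm (ennreal p) f \<le> 1}"
    then have f: "strongly_measurable lebesgue f" "Lp_norm (ennreal p) f \<le> ennreal 1" by (auto simp: Lp_def)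
    then obtain u where u: "multiplier_rel m f u" "(\<integral>\<^sup>+x. ennreal (norm (u x) powr q) \<partial>lebesgue) \<le> ennreal (B powr q)"
      using ex[OF f(1)] Lp_norm_le_iff[of p 1 f] pq by auto
    show "Lp_norm (ennreal q) (T f) \<le> ennreal B"
      unfolding Lp_norm_le_iff[OF pq(2) B] bd[OF u(1)] by (rule u(2))
  qed
  show "bounded_extension (ennreal p) (ennreal q) m T"
    unfolding bounded_extension_def bounded_Lp_operator_def
  proof (intro conjI ballI allI TL)
    fix f g :: "'a \<Rightarrow> 'x" assume fg: "f \<in> Lp (ennreal p)" "g \<in> Lp (ennreal p)"
    note r = multiplier_rel_add[OF Trel[OF fg(1)] Trel[OF fg(2)]]
    show "AE x in lebesgue. T (\<lambda>t. f t + g t) x = T f x + T g x"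
      by (rule multiplier_rel_unique[OF T[OF r] r]) simp
  next
    fix c and f :: "'a \<Rightarrow> 'x" assume f: "f \<in> Lp (ennreal p)"
    note r = multiplier_rel_scaleC[OF lin Trel[OF f], of c]
    show "AE x in lebesgue. T (\<lambda>t. c *\<^sub>C f t) x = c *\<^sub>C T f x"
      by (rule multiplier_rel_unique[OF T[OF r] r]) simp
  next
    show "Lp_opnorm (ennreal p) (ennreal q) T < \<infinity>" using op by (rule order.strict_trans1) simp
  next
    fix f :: "'a \<Rightarrow> 'x" assume f: "f \<in> schwartz"
    have "f \<in> Lp (ennreal p)"
      using schwartz_L1_Lp_gauge_finite[OF f p1] L1_Lp_gauge_finite_iff[OF schwartz_strongly_measurable[OF f]] schwartz_strongly_measurable[OF f] pq
      by (simp add: Lp_ennreal_iff)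
    then show "distribution_eq (regular_distribution (T f)) (fourier_multiplier m f)"
      by (intro multiplier_rel_schwartz Trel f)
  qed
qed

theorem theorem3p12:
  fixes p\<^sub>0 q\<^sub>0 p q r :: ennreal
  assumes "\<exists>x::'x::complex_banach. x \<noteq> 0" and "\<exists>y::'y::complex_banach. y \<noteq> 0"
    and "1 < p\<^sub>0" "p\<^sub>0 \<le> 2" and "fourier_type TYPE(real ^ 'k::finite) TYPE('x) p\<^sub>0"
    and "2 \<le> q\<^sub>0" "q\<^sub>0 < \<infinity>" and "fourier_cotype TYPE(real ^ 'l::finite) TYPE('y) q\<^sub>0"
    and "1 < p" "p < p\<^sub>0" and "q\<^sub>0 < q" "q < \<infinity>"
    and "1 \<le> r" and "1 / r = 1 / p - 1 / q"
  shows "\<exists>C::real. 0 \<le> C \<and>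
    (\<forall>m :: real ^ 'd::finite \<Rightarrow> 'x \<Rightarrow>\<^sub>L 'y.
       (\<forall>\<xi>. complex_linear (blinfun_apply (m \<xi>))) \<longrightarrow>
       (\<forall>x. strongly_measurable lebesgue (\<lambda>\<xi>. blinfun_apply (m \<xi>) x)) \<longrightarrow>
       (\<lambda>\<xi>. norm (m \<xi>)) \<in> weak_Lp r \<longrightarrow>
       (\<exists>T. bounded_extension p q m T \<and>
            Lp_opnorm p q T \<le> ennreal C * weak_Lp_norm r (\<lambda>\<xi>. norm (m \<xi>)) \<and>
            (\<forall>T'. bounded_extension p q m T' \<longrightarrow>
                  (\<forall>f\<in>Lp p. AE x in lebesgue. T' f x = T f x))))"
proof -
  obtain x0 :: 'x and y0 :: 'y where nz: "x0 \<noteq> 0" "y0 \<noteq> 0" using assms(1,2) by blast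
  obtain s K where s: "p\<^sub>0 = ennreal s" "1 < s" and K: "0 \<le> K" and F: "fourier_bounded TYPE(real ^ 'd) TYPE('x) s K"
    by (rule fourier_type_bounded[OF assms(5,3)]) (rule that)
  obtain p1 where p1: "hoelder_conjugate p1 q\<^sub>0" "fourier_type TYPE(real ^ 'l) TYPE('y) p1"
    using assms(8) by (auto simp: fourier_cotype_def)
  have "1 \<le> p1" "p1 \<le> 2" using p1(2) by (auto simp: fourier_type_def)
  \<comment> \<open>A finite cotype exponent excludes the Fourier type 1, whose conjugate is
    infinity.\<close>
  have "p1 \<noteq> 1"
  proof
    assume "p1 = 1"
    then have "1 + 1 / q\<^sub>0 = 1" using p1(1) by (simp add: hoelder_conjugate_def)
    then have "1 / q\<^sub>0 = 0" using ennreal_add_left_cancel[of 1 "1 / q\<^sub>0" 0] by simp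
    then show False using assms(7) by (simp add: ennreal_divide_eq_0_iff)
  qed
  with \<open>1 \<le> p1\<close> have "1 < p1" by simp
  have "p1 < \<infinity>" using \<open>p1 \<le> 2\<close> by (rule order.strict_trans1) simp
  obtain t where t: "p1 = ennreal t" "1 < t" "q\<^sub>0 = ennreal (t / (t - 1))"
    by (rule hoelder_conjugate_real[OF p1(1) \<open>1 < p1\<close> \<open>p1 < \<infinity>\<close>]) (rule that)
  obtain t' L where t': "p1 = ennreal t'" "1 < t'" and L: "0 \<le> L" and G': "fourier_bounded TYPE(real ^ 'd) TYPE('y) t' L"
    by (rule fourier_type_bounded[OF p1(2) \<open>1 < p1\<close>]) (rule that)
  have "t' = t" using t t' by simp
  then have G: "fourier_bounded TYPE(real ^ 'd) TYPE('y) t L" using G' by simp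
  obtain p' where p: "p = ennreal p'" "0 \<le> p'" using assms(10) by (cases p) auto
  obtain q' where q: "q = ennreal q'" "0 \<le> q'" using assms(12) by (cases q) auto
  have p': "1 < p'" "p' < s" using assms(9,10) p s by (auto simp: ennreal_less_iff simp flip: ennreal_1)
  have q0: "1 < t / (t - 1)" using t by simp
  have q': "t / (t - 1) < q'" using assms(11) q t(3) q0 by (auto simp: ennreal_less_iff)
  have "p < q" using assms(4,6,10,11) by (meson less_le_trans less_trans)
  then have pq: "p' < q'" using p q by (simp add: ennreal_less_iff)
  have pos: "0 < 1 / p' - 1 / q'" using p' pq by (simp add: divide_simps)
  have "1 / r = ennreal 1 / ennreal p' - ennreal 1 / ennreal q'" using assms(14) p q by simp
  also have "\<dots> = ennreal (1 / p' - 1 / q')" using p' pq by (simp add: divide_ennreal ennreal_minus del: ennreal_1)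
  finally have r1: "1 / r = ennreal (1 / p' - 1 / q')" .
  \<comment> \<open>Since \<open>p < q\<close>, the reciprocal of \<open>r\<close> is positive, so
    an infinite \<open>r\<close> does not occur.\<close>
  obtain r' where r: "r = ennreal r'" "0 \<le> r'" using r1 pos by (cases r) auto
  have r': "0 < r'" using assms(13) r by (simp flip: ennreal_1)
  have "ennreal 1 / ennreal r' = ennreal (1 / p' - 1 / q')" using r1 r by simp
  then have rr: "1 / r' = 1 / p' - 1 / q'" using r' pos by (simp add: divide_ennreal del: ennreal_1)
  obtain C where C: "0 \<le> C" "\<And>(m :: real ^ 'd \<Rightarrow> 'x \<Rightarrow>\<^sub>L 'y) A f. weak_multiplier r' A m \<Longrightarrow> 0 < A \<Longrightarrow> strongly_measurable lebesgue f \<Longrightarrow>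
    (\<integral>\<^sup>+x. ennreal (norm (f x) powr p') \<partial>lebesgue) \<le> 1 \<Longrightarrow>
    \<exists>u. multiplier_rel m f u \<and> (\<integral>\<^sup>+x. ennreal (norm (u x) powr q') \<partial>lebesgue) \<le> ennreal ((C * A) powr q')"
    using multiplier_strong_type[OF F K nz(1) G L nz(2) p' t(2) q' r' rr] by blast
  have pq': "0 < p'" "0 < q'" "1 \<le> p'" "1 \<le> q'" using p' pq by auto
  show ?thesis
  proof (intro exI[of _ C] conjI C(1) allI impI)
    fix m :: "real ^ 'd \<Rightarrow> 'x \<Rightarrow>\<^sub>L 'y"
    assume lin: "\<forall>\<xi>. complex_linear (blinfun_apply (m \<xi>))" and sm: "\<forall>x. strongly_measurable lebesgue (\<lambda>\<xi>. blinfun_apply (m \<xi>) x)"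
      and w: "(\<lambda>\<xi>. norm (m \<xi>)) \<in> weak_Lp r"
    \<comment> \<open>Fixed before the parameter \<open>e\<close> of the next claim, so that all its
      estimates concern the same operator.\<close>
    define T where "T = (\<lambda>f. SOME u. multiplier_rel m f u)"
    define W where "W = enn2real (weak_Lp_norm r (\<lambda>\<xi>. norm (m \<xi>)))"
    have W: "weak_Lp_norm r (\<lambda>\<xi>. norm (m \<xi>)) = ennreal W" "0 \<le> W"
      using w by (auto simp: W_def weak_Lp_def)
    \<comment> \<open>The strong-type bound needs a positive constant, but the weak norm
      \<open>W\<close> may be 0; it is applied with \<open>W + e\<close>, and \<open>e\<close> tends
      to 0 at the end.\<close>
    have T: "bounded_extension p q m T" "Lp_opnorm p q T \<le> ennreal (C * (W + e))" if e: "0 < e" for e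
    proof -
      have A: "0 < W + e" using W e by simp
      have wm: "weak_multiplier r' (W + e) m"
        using lin sm w W A e unfolding r(1) by (intro weak_Lp_multiplier r') (auto simp: ennreal_leI)
      have B: "0 \<le> C * (W + e)" using C(1) A by simp
      show "bounded_extension p q m T" "Lp_opnorm p q T \<le> ennreal (C * (W + e))"
        unfolding p(1) q(1) T_def using multiplier_extension[OF spec[OF lin] pq'(1,2) B C(2)[OF wm A] pq'(3)] by auto
    qed
    show "\<exists>T. bounded_extension p q m T \<and> Lp_opnorm p q T \<le> ennreal C * weak_Lp_norm r (\<lambda>\<xi>. norm (m \<xi>)) \<and>
      (\<forall>T'. bounded_extension p q m T' \<longrightarrow> (\<forall>f\<in>Lp p. AE x in lebesgue. T' f x = T f x))"
    proof (intro exI[of _ T] conjI allI impI ballI)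
      show ext: "bounded_extension p q m T" by (rule T(1)[of 1]) simp
      show "Lp_opnorm p q T \<le> ennreal C * weak_Lp_norm r (\<lambda>\<xi>. norm (m \<xi>))"
      proof (rule ennreal_le_epsilon)
        fix e :: real assume e: "0 < e"
        \<comment> \<open>Dividing by \<open>C + 1\<close> rather than by \<open>C\<close> covers
          the case \<open>C = 0\<close>.\<close>
        have "C * (e / (C + 1)) \<le> e" using C(1) e by (simp add: field_simps)
        then have le: "C * (W + e / (C + 1)) \<le> C * W + e" by (simp add: distrib_left)
        have "Lp_opnorm p q T \<le> ennreal (C * (W + e / (C + 1)))" using C(1) e by (intro T(2)) simp
        also have "\<dots> \<le> ennreal (C * W + e)" using le by (rule ennreal_leI)
        also have "\<dots> = ennreal C * weak_Lp_norm r (\<lambda>\<xi>. norm (m \<xi>)) + ennreal e"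
          using C(1) W e by (simp add: ennreal_mult)
        finally show "Lp_opnorm p q T \<le> ennreal C * weak_Lp_norm r (\<lambda>\<xi>. norm (m \<xi>)) + ennreal e" .
      qed
      fix T' :: "(real ^ 'd \<Rightarrow> 'x) \<Rightarrow> (real ^ 'd \<Rightarrow> 'y)" and f :: "real ^ 'd \<Rightarrow> 'x"
      assume "bounded_extension p q m T'" "f \<in> Lp p"
      then show "AE x in lebesgue. T' f x = T f x"
        using bounded_extension_unique[OF ext[unfolded p(1) q(1)] _ pq'(3,4)] unfolding p(1) q(1) by blast
    qed
  qed
qed

end
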